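(* Let $1\le p<\infty$ and let $f\in\mathscr H^p$. Then there exists a set $E\subseteq\mathbb T^\infty$ of full measure such that, for all $\chi\in E$, the map $\sigma\mapsto M_p^p(f_\chi,\sigma)$ is continuously differentiable on $(0,\infty)$, and $$\partial_\sigma M_p^p(f_\chi,\sigma)=-\lim_{T\to\infty}\frac{p^2}{2T}\int_{-T}^T\int_\sigma^\infty|f_\chi(\nu+it)|^{p-2}\,|f_\chi'(\nu+it)|^2\,\mathrm d\nu\,\mathrm dt,$$ where the limit converges uniformly in $\sigma$ on $(\kappa,\infty)$ for all $\kappa>0$. Furthermore, if $p\ne1$, then we may take $E=\mathscr C_p(f)$.
   Context: For real $\kappa$ let $\mathbb C_\kappa=\{s\in\mathbb C:\operatorname{Re}s>\kappa\}$. For a function $g$ on $\mathbb C_0$ and $\sigma>0$ put $M_p(g,\sigma)=\left(\lim_{T\to\infty}\frac1{2T}\int_{-T}^T|g(\sigma+it)|^p\,\mathrm dt\right)^{1/p}$ whenever the limit exists, and $M_p^p(g,\sigma)=(M_p(g,\sigma))^p$. The space $\mathscr H^p$ is the completion of the space of Dirichlet polynomials $P(s)=\sum_{n=1}^Na_nn^{-s}$ in the norm $\|P\|_{\mathscr H^p}=\lim_{\sigma\downarrow0}M_p(P,\sigma)$. Its elements are identified with Dirichlet series $f(s)=\sum_{n\ge1}a_nn^{-s}$ (the coefficient $a_n$ being the limit of the $n$-th coefficients of an approximating Cauchy sequence of Dirichlet polynomials); these series converge absolutely in $\mathbb C_{1/2}$. $\mathbb T$ is the unit circle and $\mathbb T^\infty=\mathbb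 T\times\mathbb T\times\cdots$ is identified with the set of completely multiplicative functions $\chi:\mathbb Z^+\to\mathbb T$ via $\chi\leftrightarrow(\chi(2),\chi(3),\chi(5),\dots)$; "full measure" refers to the normalized Haar (product) measure $m_\infty$ on $\mathbb T^\infty$. Put $f_\chi(s)=\sum_{n\ge1}a_n\chi(n)n^{-s}$; when $f_\chi$ has an analytic continuation to $\mathbb C_0$ (which for $f\in\mathscr H^p$ is the case for almost every $\chi$), this continuation is still denoted $f_\chi$. The $p$-Carlson set $\mathscr C_p(f)$ is the set of all $\chi\in\mathbb T^\infty$ such that $f_\chi$ has an analytic continuation to $\mathbb C_0$ satisfying $\sup_{\sigma>0}\sup_{T\ge1}\frac1{2T}\int_{-T}^T|f_\chi(\sigma+it)|^p\,\mathrm dt<\infty$. If $f\equiv0$, the integrand $|f_\chi|^{p-2}|f_\chi'|^2$ is interpreted as $0$ (otherwise it is defined off the zeros of $f_\chi$, hence almost everywhere). *)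

theory Defs
  imports "HOL-Probability.Probability" "HOL-Complex_Analysis.Complex_Analysis"
    "HOL-Computational_Algebra.Primes"
begin

definition half_plane :: "real \<Rightarrow> complex set" where
  "half_plane \<kappa> = {s. Re s > \<kappa>}"

definition vertical_mean :: "real \<Rightarrow> (complex \<Rightarrow> complex) \<Rightarrow> real \<Rightarrow> real \<Rightarrow> real" where
  "vertical_mean p g \<sigma> T =
     1 / (2 * T) * (LINT t:{-T..T}|lborel. norm (g (Complex \<sigma> t)) powr p)"

definition Mp :: "real \<Rightarrow> (complex \<Rightarrow> complex) \<Rightarrow> real \<Rightarrow> real" where
  "Mp p g \<sigma> = (Lim at_top (vertical_mean p g \<sigma>)) powr (1 / p)"

text \<open>Dirichlet polynomials and Dirichlet series are represented by their coefficients
  \<open>a :: nat \<Rightarrow> complex\<close>; the index 0 is padding and carries the coefficient 0.\<close>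

definition dirichlet_polys :: "(nat \<Rightarrow> complex) set" where
  "dirichlet_polys = {c. c 0 = 0 \<and> finite {n. c n \<noteq> 0}}"

definition dirichlet_poly :: "(nat \<Rightarrow> complex) \<Rightarrow> complex \<Rightarrow> complex" where
  "dirichlet_poly c s = (\<Sum>n | c n \<noteq> 0. c n * of_nat n powr (- s))"

definition Hp_norm :: "real \<Rightarrow> (nat \<Rightarrow> complex) \<Rightarrow> real" where
  "Hp_norm p c = Lim (at_right 0) (Mp p (dirichlet_poly c))"

text \<open>The completion of the Dirichlet polynomials, each element being identified with the
  coefficientwise limit of a representing Cauchy sequence.\<close>

definition Hp :: "real \<Rightarrow> (nat \<Rightarrow> complex) set" where
  "Hp p = {a. \<exists>c :: nat \<Rightarrow> nat \<Rightarrow> complex.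
      (\<forall>k. c k \<in> dirichlet_polys) \<and>
      (\<forall>\<epsilon>>0. \<exists>K. \<forall>j\<ge>K. \<forall>k\<ge>K. Hp_norm p (\<lambda>n. c j n - c k n) < \<epsilon>) \<and>
      (\<forall>n. (\<lambda>k. c k n) \<longlonglongrightarrow> a n)}"

definition circle_measure :: "complex measure" where
  "circle_measure =
     distr (uniform_measure lborel {0..1}) (restrict_space borel (sphere 0 1))
       (\<lambda>t. cis (2 * pi * t))"

text \<open>A point of the infinite torus is the family of its values at the primes;
  \<open>torus_char\<close> is the corresponding completely multiplicative function on the positive
  integers.\<close>

definition torus :: "(nat \<Rightarrow> complex) measure" where
  "torus = PiM {q. prime q} (\<lambda>_. circle_measure)"

definition torus_char :: "(nat \<Rightarrow> complex) \<Rightarrow> nat \<Rightarrow> complex" where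
  "torus_char \<omega> n = (\<Prod>q\<in>prime_factors n. \<omega> q ^ multiplicity q n)"

text \<open>Full measure refers to the completed product measure: the set need only contain a
  measurable set of measure 1.\<close>

definition full_measure :: "(nat \<Rightarrow> complex) set \<Rightarrow> bool" where
  "full_measure E \<longleftrightarrow> E \<subseteq> space torus \<and> (AE \<omega> in torus. \<omega> \<in> E)"

text \<open>\<open>F\<close> is an analytic continuation to \<open>half_plane 0\<close> of the Dirichlet series twisted
  by \<open>\<omega>\<close>. For \<open>a \<in> Hp p\<close> with \<open>p \<ge> 1\<close> that series converges absolutely on
  \<open>half_plane (1/2)\<close>; the values of \<open>F\<close> on \<open>half_plane 0\<close> are uniquely determined.\<close>

definition twist_continuation ::
    "(nat \<Rightarrow> complex) \<Rightarrow> (nat \<Rightarrow> complex) \<Rightarrow> (complex \<Rightarrow> complex) \<Rightarrow> bool" where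
  "twist_continuation a \<omega> F \<longleftrightarrow>
     F holomorphic_on half_plane 0 \<and>
     (\<forall>s\<in>half_plane (1/2).
        (\<lambda>n. a (Suc n) * torus_char \<omega> (Suc n) * of_nat (Suc n) powr (- s)) sums F s)"

definition Carlson_set :: "real \<Rightarrow> (nat \<Rightarrow> complex) \<Rightarrow> (nat \<Rightarrow> complex) set" where
  "Carlson_set p a = {\<omega> \<in> space torus. \<exists>F. twist_continuation a \<omega> F \<and>
     (\<exists>C. \<forall>\<sigma>>0. \<forall>T\<ge>1. vertical_mean p F \<sigma> T \<le> C)}"

text \<open>The iterated integral is taken in \<open>[0,\<infinity>]\<close>: for \<open>p = 1\<close> the inner integral is
  infinite for those \<open>t\<close> (a null set) for which the horizontal line hits a simple zero.
  At zeros of \<open>F\<close> the convention \<open>0 powr x = 0\<close> makes the integrand 0, which in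
  particular gives the value 0 when \<open>F\<close> vanishes identically.\<close>

definition energy_integral ::
    "real \<Rightarrow> (complex \<Rightarrow> complex) \<Rightarrow> real \<Rightarrow> real \<Rightarrow> ennreal" where
  "energy_integral p F \<sigma> T =
     (\<integral>\<^sup>+t\<in>{-T..T}. (\<integral>\<^sup>+\<nu>\<in>{\<sigma><..}.
        ennreal (norm (F (Complex \<nu> t)) powr (p - 2) * (norm (deriv F (Complex \<nu> t)))\<^sup>2)
      \<partial>lborel) \<partial>lborel)"

text \<open>The first two clauses say that the quantities in the derivative formula are
  well defined: the limit defining \<open>Mp\<close> exists and the iterated integral is finite.\<close>

definition mean_derivative_formula :: "real \<Rightarrow> (complex \<Rightarrow> complex) \<Rightarrow> bool" where
  "mean_derivative_formula p F \<longleftrightarrow>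
     (\<forall>\<sigma>>0. \<exists>L. (vertical_mean p F \<sigma> \<longlongrightarrow> L) at_top) \<and>
     (\<forall>\<sigma>>0. \<forall>T>0. energy_integral p F \<sigma> T < \<infinity>) \<and>
     (\<exists>D. (\<forall>\<sigma>>0. ((\<lambda>\<sigma>. Mp p F \<sigma> powr p) has_real_derivative D \<sigma>) (at \<sigma>)) \<and>
          continuous_on {0<..} D \<and>
          (\<forall>\<kappa>>0. uniform_limit {\<kappa><..}
             (\<lambda>T \<sigma>. - (p\<^sup>2 / (2 * T) * enn2real (energy_integral p F \<sigma> T))) D at_top))"

end

theory Submission imports Defs begin

text \<open>
 For a character \<open>\<omega>\<close> in the Carlson set let \<open>F\<close> be the continuation of the twisted series and
 \<open>M \<sigma>\<close> the limit of its vertical means of order \<open>p\<close>. The derivative formula is proved at every point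
 of the Carlson set, and that set is shown to have full measure, for all \<open>p \<ge> 1\<close> alike; so it can serve
 as \<open>E\<close>. The argument has four parts.

 \<^item> Common means and growth. Cauchy's formula in a strip, with the weight \<open>N\<^sup>w\<close> and a decaying kernel,
 approximates \<open>F\<close>, in the mean and up to a small multiple of the height, by a Dirichlet polynomial whose
 coefficients do not depend on \<open>\<omega>\<close> (\<open>carlson_approximation\<close>). For polynomials the mean values exist and
 do not depend on \<open>\<omega>\<close>, so \<open>M\<close> exists and is one function for the whole Carlson set
 (\<open>carlson_mean_limit\<close>). Moreover \<open>|F|\<^sup>p\<close> and \<open>(1 + |F|)\<^sup>p\<^sup>-\<^sup>1 |F'|\<close> are \<open>o(|t|)\<close> on
 vertical lines (\<open>gradient_growth\<close>).

 \<^item> Hardy-Stein. The Laplacian of \<open>|F|\<^sup>p\<close> is \<open>p\<^sup>2 |F|\<^sup>p\<^sup>-\<^sup>2 |F'|\<^sup>2\<close>. By Green's formula in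
 half-strips of height \<open>2T\<close>, whose horizontal edges contribute only \<open>o(T)\<close>, the mean energy \<open>e\<^sub>T\<close> to
 the right of \<open>\<sigma>\<close> and the vertical mean \<open>v\<^sub>T\<close> satisfy
 \<open>e\<^sub>T(\<sigma> + h) - o(1) \<le> (v\<^sub>T(\<sigma>) - v\<^sub>T(\<sigma> + h)) / h \<le> e\<^sub>T(\<sigma>) + o(1)\<close>
 (\<open>energy_secant_bounds\<close>).

 \<^item> Identification of the limit. It remains to exclude kinks of \<open>M\<close>. The Kronecker flow preserves
 the Haar measure and translates \<open>F\<close> vertically, so the expectation of \<open>e\<^sub>T\<close> is the same for all \<open>T\<close>,
 namely \<open>p\<^sup>2 G(\<sigma>)\<close> with \<open>G(\<sigma>)\<close> the expected energy on a horizontal ray. Averaging over the torus gives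
 \<open>p\<^sup>2 G(\<sigma> + h) \<le> (M(\<sigma>) - M(\<sigma> + h)) / h \<le> p\<^sup>2 G(\<sigma>)\<close> (\<open>expected_energy_secant\<close>). As a tail
 integral \<open>G\<close> is continuous; hence \<open>M' = - p\<^sup>2 G\<close>, and as \<open>e\<^sub>T\<close> is monotone in \<open>\<sigma>\<close>, it converges
 to \<open>p\<^sup>2 G\<close> uniformly (\<open>uniform_limit_from_secants\<close>).

 \<^item> Full measure. Take polynomials that converge rapidly to \<open>f\<close>. The maximal inequality for the time-one
 flow and the Borel-Cantelli lemma bound, for almost every \<open>\<omega>\<close>, all window means of the increments on the
 imaginary axis; Poisson's formula carries the bounds into the half-plane, and a Perron formula gives
 the convergence of the series for \<open>Re s > 1/2\<close> (\<open>limit_carlson\<close>).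
\<close>

section \<open>Cauchy's formula in a strip\<close>

text \<open>Cauchy's formula on the rectangles \<open>|Im w| \<le> T\<close>, \<open>T \<rightarrow> \<infinity>\<close>. The
 horizontal edges need to be small only along some sequence of heights, and only in the mean: for functions with
 bounded means such heights are found by averaging, while pointwise bounds are not available.\<close>

lemma strip_integral_formula:
 fixes G :: "complex \<Rightarrow> complex" and \<rho> c :: real
 assumes \<rho>: "\<rho> > 0" and c: "c > 0"
  and S: "open S" "convex S" and G: "G holomorphic_on S"
  and strip: "\<And>w. - \<rho> \<le> Re w \<Longrightarrow> Re w \<le> c \<Longrightarrow> w \<in> S"
  and intc: "integrable lborel (\<lambda>u. G (Complex c u) / Complex c u)"
  and intr: "integrable lborel (\<lambda>u. G (Complex (-\<rho>) u) / Complex (-\<rho>) u)"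
  and hor: "\<And>\<epsilon> T0. \<epsilon> > 0 \<Longrightarrow> \<exists>T\<ge>T0. T > 0 \<and>
    integral {-\<rho>..c} (\<lambda>x. norm (G (Complex x T))) \<le> \<epsilon> * T \<and>
    integral {-\<rho>..c} (\<lambda>x. norm (G (Complex x (-T)))) \<le> \<epsilon> * T"
 shows "2 * pi * G 0 = (LINT u|lborel. G (Complex c u) / Complex c u)
   - (LINT u|lborel. G (Complex (-\<rho>) u) / Complex (-\<rho>) u)"
proof -
 let ?f = "\<lambda>w. G w / w"
 define V where "V b T = integral {-T..T} (\<lambda>u. ?f (Complex b u))" for b T
 define H where "H y = integral {-\<rho>..c} (\<lambda>x. norm (G (Complex x y)))" for y
 have Gc: "continuous_on S G" using G holomorphic_on_imp_continuous_on by blast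
 have rect: "norm (2 * pi * G 0 - (V c T - V (-\<rho>) T)) \<le> (H T + H (-T)) / T" if T: "T > 0" for T
 proof -
  define a1 a2 a3 a4 where "a1 = Complex (-\<rho>) (-T)" "a2 = Complex c (-T)"
   "a3 = Complex c T" "a4 = Complex (-\<rho>) T"
  note a = this
  have seg: "closed_segment x y \<subseteq> S - {0}"
   if "(Re x = Re y \<and> (Re x = -\<rho> \<or> Re x = c)) \<or> (Im x = Im y \<and> (Im x = T \<or> Im x = -T))"
    "x \<in> {a1,a2,a3,a4}" "y \<in> {a1,a2,a3,a4}" for x y
  proof -
   have xs: "x \<in> S" "y \<in> S" using that(2,3) strip a \<rho> c by auto
   have "closed_segment x y \<subseteq> S" using xs S(2) by (simp add: closed_segment_subset)
   moreover have "0 \<notin> closed_segment x y"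
   proof
    assume "0 \<in> closed_segment x y"
    then obtain u where "0 = (1-u) *\<^sub>R x + u *\<^sub>R y" by (auto simp: closed_segment_def)
    then have "Re ((1-u) *\<^sub>R x + u *\<^sub>R y) = 0" "Im ((1-u) *\<^sub>R x + u *\<^sub>R y) = 0" by simp_all
    then have "(1-u) * Re x + u * Re y = 0" "(1-u) * Im x + u * Im y = 0" by auto
    with that(1) \<rho> c T show False by (auto simp: algebra_simps)
   qed
   ultimately show ?thesis by blast
  qed
  have cont: "continuous_on (S - {0}) ?f" by (intro continuous_intros continuous_on_subset[OF Gc]) auto
  have ci: "?f contour_integrable_on (linepath x y)" if "closed_segment x y \<subseteq> S - {0}" for x y
   using contour_integrable_continuous_linepath continuous_on_subset[OF cont that] by blast
  have segs: "closed_segment a1 a2 \<subseteq> S - {0}" "closed_segment a2 a3 \<subseteq> S - {0}"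
   "closed_segment a3 a4 \<subseteq> S - {0}" "closed_segment a4 a1 \<subseteq> S - {0}"
   "closed_segment a1 a4 \<subseteq> S - {0}" by (rule seg; simp add: a)+
  have horb: "norm (contour_integral (linepath x y) ?f) \<le> H s / T"
   if xy: "(x, y, s) \<in> {(a1,a2,-T), (a4,a3,T)}" for x y s
  proof -
   have sg: "closed_segment x y \<subseteq> S - {0}" using xy segs by (auto simp: closed_segment_commute)
   have hs: "(?f has_contour_integral contour_integral (linepath x y) ?f) (linepath x y)"
    using ci[OF sg] has_contour_integral_integral by blast
   have lp: "linepath x y t = Complex ((1-t) * (-\<rho>) + t * c) s" for t
    using xy by (auto simp: linepath_def a complex_eq_iff algebra_simps)
   have d: "y - x = complex_of_real (c + \<rho>)" using xy by (auto simp: a complex_eq_iff)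
   have h1: "((\<lambda>t. ?f (Complex ((1-t) * (-\<rho>) + t * c) s) * complex_of_real (c+\<rho>))
     has_integral contour_integral (linepath x y) ?f) {0..1}"
    using hs unfolding has_contour_integral_linepath lp d by simp
   have ing: "(\<lambda>x. norm (G (Complex x s))) integrable_on {-\<rho>..c}"
    by (intro integrable_continuous_interval continuous_intros
      continuous_on_compose2[OF Gc]) (auto simp: Complex_eq intro!: continuous_intros strip)
   have h2: "((\<lambda>x. norm (G (Complex x s))) has_integral H s) {-\<rho>..c}"
    using ing unfolding H_def by (simp add: has_integral_integral)
   have img: "(\<lambda>x. (x + \<rho>) / (c + \<rho>)) ` {-\<rho>..c} = {0..1}"
   proof -
    have "t \<in> (\<lambda>x. (x + \<rho>) / (c + \<rho>)) ` {-\<rho>..c}" if "t \<in> {0..1}" for t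
    proof -
     have "(c + \<rho>) * t \<le> c + \<rho>" "0 \<le> (c + \<rho>) * t" using that \<rho> c by (auto intro: mult_left_le)
     then have "(c + \<rho>) * t - \<rho> \<in> {-\<rho>..c}" unfolding atLeastAtMost_iff by linarith
     then show ?thesis using \<rho> c by (intro image_eqI[of _ _ "(c + \<rho>) * t - \<rho>"]) auto
    qed
    moreover have "(x + \<rho>) / (c + \<rho>) \<in> {0..1}" if "x \<in> {-\<rho>..c}" for x using that \<rho> c by (auto simp: divide_le_eq)
    ultimately show ?thesis by blast
   qed
   have h3: "((\<lambda>t. norm (G (Complex ((c+\<rho>) * t + (-\<rho>)) s))) has_integral (1 / (c+\<rho>)) *\<^sub>R H s) {0..1}"
    using has_integral_affinity[of "\<lambda>x. norm (G (Complex x s))" "H s" "-\<rho>" c "c+\<rho>" "-\<rho>"] \<rho> c h2 img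
    by (simp add: add_divide_distrib[symmetric])
   have h4: "((\<lambda>t. (c+\<rho>) / T * norm (G (Complex ((1-t) * (-\<rho>) + t * c) s))) has_integral H s / T) {0..1}"
   proof -
    have e1: "(c+\<rho>)/T * ((1 / (c+\<rho>)) *\<^sub>R H s) = H s / T" using \<rho> c by simp
    have e2: "(c+\<rho>) * t + (-\<rho>) = (1-t) * (-\<rho>) + t * c" for t by (simp add: algebra_simps)
    show ?thesis using has_integral_mult_right[OF h3, of "(c+\<rho>)/T"] unfolding e1 e2 .
   qed
   have "norm (contour_integral (linepath x y) ?f) \<le> (H s / T) \<bullet> (1::real)"
   proof (rule has_integral_norm_bound_integral_component[OF h1 h4])
    fix t :: real assume t: "t \<in> {0..1}"
    let ?z = "Complex ((1-t) * (-\<rho>) + t * c) s"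
    have "T \<le> norm ?z" using abs_Im_le_cmod[of ?z] xy T by auto
    then have "norm (?f ?z) \<le> norm (G ?z) / T" using T by (simp add: norm_divide frac_le)
    then have "norm (?f ?z) * (c + \<rho>) \<le> norm (G ?z) / T * (c + \<rho>)" using \<rho> c by (intro mult_right_mono) auto
    moreover have "norm (complex_of_real (c+\<rho>)) = c + \<rho>"
     using \<rho> c norm_of_real[of "c+\<rho>", where 'a = complex] by linarith
    ultimately show "norm (?f ?z * complex_of_real (c+\<rho>)) \<le> ((c+\<rho>) / T * norm (G ?z)) \<bullet> 1"
     unfolding norm_mult by (simp add: mult.commute)
   qed
   then show ?thesis by simp
  qed
  have ver: "contour_integral (linepath (Complex b (-T)) (Complex b T)) ?f = \<i> * V b T"
   if "closed_segment (Complex b (-T)) (Complex b T) \<subseteq> S - {0}" for b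
  proof -
   have "(?f has_contour_integral contour_integral (linepath (Complex b (-T)) (Complex b T)) ?f)
     (linepath (Complex b (-T)) (Complex b T))" using ci[OF that] has_contour_integral_integral by blast
   then have "((\<lambda>x. ?f (Complex b x)) has_integral
     (-\<i> * contour_integral (linepath (Complex b (-T)) (Complex b T)) ?f)) {-T..T}"
    using T by (subst (asm) has_contour_integral_linepath_same_Re_iff[where c = b and a = "-T" and b = T]) auto
   then have "V b T = -\<i> * contour_integral (linepath (Complex b (-T)) (Complex b T)) ?f"
    unfolding V_def by blast
   then show ?thesis by simp
  qed
  let ?I = "\<lambda>x y. contour_integral (linepath x y) ?f"
  have hc: "(?f has_contour_integral ?I x y) (linepath x y)" if "closed_segment x y \<subseteq> S - {0}" for x y
   using ci[OF that] has_contour_integral_integral by blast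
  have "(?f has_contour_integral (?I a1 a2 + (?I a2 a3 + (?I a3 a4 + ?I a4 a1)))) (rectpath a1 a3)"
   unfolding rectpath_def Let_def using hc[OF segs(1)] hc[OF segs(2)] hc[OF segs(3)] hc[OF segs(4)]
   by (auto simp: a intro!: has_contour_integral_join)
  moreover have "(?f has_contour_integral (2*pi * \<i> * winding_number (rectpath a1 a3) 0 * G 0)) (rectpath a1 a3)"
  proof -
   have img: "path_image (rectpath a1 a3) \<subseteq> S - {0}"
    using segs by (auto simp: rectpath_def Let_def path_image_join a)
   have "0 \<in> interior S" using strip[of 0] \<rho> c S by (simp add: interior_open)
   from Cauchy_integral_formula_convex_simple[OF S(2) G this valid_path_rectpath img]
   show ?thesis by simp
  qed
  moreover have "winding_number (rectpath a1 a3) 0 = 1"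
   by (rule winding_number_rectpath) (use \<rho> c T in \<open>auto simp: a in_box_complex_iff\<close>)
  ultimately have tot: "2*pi*\<i>*G 0 = ?I a1 a2 + (?I a2 a3 + (?I a3 a4 + ?I a4 a1))"
   using has_contour_integral_unique by fastforce
  have rev: "?I a3 a4 = - ?I a4 a3" "?I a4 a1 = - ?I a1 a4"
   using segs by (metis ci contour_integral_reverse_linepath continuous_on_subset[OF cont]
     closed_segment_commute)+
  have "?I a2 a3 = \<i> * V c T" "?I a1 a4 = \<i> * V (-\<rho>) T" using ver[of c] ver[of "-\<rho>"] segs by (simp_all add: a)
  with tot rev have "\<i> * (2*pi*G 0 - (V c T - V (-\<rho>) T)) = ?I a1 a2 - ?I a4 a3" by (simp add: algebra_simps)
  then have "norm (2*pi*G 0 - (V c T - V (-\<rho>) T)) = norm (?I a1 a2 - ?I a4 a3)"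
   by (metis norm_mult norm_ii mult_1)
  also have "\<dots> \<le> norm (?I a1 a2) + norm (?I a4 a3)" by (rule norm_triangle_ineq4)
  also have "\<dots> \<le> H (-T) / T + H T / T" using horb by (intro add_mono) auto
  finally show ?thesis by (simp add: add_divide_distrib)
 qed
 have "\<exists>\<tau>. \<forall>n::nat. \<tau> n \<ge> real n \<and> \<tau> n > 0 \<and> H (\<tau> n) \<le> inverse (Suc n) * \<tau> n \<and> H (-\<tau> n) \<le> inverse (Suc n) * \<tau> n"
  using hor[of "inverse (Suc n)" "real n" for n] unfolding H_def by (intro choice allI) force
 then obtain \<tau> where \<tau>: "\<And>n. \<tau> n \<ge> real n" "\<And>n. \<tau> n > 0"
  "\<And>n. H (\<tau> n) \<le> inverse (Suc n) * \<tau> n" "\<And>n. H (-\<tau> n) \<le> inverse (Suc n) * \<tau> n" by blast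
 have \<tau>inf: "filterlim \<tau> at_top sequentially"
  by (rule filterlim_at_top_mono[OF filterlim_real_sequentially]) (simp add: \<tau>)
 have Vlim: "(\<lambda>n. V b (\<tau> n)) \<longlonglongrightarrow> (LINT u|lborel. ?f (Complex b u))"
  if int: "integrable lborel (\<lambda>u. ?f (Complex b u))" for b
 proof -
  have "(\<lambda>n. LINT u|lborel. indicator {-\<tau> n..\<tau> n} u *\<^sub>R ?f (Complex b u)) \<longlonglongrightarrow> (LINT u|lborel. ?f (Complex b u))"
  proof (rule integral_dominated_convergence[where w = "\<lambda>u. norm (?f (Complex b u))"])
   show "AE u in lborel. (\<lambda>n. indicator {-\<tau> n..\<tau> n} u *\<^sub>R ?f (Complex b u)) \<longlonglongrightarrow> ?f (Complex b u)"
   proof (intro AE_I2)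
    fix u :: real
    have "eventually (\<lambda>n. \<tau> n \<ge> \<bar>u\<bar>) sequentially" using \<tau>inf by (simp add: filterlim_at_top)
    then have "eventually (\<lambda>n. indicator {-\<tau> n..\<tau> n} u *\<^sub>R ?f (Complex b u) = ?f (Complex b u)) sequentially"
     by eventually_elim (auto simp: indicator_def)
    then show "(\<lambda>n. indicator {-\<tau> n..\<tau> n} u *\<^sub>R ?f (Complex b u)) \<longlonglongrightarrow> ?f (Complex b u)"
     by (rule tendsto_eventually)
   qed
   show "integrable lborel (\<lambda>u. norm (?f (Complex b u)))" using int by (rule integrable_norm)
   show "\<And>n. (\<lambda>u. indicator {-\<tau> n..\<tau> n} u *\<^sub>R ?f (Complex b u)) \<in> borel_measurable lborel"
    using int by (intro borel_measurable_scaleR) auto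
  qed (use int in \<open>auto simp: indicator_def\<close>)
  moreover have "(LINT u|lborel. indicator {-\<tau> n..\<tau> n} u *\<^sub>R ?f (Complex b u)) = V b (\<tau> n)" for n
  proof -
   have "set_integrable lborel {-\<tau> n..\<tau> n} (\<lambda>u. ?f (Complex b u))"
    unfolding set_integrable_def using int by (intro integrable_mult_indicator) auto
   from set_borel_integral_eq_integral(2)[OF this] show ?thesis unfolding set_lebesgue_integral_def V_def .
  qed
  ultimately show ?thesis by simp
 qed
 have "(\<lambda>n. 2 * pi * G 0 - (V c (\<tau> n) - V (-\<rho>) (\<tau> n))) \<longlonglongrightarrow> 0"
 proof (rule Lim_null_comparison)
  show "\<forall>\<^sub>F n in sequentially. norm (2 * pi * G 0 - (V c (\<tau> n) - V (-\<rho>) (\<tau> n))) \<le> 2 * inverse (real (Suc n))"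
  proof (intro always_eventually allI)
   fix n
   have "(H (\<tau> n) + H (-\<tau> n)) / \<tau> n \<le> 2 * inverse (real (Suc n))"
    using \<tau>(2)[of n] \<tau>(3)[of n] \<tau>(4)[of n] by (simp add: pos_divide_le_eq)
   then show "norm (2 * pi * G 0 - (V c (\<tau> n) - V (-\<rho>) (\<tau> n))) \<le> 2 * inverse (real (Suc n))"
    using rect[OF \<tau>(2)[of n]] by linarith
  qed
  show "(\<lambda>n. 2 * inverse (real (Suc n))) \<longlonglongrightarrow> 0"
   using tendsto_mult_right_zero[OF LIMSEQ_inverse_real_of_nat] by simp
 qed
 moreover have "(\<lambda>n. 2 * pi * G 0 - (V c (\<tau> n) - V (-\<rho>) (\<tau> n))) \<longlonglongrightarrow>
   2 * pi * G 0 - ((LINT u|lborel. ?f (Complex c u)) - (LINT u|lborel. ?f (Complex (-\<rho>) u)))"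
  by (intro tendsto_intros Vlim intc intr)
 ultimately have "2 * pi * G 0 - ((LINT u|lborel. ?f (Complex c u)) - (LINT u|lborel. ?f (Complex (-\<rho>) u))) = 0"
  using LIMSEQ_unique by blast
 then show ?thesis by simp
qed

lemma cauchy_kernel_integral:
 fixes \<rho> :: real assumes "\<rho> > 0"
 shows "integrable lborel (\<lambda>u. 1 / (\<rho>\<^sup>2 + u\<^sup>2))" "(LINT u|lborel. 1 / (\<rho>\<^sup>2 + u\<^sup>2)) = pi / \<rho>"
proof -
 have i: "integrable lborel (\<lambda>x::real. inverse (1 + x\<^sup>2))"
  using integrable_inverse_1_plus_square by (simp add: set_integrable_def)
 have v: "(LINT x|lborel. inverse (1 + x\<^sup>2)) = pi"
  using LBINT_inverse_1_plus_square by (simp add: interval_lebesgue_integral_def set_lebesgue_integral_def)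
 have e: "inverse (1 + (0 + (1/\<rho>) * x)\<^sup>2) = \<rho>\<^sup>2 * (1 / (\<rho>\<^sup>2 + x\<^sup>2))" for x
  using assms by (simp add: field_simps power2_eq_square)
 have "integrable lborel (\<lambda>x. \<rho>\<^sup>2 * (1 / (\<rho>\<^sup>2 + x\<^sup>2)))"
  using lborel_integrable_real_affine[OF i, of "1/\<rho>" 0] assms unfolding e by simp
 then have "integrable lborel (\<lambda>x. (1/\<rho>\<^sup>2) * (\<rho>\<^sup>2 * (1 / (\<rho>\<^sup>2 + x\<^sup>2))))" by (rule integrable_mult_right)
 then show "integrable lborel (\<lambda>u. 1 / (\<rho>\<^sup>2 + u\<^sup>2))" using assms by simp
 have "pi = (1/\<rho>) * (LINT x|lborel. \<rho>\<^sup>2 * (1 / (\<rho>\<^sup>2 + x\<^sup>2)))"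
  using lborel_integral_real_affine[of "1/\<rho>" "\<lambda>x. inverse (1 + x\<^sup>2)" 0] v assms unfolding e by simp
 also have "\<dots> = \<rho> * (LINT x|lborel. 1 / (\<rho>\<^sup>2 + x\<^sup>2))"
  by (subst integral_mult_right_zero) (simp add: power2_eq_square)
 finally show "(LINT u|lborel. 1 / (\<rho>\<^sup>2 + u\<^sup>2)) = pi / \<rho>" using assms by (simp add: field_simps)
qed

text \<open>On the line \<open>Re w = -\<rho>\<close> the integrand \<open>exp (-yw) 2\<rho> / ((w + 2\<rho>) w)\<close> is a
 multiple of the Cauchy kernel, and its integral over \<open>Re w = c\<close> tends to 0 as \<open>c \<rightarrow>
 \<infinity>\<close>; the residue at 0 remains.\<close>

lemma cauchy_kernel_fourier:
 fixes \<rho> y :: real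
 assumes \<rho>: "\<rho> > 0" and y: "y \<ge> 0"
 shows "(LINT u|lborel. cis (- (y*u)) / complex_of_real (\<rho>\<^sup>2 + u\<^sup>2)) = complex_of_real (pi / \<rho> * exp (- (\<rho> * y)))"
proof -
 define J where "J = (LINT u|lborel. cis (- (y*u)) / complex_of_real (\<rho>\<^sup>2 + u\<^sup>2))"
 define G :: "complex \<Rightarrow> complex" where "G = (\<lambda>w::complex. exp (- (complex_of_real y * w)) * (2*\<rho> / (w + 2*\<rho>)))"
 define S where "S = {w::complex. Re w > -2*\<rho>}"
 have pos: "\<rho>\<^sup>2 + u\<^sup>2 > 0" for u :: real using \<rho> by (simp add: add_pos_nonneg)
 have S: "open S" "convex S" unfolding S_def by (simp_all add: open_halfspace_Re_gt convex_halfspace_Re_gt)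
 have ne: "w + 2*\<rho> \<noteq> 0" if "w \<in> S" for w :: complex
 proof
  assume "w + 2*\<rho> = 0"
  then have "Re (w + 2*\<rho>) = 0" by simp
  then show False using that by (simp add: S_def)
 qed
 have G: "G holomorphic_on S" unfolding G_def by (intro holomorphic_intros) (use ne in auto)
 have left: "G (Complex (-\<rho>) u) / Complex (-\<rho>) u
   = - complex_of_real (2*\<rho>*exp (y*\<rho>)) * (cis (-(y*u)) / complex_of_real (\<rho>\<^sup>2+u\<^sup>2))" for u
 proof -
  have 1: "exp (- (complex_of_real y * Complex (-\<rho>) u)) = complex_of_real (exp (y*\<rho>)) * cis (-(y*u))"
   by (subst exp_eq_polar) simp
  have 2: "(Complex (-\<rho>) u + 2*\<rho>) * Complex (-\<rho>) u = - complex_of_real (\<rho>\<^sup>2+u\<^sup>2)"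
   by (simp add: complex_eq_iff power2_eq_square algebra_simps)
  have "G (Complex (-\<rho>) u) / Complex (-\<rho>) u =
    exp (- (complex_of_real y * Complex (-\<rho>) u)) * (2*\<rho>) / ((Complex (-\<rho>) u + 2*\<rho>) * Complex (-\<rho>) u)"
   by (simp add: G_def)
  also have "\<dots> = - complex_of_real (2*\<rho>*exp (y*\<rho>)) * (cis (-(y*u)) / complex_of_real (\<rho>\<^sup>2+u\<^sup>2))"
  proof -
   have "A * B * C / (- D) = - (C * A) * (B / D)" for A B C D :: complex by simp
   then show ?thesis unfolding 1 2 of_real_mult[of "2*\<rho>"] .
  qed
  finally show ?thesis .
 qed
 have intk: "integrable lborel (\<lambda>u. cis (- (y*u)) / complex_of_real (\<rho>\<^sup>2 + u\<^sup>2))"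
 proof (rule Bochner_Integration.integrable_bound[OF cauchy_kernel_integral(1)[OF \<rho>]])
  show "(\<lambda>u. cis (- (y*u)) / complex_of_real (\<rho>\<^sup>2 + u\<^sup>2)) \<in> borel_measurable lborel"
   using pos by (auto intro!: borel_measurable_continuous_onI continuous_intros simp: less_le power2_eq_square
    simp flip: of_real_add of_real_mult)
  show "AE u in lborel. norm (cis (- (y*u)) / complex_of_real (\<rho>\<^sup>2 + u\<^sup>2)) \<le> norm (1 / (\<rho>\<^sup>2 + u\<^sup>2))"
   by (intro AE_I2) (simp only: norm_divide norm_cis norm_of_real real_norm_def abs_divide abs_one order_refl)
 qed
 have main: "norm (2*pi - complex_of_real (2*\<rho>*exp (y*\<rho>)) * (- J) * (-1)) \<le> 2*\<rho> * (pi / c)" if c: "c > 0" for c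
 proof -
  have nb: "norm (G (Complex c u) / Complex c u) \<le> 2*\<rho> * (1/(c\<^sup>2+u\<^sup>2))" for u
  proof -
   have "norm (Complex c u) \<le> norm (Complex c u + 2*\<rho>)"
    using c \<rho> by (auto simp: cmod_def power2_eq_square intro!: mult_mono)
   moreover have n0: "norm (Complex c u) > 0" using c by (simp add: complex_eq_iff)
   ultimately have "norm (Complex c u) * norm (Complex c u) \<le> norm (Complex c u + 2*\<rho>) * norm (Complex c u)"
    by (intro mult_right_mono) auto
   then have a: "c\<^sup>2+u\<^sup>2 \<le> norm (Complex c u + 2*\<rho>) * norm (Complex c u)" by (simp add: cmod_def)
   have cp: "c\<^sup>2+u\<^sup>2 > 0" using c by (simp add: add_pos_nonneg)
   have "norm (exp (- (complex_of_real y * Complex c u))) \<le> 1" using y c by simp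
   then have "norm (G (Complex c u)) \<le> 1 * (2*\<rho> / norm (Complex c u + 2*\<rho>))"
    unfolding G_def norm_mult norm_divide using \<rho> by (intro mult_mono) auto
   then have "norm (G (Complex c u) / Complex c u) \<le> (2*\<rho> / norm (Complex c u + 2*\<rho>)) / norm (Complex c u)"
    unfolding norm_divide[of "G _"] using n0 by (intro divide_right_mono) auto
   also have "\<dots> = 2*\<rho> / (norm (Complex c u + 2*\<rho>) * norm (Complex c u))" by simp
   also have "\<dots> \<le> 2*\<rho> / (c\<^sup>2+u\<^sup>2)" using a cp \<rho> by (intro divide_left_mono) auto
   finally show ?thesis by simp
  qed
  have ib: "integrable lborel (\<lambda>u. 2*\<rho> * (1/(c\<^sup>2+u\<^sup>2)))"
   by (rule integrable_mult_right[OF cauchy_kernel_integral(1)[OF c]])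
  have intc: "integrable lborel (\<lambda>u. G (Complex c u) / Complex c u)"
  proof (rule Bochner_Integration.integrable_bound[OF ib])
   have "continuous_on UNIV (\<lambda>u. G (Complex c u) / Complex c u)" unfolding G_def Complex_eq using c \<rho>
    by (intro continuous_intros) (auto simp: complex_eq_iff)
   then show "(\<lambda>u. G (Complex c u) / Complex c u) \<in> borel_measurable lborel"
    by (simp add: borel_measurable_continuous_onI)
   show "AE u in lborel. norm (G (Complex c u) / Complex c u) \<le> norm (2*\<rho> * (1/(c\<^sup>2+u\<^sup>2)))"
    using nb by (intro AE_I2) (metis abs_ge_self order_trans real_norm_def)
  qed
  have intr: "integrable lborel (\<lambda>u. G (Complex (-\<rho>) u) / Complex (-\<rho>) u)"
   unfolding left using intk by (intro integrable_mult_right) auto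
  have gb: "norm (G w) \<le> 2 * exp (y*\<rho>)" if "Re w \<ge> -\<rho>" for w
  proof -
   have "norm (exp (- (complex_of_real y * w))) \<le> exp (y*\<rho>)"
    using that y mult_left_mono[of "-\<rho>" "Re w" y] by simp
   moreover have "norm (2*\<rho> / (w + 2*\<rho>)) \<le> 2"
   proof -
    have "\<rho> \<le> norm (w + 2*\<rho>)" using that complex_Re_le_cmod[of "w + 2*\<rho>"] by simp
    moreover from this \<rho> have "norm (w + 2*\<rho>) > 0" by linarith
    ultimately show ?thesis using \<rho> by (simp add: norm_divide pos_divide_le_eq)
   qed
   ultimately have "norm (G w) \<le> exp (y*\<rho>) * 2" unfolding G_def norm_mult by (intro mult_mono) auto
   then show ?thesis by simp
  qed
  have G0: "G 0 = 1" using \<rho> by (simp add: G_def)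
  have "2 * pi * G 0 = (LINT u|lborel. G (Complex c u) / Complex c u)
    - (LINT u|lborel. G (Complex (-\<rho>) u) / Complex (-\<rho>) u)"
  proof (rule strip_integral_formula[OF \<rho> c S G _ intc intr])
   show "w \<in> S" if "-\<rho> \<le> Re w" for w using that \<rho> by (simp add: S_def)
   fix \<epsilon> T0 :: real assume \<epsilon>: "\<epsilon> > 0"
   define B where "B = (c+\<rho>) * (2 * exp (y*\<rho>))"
   have hb: "integral {-\<rho>..c} (\<lambda>x. norm (G (Complex x t))) \<le> B" for t
   proof -
    have "integral {-\<rho>..c} (\<lambda>x. norm (G (Complex x t))) \<le> integral {-\<rho>..c} (\<lambda>x. 2 * exp (y*\<rho>))"
    proof (rule integral_le)
     show "(\<lambda>x. norm (G (Complex x t))) integrable_on {-\<rho>..c}"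
      using \<rho> by (intro integrable_continuous_interval continuous_intros
       continuous_on_compose2[OF holomorphic_on_imp_continuous_on[OF G]])
       (auto simp: Complex_eq S_def intro!: continuous_intros)
    qed (use gb in auto)
    then show ?thesis using c \<rho> by (simp add: B_def algebra_simps)
   qed
   have "B \<le> \<epsilon> * max (max T0 1) (B/\<epsilon>)" using \<epsilon> by (metis max.cobounded2 mult.commute pos_divide_le_eq)
   then have "max (max T0 1) (B/\<epsilon>) \<ge> T0 \<and> max (max T0 1) (B/\<epsilon>) > 0 \<and> B \<le> \<epsilon> * max (max T0 1) (B/\<epsilon>)" by auto
   then show "\<exists>T\<ge>T0. T > 0 \<and> integral {-\<rho>..c} (\<lambda>x. norm (G (Complex x T))) \<le> \<epsilon> * T \<and>
    integral {-\<rho>..c} (\<lambda>x. norm (G (Complex x (-T)))) \<le> \<epsilon> * T" using hb order_trans by blast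
  qed
  moreover have "(LINT u|lborel. G (Complex (-\<rho>) u) / Complex (-\<rho>) u)
    = - complex_of_real (2*\<rho>*exp (y*\<rho>)) * J" unfolding left J_def by (rule integral_mult_right_zero)
  ultimately have "2*pi - complex_of_real (2*\<rho>*exp (y*\<rho>)) * (- J) * (-1)
    = (LINT u|lborel. G (Complex c u) / Complex c u)" by (simp add: G0)
  also have "norm \<dots> \<le> (LINT u|lborel. 2*\<rho> * (1/(c\<^sup>2+u\<^sup>2)))"
   using nb by (intro Bochner_Integration.integral_norm_bound_integral intc ib) auto
  also have "\<dots> = 2*\<rho> * (pi / c)" by (simp only: integral_mult_right_zero cauchy_kernel_integral(2)[OF c])
  finally show ?thesis .
 qed
 have "norm (2*pi - complex_of_real (2*\<rho>*exp (y*\<rho>)) * J) \<le> 0"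
 proof (rule field_le_epsilon)
  fix e :: real assume e: "e > 0"
  show "norm (2*pi - complex_of_real (2*\<rho>*exp (y*\<rho>)) * J) \<le> 0 + e" using main[of "2*\<rho>*pi/e"] \<rho> e by simp
 qed
 then have "complex_of_real (2*\<rho>*exp (y*\<rho>)) * J = 2*pi" by simp
 then have "J = 2*pi / complex_of_real (2*\<rho>*exp (y*\<rho>))" using \<rho> by (simp add: field_simps)
 also have "\<dots> = complex_of_real (pi / \<rho> * exp (- (\<rho> * y)))"
  using \<rho> by (simp add: exp_minus field_simps flip: exp_of_real)
 finally show ?thesis by (simp add: J_def)
qed

section \<open>Bounded means over vertical windows\<close>

lemma nn_integral_continuous_interval:
 fixes f :: "real \<Rightarrow> real"
 assumes f: "continuous_on {a..b} f" and nn: "\<And>x. x \<in> {a..b} \<Longrightarrow> f x \<ge> 0"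
 shows "ennreal (integral {a..b} f) = (\<integral>\<^sup>+x\<in>{a..b}. ennreal (f x) \<partial>lborel)"
proof -
 have s: "set_integrable lborel {a..b} f" by (rule borel_integrable_atLeastAtMost'[OF f])
 have "integral {a..b} f = (LINT x|lborel. indicator {a..b} x *\<^sub>R f x)"
  using set_borel_integral_eq_integral(2)[OF s] by (simp add: set_lebesgue_integral_def)
 also have "ennreal \<dots> = (\<integral>\<^sup>+x. ennreal (indicator {a..b} x *\<^sub>R f x) \<partial>lborel)"
  using s nn unfolding set_integrable_def by (intro nn_integral_eq_integral[symmetric]) (auto simp: indicator_def)
 also have "\<dots> = (\<integral>\<^sup>+x\<in>{a..b}. ennreal (f x) \<partial>lborel)" by (intro nn_integral_cong) (auto simp: indicator_def)
 finally show ?thesis .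
qed

text \<open>Convexity in the form that makes Jensen's inequality available without integrability of the \<open>p\<close>-th
 power.\<close>

lemma powr_tangent_le:
 fixes m x p :: real assumes "1 \<le> p" "m > 0" "x \<ge> 0"
 shows "m powr p + p * m powr (p-1) * (x - m) \<le> x powr p"
proof (cases "x = 0")
 case True
 have "m powr (p-1) * m = m powr p" using assms powr_mult_base[of m "p-1"] by (simp add: mult.commute)
 then have "m powr p + p * m powr (p-1) * (x - m) = (1 - p) * m powr p" using True by (simp add: algebra_simps)
 also have "\<dots> \<le> 0" using assms by (intro mult_nonpos_nonneg) auto
 finally show ?thesis using True by simp
next
 case False
 have "x powr p - m powr p \<ge> (p * m powr (p-1)) * (x - m)"
 proof (rule convex_on_imp_above_tangent[of "{0<..}" "\<lambda>x. x powr p"])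
  show "convex_on {0<..} (\<lambda>x. x powr p)" using powr_convex[OF assms(1)] by (rule convex_on_subset) auto
  show "((\<lambda>x. x powr p) has_real_derivative p * m powr (p - 1)) (at m within {0<..})"
   using assms by (auto intro!: derivative_eq_intros simp: )
 qed (use assms False in \<open>auto simp: interior_open\<close>)
 then show ?thesis by simp
qed

lemma powr_integral_le_nn_integral:
 fixes g k :: "'a \<Rightarrow> real"
 assumes p: "1 \<le> p" and k: "integrable M k" "(LINT x|M. k x) = 1" "\<And>x. k x \<ge> 0"
  and g: "\<And>x. g x \<ge> 0" "g \<in> borel_measurable M" and gk: "integrable M (\<lambda>x. g x * k x)"
 shows "ennreal ((LINT x|M. g x * k x) powr p) \<le> (\<integral>\<^sup>+x. ennreal (g x powr p * k x) \<partial>M)"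
proof (cases "(\<integral>\<^sup>+x. ennreal (g x powr p * k x) \<partial>M) = \<infinity>")
 case False
 have [measurable]: "k \<in> borel_measurable M" "g \<in> borel_measurable M" using k g by auto
 have int: "integrable M (\<lambda>x. g x powr p * k x)"
  using False k g by (intro integrableI_nonneg) (auto simp: less_top)
 define m where "m = (LINT x|M. g x * k x)"
 have "m \<ge> 0" unfolding m_def using k g by (intro integral_nonneg_AE) auto
 show ?thesis
 proof (cases "m = 0")
  case True then show ?thesis by (simp add: m_def)
 next
  case False
  with \<open>m \<ge> 0\<close> have m: "m > 0" by simp
  have "(LINT x|M. (m powr p - p * m powr (p-1) * m) * k x + p * m powr (p-1) * (g x * k x)) \<le> (LINT x|M. g x powr p * k x)"
  proof (rule integral_mono)
   show "integrable M (\<lambda>x. (m powr p - p * m powr (p-1) * m) * k x + p * m powr (p-1) * (g x * k x))"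
    using k gk by auto
   fix x
   have "(m powr p + p * m powr (p-1) * (g x - m)) * k x \<le> g x powr p * k x"
    using powr_tangent_le[OF p m g(1)] k(3) by (intro mult_right_mono) auto
   then show "(m powr p - p * m powr (p-1) * m) * k x + p * m powr (p-1) * (g x * k x) \<le> g x powr p * k x"
    by (simp add: algebra_simps)
  qed (rule int)
  also have "(LINT x|M. (m powr p - p * m powr (p-1) * m) * k x + p * m powr (p-1) * (g x * k x))
    = (m powr p - p * m powr (p-1) * m) * 1 + p * m powr (p-1) * m"
   using k gk by (subst Bochner_Integration.integral_add) (auto simp: m_def)
  finally have "m powr p \<le> (LINT x|M. g x powr p * k x)" by simp
  then show ?thesis using int k g by (subst nn_integral_eq_integral) (auto simp: m_def intro!: ennreal_leI)
 qed
qed auto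

text \<open>The Carlson bound on a single vertical line, for a nonnegative \<open>h\<close>.\<close>

definition mean_bdd :: "(real \<Rightarrow> ennreal) \<Rightarrow> real \<Rightarrow> bool" where
 "mean_bdd h X \<longleftrightarrow> h \<in> borel_measurable borel \<and> X \<ge> 0 \<and>
   (\<forall>T\<ge>1. (\<integral>\<^sup>+u\<in>{-T..T}. h u \<partial>lborel) \<le> ennreal (2 * T * X))"

lemma mean_bdd_measurable[measurable_dest]: "mean_bdd h X \<Longrightarrow> h \<in> borel_measurable borel"
 by (simp add: mean_bdd_def)

lemma mean_bdd_le: "mean_bdd h X \<Longrightarrow> T \<ge> 1 \<Longrightarrow> (\<integral>\<^sup>+u\<in>{-T..T}. h u \<partial>lborel) \<le> ennreal (2 * T * X)"
 by (simp add: mean_bdd_def)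

lemma nn_integral_real_shift:
 fixes f :: "real \<Rightarrow> ennreal"
 assumes [measurable]: "f \<in> borel_measurable borel"
 shows "(\<integral>\<^sup>+x. f (x + t) \<partial>lborel) = (\<integral>\<^sup>+x. f x \<partial>lborel)"
 using nn_integral_real_affine[OF assms, of 1 t] by (simp add: add.commute)

lemma nn_integral_window_shift:
 fixes h :: "real \<Rightarrow> ennreal"
 assumes [measurable]: "h \<in> borel_measurable borel" and "\<bar>v\<bar> + T \<le> S"
 shows "(\<integral>\<^sup>+t\<in>{-T..T}. h (t + v) \<partial>lborel) \<le> (\<integral>\<^sup>+t\<in>{-S..S}. h t \<partial>lborel)"
proof -
 have "(\<integral>\<^sup>+t\<in>{-T..T}. h (t + v) \<partial>lborel) \<le> (\<integral>\<^sup>+t. h (t + v) * indicator {-S..S} (t + v) \<partial>lborel)"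
  using assms(2) by (intro nn_integral_mono) (auto simp: indicator_def)
 also have "\<dots> = (\<integral>\<^sup>+t\<in>{-S..S}. h t \<partial>lborel)" by (rule nn_integral_real_shift) auto
 finally show ?thesis .
qed

lemma mean_bdd_shift:
 assumes h: "mean_bdd h X"
 shows "mean_bdd (\<lambda>u. h (u + t)) ((1 + \<bar>t\<bar>) * X)"
 unfolding mean_bdd_def
proof (intro conjI allI impI)
 have [measurable]: "h \<in> borel_measurable borel" and X: "X \<ge> 0" using h by (auto simp: mean_bdd_def)
 show "(\<lambda>u. h (u + t)) \<in> borel_measurable borel" by measurable
 show "(1 + \<bar>t\<bar>) * X \<ge> 0" using X by simp
 fix T :: real assume T: "T \<ge> 1"
 have "(\<integral>\<^sup>+u\<in>{-T..T}. h (u + t) \<partial>lborel) \<le> (\<integral>\<^sup>+t\<in>{-(T+\<bar>t\<bar>)..T+\<bar>t\<bar>}. h t \<partial>lborel)"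
  by (rule nn_integral_window_shift) auto
 also have "\<dots> \<le> ennreal (2 * (T+\<bar>t\<bar>) * X)" using T by (intro mean_bdd_le[OF h]) auto
 also have "\<dots> \<le> ennreal (2 * T * ((1 + \<bar>t\<bar>) * X))"
 proof (rule ennreal_leI)
  have "\<bar>t\<bar> \<le> T * \<bar>t\<bar>" using T by (simp add: mult_le_cancel_right1)
  then have "(T + \<bar>t\<bar>) * X \<le> (T * (1 + \<bar>t\<bar>)) * X" using X by (intro mult_right_mono) (auto simp: algebra_simps)
  then show "2 * (T+\<bar>t\<bar>) * X \<le> 2 * T * ((1 + \<bar>t\<bar>) * X)" by (simp add: algebra_simps)
 qed
 finally show "(\<integral>\<^sup>+u\<in>{-T..T}. h (u + t) \<partial>lborel) \<le> ennreal (2 * T * ((1 + \<bar>t\<bar>) * X))" .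
qed

text \<open>A symmetric decreasing kernel is a superposition of centred windows, so estimates for kernels reduce to estimates
 for windows.\<close>

lemma nn_integral_layers:
 fixes \<mu> :: "real \<Rightarrow> real" and h :: "real \<Rightarrow> ennreal" and k :: "real \<Rightarrow> ennreal"
 assumes [measurable]: "\<mu> \<in> borel_measurable borel" "h \<in> borel_measurable borel"
  and k: "\<And>u. k u = (\<integral>\<^sup>+\<tau>\<in>{\<bar>u\<bar>..}. ennreal (\<mu> \<tau>) \<partial>lborel)"
 shows "(\<integral>\<^sup>+u. h u * k u \<partial>lborel)
   = (\<integral>\<^sup>+\<tau>\<in>{0..}. ennreal (\<mu> \<tau>) * (\<integral>\<^sup>+u\<in>{-\<tau>..\<tau>}. h u \<partial>lborel) \<partial>lborel)"
proof -
 let ?E = "\<lambda>u \<tau>. h u * (ennreal (\<mu> \<tau>) * indicator {x::real\<times>real. \<bar>fst x\<bar> \<le> snd x} (u, \<tau>))"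
 have [measurable]: "{x::real\<times>real. \<bar>fst x\<bar> \<le> snd x} \<in> sets (lborel \<Otimes>\<^sub>M lborel)" unfolding lborel_prod sets_lborel
  by (auto intro!: borel_closed closed_Collect_le continuous_intros)
 have "(\<integral>\<^sup>+u. h u * k u \<partial>lborel) = (\<integral>\<^sup>+u. (\<integral>\<^sup>+\<tau>. ?E u \<tau> \<partial>lborel) \<partial>lborel)"
  unfolding k by (intro nn_integral_cong, subst nn_integral_cmult[symmetric])
   (auto intro!: nn_integral_cong simp: indicator_def)
 also have "\<dots> = (\<integral>\<^sup>+\<tau>. (\<integral>\<^sup>+u. ?E u \<tau> \<partial>lborel) \<partial>lborel)" by (rule lborel_pair.Fubini'[symmetric]) measurable
 also have "\<dots> = (\<integral>\<^sup>+\<tau>\<in>{0..}. ennreal (\<mu> \<tau>) * (\<integral>\<^sup>+u\<in>{-\<tau>..\<tau>}. h u \<partial>lborel) \<partial>lborel)"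
 proof (intro nn_integral_cong)
  fix \<tau> :: real
  have "(\<integral>\<^sup>+u. ?E u \<tau> \<partial>lborel) = (\<integral>\<^sup>+u. ennreal (\<mu> \<tau>) * indicator {0..} \<tau> * (h u * indicator {-\<tau>..\<tau>} u) \<partial>lborel)"
   by (intro nn_integral_cong) (auto simp: indicator_def mult_ac)
  also have "\<dots> = ennreal (\<mu> \<tau>) * indicator {0..} \<tau> * (\<integral>\<^sup>+u\<in>{-\<tau>..\<tau>}. h u \<partial>lborel)"
   by (rule nn_integral_cmult) auto
  finally show "(\<integral>\<^sup>+u. ?E u \<tau> \<partial>lborel) = ennreal (\<mu> \<tau>) * (\<integral>\<^sup>+u\<in>{-\<tau>..\<tau>}. h u \<partial>lborel) * indicator {0..} \<tau>"
   by (simp add: mult_ac)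
 qed
 finally show ?thesis .
qed

lemma powr_tail_integral:
 fixes a x :: real
 assumes "a > 1" "x \<ge> 0"
 shows "(\<integral>\<^sup>+\<tau>\<in>{x..}. ennreal ((a-1) * (1+\<bar>\<tau>\<bar>) powr (-a)) \<partial>lborel) = ennreal ((1 + x) powr (1-a))"
proof -
 have "(\<integral>\<^sup>+\<tau>\<in>{x..}. ennreal ((a-1) * (1+\<bar>\<tau>\<bar>) powr (-a)) \<partial>lborel)
   = ennreal (0 - (- ((1+x) powr (1-a))))"
 proof (rule nn_integral_FTC_atLeast)
  show "(\<lambda>\<tau>. (a - 1) * (1 + \<bar>\<tau>\<bar>) powr - a) \<in> borel_measurable borel" by measurable
  show "((\<lambda>\<tau>. - ((1+\<tau>) powr (1-a))) has_real_derivative (a - 1) * (1 + \<bar>y\<bar>) powr - a) (at y)" if "x \<le> y" for y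
   using that assms by (auto intro!: derivative_eq_intros simp: algebra_simps)
  have "((\<lambda>\<tau>. (1+\<tau>) powr (1-a)) \<longlongrightarrow> 0) at_top"
   using assms by (intro tendsto_neg_powr) (auto intro!: filterlim_tendsto_add_at_top filterlim_ident)
  then show "((\<lambda>\<tau>. - ((1+\<tau>) powr (1-a))) \<longlongrightarrow> 0) at_top" using tendsto_minus by fastforce
 qed (use assms in auto)
 then show ?thesis by simp
qed

lemma nn_integral_mean_bdd_weight:
 assumes h: "mean_bdd h X" and a: "a > 1"
 shows "(\<integral>\<^sup>+u. h u * ennreal ((1 + \<bar>u\<bar>) powr (-a)) \<partial>lborel) \<le> ennreal (2 * a / (a-1) * X)"
proof -
 have [measurable]: "h \<in> borel_measurable borel" and X: "X \<ge> 0" using h by (auto simp: mean_bdd_def)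
 have "(\<integral>\<^sup>+u. h u * ennreal ((1 + \<bar>u\<bar>) powr (-a)) \<partial>lborel)
   = (\<integral>\<^sup>+\<tau>\<in>{0..}. ennreal (a * (1+\<bar>\<tau>\<bar>) powr (-(a+1))) * (\<integral>\<^sup>+u\<in>{-\<tau>..\<tau>}. h u \<partial>lborel) \<partial>lborel)"
  using powr_tail_integral[of "a+1"] a by (intro nn_integral_layers) auto
 also have "\<dots> \<le> (\<integral>\<^sup>+\<tau>\<in>{0..}. ennreal (2*a*X/(a-1)) * ennreal ((a-1) * (1+\<bar>\<tau>\<bar>) powr (-a)) \<partial>lborel)"
 proof (intro nn_integral_mono, goal_cases)
  case (1 \<tau>)
  show ?case
  proof (cases "\<tau> \<ge> 0")
   case True
   have "(\<integral>\<^sup>+u\<in>{-\<tau>..\<tau>}. h u \<partial>lborel) \<le> (\<integral>\<^sup>+u\<in>{-(1+\<tau>)..1+\<tau>}. h u \<partial>lborel)"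
    by (intro nn_integral_mono) (auto simp: indicator_def)
   also have "\<dots> \<le> ennreal (2*(1+\<tau>)*X)" using True by (intro mean_bdd_le[OF h]) auto
   finally have "ennreal (a * (1+\<bar>\<tau>\<bar>) powr (-(a+1))) * (\<integral>\<^sup>+u\<in>{-\<tau>..\<tau>}. h u \<partial>lborel)
     \<le> ennreal (a * (1+\<bar>\<tau>\<bar>) powr (-(a+1))) * ennreal (2*(1+\<tau>)*X)" by (intro mult_left_mono) auto
   also have "\<dots> = ennreal (2*a*X * ((1+\<tau>) powr (-(a+1)) * (1+\<tau>)))"
    using True a X by (subst ennreal_mult[symmetric]) (auto simp: mult_ac)
   also have "(1+\<tau>) powr (-(a+1)) * (1+\<tau>) = (1+\<tau>) powr (-a)" using True powr_add[of "1+\<tau>" "-(a+1)" 1] by simp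
   also have "ennreal (2*a*X * (1+\<tau>) powr (-a)) = ennreal (2*a*X/(a-1)) * ennreal ((a-1) * (1+\<bar>\<tau>\<bar>) powr (-a))"
    using True a X by (subst ennreal_mult[symmetric]) auto
   finally show ?thesis using True by (simp add: indicator_def)
  qed (simp add: indicator_def)
 qed
 also have "\<dots> = (\<integral>\<^sup>+\<tau>. ennreal (2*a*X/(a-1)) * (ennreal ((a-1) * (1+\<bar>\<tau>\<bar>) powr (-a)) * indicator {0..} \<tau>) \<partial>lborel)"
  by (simp add: mult.assoc)
 also have "\<dots> = ennreal (2*a*X/(a-1)) * (\<integral>\<^sup>+\<tau>\<in>{0..}. ennreal ((a-1) * (1+\<bar>\<tau>\<bar>) powr (-a)) \<partial>lborel)"
  by (rule nn_integral_cmult) measurable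
 also have "\<dots> = ennreal (2*a*X/(a-1))" using powr_tail_integral[OF a, of 0] by simp
 finally show ?thesis by (simp add: mult_ac)
qed

lemma nn_integral_conv_swap:
 fixes h :: "real \<Rightarrow> ennreal"
 assumes [measurable]: "h \<in> borel_measurable borel" "k \<in> borel_measurable borel"
 shows "(\<integral>\<^sup>+t\<in>{-T..T}. (\<integral>\<^sup>+u. h (t + u) * k u \<partial>lborel) \<partial>lborel)
   = (\<integral>\<^sup>+u. (\<integral>\<^sup>+t\<in>{-T..T}. h (t + u) \<partial>lborel) * k u \<partial>lborel)"
proof -
 have "(\<integral>\<^sup>+t\<in>{-T..T}. (\<integral>\<^sup>+u. h (t + u) * k u \<partial>lborel) \<partial>lborel)
   = (\<integral>\<^sup>+t. (\<integral>\<^sup>+u. h (t + u) * k u * indicator {-T..T} t \<partial>lborel) \<partial>lborel)"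
  by (intro nn_integral_cong nn_integral_multc[symmetric]) measurable
 also have "\<dots> = (\<integral>\<^sup>+u. (\<integral>\<^sup>+t. h (t + u) * k u * indicator {-T..T} t \<partial>lborel) \<partial>lborel)"
  by (rule lborel_pair.Fubini'[symmetric]) measurable
 also have "\<dots> = (\<integral>\<^sup>+u. (\<integral>\<^sup>+t. h (t + u) * indicator {-T..T} t * k u \<partial>lborel) \<partial>lborel)" by (simp add: mult_ac)
 also have "\<dots> = (\<integral>\<^sup>+u. (\<integral>\<^sup>+t\<in>{-T..T}. h (t + u) \<partial>lborel) * k u \<partial>lborel)"
  by (intro nn_integral_cong nn_integral_multc) measurable
 finally show ?thesis .
qed

lemma mean_bdd_conv:
 fixes k :: "real \<Rightarrow> ennreal"
 assumes h: "mean_bdd h X" and [measurable]: "k \<in> borel_measurable borel" and T: "T \<ge> 1"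
 shows "(\<integral>\<^sup>+t\<in>{-T..T}. (\<integral>\<^sup>+u. h (t + u) * k u \<partial>lborel) \<partial>lborel)
   \<le> ennreal (2 * T * X) * (\<integral>\<^sup>+u. ennreal (1 + \<bar>u\<bar>) * k u \<partial>lborel)"
proof -
 have [measurable]: "h \<in> borel_measurable borel" and X: "X \<ge> 0" using h by (auto simp: mean_bdd_def)
 have "(\<integral>\<^sup>+t\<in>{-T..T}. (\<integral>\<^sup>+u. h (t + u) * k u \<partial>lborel) \<partial>lborel)
   = (\<integral>\<^sup>+u. (\<integral>\<^sup>+t\<in>{-T..T}. h (t + u) \<partial>lborel) * k u \<partial>lborel)" by (rule nn_integral_conv_swap) auto
 also have "\<dots> \<le> (\<integral>\<^sup>+u. ennreal (2 * T * X) * (ennreal (1 + \<bar>u\<bar>) * k u) \<partial>lborel)"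
 proof (intro nn_integral_mono)
  fix u :: real
  have "(\<integral>\<^sup>+t\<in>{-T..T}. h (t + u) \<partial>lborel) \<le> ennreal (2 * T * ((1 + \<bar>u\<bar>) * X))"
   by (rule mean_bdd_le[OF mean_bdd_shift[OF h] T])
  also have "\<dots> = ennreal (2*T*X) * ennreal (1 + \<bar>u\<bar>)"
   using X T by (subst ennreal_mult[symmetric]) (auto simp: mult_ac)
  finally show "(\<integral>\<^sup>+t\<in>{-T..T}. h (t + u) \<partial>lborel) * k u \<le> ennreal (2 * T * X) * (ennreal (1 + \<bar>u\<bar>) * k u)"
   using mult_right_mono by (fastforce simp: mult.assoc)
 qed
 also have "\<dots> = ennreal (2 * T * X) * (\<integral>\<^sup>+u. ennreal (1 + \<bar>u\<bar>) * k u \<partial>lborel)"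
  by (rule nn_integral_cmult) measurable
 finally show ?thesis .
qed

definition poisson_kernel :: "real \<Rightarrow> real \<Rightarrow> real" where
 "poisson_kernel \<sigma> u = \<sigma> / (pi * (\<sigma>\<^sup>2 + u\<^sup>2))"

lemma poisson_kernel_layers:
 fixes \<sigma> u :: real
 assumes "\<sigma> > 0"
 defines "\<mu> \<equiv> \<lambda>\<tau>::real. 2 * \<sigma> * \<bar>\<tau>\<bar> / (pi * (\<sigma>\<^sup>2 + \<tau>\<^sup>2)\<^sup>2)"
 shows "ennreal (poisson_kernel \<sigma> u) = (\<integral>\<^sup>+\<tau>\<in>{\<bar>u\<bar>..}. ennreal (\<mu> \<tau>) \<partial>lborel)"
  and "(\<integral>\<^sup>+\<tau>\<in>{0..}. ennreal (2 * \<tau> * \<mu> \<tau>) \<partial>lborel) = 1"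
proof -
 have pos: "\<sigma>\<^sup>2 + x\<^sup>2 > 0" for x :: real using assms by (simp add: add_pos_nonneg)
 have nz: "\<sigma>\<^sup>2 + x\<^sup>2 \<noteq> 0" for x :: real using pos[of x] by linarith
 have "(\<integral>\<^sup>+\<tau>\<in>{\<bar>u\<bar>..}. ennreal (\<mu> \<tau>) \<partial>lborel) = ennreal (0 - (- poisson_kernel \<sigma> \<bar>u\<bar>))"
 proof (rule nn_integral_FTC_atLeast)
  show "\<mu> \<in> borel_measurable borel" unfolding \<mu>_def by measurable
  show "((\<lambda>\<tau>. - poisson_kernel \<sigma> \<tau>) has_real_derivative \<mu> x) (at x)" if "\<bar>u\<bar> \<le> x" for x
   unfolding poisson_kernel_def \<mu>_def using that nz[of x]
   by (auto intro!: derivative_eq_intros simp: power2_eq_square divide_simps)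
  show "0 \<le> \<mu> x" for x using assms by (simp add: \<mu>_def)
  show "((\<lambda>\<tau>. - poisson_kernel \<sigma> \<tau>) \<longlongrightarrow> 0) at_top"
  proof -
   have "filterlim (\<lambda>\<tau>::real. pi * (\<sigma>\<^sup>2 + \<tau>\<^sup>2)) at_top at_top"
    by (intro filterlim_tendsto_pos_mult_at_top[OF tendsto_const] filterlim_tendsto_add_at_top[OF tendsto_const]
      filterlim_pow_at_top filterlim_ident) auto
   then have "((\<lambda>\<tau>. poisson_kernel \<sigma> \<tau>) \<longlongrightarrow> 0) at_top"
    unfolding poisson_kernel_def by (intro tendsto_divide_0[OF tendsto_const] filterlim_at_top_imp_at_infinity)
   then show ?thesis using tendsto_minus by fastforce
  qed
 qed
 then show "ennreal (poisson_kernel \<sigma> u) = (\<integral>\<^sup>+\<tau>\<in>{\<bar>u\<bar>..}. ennreal (\<mu> \<tau>) \<partial>lborel)"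
  by (simp add: poisson_kernel_def)
 have "(\<integral>\<^sup>+\<tau>\<in>{0..}. ennreal (2 * \<tau> * \<mu> \<tau>) \<partial>lborel)
   = ennreal (1 - (2/pi * (arctan (0/\<sigma>) - \<sigma> * 0 / (\<sigma>\<^sup>2 + 0\<^sup>2))))"
 proof (rule nn_integral_FTC_atLeast)
  show "(\<lambda>\<tau>. 2 * \<tau> * \<mu> \<tau>) \<in> borel_measurable borel" unfolding \<mu>_def by measurable
  show "((\<lambda>\<tau>. 2/pi * (arctan (\<tau>/\<sigma>) - \<sigma> * \<tau> / (\<sigma>\<^sup>2 + \<tau>\<^sup>2))) has_real_derivative 2 * x * \<mu> x) (at x)" if "0 \<le> x" for x
  proof -
   have "((\<lambda>\<tau>. 2/pi * (arctan (\<tau>/\<sigma>) - \<sigma> * \<tau> / (\<sigma>\<^sup>2 + \<tau>\<^sup>2))) has_real_derivative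
     2/pi * (inverse (1 + (x/\<sigma>)\<^sup>2) * (1/\<sigma>) - (\<sigma> * (\<sigma>\<^sup>2 + x\<^sup>2) - \<sigma> * x * (2*x)) / (\<sigma>\<^sup>2 + x\<^sup>2)\<^sup>2)) (at x)"
    using nz[of x] assms(1) by (auto intro!: derivative_eq_intros simp: power2_eq_square mult_ac)
   moreover have "inverse (1 + (x/\<sigma>)\<^sup>2) * (1/\<sigma>) = \<sigma> / (\<sigma>\<^sup>2 + x\<^sup>2)"
   proof -
    have "1 + (x/\<sigma>)\<^sup>2 = (\<sigma>\<^sup>2 + x\<^sup>2) / \<sigma>\<^sup>2" using assms(1) by (simp add: field_simps)
    then show ?thesis using assms(1) by (simp add: power2_eq_square)
   qed
   moreover have "2/pi * (\<sigma> / (\<sigma>\<^sup>2 + x\<^sup>2) - (\<sigma> * (\<sigma>\<^sup>2 + x\<^sup>2) - \<sigma> * x * (2*x)) / (\<sigma>\<^sup>2 + x\<^sup>2)\<^sup>2) = 2 * x * \<mu> x"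
   proof -
    have "\<sigma> / (\<sigma>\<^sup>2 + x\<^sup>2) = \<sigma> * (\<sigma>\<^sup>2 + x\<^sup>2) / (\<sigma>\<^sup>2 + x\<^sup>2)\<^sup>2" using nz[of x] by (simp add: power2_eq_square)
    then have "\<sigma> / (\<sigma>\<^sup>2 + x\<^sup>2) - (\<sigma> * (\<sigma>\<^sup>2 + x\<^sup>2) - \<sigma> * x * (2*x)) / (\<sigma>\<^sup>2 + x\<^sup>2)\<^sup>2 = 2*\<sigma>*x*x / (\<sigma>\<^sup>2 + x\<^sup>2)\<^sup>2"
     by (simp add: diff_divide_distrib[symmetric])
    then show ?thesis using that by (simp add: \<mu>_def)
   qed
   ultimately show ?thesis by (simp only:)
  qed
  show "0 \<le> 2 * x * \<mu> x" if "0 \<le> x" for x using that assms by (simp add: \<mu>_def)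
  have "((\<lambda>\<tau>. arctan (\<tau>/\<sigma>)) \<longlongrightarrow> pi/2) at_top" using assms(1) by (intro filterlim_compose[OF tendsto_arctan_at_top])
    (auto simp: divide_inverse intro!: filterlim_at_top_mult_tendsto_pos[OF tendsto_const] filterlim_ident)
  moreover have "((\<lambda>\<tau>. \<sigma> * \<tau> / (\<sigma>\<^sup>2 + \<tau>\<^sup>2)) \<longlongrightarrow> 0) at_top"
  proof (rule Lim_null_comparison)
   show "\<forall>\<^sub>F \<tau> in at_top. norm (\<sigma> * \<tau> / (\<sigma>\<^sup>2 + \<tau>\<^sup>2)) \<le> \<sigma> / \<tau>" using eventually_gt_at_top[of 0]
   proof eventually_elim
    case (elim \<tau>)
    have "\<sigma> * \<tau> * \<tau> \<le> \<sigma> * (\<sigma>\<^sup>2 + \<tau>\<^sup>2)" using assms(1) by (simp add: power2_eq_square algebra_simps)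
    then show ?case using elim assms(1) pos[of \<tau>] by (simp add: divide_simps mult_ac)
   qed
   show "((\<lambda>\<tau>. \<sigma> / \<tau>) \<longlongrightarrow> 0) at_top"
    by (intro tendsto_divide_0[OF tendsto_const] filterlim_at_top_imp_at_infinity filterlim_ident)
  qed
  ultimately have "((\<lambda>\<tau>. 2/pi * (arctan (\<tau>/\<sigma>) - \<sigma> * \<tau> / (\<sigma>\<^sup>2 + \<tau>\<^sup>2))) \<longlongrightarrow> 2/pi * (pi/2 - 0)) at_top"
   by (intro tendsto_intros)
  then show "((\<lambda>\<tau>. 2/pi * (arctan (\<tau>/\<sigma>) - \<sigma> * \<tau> / (\<sigma>\<^sup>2 + \<tau>\<^sup>2))) \<longlongrightarrow> 1) at_top" by simp
 qed
 then show "(\<integral>\<^sup>+\<tau>\<in>{0..}. ennreal (2 * \<tau> * \<mu> \<tau>) \<partial>lborel) = 1" by simp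
qed

text \<open>Two windows of lengths \<open>2T\<close> and \<open>2\<tau>\<close> are convolved by shifting the shorter one along
 the longer one, which stays inside a window of twice the longer length. Hence the factor 2, uniformly in
 \<open>\<sigma>\<close>.\<close>

lemma poisson_mean_le:
 assumes h: "mean_bdd h X" and \<sigma>: "\<sigma> > 0" and T: "T \<ge> 1"
 shows "(\<integral>\<^sup>+t\<in>{-T..T}. (\<integral>\<^sup>+u. h (t + u) * ennreal (poisson_kernel \<sigma> u) \<partial>lborel) \<partial>lborel) \<le> ennreal (2 * T * (2 * X))"
proof -
 have [measurable]: "h \<in> borel_measurable borel" and X: "X \<ge> 0" using h by (auto simp: mean_bdd_def)
 define \<mu> where "\<mu> = (\<lambda>\<tau>::real. 2 * \<sigma> * \<bar>\<tau>\<bar> / (pi * (\<sigma>\<^sup>2 + \<tau>\<^sup>2)\<^sup>2))"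
 have \<mu>0: "\<mu> \<tau> \<ge> 0" for \<tau> using \<sigma> by (simp add: \<mu>_def)
 have [measurable]: "\<mu> \<in> borel_measurable borel" unfolding \<mu>_def by measurable
 have [measurable]: "poisson_kernel \<sigma> \<in> borel_measurable borel" unfolding poisson_kernel_def[abs_def] by measurable
 define H where "H u = (\<integral>\<^sup>+t\<in>{-T..T}. h (t + u) \<partial>lborel)" for u
 have [measurable]: "H \<in> borel_measurable borel" unfolding H_def[abs_def] by measurable
 have "(\<integral>\<^sup>+t\<in>{-T..T}. (\<integral>\<^sup>+u. h (t + u) * ennreal (poisson_kernel \<sigma> u) \<partial>lborel) \<partial>lborel)
   = (\<integral>\<^sup>+u. H u * ennreal (poisson_kernel \<sigma> u) \<partial>lborel)"
  unfolding H_def by (rule nn_integral_conv_swap) measurable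
 also have "\<dots> = (\<integral>\<^sup>+\<tau>\<in>{0..}. ennreal (\<mu> \<tau>) * (\<integral>\<^sup>+u\<in>{-\<tau>..\<tau>}. H u \<partial>lborel) \<partial>lborel)"
  by (rule nn_integral_layers) (auto simp: \<mu>_def poisson_kernel_layers(1)[OF \<sigma>])
 also have "\<dots> \<le> (\<integral>\<^sup>+\<tau>\<in>{0..}. ennreal (2 * T * (2 * X)) * ennreal (2 * \<tau> * \<mu> \<tau>) \<partial>lborel)"
 proof (intro nn_integral_mono, goal_cases)
  case (1 \<tau>)
  show ?case
  proof (cases "\<tau> \<ge> 0")
   case True
   have "(\<integral>\<^sup>+u\<in>{-\<tau>..\<tau>}. H u \<partial>lborel) \<le> ennreal (2 * T * (2 * X) * (2 * \<tau>))"
   proof (cases "\<tau> \<le> T")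
    case le: True
    have "H u \<le> ennreal (2 * (2*T) * X)" if "u \<in> {-\<tau>..\<tau>}" for u
    proof -
     have "H u \<le> (\<integral>\<^sup>+t\<in>{-(2*T)..2*T}. h t \<partial>lborel)"
      unfolding H_def using that le by (intro nn_integral_window_shift) auto
     also have "\<dots> \<le> ennreal (2 * (2*T) * X)" using T by (intro mean_bdd_le[OF h]) auto
     finally show ?thesis .
    qed
    then have "(\<integral>\<^sup>+u\<in>{-\<tau>..\<tau>}. H u \<partial>lborel) \<le> (\<integral>\<^sup>+u\<in>{-\<tau>..\<tau>}. ennreal (2 * (2*T) * X) \<partial>lborel)"
     by (intro nn_integral_mono) (auto simp: indicator_def)
    also have "\<dots> = ennreal (2 * T * (2 * X) * (2 * \<tau>))"
     using True T X by (subst nn_integral_cmult_indicator) (auto simp: ennreal_mult[symmetric] mult_ac)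
    finally show ?thesis .
   next
    case False
    have "(\<integral>\<^sup>+u\<in>{-\<tau>..\<tau>}. H u \<partial>lborel) = (\<integral>\<^sup>+t\<in>{-T..T}. (\<integral>\<^sup>+u. h (t + u) * indicator {-\<tau>..\<tau>} u \<partial>lborel) \<partial>lborel)"
     unfolding H_def by (rule nn_integral_conv_swap[symmetric]) measurable
    also have "\<dots> = (\<integral>\<^sup>+t\<in>{-T..T}. (\<integral>\<^sup>+u\<in>{-\<tau>..\<tau>}. h (u + t) \<partial>lborel) \<partial>lborel)" by (simp add: add.commute)
    also have "\<dots> \<le> (\<integral>\<^sup>+t\<in>{-T..T}. ennreal (2 * (2*\<tau>) * X) \<partial>lborel)"
    proof (intro nn_integral_mono, goal_cases)
     case (1 t)
     have "(\<integral>\<^sup>+u\<in>{-\<tau>..\<tau>}. h (u + t) \<partial>lborel) \<le> (\<integral>\<^sup>+u\<in>{-(2*\<tau>)..2*\<tau>}. h u \<partial>lborel)" if "t \<in> {-T..T}"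
      using that False by (intro nn_integral_window_shift) auto
     moreover have "(\<integral>\<^sup>+u\<in>{-(2*\<tau>)..2*\<tau>}. h u \<partial>lborel) \<le> ennreal (2 * (2*\<tau>) * X)"
      using T False by (intro mean_bdd_le[OF h]) auto
     ultimately show ?case by (auto simp: indicator_def)
    qed
    also have "\<dots> = ennreal (2 * T * (2 * X) * (2 * \<tau>))"
     using True T X by (subst nn_integral_cmult_indicator) (auto simp: ennreal_mult[symmetric] mult_ac)
    finally show ?thesis .
   qed
   then have "ennreal (\<mu> \<tau>) * (\<integral>\<^sup>+u\<in>{-\<tau>..\<tau>}. H u \<partial>lborel) \<le> ennreal (\<mu> \<tau>) * ennreal (2 * T * (2 * X) * (2 * \<tau>))"
    by (intro mult_left_mono) auto
   also have "\<dots> = ennreal (2 * T * (2 * X)) * ennreal (2 * \<tau> * \<mu> \<tau>)"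
    using True T X \<mu>0 by (simp add: ennreal_mult[symmetric] mult_ac)
   finally show ?thesis using True by (simp add: indicator_def)
  qed (simp add: indicator_def)
 qed
 also have "\<dots> = (\<integral>\<^sup>+\<tau>. ennreal (2 * T * (2 * X)) * (ennreal (2 * \<tau> * \<mu> \<tau>) * indicator {0..} \<tau>) \<partial>lborel)"
  by (simp add: mult.assoc)
 also have "\<dots> = ennreal (2 * T * (2 * X)) * (\<integral>\<^sup>+\<tau>\<in>{0..}. ennreal (2 * \<tau> * \<mu> \<tau>) \<partial>lborel)"
  by (rule nn_integral_cmult) measurable
 also have "\<dots> = ennreal (2 * T * (2 * X))" unfolding \<mu>_def poisson_kernel_layers(2)[OF \<sigma>] by simp
 finally show ?thesis .
qed

section \<open>The infinite torus and the Kronecker flow\<close>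

lemma nn_integral_periodic_shift:
 fixes g :: "real \<Rightarrow> ennreal"
 assumes [measurable]: "g \<in> borel_measurable borel" and per: "\<And>t. g (t + 1) = g t"
 shows "(\<integral>\<^sup>+t\<in>{0..1}. g (t + \<alpha>) \<partial>lborel) = (\<integral>\<^sup>+t\<in>{0..1}. g t \<partial>lborel)"
proof -
 have perk: "g (t + of_int k) = g t" for t k
 proof (induction k rule: int_induct[where k = 0])
  case (step1 i) then show ?case using per[of "t + of_int i"] by (simp add: add.assoc)
 next
  case (step2 i) then show ?case using per[of "t + of_int i - 1"] by (simp add: algebra_simps)
 qed simp
 define \<beta> where "\<beta> = frac \<alpha>"
 have \<beta>: "0 \<le> \<beta>" "\<beta> < 1" by (auto simp: \<beta>_def frac_lt_1)
 have g\<alpha>: "g (t + \<alpha>) = g (t + \<beta>)" for t using perk[of "t + \<beta>" "\<lfloor>\<alpha>\<rfloor>"] by (simp add: \<beta>_def frac_def algebra_simps)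
 have ae: "(\<integral>\<^sup>+t\<in>{0..1}. h t \<partial>lborel) = (\<integral>\<^sup>+t\<in>{0<..1}. h t \<partial>lborel)" for h :: "real \<Rightarrow> ennreal"
  by (intro nn_integral_cong_AE eventually_mono[OF AE_lborel_singleton[of 0]]) (auto simp: indicator_def)
 have shift: "(\<integral>\<^sup>+x. f (x + t) \<partial>lborel) = (\<integral>\<^sup>+x. f x \<partial>lborel)"
  if [measurable]: "f \<in> borel_measurable borel" for f :: "real \<Rightarrow> ennreal" and t
  using nn_integral_real_affine[of f 1 t] by (simp add: add.commute)
 have "(\<integral>\<^sup>+t\<in>{0..1}. g (t + \<alpha>) \<partial>lborel) = (\<integral>\<^sup>+t. g (t + \<beta>) * indicator {\<beta><..1+\<beta>} (t + \<beta>) \<partial>lborel)"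
  unfolding ae g\<alpha> by (intro nn_integral_cong) (auto simp: indicator_def)
 also have "\<dots> = (\<integral>\<^sup>+t\<in>{\<beta><..1+\<beta>}. g t \<partial>lborel)" by (rule shift) measurable
 also have "\<dots> = (\<integral>\<^sup>+t. g t * indicator {\<beta><..1} t + g t * indicator {1<..1+\<beta>} t \<partial>lborel)"
  using \<beta> by (intro nn_integral_cong) (auto simp: indicator_def)
 also have "\<dots> = (\<integral>\<^sup>+t\<in>{\<beta><..1}. g t \<partial>lborel) + (\<integral>\<^sup>+t\<in>{1<..1+\<beta>}. g t \<partial>lborel)" by (rule nn_integral_add) measurable
 also have "(\<integral>\<^sup>+t\<in>{1<..1+\<beta>}. g t \<partial>lborel) = (\<integral>\<^sup>+t. g (t + 1) * indicator {1<..1+\<beta>} (t + 1) \<partial>lborel)"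
  by (rule shift[symmetric]) measurable
 also have "\<dots> = (\<integral>\<^sup>+t\<in>{0<..\<beta>}. g t \<partial>lborel)" by (intro nn_integral_cong) (auto simp: per indicator_def)
 also have "(\<integral>\<^sup>+t\<in>{\<beta><..1}. g t \<partial>lborel) + \<dots> = (\<integral>\<^sup>+t. g t * indicator {\<beta><..1} t + g t * indicator {0<..\<beta>} t \<partial>lborel)"
  by (rule nn_integral_add[symmetric]) measurable
 also have "\<dots> = (\<integral>\<^sup>+t\<in>{0<..1}. g t \<partial>lborel)" using \<beta> by (intro nn_integral_cong) (auto simp: indicator_def)
 finally show ?thesis unfolding ae .
qed

lemma cis_measurable [measurable]:
 "(\<lambda>t. cis (2 * pi * t)) \<in> lborel \<rightarrow>\<^sub>M restrict_space borel (sphere 0 1)"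
 by (intro measurable_restrict_space2 borel_measurable_continuous_onI continuous_intros | simp)+

lemma space_circle [simp]: "space circle_measure = sphere 0 1"
 and sets_circle [simp, measurable_cong]: "sets circle_measure = sets (restrict_space borel (sphere 0 1))"
 by (simp_all add: circle_measure_def space_restrict_space)

lemma prob_space_circle: "prob_space circle_measure"
proof -
 interpret prob_space "uniform_measure lborel {0..1::real}" by (rule prob_space_uniform_measure) auto
 show ?thesis unfolding circle_measure_def by (rule prob_space_distr) (simp add: cong: measurable_cong_sets)
qed

lemma emeasure_circle:
 assumes "A \<in> sets circle_measure"
 shows "emeasure circle_measure A = (\<integral>\<^sup>+t\<in>{0..1}. indicator A (cis (2 * pi * t)) \<partial>lborel)"
proof -
 have A: "A \<in> sets (restrict_space borel (sphere 0 1))" using assms by simp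
 have m: "(\<lambda>t. cis (2 * pi * t)) -` A \<inter> space lborel \<in> sets lborel" by (rule measurable_sets[OF cis_measurable A])
 have "emeasure circle_measure A = emeasure (uniform_measure lborel {0..1}) ((\<lambda>t. cis (2 * pi * t)) -` A)"
  unfolding circle_measure_def using A by (subst emeasure_distr) (auto cong: measurable_cong_sets)
 also have "\<dots> = emeasure lborel ({0..1} \<inter> (\<lambda>t. cis (2 * pi * t)) -` A)"
  using m by (subst emeasure_uniform_measure) (auto simp: divide_ennreal_def)
 also have "\<dots> = (\<integral>\<^sup>+t. indicator ({0..1} \<inter> (\<lambda>t. cis (2 * pi * t)) -` A) t \<partial>lborel)"
  using m by (intro nn_integral_indicator[symmetric] sets.Int) auto
 also have "\<dots> = (\<integral>\<^sup>+t\<in>{0..1}. indicator A (cis (2 * pi * t)) \<partial>lborel)"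
  by (intro nn_integral_cong) (auto simp: indicator_def)
 finally show ?thesis .
qed

lemma circle_rotation_measurable:
 assumes "norm z = 1"
 shows "(\<lambda>x. z * x) \<in> circle_measure \<rightarrow>\<^sub>M circle_measure"
proof -
 have "(\<lambda>x. z * x) \<in> restrict_space borel (sphere 0 1) \<rightarrow>\<^sub>M restrict_space borel (sphere 0 1)"
  by (intro measurable_restrict_space2 measurable_restrict_space1) (auto simp: norm_mult assms)
 then show ?thesis by (simp cong: measurable_cong_sets)
qed

lemma emeasure_circle_rotation:
 assumes z: "norm z = 1" and A: "A \<in> sets circle_measure"
 shows "emeasure circle_measure ((\<lambda>x. z * x) -` A \<inter> sphere 0 1) = emeasure circle_measure A"
proof -
 define \<alpha> where "\<alpha> = Arg z / (2 * pi)"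
 have zc: "z = cis (2 * pi * \<alpha>)" using z cis_Arg[of z] by (cases "z = 0") (auto simp: \<alpha>_def sgn_div_norm)
 have A': "A \<in> sets (restrict_space borel (sphere 0 1))" using A by simp
 have m: "(\<lambda>t. cis (2 * pi * t)) -` A \<inter> space lborel \<in> sets lborel"
  by (rule measurable_sets[OF cis_measurable A'])
 have [measurable]: "(\<lambda>t. indicator A (cis (2 * pi * t)) :: ennreal) \<in> borel_measurable borel"
 proof -
  have "(\<lambda>t. indicator A (cis (2 * pi * t)) :: ennreal) = indicator ((\<lambda>t. cis (2 * pi * t)) -` A)"
   by (auto simp: indicator_def fun_eq_iff)
  then show ?thesis using m by simp
 qed
 have B: "(\<lambda>x. z * x) -` A \<inter> sphere 0 1 \<in> sets circle_measure"
  using measurable_sets[OF circle_rotation_measurable[OF z] A] by simp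
 have "emeasure circle_measure ((\<lambda>x. z * x) -` A \<inter> sphere 0 1)
   = (\<integral>\<^sup>+t\<in>{0..1}. indicator A (cis (2 * pi * (t + \<alpha>))) \<partial>lborel)" unfolding emeasure_circle[OF B]
  by (intro nn_integral_cong) (auto simp: indicator_def zc cis_mult distrib_left add.commute)
 also have "\<dots> = (\<integral>\<^sup>+t\<in>{0..1}. indicator A (cis (2 * pi * t)) \<partial>lborel)"
 proof (rule nn_integral_periodic_shift)
  fix t :: real
  have "cis (2 * pi * (t + 1)) = cis (2 * pi * t) * cis (2 * pi)"
   by (simp only: cis_mult distrib_left mult_1_right)
  then have "cis (2 * pi * (t + 1)) = cis (2 * pi * t)" by (simp only: cis_2pi mult_1_right)
  then show "indicator A (cis (2 * pi * (t + 1))) = (indicator A (cis (2 * pi * t)) :: ennreal)" by (simp only:)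
 qed measurable
 also have "\<dots> = emeasure circle_measure A" by (rule emeasure_circle[OF A, symmetric])
 finally show ?thesis .
qed

lemma space_torus: "space torus = (\<Pi>\<^sub>E q\<in>{q. prime q}. sphere 0 1)"
 by (simp add: torus_def space_PiM)

lemma prob_space_torus: "prob_space torus"
 unfolding torus_def by (intro prob_space_PiM prob_space_circle)

interpretation torus: prob_space torus by (rule prob_space_torus)

definition torus_rotate :: "(nat \<Rightarrow> complex) \<Rightarrow> (nat \<Rightarrow> complex) \<Rightarrow> nat \<Rightarrow> complex" where
 "torus_rotate z \<omega> = (\<lambda>q\<in>{q. prime q}. z q * \<omega> q)"

lemma torus_rotate_measurable:
 assumes "\<And>q. prime q \<Longrightarrow> norm (z q) = 1"
 shows "torus_rotate z \<in> torus \<rightarrow>\<^sub>M torus"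
 unfolding torus_rotate_def[abs_def] torus_def
proof (rule measurable_restrict)
 fix q :: nat assume q: "q \<in> {q. prime q}"
 have "(\<lambda>\<omega>. \<omega> q) \<in> Pi\<^sub>M {q. prime q} (\<lambda>_. circle_measure) \<rightarrow>\<^sub>M circle_measure"
  by (rule measurable_component_singleton[OF q])
 from measurable_compose[OF this circle_rotation_measurable[of "z q"]]
 show "(\<lambda>\<omega>. z q * \<omega> q) \<in> Pi\<^sub>M {q. prime q} (\<lambda>_. circle_measure) \<rightarrow>\<^sub>M circle_measure" using assms q by auto
qed

text \<open>Finite products of rotations preserve the measure, and they determine a measure on the infinite product.\<close>

lemma distr_torus_rotate:
 assumes z: "\<And>q. prime q \<Longrightarrow> norm (z q) = 1"
 shows "distr torus torus (torus_rotate z) = torus"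
proof -
 let ?P = "{q::nat. prime q}" and ?M = "\<lambda>_::nat. circle_measure"
 let ?D = "distr (PiM ?P ?M) (PiM ?P ?M) (torus_rotate z)"
 have meas: "torus_rotate z \<in> PiM ?P ?M \<rightarrow>\<^sub>M PiM ?P ?M"
  using torus_rotate_measurable[of z, OF z] by (simp add: torus_def)
 have "PiM ?P ?M = ?D"
 proof (rule measure_eqI_PiM_infinite[OF refl])
  show "finite_measure (PiM ?P ?M)"
   using prob_space_torus unfolding torus_def by (simp add: prob_space.finite_measure)
  show "sets ?D = sets (PiM ?P ?M)" by simp
  fix A J assume J: "finite J" "J \<subseteq> ?P" and A: "\<And>q. q \<in> J \<Longrightarrow> A q \<in> sets circle_measure"
  let ?B = "\<lambda>q. (\<lambda>x. z q * x) -` A q \<inter> sphere 0 1"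
  have B: "?B q \<in> sets circle_measure" if "q \<in> J" for q
   using measurable_sets[OF circle_rotation_measurable[of "z q"] A[OF that]] J z that by auto
  have "PiM ?P ?M (prod_emb ?P ?M J (Pi\<^sub>E J A)) = (\<Prod>q\<in>J. emeasure circle_measure (A q))"
   using J A by (intro emeasure_PiM_emb prob_space_circle) auto
  also have "\<dots> = (\<Prod>q\<in>J. emeasure circle_measure (?B q))"
   using J A z by (intro prod.cong refl emeasure_circle_rotation[symmetric]) auto
  also have "\<dots> = PiM ?P ?M (prod_emb ?P ?M J (Pi\<^sub>E J ?B))"
   using J B by (intro emeasure_PiM_emb[symmetric] prob_space_circle) auto
  also have "prod_emb ?P ?M J (Pi\<^sub>E J ?B) = torus_rotate z -` prod_emb ?P ?M J (Pi\<^sub>E J A) \<inter> space (PiM ?P ?M)"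
   using J z by (auto simp: prod_emb_def space_PiM PiE_iff torus_rotate_def norm_mult subset_eq)
  also have "PiM ?P ?M \<dots> = emeasure ?D (prod_emb ?P ?M J (Pi\<^sub>E J A))"
   using J A by (intro emeasure_distr[symmetric] sets_PiM_I meas) (auto simp: Pi_iff)
  finally show "PiM ?P ?M (prod_emb ?P ?M J (Pi\<^sub>E J A)) = emeasure ?D (prod_emb ?P ?M J (Pi\<^sub>E J A))" .
 qed
 then show ?thesis by (simp add: torus_def)
qed

lemma nat_powr_eq_exp: "n > 0 \<Longrightarrow> of_nat n powr (- s) = exp (- (s * complex_of_real (ln (real n))))" for s :: complex
 by (simp add: powr_def Ln_of_nat)

lemma norm_nat_powr: "n > 0 \<Longrightarrow> norm (of_nat n powr (- s)) = real n powr (- Re s)" for s :: complex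
 by (simp add: nat_powr_eq_exp powr_def)

lemma torus_char_prod:
 assumes "finite S" "prime_factors n \<subseteq> S" "n > 0"
 shows "torus_char \<omega> n = (\<Prod>q\<in>S. \<omega> q ^ (if prime q then multiplicity q n else 0))"
proof -
 have "torus_char \<omega> n = (\<Prod>q\<in>prime_factors n. \<omega> q ^ (if prime q then multiplicity q n else 0))"
  unfolding torus_char_def by (intro prod.cong) auto
 also have "\<dots> = (\<Prod>q\<in>S. \<omega> q ^ (if prime q then multiplicity q n else 0))"
  using assms by (intro prod.mono_neutral_left) (auto simp: prime_factors_multiplicity)
 finally show ?thesis .
qed

lemma torus_char_mult:
 assumes "m > 0" "n > 0"
 shows "torus_char \<omega> (m * n) = torus_char \<omega> m * torus_char \<omega> n"
proof -
 let ?S = "prime_factors m \<union> prime_factors n"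
 have "torus_char \<omega> (m * n) = (\<Prod>q\<in>?S. \<omega> q ^ (if prime q then multiplicity q (m*n) else 0))"
  using assms by (intro torus_char_prod) (auto simp: prime_factors_product)
 also have "\<dots> = (\<Prod>q\<in>?S. \<omega> q ^ (if prime q then multiplicity q m else 0) * \<omega> q ^ (if prime q then multiplicity q n else 0))"
  using assms by (intro prod.cong refl) (auto simp: prime_elem_multiplicity_mult_distrib power_add)
 also have "\<dots> = torus_char \<omega> m * torus_char \<omega> n" using assms unfolding prod.distrib
  by (intro arg_cong2[where f = "(*)"] torus_char_prod[symmetric]) auto
 finally show ?thesis .
qed

lemma torus_char_1 [simp]: "torus_char \<omega> (Suc 0) = 1" by (simp add: torus_char_def)

lemma norm_torus_char:
 assumes "\<omega> \<in> space torus"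
 shows "norm (torus_char \<omega> n) = 1"
proof -
 have "norm (\<omega> q) = 1" if "q \<in> prime_factors n" for q
  using assms that by (auto simp: space_torus PiE_iff prime_factors_multiplicity)
 then show ?thesis by (simp add: torus_char_def prod_norm[symmetric] norm_power)
qed

text \<open>Multiplying the value at \<open>q\<close> by \<open>q\<^sup>-\<^sup>i\<^sup>t\<close> translates the twisted series
 vertically by \<open>t\<close>.\<close>

definition flow :: "real \<Rightarrow> (nat \<Rightarrow> complex) \<Rightarrow> nat \<Rightarrow> complex" where
 "flow t = torus_rotate (\<lambda>q. of_nat q powr (- (\<i> * of_real t)))"

lemma norm_flow_factor: "q > 0 \<Longrightarrow> norm (of_nat q powr (- (\<i> * complex_of_real t))) = 1"
 by (simp add: norm_nat_powr)

lemma flow_measurable [measurable]: "flow t \<in> torus \<rightarrow>\<^sub>M torus"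
 unfolding flow_def by (rule torus_rotate_measurable) (simp add: norm_flow_factor prime_gt_0_nat)

lemma distr_flow: "distr torus torus (flow t) = torus"
 unfolding flow_def by (rule distr_torus_rotate) (simp add: norm_flow_factor prime_gt_0_nat)

lemma flow_space: "\<omega> \<in> space torus \<Longrightarrow> flow t \<omega> \<in> space torus"
 using measurable_space[OF flow_measurable] .

lemma nn_integral_flow:
 assumes "f \<in> borel_measurable torus"
 shows "(\<integral>\<^sup>+\<omega>. f (flow t \<omega>) \<partial>torus) = (\<integral>\<^sup>+\<omega>. f \<omega> \<partial>torus)"
 using nn_integral_distr[OF flow_measurable, of f t] assms by (simp add: distr_flow)

lemma flow_flow:
 assumes "\<omega> \<in> space torus" shows "flow s (flow t \<omega>) = flow (s + t) \<omega>"
proof (rule ext)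
 fix q
 show "flow s (flow t \<omega>) q = flow (s + t) \<omega> q"
 proof (cases "prime q")
  case True
  have "of_nat q powr (- (\<i> * of_real s)) * of_nat q powr (- (\<i> * of_real t))
    = (of_nat q powr (- (\<i> * of_real (s + t))) :: complex)"
   unfolding nat_powr_eq_exp[OF prime_gt_0_nat[OF True]] exp_add[symmetric] by (simp add: algebra_simps)
  then show ?thesis using True by (simp add: flow_def torus_rotate_def mult.assoc[symmetric])
 qed (simp add: flow_def torus_rotate_def)
qed

lemma torus_char_flow:
 assumes n: "n > 0"
 shows "torus_char (flow t \<omega>) n = of_nat n powr (- (\<i> * of_real t)) * torus_char \<omega> n"
proof -
 define e where "e n = exp (- (\<i> * of_real t * complex_of_real (ln (real n))))" for n :: nat
 have e_mult: "e (m * k) = e m * e k" if "m > 0" "k > 0" for m k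
  using that by (simp add: e_def ln_mult exp_add[symmetric] algebra_simps)
 have e_pow: "e (m ^ k) = e m ^ k" if "m > 0" for m k
  using that by (induction k) (simp_all add: e_mult, simp add: e_def)
 have e_prod: "e (\<Prod>q\<in>S. f q) = (\<Prod>q\<in>S. e (f q))" if "finite S" "\<And>q. q \<in> S \<Longrightarrow> f q > 0" for S and f :: "nat \<Rightarrow> nat"
  using that by (induction S rule: finite_induct) (simp_all add: e_mult prod_pos, simp add: e_def)
 have "torus_char (flow t \<omega>) n = (\<Prod>q\<in>prime_factors n. (e q * \<omega> q) ^ multiplicity q n)" unfolding torus_char_def
  by (intro prod.cong refl) (auto simp: flow_def torus_rotate_def nat_powr_eq_exp prime_gt_0_nat e_def
   prime_factors_multiplicity)
 also have "\<dots> = (\<Prod>q\<in>prime_factors n. e q ^ multiplicity q n) * torus_char \<omega> n"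
  by (simp add: power_mult_distrib prod.distrib torus_char_def)
 also have "(\<Prod>q\<in>prime_factors n. e q ^ multiplicity q n) = (\<Prod>q\<in>prime_factors n. e (q ^ multiplicity q n))"
  by (intro prod.cong refl e_pow[symmetric]) (auto simp: prime_factors_multiplicity prime_gt_0_nat)
 also have "\<dots> = e (\<Prod>q\<in>prime_factors n. q ^ multiplicity q n)"
  by (intro e_prod[symmetric] finite_set_mset) (auto simp: prime_factors_multiplicity prime_gt_0_nat)
 also have "(\<Prod>q\<in>prime_factors n. q ^ multiplicity q n) = n" using n prime_factorization_nat[of n] by simp
 finally show ?thesis using n by (simp add: nat_powr_eq_exp e_def)
qed

lemma torus_coord_measurable [measurable]: "prime q \<Longrightarrow> (\<lambda>\<omega>. \<omega> q) \<in> borel_measurable torus"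
proof -
 assume q: "prime q"
 have "(\<lambda>\<omega>. \<omega> q) \<in> torus \<rightarrow>\<^sub>M circle_measure"
  unfolding torus_def by (rule measurable_component_singleton) (use q in simp)
 then have "(\<lambda>\<omega>. \<omega> q) \<in> torus \<rightarrow>\<^sub>M restrict_space borel (sphere 0 1)" by (simp cong: measurable_cong_sets)
 then show ?thesis by (simp add: measurable_restrict_space2_iff)
qed

lemma torus_char_measurable [measurable]: "(\<lambda>\<omega>. torus_char \<omega> n) \<in> borel_measurable torus"
 unfolding torus_char_def
 by (intro borel_measurable_prod borel_measurable_power torus_coord_measurable) (auto simp: prime_factors_multiplicity)

definition twisted_poly :: "nat \<Rightarrow> (nat \<Rightarrow> complex) \<Rightarrow> (nat \<Rightarrow> complex) \<Rightarrow> complex \<Rightarrow> complex" where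
 "twisted_poly K c \<omega> s = (\<Sum>n=1..K. c n * torus_char \<omega> n * of_nat n powr (- s))"

lemma twisted_poly_flow: "twisted_poly K c (flow t \<omega>) s = twisted_poly K c \<omega> (s + \<i> * of_real t)"
 unfolding twisted_poly_def
proof (intro sum.cong refl)
 fix n assume "n \<in> {1..K}"
 then have n: "n > 0" by simp
 show "c n * torus_char (flow t \<omega>) n * of_nat n powr (- s) = c n * torus_char \<omega> n * of_nat n powr (- (s + \<i> * of_real t))"
 proof -
  have "of_nat n powr (- (\<i> * of_real t)) * of_nat n powr (- s) = of_nat n powr (- (s + \<i> * of_real t))"
   unfolding nat_powr_eq_exp[OF n] exp_add[symmetric] by (simp add: algebra_simps)
  then show ?thesis unfolding torus_char_flow[OF n] by (simp add: mult_ac)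
 qed
qed

lemma twisted_poly_diff:
 "twisted_poly K c \<omega> s - twisted_poly K d \<omega> s = twisted_poly K (\<lambda>n. c n - d n) \<omega> s"
 by (simp add: twisted_poly_def sum_subtractf algebra_simps)

lemma twisted_poly_extend:
 assumes "K \<le> K'" "\<And>n. n > K \<Longrightarrow> c n = 0"
 shows "twisted_poly K' c \<omega> s = twisted_poly K c \<omega> s"
 unfolding twisted_poly_def using assms by (intro sum.mono_neutral_right) auto

lemma norm_twisted_poly_le:
 assumes "\<omega> \<in> space torus" "Re s \<ge> 0"
 shows "norm (twisted_poly K c \<omega> s) \<le> (\<Sum>n=1..K. norm (c n))"
 unfolding twisted_poly_def
proof (intro sum_norm_le)
 fix n assume "n \<in> {1..K}"
 then have n: "n > 0" by simp
 have "real n powr (- Re s) \<le> real n powr 0" using n assms by (intro powr_mono) auto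
 then show "norm (c n * torus_char \<omega> n * of_nat n powr (- s)) \<le> norm (c n)"
  using n by (simp add: norm_mult norm_torus_char[OF assms(1)] norm_nat_powr mult_left_le)
qed

lemma twisted_poly_holomorphic: "twisted_poly K c \<omega> holomorphic_on A"
 unfolding twisted_poly_def[abs_def] by (intro holomorphic_intros) auto

lemma twisted_poly_continuous: "continuous_on A (twisted_poly K c \<omega>)"
 using twisted_poly_holomorphic holomorphic_on_imp_continuous_on by blast

lemma twisted_poly_measurable_pair [measurable]:
 "(\<lambda>(\<omega>, t). twisted_poly K c \<omega> (Complex \<sigma> t)) \<in> borel_measurable (torus \<Otimes>\<^sub>M lborel)"
proof -
 have "(\<lambda>t. of_nat n powr (- Complex \<sigma> t)) \<in> borel_measurable lborel" if "n \<in> {1..K}" for n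
  using that by (auto simp: Complex_eq intro!: borel_measurable_continuous_onI continuous_intros)
 then have [measurable]: "(\<lambda>t. of_nat n powr (- Complex \<sigma> t)) \<in> borel_measurable lborel" if "n \<in> {1..K}" for n
  using that by blast
 show ?thesis unfolding twisted_poly_def case_prod_beta
  by (intro borel_measurable_sum borel_measurable_times borel_measurable_const)
   (auto intro!: measurable_compose[OF measurable_fst torus_char_measurable] measurable_compose[OF measurable_snd])
qed

lemma twisted_poly_measurable [measurable]: "(\<lambda>\<omega>. twisted_poly K c \<omega> s) \<in> borel_measurable torus"
 unfolding twisted_poly_def by measurable

section \<open>Poisson and Perron formulas for Dirichlet polynomials\<close>

lemma poisson_kernel_pos: "\<sigma> > 0 \<Longrightarrow> poisson_kernel \<sigma> u \<ge> 0"
 by (simp add: poisson_kernel_def)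

lemma poisson_kernel_eq: "poisson_kernel \<sigma> u = \<sigma> / pi * (1 / (\<sigma>\<^sup>2 + u\<^sup>2))"
 by (simp add: poisson_kernel_def)

lemma poisson_kernel_integral:
 assumes "\<sigma> > 0"
 shows "integrable lborel (poisson_kernel \<sigma>)" "(LINT u|lborel. poisson_kernel \<sigma> u) = 1"
proof -
 show "integrable lborel (poisson_kernel \<sigma>)"
  unfolding poisson_kernel_eq[abs_def] by (rule integrable_mult_right[OF cauchy_kernel_integral(1)[OF assms]])
 have "(LINT u|lborel. poisson_kernel \<sigma> u) = \<sigma> / pi * (pi / \<sigma>)"
  unfolding poisson_kernel_eq by (simp only: integral_mult_right_zero cauchy_kernel_integral(2)[OF assms])
 then show "(LINT u|lborel. poisson_kernel \<sigma> u) = 1" using assms by simp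
qed

lemma poisson_kernel_measurable [measurable]: "poisson_kernel \<sigma> \<in> borel_measurable borel"
 unfolding poisson_kernel_def[abs_def] by measurable

lemma poisson_kernel_weight:
 assumes \<sigma>: "\<sigma> > 0"
 shows "poisson_kernel \<sigma> (u - t) \<le> (\<sigma> + 1/\<sigma>) * (1 + \<bar>t\<bar>)\<^sup>2 * (1 + \<bar>u\<bar>) powr (-2)"
proof -
 define v where "v = u - t"
 have pos: "\<sigma>\<^sup>2 + v\<^sup>2 > 0" using \<sigma> by (simp add: add_pos_nonneg)
 have "1 + \<bar>u\<bar> \<le> (1 + \<bar>t\<bar>) * (1 + \<bar>v\<bar>)"
 proof -
  have "\<bar>u\<bar> \<le> \<bar>t\<bar> + \<bar>v\<bar>" by (simp add: v_def)
  moreover have "(1 + \<bar>t\<bar>) * (1 + \<bar>v\<bar>) = 1 + \<bar>t\<bar> + \<bar>v\<bar> + \<bar>t\<bar>*\<bar>v\<bar>" by (simp add: algebra_simps)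
  moreover have "\<bar>t\<bar>*\<bar>v\<bar> \<ge> 0" by simp
  ultimately show ?thesis by linarith
 qed
 then have "(1 + \<bar>u\<bar>)\<^sup>2 \<le> ((1 + \<bar>t\<bar>) * (1 + \<bar>v\<bar>))\<^sup>2" by (intro power_mono) auto
 also have "\<dots> = (1 + \<bar>t\<bar>)\<^sup>2 * (1 + \<bar>v\<bar>)\<^sup>2" by (rule power_mult_distrib)
 also have "(1 + \<bar>v\<bar>)\<^sup>2 \<le> 2 * (1 + v\<^sup>2)"
  using zero_le_power2[of "1 - \<bar>v\<bar>"] by (simp add: power2_eq_square algebra_simps)
 also have "2 * (1 + v\<^sup>2) \<le> 2 * ((\<sigma> + 1/\<sigma>) / \<sigma> * (\<sigma>\<^sup>2 + v\<^sup>2))"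
 proof -
  have "(\<sigma> + 1/\<sigma>) / \<sigma> = 1 + 1/\<sigma>\<^sup>2" using \<sigma> by (simp add: add_divide_distrib power2_eq_square)
  then have "(\<sigma> + 1/\<sigma>) / \<sigma> * (\<sigma>\<^sup>2 + v\<^sup>2) = \<sigma>\<^sup>2 + v\<^sup>2 + 1 + v\<^sup>2 / \<sigma>\<^sup>2" using \<sigma> by (simp add: field_simps)
  then show ?thesis by simp
 qed
 finally have *: "(1 + \<bar>u\<bar>)\<^sup>2 \<le> (1 + \<bar>t\<bar>)\<^sup>2 * (2 * ((\<sigma> + 1/\<sigma>) / \<sigma> * (\<sigma>\<^sup>2 + v\<^sup>2)))" by (simp add: mult_left_mono)
 have "poisson_kernel \<sigma> v * (1 + \<bar>u\<bar>)\<^sup>2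
   \<le> poisson_kernel \<sigma> v * ((1 + \<bar>t\<bar>)\<^sup>2 * (2 * ((\<sigma> + 1/\<sigma>) / \<sigma> * (\<sigma>\<^sup>2 + v\<^sup>2))))"
  by (intro mult_left_mono * poisson_kernel_pos \<sigma>)
 also have "\<dots> = (2/pi) * ((1 + \<bar>t\<bar>)\<^sup>2 * (\<sigma> + 1/\<sigma>))" using \<sigma> pos by (simp add: poisson_kernel_def divide_simps)
 also have "\<dots> \<le> 1 * ((1 + \<bar>t\<bar>)\<^sup>2 * (\<sigma> + 1/\<sigma>))" using pi_ge_two \<sigma> by (intro mult_right_mono) auto
 finally have "poisson_kernel \<sigma> v * (1 + \<bar>u\<bar>)\<^sup>2 \<le> (1 + \<bar>t\<bar>)\<^sup>2 * (\<sigma> + 1/\<sigma>)" by simp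
 moreover have "(1 + \<bar>u\<bar>) powr (-2) = 1 / (1 + \<bar>u\<bar>)\<^sup>2" by (simp add: powr_minus_divide flip: powr_numeral)
 moreover have "(1 + \<bar>u\<bar>)\<^sup>2 > 0" by (simp add: add_pos_nonneg)
 ultimately show ?thesis unfolding v_def[symmetric] by (simp add: pos_le_divide_eq mult.commute)
qed

lemma nat_powr_vertical:
 assumes "n > 0"
 shows "of_nat n powr (- Complex \<sigma> t) = complex_of_real (real n powr (-\<sigma>)) * cis (- (t * ln (real n)))"
proof -
 have "- (Complex \<sigma> t * complex_of_real (ln (real n))) = Complex (-\<sigma> * ln (real n)) (- (t * ln (real n)))"
  by (simp add: complex_eq_iff)
 then show ?thesis using assms unfolding nat_powr_eq_exp[OF assms] by (simp add: exp_eq_polar powr_def)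
qed

lemma cauchy_kernel_fourier_integrable:
 assumes "\<rho> > 0"
 shows "integrable lborel (\<lambda>u. cis (y*u) / complex_of_real (\<rho>\<^sup>2 + u\<^sup>2))"
proof (rule Bochner_Integration.integrable_bound[OF cauchy_kernel_integral(1)[OF assms]])
 have "\<rho>\<^sup>2 + u\<^sup>2 \<noteq> 0" for u :: real using assms by (metis add_pos_nonneg less_irrefl zero_le_power2 zero_less_power)
 then show "(\<lambda>u. cis (y*u) / complex_of_real (\<rho>\<^sup>2 + u\<^sup>2)) \<in> borel_measurable lborel"
  by (auto intro!: borel_measurable_continuous_onI continuous_intros simp del: of_real_add)
 show "AE u in lborel. norm (cis (y*u) / complex_of_real (\<rho>\<^sup>2 + u\<^sup>2)) \<le> norm (1 / (\<rho>\<^sup>2 + u\<^sup>2))"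
  by (intro AE_I2) (simp only: norm_divide norm_cis norm_of_real real_norm_def abs_divide abs_one order_refl)
qed

lemma cauchy_kernel_fourier_abs:
 assumes "\<rho> > 0"
 shows "(LINT u|lborel. cis (y*u) / complex_of_real (\<rho>\<^sup>2 + u\<^sup>2)) = complex_of_real (pi / \<rho> * exp (- (\<rho> * \<bar>y\<bar>)))"
proof (cases "y \<le> 0")
 case True
 then show ?thesis using cauchy_kernel_fourier[OF assms, of "-y"] by simp
next
 case False
 have "(LINT u|lborel. cis (y*u) / complex_of_real (\<rho>\<^sup>2 + u\<^sup>2))
   = (LINT u|lborel. cnj (cis (- (y*u)) / complex_of_real (\<rho>\<^sup>2 + u\<^sup>2)))" by (simp add: cis_cnj)
 also have "\<dots> = cnj (LINT u|lborel. cis (- (y*u)) / complex_of_real (\<rho>\<^sup>2 + u\<^sup>2))"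
  by (rule Bochner_Integration.integral_cnj)
 also have "\<dots> = complex_of_real (pi / \<rho> * exp (- (\<rho> * \<bar>y\<bar>)))"
 proof -
  have y0: "y \<ge> 0" using False by simp
  show ?thesis unfolding cauchy_kernel_fourier[OF assms y0] complex_cnj_complex_of_real using y0 by simp
 qed
 finally show ?thesis .
qed

lemma twisted_poly_poisson:
 assumes \<sigma>: "\<sigma> > 0"
 shows "twisted_poly K c \<omega> (Complex \<sigma> t)
   = (LINT u|lborel. twisted_poly K c \<omega> (Complex 0 (t + u)) * complex_of_real (poisson_kernel \<sigma> u))"
proof -
 let ?k = "\<lambda>u. complex_of_real (poisson_kernel \<sigma> u)"
 have term_eq: "of_nat n powr (- Complex 0 (t + u)) * ?k u
   = (cis (- (t * ln (real n))) * complex_of_real (\<sigma>/pi)) * (cis ((- ln (real n)) * u) / complex_of_real (\<sigma>\<^sup>2 + u\<^sup>2))"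
  if "n \<in> {1..K}" for n u
 proof -
  have "cis (- ((t+u) * ln (real n))) = cis (- (t * ln (real n))) * cis ((- ln (real n)) * u)"
   by (simp add: cis_mult algebra_simps)
  then show ?thesis using that by (subst nat_powr_vertical) (auto simp: poisson_kernel_eq)
 qed
 have int: "integrable lborel (\<lambda>u. of_nat n powr (- Complex 0 (t + u)) * ?k u)" if "n \<in> {1..K}" for n
  unfolding term_eq[OF that] by (intro integrable_mult_right cauchy_kernel_fourier_integrable \<sigma>)
 have val: "(LINT u|lborel. of_nat n powr (- Complex 0 (t + u)) * ?k u) = of_nat n powr (- Complex \<sigma> t)"
  if n: "n \<in> {1..K}" for n
 proof -
  have "(LINT u|lborel. of_nat n powr (- Complex 0 (t + u)) * ?k u)
   = (cis (- (t * ln (real n))) * complex_of_real (\<sigma>/pi)) * complex_of_real (pi / \<sigma> * exp (- (\<sigma> * \<bar>- ln (real n)\<bar>)))"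
   unfolding term_eq[OF n] integral_mult_right_zero cauchy_kernel_fourier_abs[OF \<sigma>] by (rule refl)
  also have "exp (- (\<sigma> * \<bar>- ln (real n)\<bar>)) = real n powr (-\<sigma>)" using n by (simp add: powr_def)
  also have "(cis (- (t * ln (real n))) * complex_of_real (\<sigma>/pi)) * complex_of_real (pi / \<sigma> * real n powr (-\<sigma>))
    = of_nat n powr (- Complex \<sigma> t)" using n \<sigma> by (subst nat_powr_vertical) (auto simp: field_simps)
  finally show ?thesis .
 qed
 have "(LINT u|lborel. twisted_poly K c \<omega> (Complex 0 (t + u)) * ?k u)
   = (LINT u|lborel. (\<Sum>n=1..K. (c n * torus_char \<omega> n) * (of_nat n powr (- Complex 0 (t + u)) * ?k u)))"
  by (simp add: twisted_poly_def sum_distrib_right mult.assoc)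
 also have "\<dots> = (\<Sum>n=1..K. (LINT u|lborel. (c n * torus_char \<omega> n) * (of_nat n powr (- Complex 0 (t + u)) * ?k u)))"
  by (rule Bochner_Integration.integral_sum) (intro integrable_mult_right int)
 also have "\<dots> = (\<Sum>n=1..K. (c n * torus_char \<omega> n) * of_nat n powr (- Complex \<sigma> t))"
  by (intro sum.cong refl) (simp only: integral_mult_right_zero val)
 finally show ?thesis by (simp add: twisted_poly_def)
qed

lemma twisted_poly_vertical_continuous: "continuous_on A (\<lambda>t. twisted_poly K c \<omega> (Complex \<sigma> t))"
 unfolding Complex_eq
 by (intro continuous_on_compose2[OF twisted_poly_continuous[of UNIV]] continuous_intros) auto

lemma twisted_poly_vertical_measurable [measurable]:
 "(\<lambda>t. twisted_poly K c \<omega> (Complex \<sigma> t)) \<in> borel_measurable borel"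
 by (intro borel_measurable_continuous_onI twisted_poly_vertical_continuous)

lemma twisted_poly_poisson_powr:
 assumes \<omega>: "\<omega> \<in> space torus" and p: "1 \<le> p" and \<sigma>: "\<sigma> > 0"
 shows "ennreal (norm (twisted_poly K c \<omega> (Complex \<sigma> t)) powr p)
   \<le> (\<integral>\<^sup>+u. ennreal (norm (twisted_poly K c \<omega> (Complex 0 (t + u))) powr p) * ennreal (poisson_kernel \<sigma> u) \<partial>lborel)"
proof -
 let ?Q = "\<lambda>u. twisted_poly K c \<omega> (Complex 0 (t + u))"
 let ?k = "poisson_kernel \<sigma>"
 have int: "integrable lborel (\<lambda>u. norm (?Q u) * ?k u)"
 proof (rule Bochner_Integration.integrable_bound)
  show "integrable lborel (\<lambda>u. (\<Sum>n=1..K. norm (c n)) * ?k u)"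
   by (intro integrable_mult_right poisson_kernel_integral \<sigma>)
  show "AE u in lborel. norm (norm (?Q u) * ?k u) \<le> norm ((\<Sum>n=1..K. norm (c n)) * ?k u)"
   using norm_twisted_poly_le[OF \<omega>, of _ K c] poisson_kernel_pos[OF \<sigma>]
   by (intro AE_I2) (auto simp: abs_mult sum_nonneg intro!: mult_right_mono)
 qed measurable
 have "norm (twisted_poly K c \<omega> (Complex \<sigma> t)) \<le> (LINT u|lborel. norm (?Q u * complex_of_real (?k u)))"
  unfolding twisted_poly_poisson[OF \<sigma>] by (rule integral_norm_bound)
 also have "\<dots> = (LINT u|lborel. norm (?Q u) * ?k u)" using poisson_kernel_pos[OF \<sigma>] by (simp add: norm_mult)
 finally have "ennreal (norm (twisted_poly K c \<omega> (Complex \<sigma> t)) powr p) \<le> ennreal ((LINT u|lborel. norm (?Q u) * ?k u) powr p)"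
  using p by (intro ennreal_leI powr_mono2) auto
 also have "\<dots> \<le> (\<integral>\<^sup>+u. ennreal (norm (?Q u) powr p * ?k u) \<partial>lborel)"
  by (rule powr_integral_le_nn_integral[OF p poisson_kernel_integral[OF \<sigma>] poisson_kernel_pos[OF \<sigma>]])
   (use int in auto)
 also have "\<dots> = (\<integral>\<^sup>+u. ennreal (norm (?Q u) powr p) * ennreal (?k u) \<partial>lborel)"
  using poisson_kernel_pos[OF \<sigma>] by (intro nn_integral_cong ennreal_mult) auto
 finally show ?thesis .
qed

text \<open>By Poisson's formula and Jensen's inequality \<open>|P|\<^sup>p\<close> is at most the Poisson integral of its
 values on the imaginary axis.\<close>

lemma twisted_poly_mean_bdd:
 assumes \<omega>: "\<omega> \<in> space torus" and p: "1 \<le> p" and \<sigma>: "\<sigma> > 0"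
  and h: "mean_bdd (\<lambda>u. ennreal (norm (twisted_poly K c \<omega> (Complex 0 u)) powr p)) X"
 shows "mean_bdd (\<lambda>u. ennreal (norm (twisted_poly K c \<omega> (Complex \<sigma> u)) powr p)) (2 * X)"
 unfolding mean_bdd_def
proof (intro conjI allI impI)
 show "0 \<le> 2 * X" using h by (simp add: mean_bdd_def)
 fix T :: real assume T: "T \<ge> 1"
 have "(\<integral>\<^sup>+t\<in>{-T..T}. ennreal (norm (twisted_poly K c \<omega> (Complex \<sigma> t)) powr p) \<partial>lborel)
  \<le> (\<integral>\<^sup>+t\<in>{-T..T}. (\<integral>\<^sup>+u. ennreal (norm (twisted_poly K c \<omega> (Complex 0 (t + u))) powr p) * ennreal (poisson_kernel \<sigma> u) \<partial>lborel) \<partial>lborel)"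
  by (intro nn_integral_mono mult_right_mono twisted_poly_poisson_powr \<omega> p \<sigma>) auto
 also have "\<dots> \<le> ennreal (2 * T * (2 * X))" by (rule poisson_mean_le[OF h \<sigma> T])
 finally show "(\<integral>\<^sup>+t\<in>{-T..T}. ennreal (norm (twisted_poly K c \<omega> (Complex \<sigma> t)) powr p) \<partial>lborel) \<le> ennreal (2 * T * (2 * X))" .
qed measurable

lemma twisted_poly_pointwise:
 assumes \<omega>: "\<omega> \<in> space torus" and p: "1 \<le> p" and \<sigma>: "\<sigma> > 0"
 shows "ennreal (norm (twisted_poly K c \<omega> (Complex \<sigma> t)) powr p) \<le> ennreal ((\<sigma> + 1/\<sigma>) * (1 + \<bar>t\<bar>)\<^sup>2) *
   (\<integral>\<^sup>+u. ennreal (norm (twisted_poly K c \<omega> (Complex 0 u)) powr p) * ennreal ((1 + \<bar>u\<bar>) powr (-2)) \<partial>lborel)"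
proof -
 let ?h = "\<lambda>u. ennreal (norm (twisted_poly K c \<omega> (Complex 0 u)) powr p)"
 have "ennreal (norm (twisted_poly K c \<omega> (Complex \<sigma> t)) powr p) \<le> (\<integral>\<^sup>+u. ?h (t + u) * ennreal (poisson_kernel \<sigma> u) \<partial>lborel)"
  by (rule twisted_poly_poisson_powr[OF \<omega> p \<sigma>])
 also have "\<dots> = (\<integral>\<^sup>+u. ?h (u + t) * ennreal (poisson_kernel \<sigma> ((u + t) - t)) \<partial>lborel)" by (simp add: add.commute)
 also have "\<dots> = (\<integral>\<^sup>+u. ?h u * ennreal (poisson_kernel \<sigma> (u - t)) \<partial>lborel)"
  by (rule nn_integral_real_shift[where f = "\<lambda>u. ?h u * ennreal (poisson_kernel \<sigma> (u - t))"]) measurable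
 also have "\<dots> \<le> (\<integral>\<^sup>+u. ennreal ((\<sigma> + 1/\<sigma>) * (1 + \<bar>t\<bar>)\<^sup>2) * (?h u * ennreal ((1 + \<bar>u\<bar>) powr (-2))) \<partial>lborel)"
 proof (intro nn_integral_mono)
  fix u
  have "?h u * ennreal (poisson_kernel \<sigma> (u - t)) \<le> ?h u * ennreal ((\<sigma> + 1/\<sigma>) * (1 + \<bar>t\<bar>)\<^sup>2 * (1 + \<bar>u\<bar>) powr (-2))"
   by (intro mult_left_mono ennreal_leI poisson_kernel_weight \<sigma>) auto
  also have "\<dots> = ennreal ((\<sigma> + 1/\<sigma>) * (1 + \<bar>t\<bar>)\<^sup>2) * (?h u * ennreal ((1 + \<bar>u\<bar>) powr (-2)))"
   using \<sigma> by (subst ennreal_mult) (auto simp: mult_ac)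
  finally show "?h u * ennreal (poisson_kernel \<sigma> (u - t)) \<le> ennreal ((\<sigma> + 1/\<sigma>) * (1 + \<bar>t\<bar>)\<^sup>2) * (?h u * ennreal ((1 + \<bar>u\<bar>) powr (-2)))" .
 qed
 also have "\<dots> = ennreal ((\<sigma> + 1/\<sigma>) * (1 + \<bar>t\<bar>)\<^sup>2) * (\<integral>\<^sup>+u. ?h u * ennreal ((1 + \<bar>u\<bar>) powr (-2)) \<partial>lborel)"
  by (rule nn_integral_cmult) measurable
 finally show ?thesis .
qed

text \<open>The trivial bound of order \<open>N\<^sup>1\<^sup>/\<^sup>2\<close> and the mean value bound \<open>|z|
 N\<^sup>-\<^sup>1\<^sup>/\<^sup>2\<close> are interpolated with weights 1/4 and 3/4. Weight 1 on the second would
 destroy the integrability in \<open>u\<close>, weight 1/2 the decay in \<open>N\<close>.\<close>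

lemma power_difference_bound:
 fixes u :: real
 assumes N: "N \<ge> (1::nat)"
 defines "L \<equiv> of_nat (N+1) powr Complex (1/2) u - of_nat N powr Complex (1/2) u"
 shows "norm L / ((1/2)\<^sup>2 + u\<^sup>2) \<le> 8 * real N powr (-1/4) * (1 + \<bar>u\<bar>) powr (-5/4)"
proof -
 define z where "z = Complex (1/2) u"
 define m where "m = norm z"
 have m2: "m\<^sup>2 = (1/2)\<^sup>2 + u\<^sup>2" by (simp add: m_def z_def cmod_def)
 have mpos: "m > 0" by (simp add: m_def z_def complex_eq_iff)
 have mlow: "(1 + \<bar>u\<bar>) / 4 \<le> m"
 proof -
  have "\<bar>u\<bar> \<le> m" "(1::real)/2 \<le> m" using abs_Im_le_cmod[of z] abs_Re_le_cmod[of z] by (simp_all add: m_def z_def)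
  then have "1 + \<bar>u\<bar> \<le> 2 * m + m" by (intro add_mono) auto
  then show ?thesis using mpos by simp
 qed
 have np: "norm (of_nat n powr z) = real n powr (1/2)" if "n > 0" for n :: nat
  using norm_nat_powr[OF that, of "-z"] by (simp add: z_def)
 have A: "norm L \<le> 4 * real N powr (1/2)"
 proof -
  have "norm L \<le> real (N+1) powr (1/2) + real N powr (1/2)"
   unfolding L_def z_def[symmetric] using norm_triangle_ineq4 np N by (metis add_gr_0 less_one not_less_zero order_less_le_trans zero_less_one le_numeral_extra(4))
  moreover have "real (N+1) powr (1/2) \<le> (4 * real N) powr (1/2)" using N by (intro powr_mono2) auto
  moreover have "(4 * real N) powr (1/2) = 2 * real N powr (1/2)" by (simp add: powr_mult powr_half_sqrt)
  ultimately show ?thesis using powr_ge_zero[of "real N" "1/2"] by linarith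
 qed
 have B: "norm L \<le> m * real N powr (-1/2)"
 proof -
  have "norm (complex_of_real (real (N+1)) powr z - complex_of_real (real N) powr z)
    \<le> (m * real N powr (-1/2)) * norm (complex_of_real (real (N+1)) - complex_of_real (real N))"
  proof (rule field_differentiable_bound[where S = "closed_segment (complex_of_real (real N)) (complex_of_real (real (N+1)))"
     and f' = "\<lambda>y. z * y powr (z - 1)"])
   fix y assume "y \<in> closed_segment (complex_of_real (real N)) (complex_of_real (real (N+1)))"
   then have "y \<in> complex_of_real ` closed_segment (real N) (real (N+1))" unfolding closed_segment_of_real .
   then obtain r where r: "y = complex_of_real r" "real N \<le> r" "r \<le> real (N+1)"
    by (auto simp: closed_segment_eq_real_ivl)
   have r0: "r > 0" using r N by linarith
   have "y \<notin> \<real>\<^sub>\<le>\<^sub>0" using r0 r by (auto simp: complex_nonpos_Reals_iff)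
   then show "((\<lambda>y. y powr z) has_field_derivative z * y powr (z - 1)) (at y within closed_segment (complex_of_real (real N)) (complex_of_real (real (N+1))))"
    by (rule has_field_derivative_at_within[OF has_field_derivative_powr])
   have "norm (y powr (z - 1)) = r powr (-1/2)" using r r0 by (simp add: norm_powr_real_powr z_def)
   also have "\<dots> \<le> real N powr (-1/2)" using r N by (intro powr_mono2') auto
   finally show "norm (z * y powr (z - 1)) \<le> m * real N powr (-1/2)"
    unfolding norm_mult m_def[symmetric] using mpos by (intro mult_left_mono) auto
  qed auto
  then show ?thesis unfolding L_def z_def by simp
 qed
 define l where "l = norm L"
 have "l = l powr (1/4) * l powr (3/4)" by (simp add: l_def powr_add[symmetric])
 also have "\<dots> \<le> (4 * real N powr (1/2)) powr (1/4) * (m * real N powr (-1/2)) powr (3/4)"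
  using A B by (intro mult_mono powr_mono2) (auto simp: l_def)
 also have "\<dots> = 4 powr (1/4) * (real N powr (1/8) * real N powr (-3/8)) * m powr (3/4)"
  using mpos N by (simp add: powr_mult powr_powr)
 also have "real N powr (1/8) * real N powr (-3/8) = real N powr (-1/4)" by (simp add: powr_add[symmetric])
 finally have l: "l \<le> 4 powr (1/4) * real N powr (-1/4) * m powr (3/4)" .
 have "l / ((1/2)\<^sup>2 + u\<^sup>2) \<le> (4 powr (1/4) * real N powr (-1/4) * m powr (3/4)) / m\<^sup>2"
  unfolding m2[symmetric] by (intro divide_right_mono l) auto
 also have "\<dots> = 4 powr (1/4) * real N powr (-1/4) * m powr (-5/4)"
 proof -
  have "m powr (3/4) / m powr 2 = m powr (3/4 - 2)" by (rule powr_diff[symmetric])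
  then have "m powr (3/4) / m\<^sup>2 = m powr (-5/4)" using mpos by (simp add: powr_numeral)
  then show ?thesis unfolding times_divide_eq_right[symmetric] by (simp only:)
 qed
 also have "\<dots> \<le> 4 powr (1/4) * real N powr (-1/4) * ((1 + \<bar>u\<bar>) / 4) powr (-5/4)"
  using mlow by (intro mult_left_mono powr_mono2') auto
 also have "((1 + \<bar>u\<bar>) / 4) powr (-5/4) = (1 + \<bar>u\<bar>) powr (-5/4) * 4 powr (5/4)"
 proof -
  have "4 powr (-5/4) * 4 powr (5/4) = (1::real)" by (simp add: powr_add[symmetric])
  then have "inverse (4 powr (-5/4)) = (4 powr (5/4) :: real)" by (rule inverse_unique)
  then have "x / 4 powr (-5/4) = x * 4 powr (5/4)" for x :: real by (simp only: divide_inverse)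
  moreover have "((1 + \<bar>u\<bar>) / 4) powr (-5/4) = (1 + \<bar>u\<bar>) powr (-5/4) / 4 powr (-5/4)" by (rule powr_divide)
  ultimately show ?thesis by (simp only:)
 qed
 also have "4 powr (1/4) * real N powr (-1/4) * ((1 + \<bar>u\<bar>) powr (-5/4) * 4 powr (5/4))
   = (4 powr (1/4) * 4 powr (5/4)) * real N powr (-1/4) * (1 + \<bar>u\<bar>) powr (-5/4)" by simp
 also have "4 powr (1/4) * 4 powr (5/4) = (8::real)"
 proof -
  have "4 powr (1/4) * 4 powr (5/4) = (4::real) powr (3/2)" by (simp add: powr_add[symmetric])
  also have "\<dots> = (2 powr 2) powr (3/2)" by simp
  also have "\<dots> = 2 powr 3" by (simp only: powr_powr) simp
  finally show ?thesis by simp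
 qed
 finally show ?thesis by (simp add: l_def)
qed

text \<open>A Perron formula: against the Poisson kernel of width 1/2 the powers of \<open>M\<close> detect \<open>min M
 n\<close>, and \<open>min (N + 1) n - min N n\<close> is the indicator of \<open>n > N\<close>.\<close>

lemma twisted_poly_truncate:
 assumes N: "N \<ge> 1"
 defines "L \<equiv> \<lambda>u. of_nat (N+1) powr Complex (1/2) u - of_nat N powr Complex (1/2) u"
 shows "twisted_poly K (\<lambda>n. if n \<le> N then c n else 0) \<omega> (Complex (\<eta> + 1/2) t) - twisted_poly K c \<omega> (Complex (\<eta> + 1/2) t)
  = - (1/(2*pi)) * (LINT u|lborel. twisted_poly K c \<omega> (Complex \<eta> (t + u)) * (L u / complex_of_real ((1/2)\<^sup>2 + u\<^sup>2)))"
proof -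
 let ?D = "\<lambda>u. complex_of_real ((1/2)\<^sup>2 + u\<^sup>2)"
 have M_term: "of_nat n powr (- Complex \<eta> (t + u)) * (of_nat M powr Complex (1/2) u / ?D u)
   = (of_nat n powr (- Complex (\<eta> + 1/2) t) * complex_of_real (sqrt (real n * real M))) * (cis (ln (real M / real n) * u) / ?D u)"
  if "n > 0" "M > 0" for n M :: nat and u
 proof -
  have e1: "of_nat M powr Complex (1/2) u = complex_of_real (sqrt (real M)) * cis (u * ln (real M))"
   using nat_powr_vertical[OF that(2), of "-1/2" "-u"] by (simp add: powr_half_sqrt Complex_eq add.commute)
  have "real n powr (-\<eta>) = real n powr (-(\<eta>+1/2)) * sqrt (real n)"
   using that by (simp add: powr_half_sqrt[symmetric] powr_add[symmetric])
  moreover have "cis (- ((t+u) * ln (real n))) * cis (u * ln (real M)) = cis (- (t * ln (real n))) * cis (ln (real M / real n) * u)"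
   using that by (simp add: cis_mult ln_div algebra_simps)
  ultimately show ?thesis unfolding nat_powr_vertical[OF that(1)] e1 by (simp add: real_sqrt_mult mult_ac)
 qed
 have Mint: "integrable lborel (\<lambda>u. of_nat n powr (- Complex \<eta> (t + u)) * (of_nat M powr Complex (1/2) u / ?D u))"
  if "n > 0" "M > 0" for n M :: nat
  unfolding M_term[OF that] by (intro integrable_mult_right cauchy_kernel_fourier_integrable) simp
 have Mval: "(LINT u|lborel. of_nat n powr (- Complex \<eta> (t + u)) * (of_nat M powr Complex (1/2) u / ?D u))
   = 2 * pi * of_nat n powr (- Complex (\<eta> + 1/2) t) * of_real (min (real M) (real n))"
  if nM: "n > 0" "M > 0" for n M :: nat
 proof -
  have "sqrt (real n * real M) * (pi / (1/2) * exp (- (1/2 * \<bar>ln (real M / real n)\<bar>))) = 2 * pi * min (real M) (real n)"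
  proof (cases "M \<le> n")
   case True
   then have "\<bar>ln (real M / real n)\<bar> = ln (real n / real M)" using nM by (simp add: ln_div)
   then have "exp (- (1/2 * \<bar>ln (real M / real n)\<bar>)) = (real n / real M) powr (-1/2)"
    using nM by (simp add: powr_def)
   also have "\<dots> = sqrt (real M) / sqrt (real n)"
    using powr_minus[of "real n / real M" "1/2"] nM by (simp add: powr_half_sqrt real_sqrt_divide)
   finally show ?thesis using True nM by (simp add: real_sqrt_mult)
  next
   case False
   then have "\<bar>ln (real M / real n)\<bar> = ln (real M / real n)" using nM by (simp add: ln_div)
   then have "exp (- (1/2 * \<bar>ln (real M / real n)\<bar>)) = (real M / real n) powr (-1/2)"
    using nM by (simp add: powr_def)
   also have "\<dots> = sqrt (real n) / sqrt (real M)"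
    using powr_minus[of "real M / real n" "1/2"] nM by (simp add: powr_half_sqrt real_sqrt_divide)
   finally show ?thesis using False nM by (simp add: real_sqrt_mult)
  qed
  then have "complex_of_real (sqrt (real n * real M)) * complex_of_real (pi / (1/2) * exp (- (1/2 * \<bar>ln (real M / real n)\<bar>)))
    = complex_of_real (2 * pi * min (real M) (real n))" by (simp only: of_real_mult[symmetric])
  moreover have "(LINT u|lborel. of_nat n powr (- Complex \<eta> (t + u)) * (of_nat M powr Complex (1/2) u / ?D u))
   = of_nat n powr (- Complex (\<eta> + 1/2) t) * (complex_of_real (sqrt (real n * real M)) * complex_of_real (pi / (1/2) * exp (- (1/2 * \<bar>ln (real M / real n)\<bar>))))"
   unfolding M_term[OF nM] integral_mult_right_zero by (subst cauchy_kernel_fourier_abs) (simp_all add: mult.assoc)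
  ultimately show ?thesis by simp
 qed
 have diff: "of_nat n powr (- Complex \<eta> (t + u)) * (L u / ?D u)
   = of_nat n powr (- Complex \<eta> (t + u)) * (of_nat (N+1) powr Complex (1/2) u / ?D u)
   - of_nat n powr (- Complex \<eta> (t + u)) * (of_nat N powr Complex (1/2) u / ?D u)" for n u
  by (simp only: L_def diff_divide_distrib right_diff_distrib)
 have int: "integrable lborel (\<lambda>u. of_nat n powr (- Complex \<eta> (t + u)) * (L u / ?D u))" if "n > 0" for n
  unfolding diff using Mint[OF that, of "N+1"] Mint[OF that, of N] N by (intro Bochner_Integration.integrable_diff) auto
 have val: "(LINT u|lborel. of_nat n powr (- Complex \<eta> (t + u)) * (L u / ?D u))
   = 2 * pi * of_nat n powr (- Complex (\<eta> + 1/2) t) * (if n \<le> N then 0 else 1)" if n: "n > 0" for n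
 proof -
  have "(LINT u|lborel. of_nat n powr (- Complex \<eta> (t + u)) * (L u / ?D u))
    = 2 * pi * of_nat n powr (- Complex (\<eta> + 1/2) t) * of_real (min (real (N+1)) (real n))
    - 2 * pi * of_nat n powr (- Complex (\<eta> + 1/2) t) * of_real (min (real N) (real n))"
  proof -
   have N0: "N + 1 > 0" "N > 0" using N by auto
   show ?thesis unfolding diff Bochner_Integration.integral_diff[OF Mint[OF n N0(1)] Mint[OF n N0(2)]]
     Mval[OF n N0(1)] Mval[OF n N0(2)] ..
  qed
  moreover have "min (real (N+1)) (real n) - min (real N) (real n) = (if n \<le> N then 0 else 1)" using N by auto
  ultimately show ?thesis
   by (simp only: right_diff_distrib[symmetric] of_real_diff[symmetric]) (simp split: if_splits)
 qed
 have "(LINT u|lborel. twisted_poly K c \<omega> (Complex \<eta> (t + u)) * (L u / ?D u))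
   = (LINT u|lborel. (\<Sum>n=1..K. (c n * torus_char \<omega> n) * (of_nat n powr (- Complex \<eta> (t + u)) * (L u / ?D u))))"
  by (simp only: twisted_poly_def sum_distrib_right mult.assoc)
 also have "\<dots> = (\<Sum>n=1..K. (LINT u|lborel. (c n * torus_char \<omega> n) * (of_nat n powr (- Complex \<eta> (t + u)) * (L u / ?D u))))"
  by (rule Bochner_Integration.integral_sum) (intro integrable_mult_right int, auto)
 also have "\<dots> = (\<Sum>n=1..K. (c n * torus_char \<omega> n) * (2 * pi * of_nat n powr (- Complex (\<eta> + 1/2) t) * (if n \<le> N then 0 else 1)))"
  by (intro sum.cong refl) (auto simp only: integral_mult_right_zero val atLeastAtMost_iff)
 also have "\<dots> = 2 * pi * (twisted_poly K c \<omega> (Complex (\<eta> + 1/2) t) - twisted_poly K (\<lambda>n. if n \<le> N then c n else 0) \<omega> (Complex (\<eta> + 1/2) t))"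
  unfolding twisted_poly_def sum_subtractf[symmetric] sum_distrib_left by (intro sum.cong refl) auto
 finally show ?thesis by (simp add: field_simps)
qed

lemma twisted_poly_truncate_bound:
 assumes \<omega>: "\<omega> \<in> space torus" and N: "N \<ge> 1" and h: "mean_bdd (\<lambda>u. ennreal (norm (twisted_poly K c \<omega> (Complex \<eta> u)))) X"
 shows "norm (twisted_poly K (\<lambda>n. if n \<le> N then c n else 0) \<omega> (Complex (\<eta> + 1/2) t) - twisted_poly K c \<omega> (Complex (\<eta> + 1/2) t))
   \<le> 80 * (1 + \<bar>t\<bar>) * X * real N powr (-1/4)"
proof -
 let ?Q = "\<lambda>u. twisted_poly K c \<omega> (Complex \<eta> (t + u))"
 define L where "L = (\<lambda>u. of_nat (N+1) powr Complex (1/2) u - of_nat N powr Complex (1/2) u)"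
 let ?k = "\<lambda>u. L u / complex_of_real ((1/2)\<^sup>2 + u\<^sup>2)"
 have X: "X \<ge> 0" using h by (simp add: mean_bdd_def)
 have nk: "norm (?k u) \<le> 8 * real N powr (-1/4) * (1 + \<bar>u\<bar>) powr (-5/4)" for u
 proof -
  have "norm (?k u) = norm (L u) / ((1/2)\<^sup>2 + u\<^sup>2)"
   unfolding norm_divide norm_of_real by (simp add: add_nonneg_nonneg)
  then show ?thesis using power_difference_bound[OF N, of u] unfolding L_def by simp
 qed
 have "ennreal (norm (LINT u|lborel. ?Q u * ?k u)) \<le> (\<integral>\<^sup>+u. ennreal (norm (?Q u * ?k u)) \<partial>lborel)"
  by (cases "integrable lborel (\<lambda>u. ?Q u * ?k u)")
   (auto simp: integral_norm_bound_ennreal not_integrable_integral_eq)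
 also have "\<dots> \<le> (\<integral>\<^sup>+u. ennreal (8 * real N powr (-1/4)) * (ennreal (norm (?Q u)) * ennreal ((1 + \<bar>u\<bar>) powr (-(5/4)))) \<partial>lborel)"
 proof (intro nn_integral_mono)
  fix u
  have "norm (?Q u * ?k u) \<le> norm (?Q u) * (8 * real N powr (-1/4) * (1 + \<bar>u\<bar>) powr (-5/4))"
   unfolding norm_mult by (intro mult_left_mono nk) auto
  also have "\<dots> = (8 * real N powr (-1/4)) * (norm (?Q u) * (1 + \<bar>u\<bar>) powr (-(5/4)))" by simp
  finally show "ennreal (norm (?Q u * ?k u)) \<le> ennreal (8 * real N powr (-1/4)) * (ennreal (norm (?Q u)) * ennreal ((1 + \<bar>u\<bar>) powr (-(5/4))))"
   by (simp add: ennreal_mult[symmetric] ennreal_leI)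
 qed
 also have "\<dots> = ennreal (8 * real N powr (-1/4)) * (\<integral>\<^sup>+u. ennreal (norm (?Q u)) * ennreal ((1 + \<bar>u\<bar>) powr (-(5/4))) \<partial>lborel)"
  by (rule nn_integral_cmult) measurable
 also have "\<dots> \<le> ennreal (8 * real N powr (-1/4)) * ennreal (2 * (5/4) / (5/4-1) * ((1 + \<bar>t\<bar>) * X))"
  using mean_bdd_shift[OF h, of t] by (intro mult_left_mono nn_integral_mean_bdd_weight) (auto simp: add.commute)
 also have "\<dots> = ennreal (80 * (1 + \<bar>t\<bar>) * X * real N powr (-1/4))"
  using X by (subst ennreal_mult[symmetric]) (auto simp: mult_ac)
 finally have b: "norm (LINT u|lborel. ?Q u * ?k u) \<le> 80 * (1 + \<bar>t\<bar>) * X * real N powr (-1/4)"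
  using X by (subst (asm) ennreal_le_iff) auto
 have "norm (- (1/(2*pi)) * (LINT u|lborel. ?Q u * ?k u)) \<le> 1 * norm (LINT u|lborel. ?Q u * ?k u)"
 proof -
  have "norm (- (1/(2*complex_of_real pi))) \<le> 1" using pi_ge_two by (simp add: norm_divide)
  then show ?thesis unfolding norm_mult by (intro mult_right_mono) auto
 qed
 with b show ?thesis unfolding twisted_poly_truncate[OF N] L_def by linarith
qed

section \<open>Mean values of Dirichlet polynomials\<close>

text \<open>Sums of exponentials in \<open>t\<close> with frequencies \<open>ln (n/m)\<close>. A frequency vanishes only for
 \<open>m = n\<close>, and then the coefficient is free of \<open>\<omega>\<close>; so the mean value does not depend
 on \<open>\<omega>\<close>. The family is closed under products, as \<open>torus_char\<close> is completely
 multiplicative.\<close>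

inductive trig_family :: "((nat \<Rightarrow> complex) \<Rightarrow> real \<Rightarrow> complex) \<Rightarrow> bool" where
 mono: "m > 0 \<Longrightarrow> n > 0 \<Longrightarrow> trig_family
  (\<lambda>\<omega> t. c * (torus_char \<omega> m * cnj (torus_char \<omega> n) * cis (t * (ln (real n) - ln (real m)))))"
| add: "trig_family f \<Longrightarrow> trig_family g \<Longrightarrow> trig_family (\<lambda>\<omega> t. f \<omega> t + g \<omega> t)"

lemma trig_family_const: "trig_family (\<lambda>\<omega> t. c)"
 using trig_family.mono[of 1 1 c] by simp

lemma trig_family_mult:
 assumes "trig_family f" "trig_family g"
 shows "trig_family (\<lambda>\<omega> t. f \<omega> t * g \<omega> t)"
 using assms(1)
proof induction
 case (mono m n c)
 from assms(2) show ?case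
 proof induction
  case (mono m' n' c')
  have "c * (torus_char \<omega> m * cnj (torus_char \<omega> n) * cis (t * (ln (real n) - ln (real m)))) *
    (c' * (torus_char \<omega> m' * cnj (torus_char \<omega> n') * cis (t * (ln (real n') - ln (real m')))))
   = (c * c') * (torus_char \<omega> (m * m') * cnj (torus_char \<omega> (n * n')) * cis (t * (ln (real (n * n')) - ln (real (m * m')))))"
   for \<omega> t
  proof -
   have "cis (t * (ln (real n) - ln (real m))) * cis (t * (ln (real n') - ln (real m')))
     = cis (t * (ln (real (n * n')) - ln (real (m * m'))))"
    using mono \<open>m > 0\<close> \<open>n > 0\<close> by (simp add: cis_mult ln_mult algebra_simps)
   then show ?thesis using mono \<open>m > 0\<close> \<open>n > 0\<close> by (simp add: torus_char_mult mult_ac)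
  qed
  then show ?case using mono \<open>m > 0\<close> \<open>n > 0\<close> by (simp only:) (rule trig_family.mono, auto)
 next
  case (add g h)
  show ?case unfolding distrib_left by (rule trig_family.add[OF add.IH])
 qed
next
 case (add f h)
 show ?case unfolding distrib_right by (rule trig_family.add[OF add.IH])
qed

lemma trig_family_cnj:
 assumes "trig_family f" shows "trig_family (\<lambda>\<omega> t. cnj (f \<omega> t))"
 using assms
proof induction
 case (mono m n c)
 have "cnj (c * (torus_char \<omega> m * cnj (torus_char \<omega> n) * cis (t * (ln (real n) - ln (real m)))))
   = cnj c * (torus_char \<omega> n * cnj (torus_char \<omega> m) * cis (t * (ln (real m) - ln (real n))))" for \<omega> t
  by (simp add: cis_cnj right_diff_distrib mult_ac)
 then show ?case using mono by (simp only:) (rule trig_family.mono)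
next
 case (add f h)
 then show ?case by (simp, intro trig_family.add)
qed

lemma trig_family_sum:
 assumes "finite S" "\<And>n. n \<in> S \<Longrightarrow> trig_family (f n)"
 shows "trig_family (\<lambda>\<omega> t. \<Sum>n\<in>S. f n \<omega> t)"
 using assms by (induction S rule: finite_induct) (auto intro: trig_family_const trig_family.add)

lemma trig_family_twisted_poly: "trig_family (\<lambda>\<omega> t. twisted_poly K c \<omega> (Complex \<sigma> t))"
 unfolding twisted_poly_def
proof (intro trig_family_sum)
 fix n assume "n \<in> {1..K}"
 then have n: "n > 0" by simp
 have "c n * torus_char \<omega> n * of_nat n powr (- Complex \<sigma> t)
   = (c n * complex_of_real (real n powr (-\<sigma>))) * (torus_char \<omega> n * cnj (torus_char \<omega> 1) * cis (t * (ln (real 1) - ln (real n))))" for \<omega> t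
  by (simp add: nat_powr_vertical[OF n])
 then show "trig_family (\<lambda>\<omega> t. c n * torus_char \<omega> n * of_nat n powr (- Complex \<sigma> t))"
  using n by (simp only:) (rule trig_family.mono, auto)
qed simp

lemma trig_family_polynomial:
 assumes q: "real_polynomial_function (q :: real \<Rightarrow> real)" and x: "trig_family (\<lambda>\<omega> t. complex_of_real (x \<omega> t))"
 shows "trig_family (\<lambda>\<omega> t. complex_of_real (q (x \<omega> t)))"
 using q
proof induction
 case (linear f)
 then interpret bounded_linear f .
 have "complex_of_real (f (x \<omega> t)) = complex_of_real (f 1) * complex_of_real (x \<omega> t)" for \<omega> t
  using scaleR[of "x \<omega> t" 1] by simp
 then show ?case using trig_family_mult[OF trig_family_const x] by simp
next
 case (const c) show ?case by (rule trig_family_const)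
next
 case (add f g)
 then show ?case using trig_family.add[OF add.IH] by simp
next
 case (mult f g)
 then show ?case using trig_family_mult[OF mult.IH] by simp
qed

lemma cis_mean_tendsto_0:
 assumes "a \<noteq> 0"
 shows "((\<lambda>T. (LINT t:{-T..T}|lborel. cis (t * a)) / complex_of_real (2 * T)) \<longlongrightarrow> 0) at_top"
proof (rule Lim_null_comparison)
 show "\<forall>\<^sub>F T in at_top. norm ((LINT t:{-T..T}|lborel. cis (t * a)) / complex_of_real (2 * T)) \<le> (1 / \<bar>a\<bar>) / T"
  using eventually_gt_at_top[of 0]
 proof eventually_elim
  case (elim T)
  let ?F = "\<lambda>t. cis (t * a) / (\<i> * complex_of_real a)"
  have "((\<lambda>t. cis (t * a)) has_integral (?F T - ?F (-T))) {-T..T}"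
  proof (rule fundamental_theorem_of_calculus)
   fix t
   have "((\<lambda>t. exp (\<i> * complex_of_real a * complex_of_real t) / (\<i> * complex_of_real a)) has_vector_derivative
     exp (\<i> * complex_of_real a * complex_of_real t)) (at t within {-T..T})"
    using assms by (auto intro!: derivative_eq_intros has_vector_derivative_real_field)
   then show "(?F has_vector_derivative cis (t * a)) (at t within {-T..T})" by (simp add: cis_conv_exp mult_ac)
  qed (use elim in simp)
  moreover have "set_integrable lborel {-T..T} (\<lambda>t. cis (t * a))"
   by (intro borel_integrable_atLeastAtMost' continuous_intros)
  ultimately have "(LINT t:{-T..T}|lborel. cis (t * a)) = ?F T - ?F (-T)"
   using set_borel_integral_eq_integral(2) by (metis integral_unique)
  also have "norm \<dots> \<le> norm (?F T) + norm (?F (-T))" by (rule norm_triangle_ineq4)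
  also have "\<dots> = 2 / \<bar>a\<bar>" by (simp add: norm_divide norm_mult)
  finally have "norm (LINT t:{-T..T}|lborel. cis (t * a)) \<le> 2 / \<bar>a\<bar>" .
  then have "norm (LINT t:{-T..T}|lborel. cis (t * a)) / (2 * T) \<le> (2 / \<bar>a\<bar>) / (2 * T)"
   using elim by (intro divide_right_mono) auto
  then show ?case using elim by (simp add: norm_divide norm_mult)
 qed
 show "((\<lambda>T. (1 / \<bar>a\<bar>) / T) \<longlongrightarrow> 0) at_top"
  by (intro tendsto_divide_0[OF tendsto_const] filterlim_at_top_imp_at_infinity filterlim_ident)
qed

lemma trig_family_continuous:
 assumes "trig_family f" shows "continuous_on UNIV (f \<omega>)"
 using assms by induction (auto intro!: continuous_intros)

lemma trig_family_mean:
 assumes "trig_family f"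
 shows "\<exists>L. \<forall>\<omega>\<in>space torus. ((\<lambda>T. (LINT t:{-T..T}|lborel. f \<omega> t) / complex_of_real (2 * T)) \<longlongrightarrow> L) at_top"
 using assms
proof induction
 case (mono m n c)
 show ?case
 proof (cases "m = n")
  case True
  have "((\<lambda>T. (LINT t:{-T..T}|lborel. c * (torus_char \<omega> m * cnj (torus_char \<omega> n) * cis (t * (ln (real n) - ln (real m))))) / complex_of_real (2 * T)) \<longlongrightarrow> c) at_top"
   if "\<omega> \<in> space torus" for \<omega>
  proof (rule tendsto_eventually)
   have one: "torus_char \<omega> m * cnj (torus_char \<omega> n) = 1"
    using True norm_torus_char[OF that, of n] complex_norm_square[of "torus_char \<omega> n"] by simp
   show "\<forall>\<^sub>F T in at_top. (LINT t:{-T..T}|lborel. c * (torus_char \<omega> m * cnj (torus_char \<omega> n) * cis (t * (ln (real n) - ln (real m))))) / complex_of_real (2 * T) = c"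
    using eventually_gt_at_top[of 0]
   proof eventually_elim
    case (elim T)
    then show ?case unfolding one by (simp add: True set_lebesgue_integral_def scaleR_conv_of_real)
   qed
  qed
  then show ?thesis by blast
 next
  case False
  then have "ln (real n) - ln (real m) \<noteq> 0" using mono by auto
  from tendsto_mult_right_zero[OF cis_mean_tendsto_0[OF this]]
  have "((\<lambda>T. (LINT t:{-T..T}|lborel. c * (torus_char \<omega> m * cnj (torus_char \<omega> n) * cis (t * (ln (real n) - ln (real m))))) / complex_of_real (2 * T)) \<longlongrightarrow> 0) at_top" for \<omega>
   unfolding mult.assoc[symmetric] set_integral_mult_right times_divide_eq_right[symmetric] .
  then show ?thesis by blast
 qed
next
 case (add f g)
 then obtain L L' where L: "\<And>\<omega>. \<omega> \<in> space torus \<Longrightarrow> ((\<lambda>T. (LINT t:{-T..T}|lborel. f \<omega> t) / complex_of_real (2 * T)) \<longlongrightarrow> L) at_top"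
  "\<And>\<omega>. \<omega> \<in> space torus \<Longrightarrow> ((\<lambda>T. (LINT t:{-T..T}|lborel. g \<omega> t) / complex_of_real (2 * T)) \<longlongrightarrow> L') at_top" by blast
 have "(LINT t:{-T..T}|lborel. f \<omega> t + g \<omega> t) = (LINT t:{-T..T}|lborel. f \<omega> t) + (LINT t:{-T..T}|lborel. g \<omega> t)" for \<omega> T
  using add by (intro set_integral_add borel_integrable_atLeastAtMost'
   continuous_on_subset[OF trig_family_continuous]) auto
 then have "((\<lambda>T. (LINT t:{-T..T}|lborel. f \<omega> t + g \<omega> t) / complex_of_real (2 * T)) \<longlongrightarrow> L + L') at_top" if "\<omega> \<in> space torus" for \<omega>
  using tendsto_add[OF L[OF that]] by (simp add: add_divide_distrib)
 then show ?case by blast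
qed

text \<open>The limits of the approximants form a Cauchy family, because on a nonempty index set they are close to the same
 \<open>V\<close>.\<close>

lemma common_limit_approx:
 fixes V :: "'i \<Rightarrow> real \<Rightarrow> real"
 assumes "\<And>e. e > 0 \<Longrightarrow> \<exists>L A. \<forall>i\<in>I. ((A i) \<longlongrightarrow> L) at_top \<and> (\<forall>\<^sub>F T in at_top. \<bar>V i T - A i T\<bar> \<le> e)"
 shows "\<exists>L. \<forall>i\<in>I. ((V i) \<longlongrightarrow> L) at_top"
proof (cases "I = {}")
 case False
 then obtain i0 where i0: "i0 \<in> I" by blast
 have "\<exists>L A. \<forall>i\<in>I. ((A i) \<longlongrightarrow> L) at_top \<and> (\<forall>\<^sub>F T in at_top. \<bar>V i T - A i T\<bar> \<le> inverse (real (Suc k)))" for k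
  by (rule assms) simp
 then obtain L A where LA: "\<And>k i. i \<in> I \<Longrightarrow> ((A k i) \<longlongrightarrow> L k) at_top"
  "\<And>k i. i \<in> I \<Longrightarrow> (\<forall>\<^sub>F T in at_top. \<bar>V i T - A k i T\<bar> \<le> inverse (real (Suc k)))" by metis
 have diff: "\<bar>L k - L j\<bar> \<le> inverse (real (Suc k)) + inverse (real (Suc j))" for k j
 proof (rule tendsto_upperbound)
  show "((\<lambda>T. \<bar>A k i0 T - A j i0 T\<bar>) \<longlongrightarrow> \<bar>L k - L j\<bar>) at_top" by (intro tendsto_intros LA i0)
  show "\<forall>\<^sub>F T in at_top. \<bar>A k i0 T - A j i0 T\<bar> \<le> inverse (real (Suc k)) + inverse (real (Suc j))"
   using LA(2)[OF i0, of k] LA(2)[OF i0, of j] by eventually_elim linarith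
 qed simp
 have "Cauchy L"
 proof (rule metric_CauchyI)
  fix e :: real assume e: "e > 0"
  then obtain M where M: "inverse (real (Suc M)) < e / 2" using reals_Archimedean[of "e/2"] by auto
  have "dist (L m) (L n) < e" if "m \<ge> M" "n \<ge> M" for m n
  proof -
   have "inverse (real (Suc m)) \<le> inverse (real (Suc M))" "inverse (real (Suc n)) \<le> inverse (real (Suc M))"
    using that by (intro le_imp_inverse_le; simp)+
   then show ?thesis using diff[of m n] M unfolding dist_real_def by linarith
  qed
  then show "\<exists>M. \<forall>m\<ge>M. \<forall>n\<ge>M. dist (L m) (L n) < e" by blast
 qed
 then obtain l where l: "L \<longlonglongrightarrow> l" using Cauchy_convergent_iff convergent_def by blast
 have Ll: "\<bar>L k - l\<bar> \<le> inverse (real (Suc k))" for k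
 proof (rule tendsto_le)
  show "(\<lambda>j. \<bar>L k - L j\<bar>) \<longlonglongrightarrow> \<bar>L k - l\<bar>" by (intro tendsto_intros l)
  show "(\<lambda>j. inverse (real (Suc k)) + inverse (real (Suc j))) \<longlonglongrightarrow> inverse (real (Suc k))"
   using tendsto_add[OF tendsto_const LIMSEQ_inverse_real_of_nat] by simp
  show "\<forall>\<^sub>F j in sequentially. \<bar>L k - L j\<bar> \<le> inverse (real (Suc k)) + inverse (real (Suc j))"
   by (intro always_eventually allI diff)
 qed simp
 have "((V i) \<longlongrightarrow> l) at_top" if i: "i \<in> I" for i
 proof (rule tendstoI)
  fix e :: real assume e: "e > 0"
  then obtain M where M: "inverse (real (Suc M)) < e / 3" using reals_Archimedean[of "e/3"] by auto
  have "\<forall>\<^sub>F T in at_top. dist (A M i T) (L M) < e / 3" using LA(1)[OF i] e by (intro tendstoD) auto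
  then show "\<forall>\<^sub>F T in at_top. dist (V i T) l < e" using LA(2)[OF i, of M]
  proof eventually_elim
   case (elim T)
   then show ?case using Ll[of M] M unfolding dist_real_def by linarith
  qed
 qed
 then show ?thesis by blast
qed simp

lemma vertical_mean_nn_integral:
 assumes "continuous_on UNIV (\<lambda>t. F (Complex \<sigma> t))" "p > 0" "T > 0"
 shows "ennreal (vertical_mean p F \<sigma> T) = ennreal (1 / (2 * T)) * (\<integral>\<^sup>+t\<in>{-T..T}. ennreal (norm (F (Complex \<sigma> t)) powr p) \<partial>lborel)"
  and "set_integrable lborel {-T..T} (\<lambda>t. norm (F (Complex \<sigma> t)) powr p)"
  and "vertical_mean p F \<sigma> T \<ge> 0"
proof -
 show int: "set_integrable lborel {-T..T} (\<lambda>t. norm (F (Complex \<sigma> t)) powr p)"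
  using assms by (intro borel_integrable_atLeastAtMost' continuous_on_powr' continuous_intros
    continuous_on_subset[OF assms(1)]) auto
 have "ennreal (LINT t:{-T..T}|lborel. norm (F (Complex \<sigma> t)) powr p)
   = (\<integral>\<^sup>+t. ennreal (indicator {-T..T} t *\<^sub>R (norm (F (Complex \<sigma> t)) powr p)) \<partial>lborel)"
  unfolding set_lebesgue_integral_def using int unfolding set_integrable_def
  by (intro nn_integral_eq_integral[symmetric]) (auto simp: indicator_def)
 also have "\<dots> = (\<integral>\<^sup>+t\<in>{-T..T}. ennreal (norm (F (Complex \<sigma> t)) powr p) \<partial>lborel)"
  by (intro nn_integral_cong) (auto simp: indicator_def)
 finally have e: "ennreal (LINT t:{-T..T}|lborel. norm (F (Complex \<sigma> t)) powr p)
   = (\<integral>\<^sup>+t\<in>{-T..T}. ennreal (norm (F (Complex \<sigma> t)) powr p) \<partial>lborel)" .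
 have nn: "(LINT t:{-T..T}|lborel. norm (F (Complex \<sigma> t)) powr p) \<ge> 0"
  unfolding set_lebesgue_integral_def by (intro integral_nonneg_AE) (auto simp: indicator_def)
 show "ennreal (vertical_mean p F \<sigma> T) = ennreal (1 / (2 * T)) * (\<integral>\<^sup>+t\<in>{-T..T}. ennreal (norm (F (Complex \<sigma> t)) powr p) \<partial>lborel)"
  unfolding vertical_mean_def e[symmetric] using nn assms by (intro ennreal_mult) auto
 show "vertical_mean p F \<sigma> T \<ge> 0" unfolding vertical_mean_def using nn assms by simp
qed

text \<open>\<open>|P|\<^sup>2\<close> belongs to the family and is bounded; by the Weierstrass theorem \<open>x powr
 (p/2)\<close> may be replaced by a polynomial in \<open>|P|\<^sup>2\<close>.\<close>

lemma twisted_poly_vertical_mean: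
 assumes p: "p > 0" and \<sigma>: "\<sigma> \<ge> 0"
 shows "\<exists>L. \<forall>\<omega>\<in>space torus. (vertical_mean p (twisted_poly K c \<omega>) \<sigma> \<longlongrightarrow> L) at_top"
proof (rule common_limit_approx)
 fix e :: real assume e: "e > 0"
 define B where "B = (\<Sum>n=1..K. norm (c n))"
 let ?x = "\<lambda>\<omega> t. (norm (twisted_poly K c \<omega> (Complex \<sigma> t)))\<^sup>2"
 have x: "?x \<omega> t \<in> {0..B\<^sup>2}" if "\<omega> \<in> space torus" for \<omega> t
  using norm_twisted_poly_le[OF that, of "Complex \<sigma> t" K c] \<sigma> by (auto simp: B_def intro!: power_mono)
 have "continuous_on {0..B\<^sup>2} (\<lambda>x. x powr (p/2))" using p by (intro continuous_on_powr' continuous_intros) auto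
 then obtain q where q: "real_polynomial_function q" "\<And>x. x \<in> {0..B\<^sup>2} \<Longrightarrow> \<bar>x powr (p/2) - q x\<bar> < e"
  using Stone_Weierstrass_real_polynomial_function[of "{0..B\<^sup>2}" "\<lambda>x. x powr (p/2)" e] e by auto
 have "trig_family (\<lambda>\<omega> t. complex_of_real (?x \<omega> t))" unfolding complex_norm_square
  by (rule trig_family_mult[OF trig_family_twisted_poly trig_family_cnj[OF trig_family_twisted_poly]])
 from trig_family_polynomial[OF q(1) this]
 have tf: "trig_family (\<lambda>\<omega> t. complex_of_real (q (?x \<omega> t)))" .
 from trig_family_mean[OF this] obtain L where
  L: "\<And>\<omega>. \<omega> \<in> space torus \<Longrightarrow> ((\<lambda>T. (LINT t:{-T..T}|lborel. complex_of_real (q (?x \<omega> t))) / complex_of_real (2 * T)) \<longlongrightarrow> L) at_top"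
  by blast
 let ?A = "\<lambda>\<omega> T. 1 / (2 * T) * (LINT t:{-T..T}|lborel. q (?x \<omega> t))"
 show "\<exists>L A. \<forall>\<omega>\<in>space torus. ((A \<omega>) \<longlongrightarrow> L) at_top \<and> (\<forall>\<^sub>F T in at_top. \<bar>vertical_mean p (twisted_poly K c \<omega>) \<sigma> T - A \<omega> T\<bar> \<le> e)"
 proof (rule exI[of _ "Re L"], rule exI[of _ ?A], intro ballI conjI)
  fix \<omega> assume \<omega>: "\<omega> \<in> space torus"
  have "(LINT t:{-T..T}|lborel. complex_of_real (q (?x \<omega> t))) / complex_of_real (2 * T) = complex_of_real (?A \<omega> T)" for T
   unfolding set_integral_complex_of_real of_real_divide[symmetric] by simp
  then have "((\<lambda>T. complex_of_real (?A \<omega> T)) \<longlongrightarrow> L) at_top" using L[OF \<omega>] by (simp only:)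
  from tendsto_Re[OF this] show "(?A \<omega> \<longlongrightarrow> Re L) at_top" by simp
  have cx: "continuous_on UNIV (\<lambda>t. q (?x \<omega> t))"
   using continuous_on_Re[OF trig_family_continuous[OF tf, of \<omega>]] by simp
  show "\<forall>\<^sub>F T in at_top. \<bar>vertical_mean p (twisted_poly K c \<omega>) \<sigma> T - ?A \<omega> T\<bar> \<le> e"
   using eventually_gt_at_top[of 0]
  proof eventually_elim
   case (elim T)
   have i1: "set_integrable lborel {-T..T} (\<lambda>t. norm (twisted_poly K c \<omega> (Complex \<sigma> t)) powr p)"
    using elim p by (intro vertical_mean_nn_integral twisted_poly_vertical_continuous) auto
   have i2: "set_integrable lborel {-T..T} (\<lambda>t. q (?x \<omega> t))"
    by (intro borel_integrable_atLeastAtMost' continuous_on_subset[OF cx]) auto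
   have "vertical_mean p (twisted_poly K c \<omega>) \<sigma> T - ?A \<omega> T
     = 1 / (2 * T) * (LINT t:{-T..T}|lborel. norm (twisted_poly K c \<omega> (Complex \<sigma> t)) powr p - q (?x \<omega> t))"
    unfolding vertical_mean_def set_integral_diff(2)[OF i1 i2] by (simp add: right_diff_distrib)
   moreover have "\<bar>LINT t:{-T..T}|lborel. norm (twisted_poly K c \<omega> (Complex \<sigma> t)) powr p - q (?x \<omega> t)\<bar> \<le> (LINT t:{-T..T}|lborel. e)"
   proof -
    have pw: "\<bar>norm (twisted_poly K c \<omega> (Complex \<sigma> t)) powr p - q (?x \<omega> t)\<bar> \<le> e" for t
    proof -
     have "norm (twisted_poly K c \<omega> (Complex \<sigma> t)) powr p = (?x \<omega> t) powr (p/2)"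
      by (simp add: powr_powr flip: powr_numeral)
     then show ?thesis using q(2)[OF x[OF \<omega>, of t]] by simp
    qed
    have i3: "set_integrable lborel {-T..T} (\<lambda>t. norm (twisted_poly K c \<omega> (Complex \<sigma> t)) powr p - q (?x \<omega> t))"
     using i1 i2 by (rule set_integral_diff)
    have i4: "set_integrable lborel {-T..T} (\<lambda>t. e)"
     by (intro borel_integrable_atLeastAtMost' continuous_intros)
    show ?thesis unfolding set_lebesgue_integral_def real_norm_def[symmetric]
     by (rule Bochner_Integration.integral_norm_bound_integral[OF i3[unfolded set_integrable_def] i4[unfolded set_integrable_def]])
      (use pw e in \<open>auto simp: indicator_def\<close>)
   qed
   moreover have "(LINT t:{-T..T}|lborel. e) = e * (2 * T)" using elim by (simp add: set_lebesgue_integral_def)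
   ultimately show ?case using elim by (simp add: abs_mult field_simps)
  qed
 qed
qed

interpretation torus_line: pair_sigma_finite torus lborel ..

lemma nn_integral_flow_window:
 assumes G [measurable]: "G \<in> borel_measurable torus" and pair: "(\<lambda>(\<omega>, t). G (flow t \<omega>)) \<in> borel_measurable (torus \<Otimes>\<^sub>M lborel)"
  and A [measurable]: "A \<in> sets lborel"
 shows "(\<integral>\<^sup>+\<omega>. (\<integral>\<^sup>+t\<in>A. G (flow t \<omega>) \<partial>lborel) \<partial>torus) = emeasure lborel A * (\<integral>\<^sup>+\<omega>. G \<omega> \<partial>torus)"
proof -
 have [measurable]: "(\<lambda>x. G (flow (snd x) (fst x))) \<in> borel_measurable (torus \<Otimes>\<^sub>M lborel)"
  using pair by (simp add: case_prod_beta)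
 have "(\<integral>\<^sup>+\<omega>. (\<integral>\<^sup>+t\<in>A. G (flow t \<omega>) \<partial>lborel) \<partial>torus) = (\<integral>\<^sup>+t. (\<integral>\<^sup>+\<omega>. G (flow t \<omega>) * indicator A t \<partial>torus) \<partial>lborel)"
 proof (rule torus_line.Fubini'[symmetric])
  show "(\<lambda>(\<omega>, t). G (flow t \<omega>) * indicator A t) \<in> borel_measurable (torus \<Otimes>\<^sub>M lborel)"
   unfolding case_prod_beta by measurable
 qed
 also have "\<dots> = (\<integral>\<^sup>+t. (\<integral>\<^sup>+\<omega>. G \<omega> \<partial>torus) * indicator A t \<partial>lborel)"
 proof (intro nn_integral_cong)
  fix t :: real
  have "(\<integral>\<^sup>+\<omega>. G (flow t \<omega>) * indicator A t \<partial>torus) = (\<integral>\<^sup>+\<omega>. G (flow t \<omega>) \<partial>torus) * indicator A t"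
   by (rule nn_integral_multc) (rule measurable_compose[OF flow_measurable G])
  then show "(\<integral>\<^sup>+\<omega>. G (flow t \<omega>) * indicator A t \<partial>torus) = (\<integral>\<^sup>+\<omega>. G \<omega> \<partial>torus) * indicator A t"
   by (simp add: nn_integral_flow[OF G])
 qed
 also have "\<dots> = (\<integral>\<^sup>+\<omega>. G \<omega> \<partial>torus) * emeasure lborel A" by (rule nn_integral_cmult_indicator) measurable
 finally show ?thesis by (simp add: mult.commute)
qed

lemma twisted_poly_flow_real: "twisted_poly K c (flow t \<omega>) (complex_of_real \<sigma>) = twisted_poly K c \<omega> (Complex \<sigma> t)"
 by (simp add: twisted_poly_flow Complex_eq)

definition torus_norm :: "real \<Rightarrow> nat \<Rightarrow> (nat \<Rightarrow> complex) \<Rightarrow> real \<Rightarrow> real" where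
 "torus_norm p K c \<sigma> = (LINT \<omega>|torus. norm (twisted_poly K c \<omega> (complex_of_real \<sigma>)) powr p)"

lemma twisted_poly_powr_bound:
 assumes "\<omega> \<in> space torus" "\<sigma> \<ge> 0" "p > 0"
 shows "norm (twisted_poly K c \<omega> (Complex \<sigma> t)) powr p \<le> (\<Sum>n=1..K. norm (c n)) powr p"
 using assms norm_twisted_poly_le[OF assms(1), of "Complex \<sigma> t" K c] by (intro powr_mono2) auto

lemma torus_norm_nn:
 assumes "p > 0" "\<sigma> \<ge> 0"
 shows "ennreal (torus_norm p K c \<sigma>) = (\<integral>\<^sup>+\<omega>. ennreal (norm (twisted_poly K c \<omega> (complex_of_real \<sigma>)) powr p) \<partial>torus)"
  and "torus_norm p K c \<sigma> \<ge> 0"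
proof -
 have "integrable torus (\<lambda>\<omega>. norm (twisted_poly K c \<omega> (complex_of_real \<sigma>)) powr p)"
  using twisted_poly_powr_bound[OF _ assms(2,1), of _ K c 0]
  by (intro torus.integrable_const_bound[where B = "(\<Sum>n=1..K. norm (c n)) powr p"] AE_I2) (auto simp: Complex_eq)
 then show "ennreal (torus_norm p K c \<sigma>) = (\<integral>\<^sup>+\<omega>. ennreal (norm (twisted_poly K c \<omega> (complex_of_real \<sigma>)) powr p) \<partial>torus)"
  unfolding torus_norm_def by (intro nn_integral_eq_integral[symmetric]) auto
 show "torus_norm p K c \<sigma> \<ge> 0" unfolding torus_norm_def by (intro integral_nonneg_AE) auto
qed

lemma nn_integral_twisted_poly_window:
 assumes p: "p > 0" and \<sigma>: "\<sigma> \<ge> 0" and A: "A \<in> sets lborel"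
 shows "(\<integral>\<^sup>+\<omega>. (\<integral>\<^sup>+t\<in>A. ennreal (norm (twisted_poly K c \<omega> (Complex \<sigma> t)) powr p) \<partial>lborel) \<partial>torus)
   = emeasure lborel A * ennreal (torus_norm p K c \<sigma>)"
proof -
 let ?G = "\<lambda>\<omega>. ennreal (norm (twisted_poly K c \<omega> (complex_of_real \<sigma>)) powr p)"
 have "(\<lambda>(\<omega>, t). ennreal (norm (twisted_poly K c \<omega> (Complex \<sigma> t)) powr p)) \<in> borel_measurable (torus \<Otimes>\<^sub>M lborel)"
 proof -
  have "(\<lambda>x. twisted_poly K c (fst x) (Complex \<sigma> (snd x))) \<in> borel_measurable (torus \<Otimes>\<^sub>M lborel)"
   using twisted_poly_measurable_pair[of K c \<sigma>] by (simp add: case_prod_beta)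
  then show ?thesis unfolding case_prod_beta by measurable
 qed
 then show ?thesis using nn_integral_flow_window[of ?G A] A
  by (simp add: torus_norm_nn[OF p \<sigma>] twisted_poly_flow_real)
qed

text \<open>The limit is a constant and therefore equals the limit of the expectations, which by stationarity are all equal to
 the norm on the torus.\<close>

lemma vertical_mean_twisted_poly_tendsto:
 assumes p: "p > 0" and \<sigma>: "\<sigma> \<ge> 0" and \<omega>: "\<omega> \<in> space torus"
 shows "(vertical_mean p (twisted_poly K c \<omega>) \<sigma> \<longlongrightarrow> torus_norm p K c \<sigma>) at_top"
proof -
 obtain L where L: "\<And>\<omega>. \<omega> \<in> space torus \<Longrightarrow> (vertical_mean p (twisted_poly K c \<omega>) \<sigma> \<longlongrightarrow> L) at_top"
  using twisted_poly_vertical_mean[OF p \<sigma>, of K c] by blast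
 let ?V = "\<lambda>\<omega> T. vertical_mean p (twisted_poly K c \<omega>) \<sigma> T"
 let ?W = "\<lambda>\<omega> T. (\<integral>\<^sup>+t\<in>{-T..T}. ennreal (norm (twisted_poly K c \<omega> (Complex \<sigma> t)) powr p) \<partial>lborel)"
 define B where "B = (\<Sum>n=1..K. norm (c n)) powr p"
 have V: "ennreal (?V \<omega> T) = ennreal (1 / (2 * T)) * ?W \<omega> T" "?V \<omega> T \<ge> 0" if "T > 0" for \<omega> T
  using that p by (auto intro!: vertical_mean_nn_integral twisted_poly_vertical_continuous)
 have VB: "?V \<omega> T \<le> B" if "T > 0" "\<omega> \<in> space torus" for \<omega> T
 proof -
  have "?W \<omega> T \<le> (\<integral>\<^sup>+t\<in>{-T..T}. ennreal B \<partial>lborel)" using twisted_poly_powr_bound[OF that(2) \<sigma> p, of K c]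
   by (intro nn_integral_mono) (auto simp: indicator_def B_def intro!: ennreal_leI)
  also have "\<dots> = ennreal (B * (2*T))" using that
   by (subst nn_integral_cmult_indicator) (auto simp: B_def ennreal_mult)
  finally have "ennreal (?V \<omega> T) \<le> ennreal (1 / (2 * T)) * ennreal (B * (2*T))"
   unfolding V(1)[OF that(1)] by (intro mult_left_mono) auto
  also have "\<dots> = ennreal B" using that by (simp add: ennreal_mult[symmetric] B_def)
  finally show ?thesis by (simp add: B_def)
 qed
 have Wm [measurable]: "(\<lambda>\<omega>. ?W \<omega> T) \<in> borel_measurable torus" for T
 proof -
  have "(\<lambda>x. twisted_poly K c (fst x) (Complex \<sigma> (snd x))) \<in> borel_measurable (torus \<Otimes>\<^sub>M lborel)"
   using twisted_poly_measurable_pair[of K c \<sigma>] by (simp add: case_prod_beta)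
  then have [measurable]: "(\<lambda>(\<omega>, t). twisted_poly K c \<omega> (Complex \<sigma> t)) \<in> borel_measurable (torus \<Otimes>\<^sub>M lborel)"
   by (simp add: case_prod_beta)
  show ?thesis by measurable
 qed
 have [measurable]: "(\<lambda>\<omega>. ?V \<omega> T) \<in> borel_measurable torus" if "T > 0" for T
 proof -
  have "?V \<omega> T = enn2real (ennreal (1 / (2 * T)) * ?W \<omega> T)" for \<omega>
   using V[OF that, of \<omega>] by (metis enn2real_ennreal)
  then show ?thesis by simp
 qed
 have EV: "(LINT \<omega>|torus. ?V \<omega> T) = torus_norm p K c \<sigma>" if T: "T > 0" for T
 proof -
  have "(\<integral>\<^sup>+\<omega>. ennreal (?V \<omega> T) \<partial>torus) = (\<integral>\<^sup>+\<omega>. ennreal (1 / (2 * T)) * ?W \<omega> T \<partial>torus)"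
   by (simp only: V(1)[OF T])
  also have "\<dots> = ennreal (1 / (2 * T)) * (\<integral>\<^sup>+\<omega>. ?W \<omega> T \<partial>torus)" by (rule nn_integral_cmult[OF Wm])
  also have "(\<integral>\<^sup>+\<omega>. ?W \<omega> T \<partial>torus) = ennreal (2 * T) * ennreal (torus_norm p K c \<sigma>)"
   using T by (subst nn_integral_twisted_poly_window[OF p \<sigma>]) auto
  also have "ennreal (1 / (2 * T)) * (ennreal (2 * T) * ennreal (torus_norm p K c \<sigma>)) = ennreal (torus_norm p K c \<sigma>)"
   using T torus_norm_nn(2)[OF p \<sigma>] by (simp add: ennreal_mult[symmetric])
  finally have "(\<integral>\<^sup>+\<omega>. ennreal (?V \<omega> T) \<partial>torus) = ennreal (torus_norm p K c \<sigma>)" .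
  then show ?thesis using T V(2)[OF T] torus_norm_nn(2)[OF p \<sigma>] by (subst integral_eq_nn_integral) auto
 qed
 have "(\<lambda>n::nat. LINT \<omega>|torus. ?V \<omega> (real (Suc n))) \<longlonglongrightarrow> (LINT \<omega>|torus. L)"
 proof (rule integral_dominated_convergence[where w = "\<lambda>_. B"])
  show "AE \<omega> in torus. (\<lambda>n. ?V \<omega> (real (Suc n))) \<longlonglongrightarrow> L"
  proof (intro AE_I2)
   fix \<omega> assume "\<omega> \<in> space torus"
   from filterlim_compose[OF L[OF this], of "\<lambda>n. real (Suc n)" sequentially]
   show "(\<lambda>n. ?V \<omega> (real (Suc n))) \<longlonglongrightarrow> L"
    by (simp add: filterlim_Suc filterlim_compose[OF filterlim_real_sequentially] del: of_nat_Suc)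
  qed
  show "AE \<omega> in torus. norm (?V \<omega> (real (Suc n))) \<le> B" for n
   using VB V(2) by (intro AE_I2) (simp del: of_nat_Suc)
 qed (auto simp del: of_nat_Suc)
 moreover have "(LINT \<omega>|torus. L) = L" by (simp add: torus.prob_space)
 ultimately have limc: "(\<lambda>n::nat. torus_norm p K c \<sigma>) \<longlonglongrightarrow> L" by (simp only: EV of_nat_0_less_iff zero_less_Suc)
 have "torus_norm p K c \<sigma> = L" by (rule LIMSEQ_unique[OF tendsto_const limc])
 then show ?thesis using L[OF \<omega>] by simp
qed

lemma dirichlet_poly_twisted:
 assumes c: "c 0 = 0" "\<And>n. n > K \<Longrightarrow> c n = 0"
 shows "dirichlet_poly c s = twisted_poly K c (\<lambda>q\<in>{q. prime q}. 1) s"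
proof -
 have "torus_char (\<lambda>q\<in>{q. prime q}. 1) n = 1" for n
  by (auto simp: torus_char_def prime_factors_multiplicity intro!: prod.neutral)
 moreover have "{n. c n \<noteq> 0} \<subseteq> {1..K}" using c by (auto simp: Suc_le_eq) (metis gr0I, meson leI)
 ultimately show ?thesis unfolding dirichlet_poly_def twisted_poly_def by (intro sum.mono_neutral_cong_left) auto
qed

lemma Hp_norm_eq_torus_norm:
 assumes c: "c 0 = 0" "\<And>n. n > K \<Longrightarrow> c n = 0" and p: "p > 0"
 shows "Hp_norm p c = torus_norm p K c 0 powr (1 / p)"
proof -
 let ?\<omega> = "\<lambda>q\<in>{q::nat. prime q}. 1 :: complex"
 have \<omega>: "?\<omega> \<in> space torus" by (auto simp: space_torus)
 have dp: "dirichlet_poly c = twisted_poly K c ?\<omega>" by (rule ext, rule dirichlet_poly_twisted) (use c in auto)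
 have Mp: "Mp p (dirichlet_poly c) \<sigma> = torus_norm p K c \<sigma> powr (1/p)" if "\<sigma> > 0" for \<sigma>
  using tendsto_Lim[OF _ vertical_mean_twisted_poly_tendsto[OF p _ \<omega>, of \<sigma> K c]] that by (simp add: Mp_def dp)
 have lim: "((\<lambda>\<sigma>. torus_norm p K c \<sigma>) \<longlongrightarrow> torus_norm p K c 0) (at_right 0)"
 proof (rule tendsto_at_right_sequentially[of _ 1])
  fix S :: "nat \<Rightarrow> real" assume S: "\<And>n. 0 < S n" "S \<longlonglongrightarrow> 0"
  show "(\<lambda>n. torus_norm p K c (S n)) \<longlonglongrightarrow> torus_norm p K c 0" unfolding torus_norm_def
  proof (rule integral_dominated_convergence[where w = "\<lambda>_. (\<Sum>n=1..K. norm (c n)) powr p"])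
   show "AE \<omega> in torus. (\<lambda>n. norm (twisted_poly K c \<omega> (complex_of_real (S n))) powr p) \<longlonglongrightarrow> norm (twisted_poly K c \<omega> (complex_of_real 0)) powr p"
   proof (intro AE_I2 tendsto_powr' tendsto_norm tendsto_const)
    fix \<omega>
    have "isCont (twisted_poly K c \<omega>) (complex_of_real 0)"
     using twisted_poly_continuous[of UNIV] by (simp add: continuous_on_eq_continuous_at)
    then show "(\<lambda>n. twisted_poly K c \<omega> (complex_of_real (S n))) \<longlonglongrightarrow> twisted_poly K c \<omega> (complex_of_real 0)"
     by (rule isCont_tendsto_compose) (intro tendsto_of_real S)
   qed (use p in auto)
   show "AE \<omega> in torus. norm (norm (twisted_poly K c \<omega> (complex_of_real (S n))) powr p) \<le> (\<Sum>n=1..K. norm (c n)) powr p" for n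
    using twisted_poly_powr_bound[OF _ less_imp_le[OF S(1)] p, of _ K c n 0] by (intro AE_I2) (simp add: Complex_eq)
  qed auto
 qed simp
 have ev: "\<forall>\<^sub>F \<sigma> in at_right 0. 0 \<le> torus_norm p K c \<sigma>"
  using eventually_at_right_less[of 0] by eventually_elim (simp add: torus_norm_nn(2) p)
 have "((\<lambda>\<sigma>. torus_norm p K c \<sigma> powr (1/p)) \<longlongrightarrow> torus_norm p K c 0 powr (1/p)) (at_right 0)"
  by (rule tendsto_powr'[OF lim tendsto_const]) (use p ev in simp)
 moreover have "\<forall>\<^sub>F \<sigma> in at_right 0. torus_norm p K c \<sigma> powr (1/p) = Mp p (dirichlet_poly c) \<sigma>"
  using eventually_at_right_less by eventually_elim (simp add: Mp)
 ultimately have "((\<lambda>\<sigma>. Mp p (dirichlet_poly c) \<sigma>) \<longlongrightarrow> torus_norm p K c 0 powr (1/p)) (at_right 0)"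
  by (rule Lim_transform_eventually)
 then show ?thesis unfolding Hp_norm_def by (intro tendsto_Lim) auto
qed

section \<open>Approximation on the Carlson set\<close>

lemma open_half_plane: "open (half_plane \<kappa>)"
 and convex_half_plane: "convex (half_plane \<kappa>)"
 unfolding half_plane_def by (simp_all add: open_halfspace_Re_gt convex_halfspace_Re_gt)

text \<open>Equal to 1 at 0, holomorphic to the right of \<open>-2\<rho>\<close>, and with enough decay for the product with a
 function of bounded mean to be integrable on vertical lines.\<close>

definition smoothing_kernel :: "real \<Rightarrow> complex \<Rightarrow> complex" where
 "smoothing_kernel \<rho> w = (2 * complex_of_real \<rho> / (w + 2 * complex_of_real \<rho>)) ^ 3"

lemma quartic_weight_le:
 fixes u m :: real
 assumes "0 < \<delta>" "\<delta> * (1 + u\<^sup>2) \<le> m\<^sup>2" "m > 0"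
 shows "1 / m ^ 4 \<le> 4 / \<delta>\<^sup>2 * (1 + \<bar>u\<bar>) powr (-4)"
proof -
 have "(1 + \<bar>u\<bar>)\<^sup>2 \<le> 2 * (1 + u\<^sup>2)"
  using zero_le_power2[of "1 - \<bar>u\<bar>"] by (simp add: power2_eq_square algebra_simps)
 then have "((1 + \<bar>u\<bar>)\<^sup>2)\<^sup>2 \<le> (2 * (1 + u\<^sup>2))\<^sup>2" by (intro power_mono) auto
 then have "\<delta>\<^sup>2 * ((1 + \<bar>u\<bar>)\<^sup>2)\<^sup>2 \<le> \<delta>\<^sup>2 * (2 * (1 + u\<^sup>2))\<^sup>2" by (intro mult_left_mono) auto
 also have "\<dots> = 4 * (\<delta> * (1 + u\<^sup>2))\<^sup>2" by (simp only: power_mult_distrib) simp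
 also have "\<dots> \<le> 4 * (m\<^sup>2)\<^sup>2" using assms by (intro mult_left_mono power_mono) auto
 finally have "\<delta>\<^sup>2 * (1 + \<bar>u\<bar>) ^ 4 \<le> 4 * m ^ 4" by (simp flip: power_mult)
 moreover have "(1 + \<bar>u\<bar>) powr (-4) = 1 / (1 + \<bar>u\<bar>) ^ 4" by (simp add: powr_minus_divide flip: powr_numeral)
 moreover have "(1 + \<bar>u\<bar>) ^ 4 > 0" by (simp add: add_pos_nonneg)
 moreover have "4 / (4 * m ^ 4) \<le> 4 / (\<delta>\<^sup>2 * (1 + \<bar>u\<bar>) ^ 4)"
  using calculation assms by (intro divide_left_mono mult_pos_pos) auto
 ultimately show ?thesis by simp
qed

lemma smoothing_kernel_left:
 assumes \<rho>: "0 < \<rho>" "\<rho> \<le> 1"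
 shows "norm (smoothing_kernel \<rho> (Complex (-\<rho>) u) / Complex (-\<rho>) u) \<le> 32 / \<rho> * (1 + \<bar>u\<bar>) powr (-4)"
proof -
 define m where "m = norm (Complex \<rho> u)"
 have m: "m > 0" "m\<^sup>2 = \<rho>\<^sup>2 + u\<^sup>2" using \<rho> by (auto simp: m_def cmod_def complex_eq_iff add_pos_nonneg)
 have 1: "Complex (-\<rho>) u + 2 * complex_of_real \<rho> = Complex \<rho> u" by (simp add: complex_eq_iff)
 have 2: "norm (Complex (-\<rho>) u) = m" by (simp add: m_def cmod_def)
 have "norm (smoothing_kernel \<rho> (Complex (-\<rho>) u) / Complex (-\<rho>) u) = (2 * \<rho> / m) ^ 3 / m"
  unfolding smoothing_kernel_def 1 norm_divide norm_power 2 using \<rho> by (simp add: m_def[symmetric] norm_mult)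
 also have "\<dots> = 8 * \<rho> ^ 3 * (1 / m ^ 4)" by (simp add: power_divide power_mult_distrib power_numeral_reduce)
 also have "\<dots> \<le> 8 * \<rho> ^ 3 * (4 / (\<rho>\<^sup>2)\<^sup>2 * (1 + \<bar>u\<bar>) powr (-4))"
 proof (intro mult_left_mono quartic_weight_le)
  have "\<rho>\<^sup>2 * u\<^sup>2 \<le> 1 * u\<^sup>2" using \<rho> by (intro mult_right_mono) (auto simp: power_le_one)
  then show "\<rho>\<^sup>2 * (1 + u\<^sup>2) \<le> m\<^sup>2" unfolding m by (simp add: algebra_simps)
 qed (use \<rho> m in auto)
 also have "\<dots> = 32 / \<rho> * (1 + \<bar>u\<bar>) powr (-4)" using \<rho> by (simp add: power_numeral_reduce)
 finally show ?thesis .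
qed

lemma smoothing_kernel_right:
 assumes \<rho>: "0 < \<rho>" "\<rho> \<le> 1"
 shows "norm (smoothing_kernel \<rho> (Complex 2 u) / Complex 2 u) \<le> 32 * (1 + \<bar>u\<bar>) powr (-4)"
proof -
 define m where "m = norm (Complex 2 u)"
 have m: "m > 0" "m\<^sup>2 = 4 + u\<^sup>2" using \<rho> by (auto simp: m_def cmod_def complex_eq_iff add_pos_nonneg)
 have "m \<le> norm (Complex 2 u + 2 * complex_of_real \<rho>)"
  using \<rho> power_mono[of 2 "2 + 2 * \<rho>" 2] by (auto simp: m_def cmod_def)
 then have "2 * \<rho> / norm (Complex 2 u + 2 * complex_of_real \<rho>) \<le> 2 / m" using \<rho> m by (intro frac_le) auto
 then have "(2 * \<rho> / norm (Complex 2 u + 2 * complex_of_real \<rho>)) ^ 3 / m \<le> (2 / m) ^ 3 / m"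
  using \<rho> m by (intro divide_right_mono power_mono) auto
 then have "norm (smoothing_kernel \<rho> (Complex 2 u) / Complex 2 u) \<le> (2 / m) ^ 3 / m"
  unfolding smoothing_kernel_def norm_divide norm_power m_def[symmetric] using \<rho> by (simp add: norm_mult)
 also have "\<dots> = 8 * (1 / m ^ 4)" by (simp add: power_divide power_numeral_reduce)
 also have "\<dots> \<le> 8 * (4 / 1\<^sup>2 * (1 + \<bar>u\<bar>) powr (-4))" using m by (intro mult_left_mono quartic_weight_le) auto
 finally show ?thesis by simp
qed

lemma smoothing_kernel_far:
 assumes \<rho>: "0 < \<rho>" "\<rho> \<le> 1" and y: "\<bar>Im w\<bar> \<ge> 1"
 shows "norm (smoothing_kernel \<rho> w) \<le> 8 / \<bar>Im w\<bar>"
proof -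
 have "\<bar>Im w\<bar> \<le> norm (w + 2 * complex_of_real \<rho>)" using abs_Im_le_cmod[of "w + 2 * complex_of_real \<rho>"] by simp
 then have "2 * \<rho> / norm (w + 2 * complex_of_real \<rho>) \<le> 2 / \<bar>Im w\<bar>" using \<rho> y by (intro frac_le) auto
 then have "(2 * \<rho> / norm (w + 2 * complex_of_real \<rho>)) ^ 3 \<le> (2 / \<bar>Im w\<bar>) ^ 3" using \<rho> by (intro power_mono) auto
 also have "\<dots> = 8 / \<bar>Im w\<bar> ^ 3" by (simp add: power_divide)
 also have "\<dots> \<le> 8 / \<bar>Im w\<bar> ^ 1" using y by (intro divide_left_mono power_increasing) auto
 finally show ?thesis unfolding smoothing_kernel_def norm_power norm_divide using \<rho> by (simp add: norm_mult)
qed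

lemma smoothing_kernel_holomorphic:
 assumes "\<And>w. w \<in> A \<Longrightarrow> Re w > - 2 * \<rho>"
 shows "smoothing_kernel \<rho> holomorphic_on A"
proof -
 have "w + 2 * complex_of_real \<rho> \<noteq> 0" if "w \<in> A" for w
 proof
  assume "w + 2 * complex_of_real \<rho> = 0"
  then have "Re (w + 2 * complex_of_real \<rho>) = 0" by simp
  then show False using assms[OF that] by simp
 qed
 then show ?thesis unfolding smoothing_kernel_def[abs_def] by (intro holomorphic_intros) auto
qed

lemma quartic_weight_integral:
 "integrable lborel (\<lambda>u::real. (1 + \<bar>u\<bar>) powr (-4))" "(LINT u|lborel. (1 + \<bar>u::real\<bar>) powr (-4)) \<le> 3"
proof -
 have one: "mean_bdd (\<lambda>_. 1) 1" unfolding mean_bdd_def by (auto simp: ennreal_mult)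
 have le: "(\<integral>\<^sup>+u. ennreal ((1 + \<bar>u\<bar>) powr (-4)) \<partial>lborel) \<le> ennreal (2 * 4 / (4-1) * 1)"
  using nn_integral_mean_bdd_weight[OF one, of 4] by simp
 then have "(\<integral>\<^sup>+u. ennreal ((1 + \<bar>u\<bar>) powr (-4)) \<partial>lborel) < \<infinity>"
  using ennreal_less_top le_less_trans infinity_ennreal_def by metis
 then show int: "integrable lborel (\<lambda>u::real. (1 + \<bar>u\<bar>) powr (-4))" by (intro integrableI_nonneg) auto
 have "ennreal (LINT u|lborel. (1 + \<bar>u\<bar>) powr (-4)) \<le> ennreal (2 * 4 / (4-1) * 1)"
  using le by (subst nn_integral_eq_integral[symmetric, OF int]) auto
 then show "(LINT u|lborel. (1 + \<bar>u::real\<bar>) powr (-4)) \<le> 3" by (subst (asm) ennreal_le_iff) auto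
qed

definition coeff_weight :: "(nat \<Rightarrow> complex) \<Rightarrow> nat \<Rightarrow> real" where
 "coeff_weight a n = norm (a (Suc n)) * real (Suc n) powr (-2)"

definition coeff_tail :: "(nat \<Rightarrow> complex) \<Rightarrow> nat \<Rightarrow> real" where
 "coeff_tail a K = suminf (coeff_weight a) - sum (coeff_weight a) {..<K}"

text \<open>The coefficients depend on \<open>a\<close>, \<open>\<rho>\<close> and \<open>N\<close> only, not on the character:
 this makes the mean values common to the whole Carlson set.\<close>

definition smoothed_coeff :: "(nat \<Rightarrow> complex) \<Rightarrow> real \<Rightarrow> real \<Rightarrow> nat \<Rightarrow> complex" where
 "smoothed_coeff a \<rho> N n = a n * (1 / (2 * pi) * (LINT u|lborel. of_nat n powr (- Complex 2 u) *
   (exp (Complex 2 u * complex_of_real (ln N)) * (smoothing_kernel \<rho> (Complex 2 u) / Complex 2 u))))"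

lemma le_one_plus_powr:
 fixes x q :: real
 assumes "1 \<le> q" "x \<ge> 0" shows "x \<le> 1 + x powr q"
proof (cases "x \<le> 1")
 case True then show ?thesis using powr_ge_zero[of x q] by linarith
next
 case False
 then have "x powr 1 \<le> x powr q" using assms by (intro powr_mono) auto
 then show ?thesis using False by simp
qed

lemma mean_bdd_of_powr:
 fixes f :: "real \<Rightarrow> complex"
 assumes p: "1 \<le> p" and [measurable]: "f \<in> borel_measurable borel"
  and h: "mean_bdd (\<lambda>t. ennreal (norm (f t) powr p)) X"
 shows "mean_bdd (\<lambda>t. ennreal (norm (f t))) (1 + X)"
 unfolding mean_bdd_def
proof (intro conjI allI impI)
 have X: "X \<ge> 0" using h by (simp add: mean_bdd_def)
 then show "0 \<le> 1 + X" by simp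
 fix T :: real assume T: "T \<ge> 1"
 have "(\<integral>\<^sup>+t\<in>{-T..T}. ennreal (norm (f t)) \<partial>lborel)
   \<le> (\<integral>\<^sup>+t. indicator {-T..T} t + ennreal (norm (f t) powr p) * indicator {-T..T} t \<partial>lborel)"
 proof (intro nn_integral_mono)
  fix t
  have "ennreal (norm (f t)) \<le> ennreal (1 + norm (f t) powr p)" by (intro ennreal_leI le_one_plus_powr p) auto
  then show "ennreal (norm (f t)) * indicator {-T..T} t \<le> indicator {-T..T} t + ennreal (norm (f t) powr p) * indicator {-T..T} t"
   by (auto simp: indicator_def)
 qed
 also have "\<dots> = (\<integral>\<^sup>+t. indicator {-T..T} t \<partial>lborel) + (\<integral>\<^sup>+t\<in>{-T..T}. ennreal (norm (f t) powr p) \<partial>lborel)"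
  by (rule nn_integral_add) measurable
 also have "\<dots> \<le> ennreal (2 * T) + ennreal (2 * T * X)" using T mean_bdd_le[OF h T] by (intro add_mono) auto
 also have "\<dots> = ennreal (2 * T * (1 + X))"
  using T X by (simp add: ennreal_plus[symmetric] algebra_simps del: ennreal_plus)
 finally show "(\<integral>\<^sup>+t\<in>{-T..T}. ennreal (norm (f t)) \<partial>lborel) \<le> ennreal (2 * T * (1 + X))" .
qed measurable

text \<open>A point of the Carlson set together with its continuation and its bound.\<close>

locale carlson =
 fixes p :: real and a \<omega> :: "nat \<Rightarrow> complex" and F :: "complex \<Rightarrow> complex" and X :: real
 assumes p1: "1 \<le> p" and \<omega>: "\<omega> \<in> space torus" and twist: "twist_continuation a \<omega> F"
  and bounded: "\<And>\<sigma> T. \<sigma> > 0 \<Longrightarrow> T \<ge> 1 \<Longrightarrow> vertical_mean p F \<sigma> T \<le> X"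
begin

lemma F_holomorphic: "F holomorphic_on half_plane 0"
 using twist by (simp add: twist_continuation_def)

lemma F_continuous: "continuous_on (half_plane 0) F"
 using F_holomorphic by (rule holomorphic_on_imp_continuous_on)

lemma F_vertical_continuous: "\<sigma> > 0 \<Longrightarrow> continuous_on A (\<lambda>t. F (Complex \<sigma> t))"
 by (intro continuous_on_compose2[OF F_continuous])
  (auto simp: Complex_eq half_plane_def intro!: continuous_intros)

lemma F_vertical_measurable: "\<sigma> > 0 \<Longrightarrow> (\<lambda>t. F (Complex \<sigma> t)) \<in> borel_measurable borel"
 by (intro borel_measurable_continuous_onI F_vertical_continuous)

lemma X_nonneg: "X \<ge> 0"
 using bounded[of 1 1] vertical_mean_nn_integral(3)[OF F_vertical_continuous, of 1 p 1] p1 by simp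

lemma F_mean_bdd_powr:
 assumes \<sigma>: "\<sigma> > 0"
 shows "mean_bdd (\<lambda>t. ennreal (norm (F (Complex \<sigma> t)) powr p)) X"
 unfolding mean_bdd_def
proof (intro conjI allI impI)
 have [measurable]: "(\<lambda>t. F (Complex \<sigma> t)) \<in> borel_measurable borel" by (rule F_vertical_measurable[OF \<sigma>])
 show "(\<lambda>t. ennreal (norm (F (Complex \<sigma> t)) powr p)) \<in> borel_measurable borel" by measurable
 show "0 \<le> X" by (rule X_nonneg)
 fix T :: real assume T: "T \<ge> 1"
 let ?I = "\<integral>\<^sup>+t\<in>{-T..T}. ennreal (norm (F (Complex \<sigma> t)) powr p) \<partial>lborel"
 have "?I = ennreal (2 * T) * (ennreal (1 / (2 * T)) * ?I)"
  using T by (simp add: mult.assoc[symmetric] ennreal_mult[symmetric])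
 also have "\<dots> = ennreal (2 * T) * ennreal (vertical_mean p F \<sigma> T)"
  using T p1 by (subst vertical_mean_nn_integral(1)[OF F_vertical_continuous[OF \<sigma>]]) auto
 also have "\<dots> \<le> ennreal (2 * T) * ennreal X" by (intro mult_left_mono ennreal_leI bounded \<sigma> T) auto
 also have "\<dots> = ennreal (2 * T * X)" using T X_nonneg by (simp add: ennreal_mult)
 finally show "?I \<le> ennreal (2 * T * X)" .
qed

lemma F_mean_bdd:
 assumes \<sigma>: "\<sigma> > 0"
 shows "mean_bdd (\<lambda>t. ennreal (norm (F (Complex \<sigma> t)))) (1 + X)"
 by (rule mean_bdd_of_powr[OF p1 F_vertical_measurable[OF \<sigma>] F_mean_bdd_powr[OF \<sigma>]])

lemma F_sums:
 assumes "Re s > 1/2"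
 shows "(\<lambda>n. a (Suc n) * torus_char \<omega> (Suc n) * of_nat (Suc n) powr (- s)) sums F s"
 using twist assms by (simp add: twist_continuation_def half_plane_def)

lemma coeff_bound: "\<exists>C\<ge>0. \<forall>n. norm (a (Suc n)) \<le> C * real (Suc n) powr (3/4)"
proof -
 let ?f = "\<lambda>n. a (Suc n) * torus_char \<omega> (Suc n) * of_nat (Suc n) powr (- complex_of_real (3/4))"
 have "summable ?f" using F_sums[of "complex_of_real (3/4)"] by (simp add: sums_iff)
 then have "Bseq ?f" by (intro convergent_imp_Bseq) (auto simp: convergent_def dest: summable_LIMSEQ_zero)
 then obtain C where C: "C > 0" "\<And>n. norm (?f n) \<le> C" by (auto simp: Bseq_def)
 have "norm (a (Suc n)) \<le> C * real (Suc n) powr (3/4)" for n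
 proof -
  have "norm (a (Suc n)) * real (Suc n) powr (-(3/4)) \<le> C"
   using C(2)[of n] norm_nat_powr[of "Suc n" "complex_of_real (3/4)"]
   by (simp add: norm_mult norm_torus_char[OF \<omega>] del: of_nat_Suc)
  then show ?thesis by (simp add: powr_minus_divide pos_divide_le_eq del: of_nat_Suc)
 qed
 then show ?thesis using C(1) by (intro exI[of _ C]) auto
qed

lemma coeff_weight_summable: "summable (coeff_weight a)"
proof -
 obtain C where C: "C \<ge> 0" "\<And>n. norm (a (Suc n)) \<le> C * real (Suc n) powr (3/4)" using coeff_bound by blast
 have "summable (\<lambda>n. real n powr (-5/4))" by (subst summable_real_powr_iff) simp
 then have "summable (\<lambda>n. C * real (Suc n) powr (-5/4))" by (intro summable_mult) (subst summable_Suc_iff)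
 then show ?thesis
 proof (rule summable_comparison_test'[where N = 0])
  fix n
  have "coeff_weight a n \<le> (C * real (Suc n) powr (3/4)) * real (Suc n) powr (-2)"
   unfolding coeff_weight_def by (intro mult_right_mono C) auto
  also have "\<dots> = C * real (Suc n) powr (-5/4)" by (simp add: powr_add[symmetric] del: of_nat_Suc)
  finally show "norm (coeff_weight a n) \<le> C * real (Suc n) powr (-5/4)" by (simp add: coeff_weight_def)
 qed
qed

lemma coeff_tail_tendsto: "coeff_tail a \<longlonglongrightarrow> 0"
proof -
 have "(\<lambda>K. suminf (coeff_weight a) - sum (coeff_weight a) {..<K}) \<longlonglongrightarrow> suminf (coeff_weight a) - suminf (coeff_weight a)"
  by (intro tendsto_intros summable_LIMSEQ coeff_weight_summable)
 then show ?thesis by (simp add: coeff_tail_def[abs_def])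
qed

lemma coeff_tail_nonneg: "coeff_tail a K \<ge> 0"
 unfolding coeff_tail_def
 using sum_le_suminf[OF coeff_weight_summable, of "{..<K}"] by (simp add: coeff_weight_def)

lemma F_partial_sum:
 assumes s: "Re s \<ge> 2"
 shows "norm (F s - twisted_poly K a \<omega> s) \<le> coeff_tail a K"
proof -
 let ?g = "\<lambda>n. a (Suc n) * torus_char \<omega> (Suc n) * of_nat (Suc n) powr (- s)"
 have g: "?g sums F s" using s by (intro F_sums) auto
 have tp: "twisted_poly K a \<omega> s = sum ?g {..<K}"
  unfolding twisted_poly_def by (rule sum.reindex_bij_witness[of _ Suc "\<lambda>n. n - 1"]) auto
 have le: "norm (?g n) \<le> coeff_weight a n" for n
 proof -
  have "real (Suc n) powr (- Re s) \<le> real (Suc n) powr (-2)" using s by (intro powr_mono) auto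
  then show ?thesis
   by (simp add: norm_mult norm_torus_char[OF \<omega>] norm_nat_powr coeff_weight_def mult_left_mono del: of_nat_Suc)
 qed
 have "F s - twisted_poly K a \<omega> s = (\<Sum>n. ?g (n + K))"
  using suminf_minus_initial_segment[OF sums_summable[OF g], of K] g by (simp add: tp sums_iff)
 also have "norm \<dots> \<le> (\<Sum>n. coeff_weight a (n + K))"
 proof (rule norm_suminf_le)
  show "norm (?g (n + K)) \<le> coeff_weight a (n + K)" for n by (rule le)
  show "summable (\<lambda>n. coeff_weight a (n + K))" using coeff_weight_summable by (simp only: summable_iff_shift)
 qed
 also have "\<dots> = coeff_tail a K"
  unfolding coeff_tail_def by (rule suminf_minus_initial_segment[OF coeff_weight_summable])
 finally show ?thesis .
qed

text \<open>The kernel decays like \<open>8/|Im w|\<close> and the mean of \<open>F\<close> over windows of length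
 \<open>T\<close> is bounded, so the integral of \<open>G\<close> over a rectangle of height 1 at height
 \<open>T\<close> is bounded independently of \<open>T\<close>; some horizontal line in it is suitable for the strip
 formula.\<close>

lemma smoothing_identity:
 fixes \<rho> \<sigma> t N :: real
 assumes \<rho>: "0 < \<rho>" "\<rho> \<le> 1" "\<rho> < \<sigma>" and N: "N \<ge> 1"
 defines "G \<equiv> \<lambda>w. F (Complex \<sigma> t + w) * (exp (w * complex_of_real (ln N)) * smoothing_kernel \<rho> w)"
 shows "integrable lborel (\<lambda>u. G (Complex 2 u) / Complex 2 u)"
  and "integrable lborel (\<lambda>u. G (Complex (-\<rho>) u) / Complex (-\<rho>) u)"
  and "2 * pi * F (Complex \<sigma> t) = (LINT u|lborel. G (Complex 2 u) / Complex 2 u)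
   - (LINT u|lborel. G (Complex (-\<rho>) u) / Complex (-\<rho>) u)"
proof -
 define S where "S = {w. Re w > - min \<sigma> (2 * \<rho>)}"
 have S: "open S" "convex S" unfolding S_def by (simp_all add: open_halfspace_Re_gt convex_halfspace_Re_gt)
 have strip: "w \<in> S" if "-\<rho> \<le> Re w" for w using that \<rho> by (auto simp: S_def)
 have G: "G holomorphic_on S" unfolding G_def
  by (intro holomorphic_intros holomorphic_on_compose_gen[OF _ F_holomorphic, unfolded o_def] smoothing_kernel_holomorphic)
   (auto simp: S_def half_plane_def)
 have nexp: "norm (exp (w * complex_of_real (ln N))) = N powr Re w" for w using N by (simp add: powr_def)
 have pt: "Complex \<sigma> t + Complex x y = Complex (\<sigma> + x) (t + y)" for x y by (simp add: complex_eq_iff)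
 have nG: "norm (G (Complex x y)) = norm (F (Complex (\<sigma> + x) (t + y))) * (N powr x * norm (smoothing_kernel \<rho> (Complex x y)))" for x y
  unfolding G_def pt norm_mult nexp complex.sel ..
 have meas: "(\<lambda>u. G (Complex x u) / Complex x u) \<in> borel_measurable lborel" if "-\<rho> \<le> x" "x \<noteq> 0" for x
 proof -
  have "continuous_on UNIV (\<lambda>u. G (Complex x u))"
   using that strip by (intro continuous_on_compose2[OF holomorphic_on_imp_continuous_on[OF G]])
    (auto simp: Complex_eq intro!: continuous_intros)
  then have "continuous_on UNIV (\<lambda>u. G (Complex x u) / Complex x u)"
   using that by (intro continuous_intros) (auto simp: Complex_eq complex_eq_iff intro!: continuous_intros)
  then show ?thesis by (simp add: borel_measurable_continuous_onI)
 qed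
 have int: "integrable lborel (\<lambda>u. G (Complex x u) / Complex x u)"
  if x: "-\<rho> \<le> x" "x \<noteq> 0" and b: "\<And>u. norm (smoothing_kernel \<rho> (Complex x u) / Complex x u) \<le> B * (1 + \<bar>u\<bar>) powr (-4)" and B: "B \<ge> 0" for x B
 proof (rule integrableI_bounded)
  show "(\<lambda>u. G (Complex x u) / Complex x u) \<in> borel_measurable lborel" by (rule meas[OF x])
  have \<sigma>x: "\<sigma> + x > 0" using x \<rho> by auto
  have [measurable]: "(\<lambda>t. F (Complex (\<sigma> + x) t)) \<in> borel_measurable borel" by (rule F_vertical_measurable[OF \<sigma>x])
  have "(\<integral>\<^sup>+u. ennreal (norm (G (Complex x u) / Complex x u)) \<partial>lborel)
   \<le> (\<integral>\<^sup>+u. ennreal (N powr x * B) * (ennreal (norm (F (Complex (\<sigma> + x) (t + u)))) * ennreal ((1 + \<bar>u\<bar>) powr (-4))) \<partial>lborel)"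
  proof (intro nn_integral_mono)
   fix u
   have "norm (G (Complex x u) / Complex x u)
     = norm (F (Complex (\<sigma> + x) (t + u))) * (N powr x * norm (smoothing_kernel \<rho> (Complex x u) / Complex x u))"
    unfolding norm_divide nG by simp
   also have "\<dots> \<le> norm (F (Complex (\<sigma> + x) (t + u))) * (N powr x * (B * (1 + \<bar>u\<bar>) powr (-4)))"
    by (intro mult_left_mono b) auto
   finally show "ennreal (norm (G (Complex x u) / Complex x u)) \<le> ennreal (N powr x * B) * (ennreal (norm (F (Complex (\<sigma> + x) (t + u)))) * ennreal ((1 + \<bar>u\<bar>) powr (-4)))"
    using B by (simp add: ennreal_mult[symmetric] ennreal_leI mult_ac)
  qed
  also have "\<dots> = ennreal (N powr x * B) * (\<integral>\<^sup>+u. ennreal (norm (F (Complex (\<sigma> + x) (t + u)))) * ennreal ((1 + \<bar>u\<bar>) powr (-4)) \<partial>lborel)"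
   by (rule nn_integral_cmult) measurable
  also have "\<dots> \<le> ennreal (N powr x * B) * ennreal (2 * 4 / (4 - 1) * ((1 + \<bar>t\<bar>) * (1 + X)))"
   using mean_bdd_shift[OF F_mean_bdd[OF \<sigma>x], of t]
   by (intro mult_left_mono nn_integral_mean_bdd_weight) (auto simp: add.commute)
  also have "\<dots> < \<infinity>" by (simp add: ennreal_mult_less_top)
  finally show "(\<integral>\<^sup>+u. ennreal (norm (G (Complex x u) / Complex x u)) \<partial>lborel) < \<infinity>" .
 qed
 show i1: "integrable lborel (\<lambda>u. G (Complex 2 u) / Complex 2 u)"
  by (rule int[OF _ _ smoothing_kernel_right[OF \<rho>(1,2)]]) (use \<rho> in auto)
 show i2: "integrable lborel (\<lambda>u. G (Complex (-\<rho>) u) / Complex (-\<rho>) u)"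
  by (rule int[OF _ _ smoothing_kernel_left[OF \<rho>(1,2)]]) (use \<rho> in auto)
 have hor: "\<exists>T\<ge>T0. T > 0 \<and> integral {-\<rho>..2} (\<lambda>x. norm (G (Complex x T))) \<le> \<epsilon> * T \<and>
    integral {-\<rho>..2} (\<lambda>x. norm (G (Complex x (-T)))) \<le> \<epsilon> * T" if \<epsilon>: "\<epsilon> > 0" for \<epsilon> T0
 proof -
  (* The kernel contributes 8 / T, the mean of F a multiple of T + 1 \<le> 2 T, the width is at most 3. *)
  define M where "M = 96 * N powr 2 * ((1 + \<bar>t\<bar>) * (1 + X))"
  have M: "M \<ge> 0" using X_nonneg by (simp add: M_def)
  define T where "T = max (max T0 1) (2 * M / \<epsilon> + 1)"
  have T: "T \<ge> T0" "T \<ge> 1" "2 * M < \<epsilon> * T"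
  proof -
   show "T \<ge> T0" "T \<ge> 1" by (auto simp: T_def)
   have "2 * M / \<epsilon> < T" by (simp add: T_def)
   then show "2 * M < \<epsilon> * T" using \<epsilon> by (simp add: pos_divide_less_eq mult.commute)
  qed
  define h where "h y = integral {-\<rho>..2} (\<lambda>x. norm (G (Complex x y)))" for y
  have h0: "h y \<ge> 0" for y unfolding h_def by (rule integral_nonneg) (auto intro!: integrable_continuous_interval continuous_intros
    continuous_on_compose2[OF holomorphic_on_imp_continuous_on[OF G]] simp: Complex_eq strip)
  have hnn: "ennreal (h y) = (\<integral>\<^sup>+x\<in>{-\<rho>..2}. ennreal (norm (G (Complex x y))) \<partial>lborel)" for y unfolding h_def
   by (intro nn_integral_continuous_interval continuous_intros continuous_on_compose2[OF holomorphic_on_imp_continuous_on[OF G]])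
    (auto simp: Complex_eq intro!: continuous_intros strip)
  define g where "g s z = indicator (cbox (-\<rho>,T) (2,T+1)) z *\<^sub>R norm (G (Complex (fst z) (s * snd z)))" for s and z :: "real \<times> real"
  have gm [measurable]: "g s \<in> borel_measurable (lborel \<Otimes>\<^sub>M lborel)" for s
  proof -
   have "g s \<in> borel_measurable borel" unfolding g_def[abs_def]
    by (intro borel_measurable_continuous_on_indicator borel_closed[OF closed_cbox] continuous_intros
      continuous_on_compose2[OF holomorphic_on_imp_continuous_on[OF G]])
     (auto simp: Complex_eq cbox_Pair_eq intro!: continuous_intros strip)
   then show ?thesis by (simp add: lborel_prod)
  qed
  have hg: "ennreal (h (s * y)) * indicator {T..T+1} y = (\<integral>\<^sup>+x. ennreal (g s (x, y)) \<partial>lborel)" for s y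
   unfolding hnn g_def by (auto simp: indicator_def cbox_Pair_eq intro!: nn_integral_cong)
  have side: "(\<integral>\<^sup>+y\<in>{T..T+1}. ennreal (h (s * y)) \<partial>lborel) \<le> ennreal M" if s: "s = 1 \<or> s = -1" for s
  proof -
   have "(\<integral>\<^sup>+y\<in>{T..T+1}. ennreal (h (s * y)) \<partial>lborel) = (\<integral>\<^sup>+y. (\<integral>\<^sup>+x. ennreal (g s (x, y)) \<partial>lborel) \<partial>lborel)"
    unfolding hg ..
   also have "\<dots> = (\<integral>\<^sup>+x. (\<integral>\<^sup>+y. ennreal (g s (x, y)) \<partial>lborel) \<partial>lborel)" by (rule lborel_pair.Fubini') measurable
   also have "\<dots> \<le> (\<integral>\<^sup>+x\<in>{-\<rho>..2}. ennreal (8 * N powr 2 / T * (2 * (T + 1) * ((1 + \<bar>t\<bar>) * (1 + X)))) \<partial>lborel)"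
   proof (intro nn_integral_mono)
    fix x
    show "(\<integral>\<^sup>+y. ennreal (g s (x, y)) \<partial>lborel) \<le> ennreal (8 * N powr 2 / T * (2 * (T + 1) * ((1 + \<bar>t\<bar>) * (1 + X)))) * indicator {-\<rho>..2} x"
    proof (cases "x \<in> {-\<rho>..2}")
     case x: True
     then have \<sigma>x: "\<sigma> + x > 0" using \<rho> by auto
     have [measurable]: "(\<lambda>t. F (Complex (\<sigma> + x) t)) \<in> borel_measurable borel" by (rule F_vertical_measurable[OF \<sigma>x])
     have "(\<integral>\<^sup>+y. ennreal (g s (x, y)) \<partial>lborel)
      \<le> (\<integral>\<^sup>+y. ennreal (8 * N powr 2 / T) * (ennreal (norm (F (Complex (\<sigma> + x) (s * y + t)))) * indicator {-(T+1)..T+1} (s * y)) \<partial>lborel)"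
     proof (intro nn_integral_mono)
      fix y
      show "ennreal (g s (x, y)) \<le> ennreal (8 * N powr 2 / T) * (ennreal (norm (F (Complex (\<sigma> + x) (s * y + t)))) * indicator {-(T+1)..T+1} (s * y))"
      proof (cases "y \<in> {T..T+1}")
       case y: True
       have "norm (smoothing_kernel \<rho> (Complex x (s * y))) \<le> 8 / \<bar>Im (Complex x (s * y))\<bar>"
        using s y T by (intro smoothing_kernel_far \<rho>) auto
       also have "\<dots> \<le> 8 / T" using s y T by (auto simp: frac_le)
       finally have sk: "norm (smoothing_kernel \<rho> (Complex x (s * y))) \<le> 8 / T" .
       have "N powr x \<le> N powr 2" using N x by (intro powr_mono) auto
       with sk have "N powr x * norm (smoothing_kernel \<rho> (Complex x (s * y))) \<le> N powr 2 * (8 / T)"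
        by (intro mult_mono) auto
       then have "norm (F (Complex (\<sigma> + x) (s * y + t))) * (N powr x * norm (smoothing_kernel \<rho> (Complex x (s * y))))
         \<le> norm (F (Complex (\<sigma> + x) (s * y + t))) * (N powr 2 * (8 / T))" by (intro mult_left_mono) auto
       then have "norm (G (Complex x (s * y))) \<le> 8 * N powr 2 / T * norm (F (Complex (\<sigma> + x) (s * y + t)))"
        unfolding nG by (simp add: mult_ac add.commute)
       then have "ennreal (norm (G (Complex x (s * y)))) \<le> ennreal (8 * N powr 2 / T) * ennreal (norm (F (Complex (\<sigma> + x) (s * y + t))))"
        using T by (subst ennreal_mult[symmetric]) (auto intro!: ennreal_leI)
       moreover have "s * y \<in> {-(T+1)..T+1}" using s y T by auto
       ultimately show ?thesis using x y by (simp add: g_def cbox_Pair_eq)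
      qed (simp add: g_def cbox_Pair_eq)
     qed
     also have "\<dots> = ennreal (8 * N powr 2 / T) * (\<integral>\<^sup>+y. ennreal (norm (F (Complex (\<sigma> + x) (s * y + t)))) * indicator {-(T+1)..T+1} (s * y) \<partial>lborel)"
      by (rule nn_integral_cmult) measurable
     also have "(\<integral>\<^sup>+y. ennreal (norm (F (Complex (\<sigma> + x) (s * y + t)))) * indicator {-(T+1)..T+1} (s * y) \<partial>lborel)
       = (\<integral>\<^sup>+y\<in>{-(T+1)..T+1}. ennreal (norm (F (Complex (\<sigma> + x) (y + t)))) \<partial>lborel)"
      using s nn_integral_real_affine[of "\<lambda>y. ennreal (norm (F (Complex (\<sigma> + x) (y + t)))) * indicator {-(T+1)..T+1} y" s 0] by auto
     also have "\<dots> \<le> ennreal (2 * (T + 1) * ((1 + \<bar>t\<bar>) * (1 + X)))"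
      using T by (intro mean_bdd_le[OF mean_bdd_shift[OF F_mean_bdd[OF \<sigma>x]]]) auto
     also have "ennreal (8 * N powr 2 / T) * \<dots> = ennreal (8 * N powr 2 / T * (2 * (T + 1) * ((1 + \<bar>t\<bar>) * (1 + X))))"
      using T X_nonneg by (intro ennreal_mult[symmetric]) auto
     finally show ?thesis using x by (simp add: mult_left_mono)
    next
     case False
     then have g0: "g s (x, y) = 0" for y by (auto simp: g_def cbox_Pair_eq)
     show ?thesis unfolding g0 by simp
    qed
   qed
   also have "\<dots> = ennreal (8 * N powr 2 / T * (2 * (T + 1) * ((1 + \<bar>t\<bar>) * (1 + X)))) * ennreal (2 + \<rho>)"
    using \<rho> by (subst nn_integral_cmult_indicator) auto
   also have "\<dots> \<le> ennreal M"
   proof -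
    have "(T + 1) / T \<le> 2" using T by (simp add: divide_le_eq)
    then have "((T + 1) / T) * (2 + \<rho>) \<le> 2 * 3" using \<rho> T by (intro mult_mono) auto
    then have "(16 * N powr 2 * ((1 + \<bar>t\<bar>) * (1 + X))) * (((T + 1) / T) * (2 + \<rho>)) \<le> (16 * N powr 2 * ((1 + \<bar>t\<bar>) * (1 + X))) * (2 * 3)"
     using X_nonneg by (intro mult_left_mono) auto
    then have "8 * N powr 2 / T * (2 * (T + 1) * ((1 + \<bar>t\<bar>) * (1 + X))) * (2 + \<rho>) \<le> M"
    proof -
     assume le: "(16 * N powr 2 * ((1 + \<bar>t\<bar>) * (1 + X))) * (((T + 1) / T) * (2 + \<rho>)) \<le> (16 * N powr 2 * ((1 + \<bar>t\<bar>) * (1 + X))) * (2 * 3)"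
     have eq: "8 * B / T * (2 * T1 * A) * r = (16 * B * A) * ((T1 / T) * r)" for A B T1 r :: real by simp
     have eq2: "(16 * B * A) * (2 * 3) = 96 * B * A" for A B :: real by simp
     show ?thesis using le unfolding M_def eq eq2 .
    qed
    then show ?thesis using T X_nonneg \<rho> by (subst ennreal_mult[symmetric]) (auto intro!: ennreal_leI)
   qed
   finally show ?thesis .
  qed
  have "\<exists>y\<in>{T..T+1}. h y + h (- y) \<le> \<epsilon> * y"
  proof (rule ccontr)
   assume "\<not> ?thesis"
   then have big: "\<epsilon> * y < h y + h (- y)" if "y \<in> {T..T+1}" for y using that by force
   have "ennreal (\<epsilon> * T) = (\<integral>\<^sup>+y\<in>{T..T+1}. ennreal (\<epsilon> * T) \<partial>lborel)" by (subst nn_integral_cmult_indicator) auto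
   also have "\<dots> \<le> (\<integral>\<^sup>+y. ennreal (h (1 * y)) * indicator {T..T+1} y + ennreal (h (-1 * y)) * indicator {T..T+1} y \<partial>lborel)"
   proof (intro nn_integral_mono)
    fix y
    have "ennreal (\<epsilon> * T) \<le> ennreal (h y) + ennreal (h (-y))" if y: "y \<in> {T..T+1}"
    proof -
     have "\<epsilon> * T \<le> \<epsilon> * y" using y \<epsilon> by (intro mult_left_mono) auto
     then have "\<epsilon> * T \<le> h y + h (-y)" using big[OF y] by linarith
     then show ?thesis using h0 by (simp add: ennreal_plus[symmetric] ennreal_leI del: ennreal_plus)
    qed
    then show "ennreal (\<epsilon> * T) * indicator {T..T+1} y \<le> ennreal (h (1 * y)) * indicator {T..T+1} y + ennreal (h (-1 * y)) * indicator {T..T+1} y"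
     by (auto simp: indicator_def)
   qed
   also have "\<dots> = (\<integral>\<^sup>+y\<in>{T..T+1}. ennreal (h (1 * y)) \<partial>lborel) + (\<integral>\<^sup>+y\<in>{T..T+1}. ennreal (h (-1 * y)) \<partial>lborel)"
   proof (rule nn_integral_add)
    show "(\<lambda>y. ennreal (h (1 * y)) * indicator {T..T+1} y) \<in> borel_measurable lborel"
     "(\<lambda>y. ennreal (h (-1 * y)) * indicator {T..T+1} y) \<in> borel_measurable lborel" unfolding hg by measurable
   qed
   also have "\<dots> \<le> ennreal M + ennreal M" by (intro add_mono side) auto
   also have "\<dots> = ennreal (2 * M)" using M by (simp add: ennreal_plus[symmetric] del: ennreal_plus)
   finally have "\<epsilon> * T \<le> 2 * M" using M by (subst (asm) ennreal_le_iff) auto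
   then show False using T by simp
  qed
  then obtain y where y: "y \<ge> T" "h y + h (-y) \<le> \<epsilon> * y" by auto
  have "h y \<le> \<epsilon> * y" "h (-y) \<le> \<epsilon> * y" using y h0[of y] h0[of "-y"] by linarith+
  then show ?thesis using y T unfolding h_def by (intro exI[of _ y]) auto
 qed
 have "G 0 = F (Complex \<sigma> t)" using \<rho> by (simp add: G_def smoothing_kernel_def)
 then show "2 * pi * F (Complex \<sigma> t) = (LINT u|lborel. G (Complex 2 u) / Complex 2 u)
   - (LINT u|lborel. G (Complex (-\<rho>) u) / Complex (-\<rho>) u)"
  using strip_integral_formula[OF \<rho>(1) _ S G strip i1 i2 hor] by simp
qed

end

lemma powr_add_le:
 fixes x y p :: real
 assumes "x \<ge> 0" "y \<ge> 0" "p \<ge> 0"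
 shows "(x + y) powr p \<le> 2 powr p * (x powr p + y powr p)"
proof -
 have "(x + y) powr p \<le> (2 * max x y) powr p" using assms by (intro powr_mono2) auto
 also have "\<dots> = 2 powr p * max x y powr p" using assms by (simp add: powr_mult)
 also have "max x y powr p \<le> x powr p + y powr p" using assms by (auto simp: max_def)
 finally show ?thesis by (simp add: mult_left_mono)
qed

lemma quartic_weight_integral_pos: "(LINT u|lborel. (1 + \<bar>u::real\<bar>) powr (-4)) > 0"
proof -
 have "(LINT u|lborel. indicator {0..1::real} u * (1/16)) \<le> (LINT u|lborel. (1 + \<bar>u::real\<bar>) powr (-4))"
 proof (rule integral_mono[OF _ quartic_weight_integral(1)])
  fix u :: real
  show "indicator {0..1} u * (1/16) \<le> (1 + \<bar>u\<bar>) powr (-4)"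
  proof (cases "u \<in> {0..1}")
   case True
   then have "2 powr (-4) \<le> (1 + \<bar>u\<bar>) powr (-4)" by (intro powr_mono2') auto
   moreover have "(2::real) powr (-4) = 1/16" by (simp add: powr_minus_divide flip: powr_numeral)
   ultimately show ?thesis using True by simp
  qed simp
 qed simp
 then show ?thesis by simp
qed

lemma powr_weighted_integral_le:
 fixes g :: "real \<Rightarrow> real"
 assumes p: "1 \<le> p" and g: "\<And>x. g x \<ge> 0" "g \<in> borel_measurable borel"
  and int: "integrable lborel (\<lambda>u. g u * (1 + \<bar>u\<bar>) powr (-4))"
 shows "ennreal ((LINT u|lborel. g u * (1 + \<bar>u\<bar>) powr (-4)) powr p)
   \<le> ennreal (3 powr p) * (\<integral>\<^sup>+u. ennreal (g u powr p) * ennreal ((1 + \<bar>u\<bar>) powr (-4)) \<partial>lborel)"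
proof -
 define c where "c = (LINT u|lborel. (1 + \<bar>u::real\<bar>) powr (-4))"
 have c: "0 < c" "c \<le> 3" using quartic_weight_integral_pos quartic_weight_integral by (auto simp: c_def)
 define k where "k u = (1 + \<bar>u::real\<bar>) powr (-4) / c" for u
 have k: "integrable lborel k" "(LINT u|lborel. k u) = 1" "k u \<ge> 0" for u
  unfolding k_def using quartic_weight_integral(1) c by (auto simp: c_def)
 have e: "g u * k u = (1/c) * (g u * (1 + \<bar>u\<bar>) powr (-4))" for u by (simp add: k_def)
 have gk: "integrable lborel (\<lambda>u. g u * k u)" unfolding e by (rule integrable_mult_right[OF int])
 have "(LINT u|lborel. g u * (1 + \<bar>u\<bar>) powr (-4)) = c * (LINT u|lborel. g u * k u)" unfolding e using c by simp
 moreover have n0: "(LINT u|lborel. g u * k u) \<ge> 0" using g k by (intro integral_nonneg_AE) auto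
 ultimately have "ennreal ((LINT u|lborel. g u * (1 + \<bar>u\<bar>) powr (-4)) powr p) = ennreal (c powr p) * ennreal ((LINT u|lborel. g u * k u) powr p)"
  using c by (simp add: powr_mult ennreal_mult)
 also have "\<dots> \<le> ennreal (c powr p) * (\<integral>\<^sup>+u. ennreal (g u powr p * k u) \<partial>lborel)"
  by (intro mult_left_mono powr_integral_le_nn_integral p k g gk) (use g in auto)
 also have "\<dots> = (\<integral>\<^sup>+u. ennreal (c powr p) * ennreal (g u powr p * k u) \<partial>lborel)"
  using g by (intro nn_integral_cmult[symmetric]) (simp add: k_def[abs_def])
 also have "\<dots> \<le> (\<integral>\<^sup>+u. ennreal (3 powr p) * (ennreal (g u powr p) * ennreal ((1 + \<bar>u\<bar>) powr (-4))) \<partial>lborel)"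
 proof (intro nn_integral_mono)
  fix u
  have "c powr p / c = c powr (p - 1)" using c by (simp add: powr_diff)
  also have "\<dots> \<le> 3 powr (p - 1)" using c p by (intro powr_mono2) auto
  also have "\<dots> \<le> 3 powr p" by (intro powr_mono) auto
  finally have "(c powr p / c) * (g u powr p * (1 + \<bar>u\<bar>) powr (-4)) \<le> 3 powr p * (g u powr p * (1 + \<bar>u\<bar>) powr (-4))"
   by (intro mult_right_mono) auto
  then have le: "c powr p * (g u powr p * k u) \<le> 3 powr p * (g u powr p * (1 + \<bar>u\<bar>) powr (-4))"
   by (simp add: k_def)
  have "ennreal (c powr p) * ennreal (g u powr p * k u) = ennreal (c powr p * (g u powr p * k u))"
   by (rule ennreal_mult[symmetric]) (use k(3)[of u] in auto)
  also have "\<dots> \<le> ennreal (3 powr p * (g u powr p * (1 + \<bar>u\<bar>) powr (-4)))" by (rule ennreal_leI[OF le])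
  also have "\<dots> = ennreal (3 powr p) * (ennreal (g u powr p) * ennreal ((1 + \<bar>u\<bar>) powr (-4)))"
   by (simp add: ennreal_mult)
  finally show "ennreal (c powr p) * ennreal (g u powr p * k u) \<le> ennreal (3 powr p) * (ennreal (g u powr p) * ennreal ((1 + \<bar>u\<bar>) powr (-4)))" .
 qed
 also have "\<dots> = ennreal (3 powr p) * (\<integral>\<^sup>+u. ennreal (g u powr p) * ennreal ((1 + \<bar>u\<bar>) powr (-4)) \<partial>lborel)"
  using g by (intro nn_integral_cmult) auto
 finally show ?thesis .
qed

context carlson begin

lemma smoothing_bound:
 fixes \<rho> \<sigma> t N :: real
 assumes \<rho>: "0 < \<rho>" "\<rho> \<le> 1" "\<rho> < \<sigma>" and N: "N \<ge> 1"
 shows "integrable lborel (\<lambda>u. norm (F (Complex (\<sigma> - \<rho>) (t + u))) * (1 + \<bar>u\<bar>) powr (-4))"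
  and "norm (F (Complex \<sigma> t) - twisted_poly K (smoothed_coeff a \<rho> N) \<omega> (Complex \<sigma> t))
   \<le> 96 * N powr 2 * coeff_tail a K
   + 32 / \<rho> * N powr (-\<rho>) * (LINT u|lborel. norm (F (Complex (\<sigma> - \<rho>) (t + u))) * (1 + \<bar>u\<bar>) powr (-4))"
proof -
 have \<sigma>\<rho>: "\<sigma> - \<rho> > 0" using \<rho> by simp
 have [measurable]: "(\<lambda>t. F (Complex (\<sigma> - \<rho>) t)) \<in> borel_measurable borel" by (rule F_vertical_measurable[OF \<sigma>\<rho>])
 show intJ: "integrable lborel (\<lambda>u. norm (F (Complex (\<sigma> - \<rho>) (t + u))) * (1 + \<bar>u\<bar>) powr (-4))"
 proof (rule integrableI_nonneg)
  have "(\<integral>\<^sup>+u. ennreal (norm (F (Complex (\<sigma> - \<rho>) (t + u)))) * ennreal ((1 + \<bar>u\<bar>) powr (-4)) \<partial>lborel)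
   \<le> ennreal (2 * 4 / (4 - 1) * ((1 + \<bar>t\<bar>) * (1 + X)))"
   using mean_bdd_shift[OF F_mean_bdd[OF \<sigma>\<rho>], of t] by (intro nn_integral_mean_bdd_weight) (auto simp: add.commute)
  also have "\<dots> < \<infinity>" by simp
  finally show "(\<integral>\<^sup>+u. ennreal (norm (F (Complex (\<sigma> - \<rho>) (t + u))) * (1 + \<bar>u\<bar>) powr (-4)) \<partial>lborel) < \<infinity>"
   by (simp add: ennreal_mult)
 qed auto
 define J where "J = (LINT u|lborel. norm (F (Complex (\<sigma> - \<rho>) (t + u))) * (1 + \<bar>u\<bar>) powr (-4))"
 let ?s = "Complex \<sigma> t"
 have pt: "?s + Complex x y = Complex (\<sigma> + x) (t + y)" for x y by (simp add: complex_eq_iff)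
 have nexp: "norm (exp (w * complex_of_real (ln N))) = N powr Re w" for w using N by (simp add: powr_def)
 define E where "E u = exp (Complex 2 u * complex_of_real (ln N)) * (smoothing_kernel \<rho> (Complex 2 u) / Complex 2 u)" for u
 have nE: "norm (E u) \<le> N powr 2 * 32 * (1 + \<bar>u\<bar>) powr (-4)" for u
 proof -
  have "norm (E u) = N powr 2 * norm (smoothing_kernel \<rho> (Complex 2 u) / Complex 2 u)"
   unfolding E_def norm_mult nexp complex.sel ..
  also have "\<dots> \<le> N powr 2 * (32 * (1 + \<bar>u\<bar>) powr (-4))" by (intro mult_left_mono smoothing_kernel_right \<rho>) auto
  finally show ?thesis by simp
 qed
 have kb: "integrable lborel (\<lambda>u::real. C * (1 + \<bar>u\<bar>) powr (-4))" for C
  by (rule integrable_mult_right[OF quartic_weight_integral(1)])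
 have Ec: "continuous_on UNIV E"
 proof -
  have "continuous_on UNIV (\<lambda>u. smoothing_kernel \<rho> (Complex 2 u))"
   using \<rho> by (intro continuous_on_compose2[OF holomorphic_on_imp_continuous_on[OF smoothing_kernel_holomorphic[of "{w. Re w > - 2 * \<rho>}"]]])
    (auto simp: Complex_eq intro!: continuous_intros)
  then show ?thesis unfolding E_def[abs_def]
   by (intro continuous_intros) (auto simp: Complex_eq complex_eq_iff intro!: continuous_intros)
 qed
 have [measurable]: "E \<in> borel_measurable borel" by (rule borel_measurable_continuous_onI[OF Ec])
 have In: "integrable lborel (\<lambda>u. of_nat n powr (- Complex 2 u) * E u)" if n: "n > 0" for n
 proof (rule Bochner_Integration.integrable_bound[OF kb])
  have "(\<lambda>u. of_nat n powr (- Complex 2 u)) \<in> borel_measurable borel"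
   using n by (auto simp: Complex_eq intro!: borel_measurable_continuous_onI continuous_intros)
  then show "(\<lambda>u. of_nat n powr (- Complex 2 u) * E u) \<in> borel_measurable lborel" by measurable
  show "AE u in lborel. norm (of_nat n powr (- Complex 2 u) * E u) \<le> norm (N powr 2 * 32 * (1 + \<bar>u\<bar>) powr (-4))"
  proof (intro AE_I2)
   fix u
   have "real n powr (-2) \<le> real n powr 0" using n by (intro powr_mono) auto
   then have "norm (of_nat n powr (- Complex 2 u) :: complex) \<le> 1" using n norm_nat_powr[OF n, of "Complex 2 u"] by simp
   then have "norm (of_nat n powr (- Complex 2 u) * E u) \<le> 1 * (N powr 2 * 32 * (1 + \<bar>u\<bar>) powr (-4))"
    unfolding norm_mult by (intro mult_mono nE) auto
   then show "norm (of_nat n powr (- Complex 2 u) * E u) \<le> norm (N powr 2 * 32 * (1 + \<bar>u\<bar>) powr (-4))" by simp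
  qed
 qed
 have tpE: "twisted_poly K a \<omega> (Complex (\<sigma> + 2) (t + u)) * E u
   = (\<Sum>n=1..K. (a n * torus_char \<omega> n * of_nat n powr (- ?s)) * (of_nat n powr (- Complex 2 u) * E u))" for u
  unfolding twisted_poly_def sum_distrib_right
 proof (intro sum.cong refl)
  fix n assume "n \<in> {1..K}"
  then have n: "n > 0" by simp
  have "of_nat n powr (- Complex (\<sigma> + 2) (t + u)) = of_nat n powr (- ?s) * (of_nat n powr (- Complex 2 u) :: complex)"
   unfolding nat_powr_eq_exp[OF n] exp_add[symmetric] pt[symmetric] by (simp add: algebra_simps)
  then show "a n * torus_char \<omega> n * of_nat n powr (- Complex (\<sigma> + 2) (t + u)) * E u
    = (a n * torus_char \<omega> n * of_nat n powr (- ?s)) * (of_nat n powr (- Complex 2 u) * E u)" by simp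
 qed
 have tpint: "integrable lborel (\<lambda>u. twisted_poly K a \<omega> (Complex (\<sigma> + 2) (t + u)) * E u)"
  unfolding tpE by (intro Bochner_Integration.integrable_sum integrable_mult_right In) auto
 have tpval: "(LINT u|lborel. twisted_poly K a \<omega> (Complex (\<sigma> + 2) (t + u)) * E u)
   = 2 * pi * twisted_poly K (smoothed_coeff a \<rho> N) \<omega> ?s"
 proof -
  have "(LINT u|lborel. twisted_poly K a \<omega> (Complex (\<sigma> + 2) (t + u)) * E u)
    = (\<Sum>n=1..K. (a n * torus_char \<omega> n * of_nat n powr (- ?s)) * (LINT u|lborel. of_nat n powr (- Complex 2 u) * E u))"
   unfolding tpE by (subst Bochner_Integration.integral_sum) (auto intro!: integrable_mult_right In)
  also have "\<dots> = 2 * pi * twisted_poly K (smoothed_coeff a \<rho> N) \<omega> ?s"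
   unfolding twisted_poly_def smoothed_coeff_def E_def[symmetric] sum_distrib_left
   by (intro sum.cong refl) (simp add: field_simps)
  finally show ?thesis .
 qed
 define G where "G = (\<lambda>w. F (?s + w) * (exp (w * complex_of_real (ln N)) * smoothing_kernel \<rho> w))"
 have id: "integrable lborel (\<lambda>u. G (Complex 2 u) / Complex 2 u)"
  "integrable lborel (\<lambda>u. G (Complex (-\<rho>) u) / Complex (-\<rho>) u)"
  "2 * pi * F ?s = (LINT u|lborel. G (Complex 2 u) / Complex 2 u)
   - (LINT u|lborel. G (Complex (-\<rho>) u) / Complex (-\<rho>) u)" unfolding G_def by (rule smoothing_identity[OF \<rho> N])+
 have GE: "G (Complex 2 u) / Complex 2 u = F (Complex (\<sigma> + 2) (t + u)) * E u" for u
  unfolding G_def pt E_def by simp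
 have "2 * pi * (F ?s - twisted_poly K (smoothed_coeff a \<rho> N) \<omega> ?s)
   = (LINT u|lborel. (F (Complex (\<sigma> + 2) (t + u)) - twisted_poly K a \<omega> (Complex (\<sigma> + 2) (t + u))) * E u)
    - (LINT u|lborel. G (Complex (-\<rho>) u) / Complex (-\<rho>) u)"
  using id(1) tpint unfolding right_diff_distrib id(3) tpval[symmetric] left_diff_distrib GE
  by (subst Bochner_Integration.integral_diff) auto
 then have "norm (2 * pi * (F ?s - twisted_poly K (smoothed_coeff a \<rho> N) \<omega> ?s))
   \<le> norm (LINT u|lborel. (F (Complex (\<sigma> + 2) (t + u)) - twisted_poly K a \<omega> (Complex (\<sigma> + 2) (t + u))) * E u)
    + norm (LINT u|lborel. G (Complex (-\<rho>) u) / Complex (-\<rho>) u)" by (simp only: norm_triangle_ineq4)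
 also have "norm (LINT u|lborel. (F (Complex (\<sigma> + 2) (t + u)) - twisted_poly K a \<omega> (Complex (\<sigma> + 2) (t + u))) * E u)
   \<le> (LINT u|lborel. (coeff_tail a K * (N powr 2 * 32)) * (1 + \<bar>u\<bar>) powr (-4))"
 proof (rule Bochner_Integration.integral_norm_bound_integral)
  show "integrable lborel (\<lambda>u. (F (Complex (\<sigma> + 2) (t + u)) - twisted_poly K a \<omega> (Complex (\<sigma> + 2) (t + u))) * E u)"
   using id(1) tpint unfolding GE left_diff_distrib by (rule Bochner_Integration.integrable_diff)
  fix u
  have "norm (F (Complex (\<sigma> + 2) (t + u)) - twisted_poly K a \<omega> (Complex (\<sigma> + 2) (t + u))) * norm (E u)
    \<le> coeff_tail a K * (N powr 2 * 32 * (1 + \<bar>u\<bar>) powr (-4))"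
   using \<rho> by (intro mult_mono F_partial_sum nE coeff_tail_nonneg) auto
  then show "norm ((F (Complex (\<sigma> + 2) (t + u)) - twisted_poly K a \<omega> (Complex (\<sigma> + 2) (t + u))) * E u)
    \<le> (coeff_tail a K * (N powr 2 * 32)) * (1 + \<bar>u\<bar>) powr (-4)" by (simp add: norm_mult)
 qed (rule kb)
 also have "(LINT u|lborel. (coeff_tail a K * (N powr 2 * 32)) * (1 + \<bar>u::real\<bar>) powr (-4))
   \<le> (coeff_tail a K * (N powr 2 * 32)) * 3" unfolding integral_mult_right_zero using coeff_tail_nonneg
  by (intro mult_left_mono quartic_weight_integral(2)) auto
 also have "norm (LINT u|lborel. G (Complex (-\<rho>) u) / Complex (-\<rho>) u)
   \<le> (LINT u|lborel. (32 / \<rho> * N powr (-\<rho>)) * (norm (F (Complex (\<sigma> - \<rho>) (t + u))) * (1 + \<bar>u\<bar>) powr (-4)))"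
 proof (rule Bochner_Integration.integral_norm_bound_integral[OF id(2) integrable_mult_right[OF intJ]])
  fix u
  have "norm (G (Complex (-\<rho>) u) / Complex (-\<rho>) u)
    = norm (F (Complex (\<sigma> - \<rho>) (t + u))) * (N powr (-\<rho>) * norm (smoothing_kernel \<rho> (Complex (-\<rho>) u) / Complex (-\<rho>) u))"
   unfolding G_def pt norm_divide norm_mult nexp complex.sel by simp
  also have "\<dots> \<le> norm (F (Complex (\<sigma> - \<rho>) (t + u))) * (N powr (-\<rho>) * (32 / \<rho> * (1 + \<bar>u\<bar>) powr (-4)))"
   by (intro mult_left_mono smoothing_kernel_left \<rho>) auto
  finally show "norm (G (Complex (-\<rho>) u) / Complex (-\<rho>) u)
    \<le> (32 / \<rho> * N powr (-\<rho>)) * (norm (F (Complex (\<sigma> - \<rho>) (t + u))) * (1 + \<bar>u\<bar>) powr (-4))" by (simp add: mult_ac)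
 qed
 also have "\<dots> = 32 / \<rho> * N powr (-\<rho>) * J" unfolding J_def by (rule integral_mult_right_zero)
 finally have "norm (2 * pi * (F ?s - twisted_poly K (smoothed_coeff a \<rho> N) \<omega> ?s))
   \<le> 96 * N powr 2 * coeff_tail a K + 32 / \<rho> * N powr (-\<rho>) * J" by (simp add: mult_ac)
 moreover have "norm (F ?s - twisted_poly K (smoothed_coeff a \<rho> N) \<omega> ?s)
   \<le> norm (2 * pi * (F ?s - twisted_poly K (smoothed_coeff a \<rho> N) \<omega> ?s))"
 proof -
  have "1 * norm z \<le> norm (2 * complex_of_real pi) * norm z" for z :: complex
   using pi_ge_two by (intro mult_right_mono) (auto simp: norm_mult)
  then show ?thesis by (simp add: norm_mult)
 qed
 ultimately show "norm (F ?s - twisted_poly K (smoothed_coeff a \<rho> N) \<omega> ?s)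
   \<le> 96 * N powr 2 * coeff_tail a K + 32 / \<rho> * N powr (-\<rho>) * (LINT u|lborel. norm (F (Complex (\<sigma> - \<rho>) (t + u))) * (1 + \<bar>u\<bar>) powr (-4))"
  unfolding J_def by linarith
qed

lemma smoothing_bound_powr:
 fixes \<rho> \<sigma> t N :: real
 assumes \<rho>: "0 < \<rho>" "\<rho> \<le> 1" "\<rho> < \<sigma>" and N: "N \<ge> 1"
 shows "ennreal (norm (F (Complex \<sigma> t) - twisted_poly K (smoothed_coeff a \<rho> N) \<omega> (Complex \<sigma> t)) powr p)
   \<le> ennreal (2 powr p * (96 * N powr 2 * coeff_tail a K) powr p)
   + ennreal ((192 / \<rho> * N powr (-\<rho>)) powr p) *
    (\<integral>\<^sup>+u. ennreal (norm (F (Complex (\<sigma> - \<rho>) (t + u))) powr p) * ennreal ((1 + \<bar>u\<bar>) powr (-4)) \<partial>lborel)"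
proof -
 let ?I = "(\<integral>\<^sup>+u. ennreal (norm (F (Complex (\<sigma> - \<rho>) (t + u))) powr p) * ennreal ((1 + \<bar>u\<bar>) powr (-4)) \<partial>lborel)"
 define J where "J = (LINT u|lborel. norm (F (Complex (\<sigma> - \<rho>) (t + u))) * (1 + \<bar>u\<bar>) powr (-4))"
 define B where "B = 96 * N powr 2 * coeff_tail a K"
 define D where "D = 32 / \<rho> * N powr (-\<rho>)"
 have \<sigma>\<rho>: "\<sigma> - \<rho> > 0" using \<rho> by simp
 have [measurable]: "(\<lambda>t. F (Complex (\<sigma> - \<rho>) t)) \<in> borel_measurable borel" by (rule F_vertical_measurable[OF \<sigma>\<rho>])
 have J0: "J \<ge> 0" unfolding J_def by (intro integral_nonneg_AE) auto
 have D0: "D \<ge> 0" using \<rho> by (simp add: D_def)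
 have B0: "B \<ge> 0" using coeff_tail_nonneg by (simp add: B_def)
 have "norm (F (Complex \<sigma> t) - twisted_poly K (smoothed_coeff a \<rho> N) \<omega> (Complex \<sigma> t)) powr p \<le> (B + D * J) powr p"
  using smoothing_bound(2)[OF \<rho> N] p1 unfolding B_def D_def J_def by (intro powr_mono2) auto
 also have "\<dots> \<le> 2 powr p * (B powr p + (D * J) powr p)" using B0 D0 J0 p1 by (intro powr_add_le) auto
 also have "\<dots> = 2 powr p * B powr p + (2 * D) powr p * J powr p"
  using D0 J0 by (simp add: powr_mult algebra_simps)
 finally have "ennreal (norm (F (Complex \<sigma> t) - twisted_poly K (smoothed_coeff a \<rho> N) \<omega> (Complex \<sigma> t)) powr p)
   \<le> ennreal (2 powr p * B powr p + (2 * D) powr p * J powr p)" by (rule ennreal_leI)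
 also have "\<dots> = ennreal (2 powr p * B powr p) + ennreal ((2 * D) powr p) * ennreal (J powr p)"
  by (subst ennreal_plus) (auto simp: ennreal_mult)
 also have "ennreal (J powr p) \<le> ennreal (3 powr p) * ?I"
  unfolding J_def by (rule powr_weighted_integral_le[OF p1 _ _ smoothing_bound(1)[OF \<rho> N]]) auto
 also have "ennreal ((2 * D) powr p) * (ennreal (3 powr p) * ?I) = ennreal ((192 / \<rho> * N powr (-\<rho>)) powr p) * ?I"
 proof -
  have "(2 * D) powr p * 3 powr p = (192 / \<rho> * N powr (-\<rho>)) powr p"
   using D0 by (subst powr_mult[symmetric]) (auto simp: D_def)
  then show ?thesis by (simp add: mult.assoc[symmetric] ennreal_mult[symmetric])
 qed
 finally show ?thesis unfolding B_def by (simp add: mult_left_mono)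
qed

lemma smoothing_error:
 fixes \<rho> \<sigma> t N :: real and K :: nat
 assumes \<rho>: "0 < \<rho>" "\<rho> \<le> 1" "\<rho> < \<sigma>" and N: "N \<ge> 1"
 defines "e \<equiv> 2 powr p * (96 * N powr 2 * coeff_tail a K) powr p + (192 / \<rho> * N powr (-\<rho>)) powr p * (3 * X)"
 shows "T \<ge> 1 \<Longrightarrow> vertical_mean p (\<lambda>s. F s - twisted_poly K (smoothed_coeff a \<rho> N) \<omega> s) \<sigma> T \<le> e"
  and "norm (F (Complex \<sigma> t) - twisted_poly K (smoothed_coeff a \<rho> N) \<omega> (Complex \<sigma> t)) powr p \<le> e * (1 + \<bar>t\<bar>)"
proof -
 define B where "B = 2 powr p * (96 * N powr 2 * coeff_tail a K) powr p"
 define D where "D = (192 / \<rho> * N powr (-\<rho>)) powr p"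
 have BD: "B \<ge> 0" "D \<ge> 0" by (auto simp: B_def D_def)
 let ?R = "twisted_poly K (smoothed_coeff a \<rho> N) \<omega>"
 let ?h = "\<lambda>t. ennreal (norm (F (Complex (\<sigma> - \<rho>) t)) powr p)"
 let ?k = "\<lambda>u::real. ennreal ((1 + \<bar>u\<bar>) powr (-4))"
 have \<sigma>\<rho>: "\<sigma> - \<rho> > 0" "\<sigma> > 0" using \<rho> by auto
 have [measurable]: "(\<lambda>t. F (Complex (\<sigma> - \<rho>) t)) \<in> borel_measurable borel" by (rule F_vertical_measurable[OF \<sigma>\<rho>(1)])
 have pw: "ennreal (norm (F (Complex \<sigma> t) - ?R (Complex \<sigma> t)) powr p) \<le> ennreal B + ennreal D * (\<integral>\<^sup>+u. ?h (t + u) * ?k u \<partial>lborel)" for t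
  using smoothing_bound_powr[OF \<rho> N, of t K] unfolding B_def D_def .
 show "norm (F (Complex \<sigma> t) - ?R (Complex \<sigma> t)) powr p \<le> e * (1 + \<bar>t\<bar>)"
 proof -
  have "ennreal B + ennreal D * (\<integral>\<^sup>+u. ?h (t + u) * ?k u \<partial>lborel) \<le> ennreal B + ennreal D * ennreal (2 * 4 / (4-1) * ((1 + \<bar>t\<bar>) * X))"
   using mean_bdd_shift[OF F_mean_bdd_powr[OF \<sigma>\<rho>(1)], of t]
   by (intro add_mono mult_left_mono nn_integral_mean_bdd_weight) (auto simp: add.commute)
  also have "\<dots> = ennreal (B + D * (8/3 * ((1 + \<bar>t\<bar>) * X)))"
   using BD X_nonneg by (simp add: ennreal_mult[symmetric] ennreal_plus[symmetric] del: ennreal_plus)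
  finally have le: "ennreal B + ennreal D * (\<integral>\<^sup>+u. ?h (t + u) * ?k u \<partial>lborel) \<le> ennreal (B + D * (8/3 * ((1 + \<bar>t\<bar>) * X)))" .
  have nn: "0 \<le> B + D * (8/3 * ((1 + \<bar>t\<bar>) * X))" using BD X_nonneg by simp
  have "norm (F (Complex \<sigma> t) - ?R (Complex \<sigma> t)) powr p \<le> B + D * (8/3 * ((1 + \<bar>t\<bar>) * X))"
   using order_trans[OF pw[of t] le] unfolding ennreal_le_iff[OF nn] .
  also have "\<dots> \<le> B * (1 + \<bar>t\<bar>) + D * (3 * ((1 + \<bar>t\<bar>) * X))"
   using BD X_nonneg by (intro add_mono mult_left_mono mult_right_mono) (auto simp: mult_le_cancel_left1)
  also have "\<dots> = e * (1 + \<bar>t\<bar>)" unfolding e_def B_def D_def by (simp add: algebra_simps)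
  finally show ?thesis .
 qed
 assume T: "T \<ge> 1"
 have [measurable]: "(\<lambda>t. F (Complex \<sigma> t)) \<in> borel_measurable borel" by (rule F_vertical_measurable[OF \<sigma>\<rho>(2)])
 have "(\<integral>\<^sup>+t\<in>{-T..T}. ennreal (norm (F (Complex \<sigma> t) - ?R (Complex \<sigma> t)) powr p) \<partial>lborel)
   \<le> (\<integral>\<^sup>+t. ennreal B * indicator {-T..T} t + ennreal D * ((\<integral>\<^sup>+u. ?h (t + u) * ?k u \<partial>lborel) * indicator {-T..T} t) \<partial>lborel)"
  using pw by (intro nn_integral_mono) (auto simp: indicator_def)
 also have "\<dots> = (\<integral>\<^sup>+t. ennreal B * indicator {-T..T} t \<partial>lborel) + (\<integral>\<^sup>+t. ennreal D * ((\<integral>\<^sup>+u. ?h (t + u) * ?k u \<partial>lborel) * indicator {-T..T} t) \<partial>lborel)"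
  by (rule nn_integral_add) measurable
 also have "(\<integral>\<^sup>+t. ennreal D * ((\<integral>\<^sup>+u. ?h (t + u) * ?k u \<partial>lborel) * indicator {-T..T} t) \<partial>lborel)
   = ennreal D * (\<integral>\<^sup>+t\<in>{-T..T}. (\<integral>\<^sup>+u. ?h (t + u) * ?k u \<partial>lborel) \<partial>lborel)"
  by (rule nn_integral_cmult) measurable
 also have "(\<integral>\<^sup>+t\<in>{-T..T}. (\<integral>\<^sup>+u. ?h (t + u) * ?k u \<partial>lborel) \<partial>lborel) \<le> ennreal (2 * T * X) * (\<integral>\<^sup>+u. ennreal (1 + \<bar>u\<bar>) * ?k u \<partial>lborel)"
  by (rule mean_bdd_conv[OF F_mean_bdd_powr[OF \<sigma>\<rho>(1)] _ T]) measurable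
 also have "(\<integral>\<^sup>+u. ennreal (1 + \<bar>u\<bar>) * ?k u \<partial>lborel) \<le> ennreal 3"
 proof -
  have one: "mean_bdd (\<lambda>_. 1) 1" unfolding mean_bdd_def by (auto simp: ennreal_mult)
  have "ennreal (1 + \<bar>u\<bar>) * ?k u = 1 * ennreal ((1 + \<bar>u\<bar>) powr (-3))" for u :: real
  proof -
   have "(1 + \<bar>u\<bar>) * (1 + \<bar>u\<bar>) powr (-4) = (1 + \<bar>u\<bar>) powr (1 + -4)" by (rule powr_mult_base) simp
   then show ?thesis by (simp add: ennreal_mult[symmetric] del: ennreal_plus)
  qed
  then have "(\<integral>\<^sup>+u. ennreal (1 + \<bar>u\<bar>) * ?k u \<partial>lborel) = (\<integral>\<^sup>+u. 1 * ennreal ((1 + \<bar>u\<bar>) powr (-3)) \<partial>lborel)"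
   by (simp only:)
  also have "\<dots> \<le> ennreal (2 * 3 / (3-1) * 1)" by (rule nn_integral_mean_bdd_weight[OF one]) simp
  finally show ?thesis by simp
 qed
 also have "(\<integral>\<^sup>+t. ennreal B * indicator {-T..T} t \<partial>lborel) = ennreal B * ennreal (2 * T)"
  using T by (subst nn_integral_cmult_indicator) auto
 finally have "(\<integral>\<^sup>+t\<in>{-T..T}. ennreal (norm (F (Complex \<sigma> t) - ?R (Complex \<sigma> t)) powr p) \<partial>lborel)
   \<le> ennreal B * ennreal (2 * T) + ennreal D * (ennreal (2 * T * X) * ennreal 3)" by (simp add: mult_left_mono)
 also have "\<dots> = ennreal (2 * T * e)"
 proof -
  have 1: "ennreal B * ennreal (2 * T) = ennreal (B * (2 * T))"
   using BD T by (intro ennreal_mult[symmetric]) auto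
  have 2: "ennreal (2 * T * X) * ennreal 3 = ennreal (2 * T * X * 3)"
   using X_nonneg T by (intro ennreal_mult[symmetric]) auto
  have 3: "ennreal D * ennreal (2 * T * X * 3) = ennreal (D * (2 * T * X * 3))"
   using BD X_nonneg T by (intro ennreal_mult[symmetric]) auto
  have 4: "ennreal (B * (2 * T)) + ennreal (D * (2 * T * X * 3)) = ennreal (B * (2 * T) + D * (2 * T * X * 3))"
   using BD X_nonneg T by (intro ennreal_plus[symmetric]) auto
  show ?thesis unfolding 1 2 3 4 e_def B_def[symmetric] D_def[symmetric] by (simp add: algebra_simps)
 qed
 finally have I: "(\<integral>\<^sup>+t\<in>{-T..T}. ennreal (norm (F (Complex \<sigma> t) - ?R (Complex \<sigma> t)) powr p) \<partial>lborel) \<le> ennreal (2 * T * e)" .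
 have e0: "e \<ge> 0" using BD X_nonneg unfolding e_def B_def[symmetric] D_def[symmetric] by simp
 have "continuous_on UNIV (\<lambda>t. F (Complex \<sigma> t) - ?R (Complex \<sigma> t))"
  using \<sigma>\<rho>(2) by (intro continuous_intros F_vertical_continuous twisted_poly_vertical_continuous)
 then have "ennreal (vertical_mean p (\<lambda>s. F s - ?R s) \<sigma> T) \<le> ennreal (1 / (2 * T)) * ennreal (2 * T * e)"
  using T p1 I by (subst vertical_mean_nn_integral(1)) (auto intro!: mult_left_mono)
 also have "\<dots> = ennreal e" using T e0 by (simp add: ennreal_mult[symmetric])
 finally show "vertical_mean p (\<lambda>s. F s - ?R s) \<sigma> T \<le> e" using e0 by simp
qed

end

text \<open>First \<open>N\<close> is chosen so large that \<open>N\<^sup>-\<^sup>\<rho>\<close> defeats the integral over the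
 left line, then \<open>K\<close> so large that the tail of the absolutely convergent series on the right line is
 negligible.\<close>

lemma carlson_approximation:
 fixes e \<kappa> X p :: real
 assumes e: "e > 0" and \<kappa>: "\<kappa> > 0" and ex: "carlson p a \<omega>\<^sub>0 F\<^sub>0 X"
 shows "\<exists>K r. \<forall>\<omega> F. carlson p a \<omega> F X \<longrightarrow> (\<forall>\<sigma>\<ge>\<kappa>.
   (\<forall>T\<ge>1. vertical_mean p (\<lambda>s. F s - twisted_poly K r \<omega> s) \<sigma> T \<le> e) \<and>
   (\<forall>t. norm (F (Complex \<sigma> t) - twisted_poly K r \<omega> (Complex \<sigma> t)) powr p \<le> e * (1 + \<bar>t\<bar>)))"
proof -
 interpret C0: carlson p a \<omega>\<^sub>0 F\<^sub>0 X by (rule ex)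
 have p0: "p > 0" using C0.p1 by simp
 define \<rho> where "\<rho> = min (\<kappa>/2) 1"
 have \<rho>: "0 < \<rho>" "\<rho> \<le> 1" "\<rho> < \<kappa>" using \<kappa> by (auto simp: \<rho>_def)
 have "((\<lambda>N. (192 / \<rho> * N powr (-\<rho>)) powr p * (3 * X)) \<longlongrightarrow> (192 / \<rho> * 0) powr p * (3 * X)) at_top"
  using \<rho> p0 by (intro tendsto_intros tendsto_powr' tendsto_neg_powr filterlim_ident) auto
 then have "\<forall>\<^sub>F N in at_top. (192 / \<rho> * N powr (-\<rho>)) powr p * (3 * X) < e / 2"
  using e p0 by (intro order_tendstoD(2)) auto
 then obtain N where N: "N \<ge> 1" "(192 / \<rho> * N powr (-\<rho>)) powr p * (3 * X) < e / 2"
  using eventually_ge_at_top[of 1] eventually_happens'[OF trivial_limit_at_top_linorder]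
  by (metis (mono_tags, lifting) eventually_conj)
 have lim: "((\<lambda>K. 2 powr p * (96 * N powr 2 * coeff_tail a K) powr p) \<longlonglongrightarrow> 2 powr p * (96 * N powr 2 * 0) powr p)"
  using p0 C0.coeff_tail_nonneg by (intro tendsto_intros tendsto_powr' C0.coeff_tail_tendsto) auto
 have "2 powr p * (96 * N powr 2 * 0) powr p < e / 2" using e p0 by simp
 from order_tendstoD(2)[OF lim this]
 have "\<forall>\<^sub>F K in sequentially. 2 powr p * (96 * N powr 2 * coeff_tail a K) powr p < e / 2" .
 then obtain K where K: "2 powr p * (96 * N powr 2 * coeff_tail a K) powr p < e / 2"
  using eventually_happens'[OF trivial_limit_sequentially] by blast
 define e' where "e' = 2 powr p * (96 * N powr 2 * coeff_tail a K) powr p + (192 / \<rho> * N powr (-\<rho>)) powr p * (3 * X)"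
 have e': "e' \<le> e" using K N unfolding e'_def by linarith
 show ?thesis
 proof (rule exI[of _ K], rule exI[of _ "smoothed_coeff a \<rho> N"], intro allI impI conjI)
  fix \<omega> F \<sigma> assume c: "carlson p a \<omega> F X" and \<sigma>: "\<sigma> \<ge> \<kappa>"
  then interpret carlson p a \<omega> F X by simp
  have \<rho>\<sigma>: "\<rho> < \<sigma>" using \<rho> \<sigma> by simp
  show "vertical_mean p (\<lambda>s. F s - twisted_poly K (smoothed_coeff a \<rho> N) \<omega> s) \<sigma> T \<le> e" if "T \<ge> 1" for T
   using smoothing_error(1)[OF \<rho>(1,2) \<rho>\<sigma> N(1) that, of K] e' unfolding e'_def by linarith
  show "norm (F (Complex \<sigma> t) - twisted_poly K (smoothed_coeff a \<rho> N) \<omega> (Complex \<sigma> t)) powr p \<le> e * (1 + \<bar>t\<bar>)" for t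
  proof -
   have "norm (F (Complex \<sigma> t) - twisted_poly K (smoothed_coeff a \<rho> N) \<omega> (Complex \<sigma> t)) powr p \<le> e' * (1 + \<bar>t\<bar>)"
    using smoothing_error(2)[OF \<rho>(1,2) \<rho>\<sigma> N(1), of t K] unfolding e'_def .
   also have "\<dots> \<le> e * (1 + \<bar>t\<bar>)" using e' by (intro mult_right_mono) auto
   finally show ?thesis .
  qed
 qed
qed

section \<open>Common mean values and growth\<close>

text \<open>Convexity with weights \<open>1 - \<theta>\<close> and \<open>\<theta>\<close>: as \<open>\<theta> \<rightarrow>
 0\<close> the first constant tends to 1, so this replaces Minkowski's inequality.\<close>

lemma powr_add_weighted_le:
 fixes x y z p \<theta> :: real
 assumes p: "1 \<le> p" and \<theta>: "0 < \<theta>" "\<theta> < 1" and "x \<ge> 0" "y \<ge> 0" "z \<ge> 0" "z \<le> x + y"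
 shows "z powr p \<le> (1 - \<theta>) powr (1 - p) * x powr p + \<theta> powr (1 - p) * y powr p"
proof -
 have "z powr p \<le> (x + y) powr p" using assms by (intro powr_mono2) auto
 also have "\<dots> \<le> (1 - \<theta>) * (x / (1 - \<theta>)) powr p + \<theta> * (y / \<theta>) powr p"
 proof (cases "x = 0 \<or> y = 0")
  case False
  then show ?thesis using convex_onD[OF powr_convex[OF p], of \<theta> "x / (1 - \<theta>)" "y / \<theta>"] assms by simp
 next
  case True
  have scale: "w powr p \<le> t * (w / t) powr p" if "0 < t" "t < 1" "w \<ge> 0" for t w :: real
  proof -
   have "t powr p \<le> t powr 1" using that p by (intro powr_mono') auto
   then have "t powr p * (w / t) powr p \<le> t * (w / t) powr p" using that by (intro mult_right_mono) auto
   then show ?thesis using that by (simp flip: powr_mult)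
  qed
  show ?thesis using True scale[of "1 - \<theta>" x] scale[of \<theta> y] assms by auto
 qed
 also have "(1 - \<theta>) * (x / (1 - \<theta>)) powr p = (1 - \<theta>) powr (1 - p) * x powr p"
  using \<theta> assms by (simp add: powr_divide powr_diff)
 also have "\<theta> * (y / \<theta>) powr p = \<theta> powr (1 - p) * y powr p" using \<theta> assms by (simp add: powr_divide powr_diff)
 finally show ?thesis .
qed

lemma vertical_mean_triangle:
 assumes p: "1 \<le> p" and \<theta>: "0 < \<theta>" "\<theta> < 1" and T: "T > 0"
  and F: "continuous_on UNIV (\<lambda>t. F (Complex \<sigma> t))" and H: "continuous_on UNIV (\<lambda>t. H (Complex \<sigma> t))"
 shows "vertical_mean p F \<sigma> T \<le> (1 - \<theta>) powr (1 - p) * vertical_mean p H \<sigma> T + \<theta> powr (1 - p) * vertical_mean p (\<lambda>s. F s - H s) \<sigma> T"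
proof -
 have D: "continuous_on UNIV (\<lambda>t. F (Complex \<sigma> t) - H (Complex \<sigma> t))" by (intro continuous_intros F H)
 have p0: "p > 0" using p by simp
 note i = vertical_mean_nn_integral(2)[OF F p0 T] vertical_mean_nn_integral(2)[OF H p0 T]
  vertical_mean_nn_integral(2)[where F = "\<lambda>s. F s - H s", OF D p0 T]
 let ?A = "(1 - \<theta>) powr (1 - p)" and ?B = "\<theta> powr (1 - p)"
 have ia: "set_integrable lborel {-T..T} (\<lambda>t. ?A * norm (H (Complex \<sigma> t)) powr p)"
  by (rule set_integrable_mult_right) (rule i(2))
 have ib: "set_integrable lborel {-T..T} (\<lambda>t. ?B * norm (F (Complex \<sigma> t) - H (Complex \<sigma> t)) powr p)"
  by (rule set_integrable_mult_right) (rule i(3))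
 have "(LINT t:{-T..T}|lborel. norm (F (Complex \<sigma> t)) powr p)
   \<le> (LINT t:{-T..T}|lborel. ?A * norm (H (Complex \<sigma> t)) powr p + ?B * norm (F (Complex \<sigma> t) - H (Complex \<sigma> t)) powr p)"
  unfolding set_lebesgue_integral_def
 proof (rule integral_mono)
  show "integrable lborel (\<lambda>t. indicator {-T..T} t *\<^sub>R (norm (F (Complex \<sigma> t)) powr p))"
   using i(1) unfolding set_integrable_def .
  show "integrable lborel (\<lambda>t. indicator {-T..T} t *\<^sub>R (?A * norm (H (Complex \<sigma> t)) powr p + ?B * norm (F (Complex \<sigma> t) - H (Complex \<sigma> t)) powr p))"
   using set_integral_add(1)[OF ia ib] unfolding set_integrable_def .
  fix t
  have "norm (F (Complex \<sigma> t)) \<le> norm (H (Complex \<sigma> t)) + norm (F (Complex \<sigma> t) - H (Complex \<sigma> t))"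
   by (metis add.commute diff_add_cancel norm_triangle_ineq)
  from powr_add_weighted_le[OF p \<theta> _ _ _ this]
  show "indicator {-T..T} t *\<^sub>R (norm (F (Complex \<sigma> t)) powr p)
    \<le> indicator {-T..T} t *\<^sub>R (?A * norm (H (Complex \<sigma> t)) powr p + ?B * norm (F (Complex \<sigma> t) - H (Complex \<sigma> t)) powr p)"
   by (auto simp: indicator_def)
 qed
 also have "\<dots> = ?A * (LINT t:{-T..T}|lborel. norm (H (Complex \<sigma> t)) powr p) + ?B * (LINT t:{-T..T}|lborel. norm (F (Complex \<sigma> t) - H (Complex \<sigma> t)) powr p)"
  by (simp only: set_integral_add(2)[OF ia ib] set_integral_mult_right)
 finally have "1 / (2 * T) * (LINT t:{-T..T}|lborel. norm (F (Complex \<sigma> t)) powr p)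
   \<le> 1 / (2 * T) * (?A * (LINT t:{-T..T}|lborel. norm (H (Complex \<sigma> t)) powr p) + ?B * (LINT t:{-T..T}|lborel. norm (F (Complex \<sigma> t) - H (Complex \<sigma> t)) powr p))"
  using T by (intro mult_left_mono) auto
 then show ?thesis unfolding vertical_mean_def distrib_left by (simp only: mult.left_commute)
qed

lemma vertical_mean_minus: "vertical_mean p (\<lambda>s. H s - F s) \<sigma> T = vertical_mean p (\<lambda>s. F s - H s) \<sigma> T"
 by (simp add: vertical_mean_def norm_minus_commute)

lemma mean_difference_small:
 fixes p X e :: real
 assumes p: "1 \<le> p" and X: "X \<ge> 0" and e: "e > 0"
 obtains \<eta> where "\<eta> > 0" "\<And>F H \<sigma> T. T > 0 \<Longrightarrow> continuous_on UNIV (\<lambda>t. F (Complex \<sigma> t)) \<Longrightarrow> continuous_on UNIV (\<lambda>t. H (Complex \<sigma> t)) \<Longrightarrow>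
   vertical_mean p F \<sigma> T \<le> X \<Longrightarrow> vertical_mean p (\<lambda>s. F s - H s) \<sigma> T \<le> \<eta> \<Longrightarrow>
   \<bar>vertical_mean p F \<sigma> T - vertical_mean p H \<sigma> T\<bar> \<le> e"
proof -
 have "((\<lambda>\<theta>. ((1 - \<theta>) powr (1 - p) - 1) * ((1 - \<theta>) powr (1 - p) * X + 1)) \<longlongrightarrow> ((1 - 0) powr (1 - p) - 1) * ((1 - 0) powr (1 - p) * X + 1)) (at_right 0)"
  by (intro tendsto_intros) auto
 then have "\<forall>\<^sub>F \<theta> in at_right 0. ((1 - \<theta>) powr (1 - p) - 1) * ((1 - \<theta>) powr (1 - p) * X + 1) < e / 2"
  using e by (intro order_tendstoD(2)) auto
 moreover have "\<forall>\<^sub>F \<theta> in at_right 0. \<theta> < (1::real)" by (rule order_tendstoD(2)[OF tendsto_ident_at]) simp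
 ultimately have "\<forall>\<^sub>F \<theta> in at_right (0::real). \<theta> > 0 \<and> \<theta> < 1 \<and> ((1 - \<theta>) powr (1 - p) - 1) * ((1 - \<theta>) powr (1 - p) * X + 1) < e / 2"
  using eventually_at_right_less[of 0] by eventually_elim auto
 then obtain \<theta> where \<theta>: "0 < \<theta>" "\<theta> < 1" "((1 - \<theta>) powr (1 - p) - 1) * ((1 - \<theta>) powr (1 - p) * X + 1) < e / 2"
  using eventually_happens'[OF trivial_limit_at_right_real] by blast
 define A where "A = (1 - \<theta>) powr (1 - p)"
 define B where "B = \<theta> powr (1 - p)"
 have A: "A \<ge> 1"
 proof -
  have "(1 - \<theta>) powr 0 \<le> (1 - \<theta>) powr (1 - p)" using \<theta> p by (intro powr_mono') auto
  then show ?thesis using \<theta> by (simp add: A_def)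
 qed
 have B: "B > 0" using \<theta> by (simp add: B_def)
 define \<eta> where "\<eta> = min 1 (e / 2) / B"
 have \<eta>: "\<eta> > 0" "B * \<eta> \<le> 1" "B * \<eta> \<le> e / 2" using e B by (auto simp: \<eta>_def)
 show thesis
 proof (rule that)
  fix F H :: "complex \<Rightarrow> complex" and \<sigma> T :: real
  assume T: "T > 0" and F: "continuous_on UNIV (\<lambda>t. F (Complex \<sigma> t))" and H: "continuous_on UNIV (\<lambda>t. H (Complex \<sigma> t))"
   and VX: "vertical_mean p F \<sigma> T \<le> X" and V\<eta>: "vertical_mean p (\<lambda>s. F s - H s) \<sigma> T \<le> \<eta>"
  define v w d where "v = vertical_mean p F \<sigma> T" "w = vertical_mean p H \<sigma> T" "d = vertical_mean p (\<lambda>s. F s - H s) \<sigma> T"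
  note vwd = this
  have 1: "v \<le> A * w + B * d" "w \<le> A * v + B * d"
   unfolding vwd A_def B_def using vertical_mean_triangle[OF p \<theta>(1,2) T F H] vertical_mean_triangle[OF p \<theta>(1,2) T H F]
   by (simp_all add: vertical_mean_minus[of p H F])
  have Bd: "B * d \<le> B * \<eta>" using B V\<eta> by (intro mult_left_mono) (auto simp: vwd)
  have v0: "v \<ge> 0" unfolding vwd using vertical_mean_nn_integral(3)[OF F _ T] p by simp
  have vX: "v \<le> X" using VX by (simp add: vwd)
  have AX: "A * v \<le> A * X" using A vX by (intro mult_left_mono) auto
  have vv: "v \<le> A * X + 1"
  proof -
   have "1 * v \<le> A * v" using A v0 by (intro mult_right_mono) auto
   then show ?thesis using AX by simp
  qed
  have ww: "w \<le> A * X + 1" using 1(2) AX Bd \<eta> by linarith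
  have "(A - 1) * w \<le> (A - 1) * (A * X + 1)" "(A - 1) * v \<le> (A - 1) * (A * X + 1)"
   using A ww vv by (intro mult_left_mono; simp)+
  moreover have "(A - 1) * (A * X + 1) < e / 2" using \<theta>(3) by (simp add: A_def)
  moreover have "v - w \<le> (A - 1) * w + B * d" "w - v \<le> (A - 1) * v + B * d"
   using 1 by (simp_all add: algebra_simps)
  ultimately have "v - w \<le> e" "w - v \<le> e" using Bd \<eta> by linarith+
  then show "\<bar>vertical_mean p F \<sigma> T - vertical_mean p H \<sigma> T\<bar> \<le> e" by (simp add: vwd abs_le_iff)
 qed (rule \<eta>)
qed

lemma carlson_mono: "carlson p a \<omega> F X \<Longrightarrow> X \<le> X' \<Longrightarrow> carlson p a \<omega> F X'"
 unfolding carlson_def by (meson order_trans)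

lemma carlson_common_limit_bounded:
 assumes \<sigma>: "\<sigma> > 0"
 shows "\<exists>L. \<forall>\<omega> F. carlson p a \<omega> F X \<longrightarrow> (vertical_mean p F \<sigma> \<longlongrightarrow> L) at_top"
proof (cases "\<exists>\<omega> F. carlson p a \<omega> F X")
 case True
 then obtain \<omega>0 F0 where c0: "carlson p a \<omega>0 F0 X" by blast
 then interpret C0: carlson p a \<omega>0 F0 X .
 let ?I = "{i. carlson p a (fst i) (snd i) X}"
 have "\<exists>L. \<forall>i\<in>?I. ((vertical_mean p (snd i) \<sigma>) \<longlongrightarrow> L) at_top"
 proof (rule common_limit_approx)
  fix e :: real assume e: "e > 0"
  obtain \<eta> where \<eta>: "\<eta> > 0"
   "\<And>F H \<sigma> T. T > 0 \<Longrightarrow> continuous_on UNIV (\<lambda>t. F (Complex \<sigma> t)) \<Longrightarrow> continuous_on UNIV (\<lambda>t. H (Complex \<sigma> t)) \<Longrightarrow>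
    vertical_mean p F \<sigma> T \<le> X \<Longrightarrow> vertical_mean p (\<lambda>s. F s - H s) \<sigma> T \<le> \<eta> \<Longrightarrow>
    \<bar>vertical_mean p F \<sigma> T - vertical_mean p H \<sigma> T\<bar> \<le> e"
   by (rule mean_difference_small[OF C0.p1 C0.X_nonneg e]) (rule that; assumption)
  obtain K r where KR: "\<forall>\<omega> F. carlson p a \<omega> F X \<longrightarrow> (\<forall>\<sigma>'\<ge>\<sigma>.
    (\<forall>T\<ge>1. vertical_mean p (\<lambda>s. F s - twisted_poly K r \<omega> s) \<sigma>' T \<le> \<eta>) \<and>
    (\<forall>t. norm (F (Complex \<sigma>' t) - twisted_poly K r \<omega> (Complex \<sigma>' t)) powr p \<le> \<eta> * (1 + \<bar>t\<bar>)))"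
   using carlson_approximation[OF \<eta>(1) \<sigma> c0] by blast
  have Kr: "vertical_mean p (\<lambda>s. F s - twisted_poly K r \<omega> s) \<sigma> T \<le> \<eta>" if "carlson p a \<omega> F X" "T \<ge> 1" for \<omega> F T
   using KR that by simp
  show "\<exists>L A. \<forall>i\<in>?I. (A i \<longlongrightarrow> L) at_top \<and> (\<forall>\<^sub>F T in at_top. \<bar>vertical_mean p (snd i) \<sigma> T - A i T\<bar> \<le> e)"
  proof (rule exI[of _ "torus_norm p K r \<sigma>"], rule exI[of _ "\<lambda>i. vertical_mean p (twisted_poly K r (fst i)) \<sigma>"], intro ballI conjI)
   fix i assume "i \<in> ?I"
   then have i: "carlson p a (fst i) (snd i) X" by simp
   then interpret carlson p a "fst i" "snd i" X .
   show "(vertical_mean p (twisted_poly K r (fst i)) \<sigma> \<longlongrightarrow> torus_norm p K r \<sigma>) at_top"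
    using p1 \<sigma> \<omega> by (intro vertical_mean_twisted_poly_tendsto) auto
   show "\<forall>\<^sub>F T in at_top. \<bar>vertical_mean p (snd i) \<sigma> T - vertical_mean p (twisted_poly K r (fst i)) \<sigma> T\<bar> \<le> e"
    using eventually_ge_at_top[of 1]
   proof eventually_elim
    case (elim T)
    then show ?case
     using \<sigma> by (intro \<eta>(2) bounded Kr[OF i] F_vertical_continuous twisted_poly_vertical_continuous) auto
   qed
  qed
 qed
 then obtain L where L: "\<forall>i\<in>?I. (vertical_mean p (snd i) \<sigma> \<longlongrightarrow> L) at_top" by blast
 have "(vertical_mean p F \<sigma> \<longlongrightarrow> L) at_top" if "carlson p a \<omega> F X" for \<omega> F
  using bspec[OF L, of "(\<omega>, F)"] that by simp
 then show ?thesis by blast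
qed blast

text \<open>The approximating polynomials depend on the bound \<open>X\<close>; two points of the Carlson set are compared
 through the larger of their bounds.\<close>

lemma carlson_mean_limit:
 "\<exists>M. \<forall>\<omega> F X \<sigma>. carlson p a \<omega> F X \<longrightarrow> \<sigma> > 0 \<longrightarrow> (vertical_mean p F \<sigma> \<longlongrightarrow> M \<sigma>) at_top"
proof (cases "\<exists>\<omega> F X. carlson p a \<omega> F X")
 case True
 then obtain \<omega>0 F0 X0 where c0: "carlson p a \<omega>0 F0 X0" by blast
 have "(vertical_mean p F \<sigma> \<longlongrightarrow> Lim at_top (vertical_mean p F0 \<sigma>)) at_top"
  if c: "carlson p a \<omega> F X" and \<sigma>: "\<sigma> > 0" for \<omega> F X \<sigma>
 proof -
  have cc: "carlson p a \<omega>0 F0 (max X X0)" "carlson p a \<omega> F (max X X0)"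
   using carlson_mono[OF c0] carlson_mono[OF c] by simp_all
  from carlson_common_limit_bounded[OF \<sigma>, of p a "max X X0"] obtain L
   where L: "\<forall>\<omega> F. carlson p a \<omega> F (max X X0) \<longrightarrow> (vertical_mean p F \<sigma> \<longlongrightarrow> L) at_top" by blast
  have "(vertical_mean p F0 \<sigma> \<longlongrightarrow> L) at_top" "(vertical_mean p F \<sigma> \<longlongrightarrow> L) at_top"
   by (rule L[rule_format, OF cc(1)], rule L[rule_format, OF cc(2)])
  then show ?thesis using tendsto_Lim[OF trivial_limit_at_top_linorder, of "vertical_mean p F0 \<sigma>" L] by simp
 qed
 then show ?thesis by (intro exI[of _ "\<lambda>\<sigma>. Lim at_top (vertical_mean p F0 \<sigma>)"] allI impI)
next
 case False
 then have no: "\<not> carlson p a \<omega> F X" for \<omega> F X by simp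
 show ?thesis by (simp only: no) simp
qed

context carlson begin

lemma F_growth:
 assumes \<kappa>: "\<kappa> > 0" and \<eta>: "\<eta> > 0"
 shows "\<exists>C\<ge>0. \<forall>\<nu>\<ge>\<kappa>. \<forall>t. norm (F (Complex \<nu> t)) powr p \<le> C + \<eta> * \<bar>t\<bar>"
proof -
 define e where "e = \<eta> / 2 powr p"
 have e: "e > 0" using \<eta> by (simp add: e_def)
 obtain K r where KR: "\<forall>\<omega> F. carlson p a \<omega> F X \<longrightarrow> (\<forall>\<sigma>\<ge>\<kappa>.
    (\<forall>T\<ge>1. vertical_mean p (\<lambda>s. F s - twisted_poly K r \<omega> s) \<sigma> T \<le> e) \<and>
    (\<forall>t. norm (F (Complex \<sigma> t) - twisted_poly K r \<omega> (Complex \<sigma> t)) powr p \<le> e * (1 + \<bar>t\<bar>)))"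
  using carlson_approximation[OF e \<kappa> carlson_axioms] by blast
 have Kr: "norm (F (Complex \<nu> t) - twisted_poly K r \<omega> (Complex \<nu> t)) powr p \<le> e * (1 + \<bar>t\<bar>)" if "\<nu> \<ge> \<kappa>" for \<nu> t
  using KR carlson_axioms that by simp
 define B where "B = (\<Sum>n=1..K. norm (r n)) powr p"
 have "norm (F (Complex \<nu> t)) powr p \<le> (2 powr p * B + \<eta>) + \<eta> * \<bar>t\<bar>" if \<nu>: "\<nu> \<ge> \<kappa>" for \<nu> t
 proof -
  let ?R = "twisted_poly K r \<omega> (Complex \<nu> t)"
  have "norm (F (Complex \<nu> t)) \<le> norm ?R + norm (F (Complex \<nu> t) - ?R)"
   by (metis add.commute diff_add_cancel norm_triangle_ineq)
  then have "norm (F (Complex \<nu> t)) powr p \<le> (norm ?R + norm (F (Complex \<nu> t) - ?R)) powr p"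
   using p1 by (intro powr_mono2) auto
  also have "\<dots> \<le> 2 powr p * (norm ?R powr p + norm (F (Complex \<nu> t) - ?R) powr p)"
   using p1 by (intro powr_add_le) auto
  also have "\<dots> \<le> 2 powr p * (B + e * (1 + \<bar>t\<bar>))"
   using twisted_poly_powr_bound[OF \<omega>, of \<nu> p K r t] \<nu> \<kappa> p1 Kr[OF \<nu>, of t]
   by (intro mult_left_mono add_mono) (auto simp: B_def)
  also have "\<dots> = 2 powr p * B + (2 powr p * e) * (1 + \<bar>t\<bar>)" by (simp only: distrib_left mult.assoc)
  also have "2 powr p * e = \<eta>" by (simp add: e_def)
  also have "2 powr p * B + \<eta> * (1 + \<bar>t\<bar>) = (2 powr p * B + \<eta>) + \<eta> * \<bar>t\<bar>" by (simp add: algebra_simps)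
  finally show ?thesis .
 qed
 then show ?thesis using \<eta> by (intro exI[of _ "2 powr p * B + \<eta>"]) (auto simp: B_def)
qed

lemma F_deriv_bound:
 assumes r: "r > 0" "r < Re z" and B: "\<And>w. norm (z - w) = r \<Longrightarrow> norm (F w - c) \<le> B"
 shows "norm (deriv F z) \<le> B / r"
proof -
 have sub: "cball z r \<subseteq> half_plane 0"
 proof
  fix w assume "w \<in> cball z r"
  then have "\<bar>Re (z - w)\<bar> \<le> r" using abs_Re_le_cmod[of "z - w"] by (simp add: dist_norm)
  then show "w \<in> half_plane 0" using r by (simp add: half_plane_def)
 qed
 then have z: "z \<in> half_plane 0" using r by auto
 have hol: "(\<lambda>w. F w - c) holomorphic_on half_plane 0" by (intro holomorphic_intros F_holomorphic)
 have "norm ((deriv ^^ 1) (\<lambda>w. F w - c) z) \<le> fact 1 * B / r ^ 1"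
 proof (rule Cauchy_inequality)
  show "(\<lambda>w. F w - c) holomorphic_on ball z r" using sub by (intro holomorphic_on_subset[OF hol]) auto
  show "continuous_on (cball z r) (\<lambda>w. F w - c)"
   using sub by (intro holomorphic_on_imp_continuous_on holomorphic_on_subset[OF hol])
 qed (use r B in auto)
 moreover have "deriv (\<lambda>w. F w - c) z = deriv F z"
  using holomorphic_on_imp_differentiable_at[OF F_holomorphic open_half_plane z] by simp
 ultimately show ?thesis by simp
qed

lemma F_limit:
 assumes s: "Re s \<ge> 2"
 shows "norm (F s - a 1) \<le> 3 * coeff_tail a 1 * exp (- Re s / 2)"
proof -
 let ?g = "\<lambda>n. a (Suc n) * torus_char \<omega> (Suc n) * of_nat (Suc n) powr (- s)"
 have g: "?g sums F s" using s by (intro F_sums) auto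
 let ?c = "3 * exp (- Re s / 2)"
 have le: "norm (?g (n + 1)) \<le> ?c * coeff_weight a (n + 1)" for n
 proof -
  let ?m = "real (Suc (n + 1))"
  have "?m powr (- Re s) = ?m powr (-(Re s - 2)) * ?m powr (-2)" by (simp add: powr_add[symmetric] del: of_nat_Suc)
  also have "?m powr (-(Re s - 2)) \<le> 2 powr (-(Re s - 2))" using s by (intro powr_mono2') auto
  also have "2 powr (-(Re s - 2)) = exp (-(Re s - 2) * ln 2)" by (simp add: powr_def)
  also have "\<dots> \<le> exp (-(Re s - 2) * (1/2))"
  proof -
   have "(1::real)/2 \<le> ln 2" using ln2_ge_two_thirds by linarith
   then have "(Re s - 2) * (1/2) \<le> (Re s - 2) * ln 2" using s by (intro mult_left_mono) auto
   then show ?thesis by (simp only: exp_le_cancel_iff mult_minus_left neg_le_iff_le)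
  qed
  also have "\<dots> = exp 1 * exp (- Re s / 2)" by (simp add: exp_add[symmetric] diff_divide_distrib)
  also have "\<dots> \<le> ?c" using exp_le by simp
  finally have "?m powr (- Re s) \<le> ?c * ?m powr (-2)" by (simp add: mult_right_mono)
  then have "norm (a (Suc (n+1))) * ?m powr (- Re s) \<le> norm (a (Suc (n+1))) * (?c * ?m powr (-2))" by (intro mult_left_mono) auto
  then show ?thesis
   by (simp add: norm_mult norm_torus_char[OF \<omega>] norm_nat_powr coeff_weight_def mult_ac del: of_nat_Suc)
 qed
 have "F s - a 1 = (\<Sum>n. ?g (n + 1))"
  using suminf_minus_initial_segment[OF sums_summable[OF g], of 1] g by (simp add: sums_iff)
 also have "norm \<dots> \<le> (\<Sum>n. ?c * coeff_weight a (n + 1))"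
 proof (rule norm_suminf_le)
  show "norm (?g (n + 1)) \<le> ?c * coeff_weight a (n + 1)" for n by (rule le)
  show "summable (\<lambda>n. ?c * coeff_weight a (n + 1))"
   using coeff_weight_summable by (intro summable_mult) (simp only: summable_iff_shift)
 qed
 also have "\<dots> = ?c * coeff_tail a 1"
  unfolding coeff_tail_def suminf_minus_initial_segment[OF coeff_weight_summable, symmetric]
  using coeff_weight_summable by (intro suminf_mult) (simp only: summable_iff_shift)
 finally show ?thesis by (simp add: mult_ac)
qed

text \<open>For \<open>\<nu> \<le> 3\<close> Cauchy's estimate on a small circle and \<open>F_growth\<close>; for larger
 \<open>\<nu>\<close> the function is exponentially close to its first coefficient. The exponential decay makes the
 horizontal edges of a half-strip integrable.\<close>

lemma gradient_growth:
 assumes \<kappa>: "\<kappa> > 0" and \<eta>: "\<eta> > 0"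
 shows "\<exists>C\<ge>0. \<forall>\<nu>\<ge>\<kappa>. \<forall>t. (1 + norm (F (Complex \<nu> t))) powr (p - 1) * norm (deriv F (Complex \<nu> t)) \<le> (C + \<eta> * \<bar>t\<bar>) * exp (- \<nu> / 2)"
proof -
 define r where "r = min (\<kappa> / 2) 1"
 have r: "r > 0" "r \<le> 1" "r \<le> \<kappa> / 2" using \<kappa> by (auto simp: r_def)
 (* Chosen so that the coefficient of |t| in the final bound is exactly \<eta>. *)
 define \<eta>' where "\<eta>' = \<eta> * r / (2 powr (p - 1) * exp (3/2))"
 have \<eta>': "\<eta>' > 0" using \<eta> r by (simp add: \<eta>'_def)
 obtain C where C: "C \<ge> 0" "\<And>\<nu> t. \<nu> \<ge> \<kappa> / 2 \<Longrightarrow> norm (F (Complex \<nu> t)) powr p \<le> C + \<eta>' * \<bar>t\<bar>"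
  using F_growth[of "\<kappa> / 2" \<eta>'] \<kappa> \<eta>' by auto
 define C1 where "C1 = 2 powr (p - 1) / r * exp (3/2) * (1 + C + \<eta>')"
 have near: "(1 + norm (F (Complex \<nu> t))) powr (p - 1) * norm (deriv F (Complex \<nu> t)) \<le> (C1 + \<eta> * \<bar>t\<bar>) * exp (- \<nu> / 2)"
  if \<nu>: "\<nu> \<ge> \<kappa>" "\<nu> \<le> 3" for \<nu> t
 proof -
  define Y where "Y = 1 + C + \<eta>' * (\<bar>t\<bar> + 1)"
  have Y: "Y \<ge> 1" using C \<eta>' by (simp add: Y_def)
  define M where "M = Y powr (1/p)"
  have M1: "M \<ge> 1" using Y p1 by (simp add: M_def ge_one_powr_ge_zero)
  have Mp: "M powr p = Y" using Y p1 by (simp add: M_def powr_powr)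
  have FM: "norm (F w) \<le> M" if w: "Re w \<ge> \<kappa> / 2" "\<bar>Im w\<bar> \<le> \<bar>t\<bar> + 1" for w
  proof -
   have "norm (F w) powr p \<le> C + \<eta>' * \<bar>Im w\<bar>" using C(2)[of "Re w" "Im w"] w by simp
   also have "\<eta>' * \<bar>Im w\<bar> \<le> \<eta>' * (\<bar>t\<bar> + 1)" using w \<eta>' by (intro mult_left_mono) auto
   also have "C + \<eta>' * (\<bar>t\<bar> + 1) \<le> Y" by (simp add: Y_def)
   finally have "(norm (F w) powr p) powr (1/p) \<le> Y powr (1/p)" using p1 by (intro powr_mono2) auto
   then show ?thesis using p1 by (simp add: M_def powr_powr)
  qed
  have "norm (F (Complex \<nu> t)) \<le> M" using \<nu> \<kappa> by (intro FM) auto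
  then have "(1 + norm (F (Complex \<nu> t))) powr (p - 1) \<le> (2 * M) powr (p - 1)" using M1 p1 by (intro powr_mono2) auto
  moreover have "norm (deriv F (Complex \<nu> t)) \<le> M / r"
  proof (rule F_deriv_bound[where c = 0])
   show "r < Re (Complex \<nu> t)" using r \<nu> \<kappa> by simp
   fix w assume w: "norm (Complex \<nu> t - w) = r"
   have "\<bar>Re (Complex \<nu> t - w)\<bar> \<le> r" "\<bar>Im (Complex \<nu> t - w)\<bar> \<le> r"
    using abs_Re_le_cmod[of "Complex \<nu> t - w"] abs_Im_le_cmod[of "Complex \<nu> t - w"] w by simp_all
   then have "norm (F w) \<le> M" using r \<nu> by (intro FM) auto
   then show "norm (F w - 0) \<le> M" by simp
  qed (rule r)
  ultimately have "(1 + norm (F (Complex \<nu> t))) powr (p - 1) * norm (deriv F (Complex \<nu> t)) \<le> (2 * M) powr (p - 1) * (M / r)"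
   by (intro mult_mono) auto
  also have "\<dots> = 2 powr (p - 1) / r * (M * M powr (p - 1))" using M1 by (simp add: powr_mult)
  also have "M * M powr (p - 1) = Y" using M1 Mp powr_mult_base[of M "p - 1"] by simp
  also have "2 powr (p - 1) / r * Y \<le> 2 powr (p - 1) / r * Y * (exp (3/2) * exp (- \<nu> / 2))"
  proof -
   have "exp (3/2) * exp (- \<nu> / 2) = exp (3/2 - \<nu> / 2)" by (simp add: exp_add[symmetric])
   then have "1 \<le> exp (3/2) * exp (- \<nu> / 2)" using \<nu> by simp
   then have "2 powr (p - 1) / r * Y * 1 \<le> 2 powr (p - 1) / r * Y * (exp (3/2) * exp (- \<nu> / 2))"
    using r Y by (intro mult_left_mono) auto
   then show ?thesis by simp
  qed
  also have "\<dots> = (2 powr (p - 1) / r * exp (3/2) * Y) * exp (- \<nu> / 2)" by simp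
  also have "2 powr (p - 1) / r * exp (3/2) * Y = C1 + 2 powr (p - 1) / r * exp (3/2) * \<eta>' * \<bar>t\<bar>"
   by (simp add: C1_def Y_def algebra_simps add_divide_distrib)
  also have "2 powr (p - 1) / r * exp (3/2) * \<eta>' = \<eta>" using r by (simp add: \<eta>'_def)
  finally show ?thesis .
 qed
 define D where "D = 3 * coeff_tail a 1"
 have D: "D \<ge> 0" using coeff_tail_nonneg by (simp add: D_def)
 define C2 where "C2 = (1 + norm (a 1) + D) powr (p - 1) * (D * exp (1/2))"
 have far: "(1 + norm (F (Complex \<nu> t))) powr (p - 1) * norm (deriv F (Complex \<nu> t)) \<le> C2 * exp (- \<nu> / 2)" if \<nu>: "\<nu> \<ge> 3" for \<nu> t
 proof -
  have lim: "norm (F w - a 1) \<le> D * exp (- Re w / 2)" if "Re w \<ge> 2" for w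
   using F_limit[OF that] by (simp add: D_def)
  have "norm (F (Complex \<nu> t)) \<le> norm (a 1) + norm (F (Complex \<nu> t) - a 1)"
   by (metis add.commute diff_add_cancel norm_triangle_ineq)
  also have "norm (F (Complex \<nu> t) - a 1) \<le> D * 1"
  proof -
   have "norm (F (Complex \<nu> t) - a 1) \<le> D * exp (- \<nu> / 2)" using lim[of "Complex \<nu> t"] \<nu> by simp
   also have "\<dots> \<le> D * 1" using D \<nu> by (intro mult_left_mono) auto
   finally show ?thesis .
  qed
  finally have "(1 + norm (F (Complex \<nu> t))) powr (p - 1) \<le> (1 + norm (a 1) + D) powr (p - 1)"
   using p1 by (intro powr_mono2) auto
  moreover have "norm (deriv F (Complex \<nu> t)) \<le> D * exp (1/2 - \<nu>/2) / 1"
  proof (rule F_deriv_bound[where c = "a 1"])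
   show "1 < Re (Complex \<nu> t)" using \<nu> by simp
   fix w assume w: "norm (Complex \<nu> t - w) = 1"
   have "\<bar>Re (Complex \<nu> t - w)\<bar> \<le> 1" using abs_Re_le_cmod[of "Complex \<nu> t - w"] w by simp
   then have Rw: "Re w \<ge> \<nu> - 1" by simp
   then have "norm (F w - a 1) \<le> D * exp (- Re w / 2)" using \<nu> by (intro lim) simp
   also have "\<dots> \<le> D * exp (1/2 - \<nu>/2)" using Rw D by (intro mult_left_mono) auto
   finally show "norm (F w - a 1) \<le> D * exp (1/2 - \<nu>/2)" .
  qed simp
  ultimately have "(1 + norm (F (Complex \<nu> t))) powr (p - 1) * norm (deriv F (Complex \<nu> t))
    \<le> (1 + norm (a 1) + D) powr (p - 1) * (D * exp (1/2 - \<nu>/2) / 1)" by (intro mult_mono) auto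
  also have "\<dots> = C2 * exp (- \<nu> / 2)" by (simp add: C2_def exp_add[symmetric])
  finally show ?thesis .
 qed
 show ?thesis
 proof (intro exI[of _ "max C1 C2"] conjI allI impI)
  have "C2 \<ge> 0" using D by (simp add: C2_def)
  then show "0 \<le> max C1 C2" by simp
  fix \<nu> t :: real assume \<nu>: "\<nu> \<ge> \<kappa>"
  show "(1 + norm (F (Complex \<nu> t))) powr (p - 1) * norm (deriv F (Complex \<nu> t)) \<le> (max C1 C2 + \<eta> * \<bar>t\<bar>) * exp (- \<nu> / 2)"
  proof (cases "\<nu> \<le> 3")
   case True
   have "(C1 + \<eta> * \<bar>t\<bar>) * exp (- \<nu> / 2) \<le> (max C1 C2 + \<eta> * \<bar>t\<bar>) * exp (- \<nu> / 2)" by (intro mult_right_mono) auto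
   then show ?thesis using near[OF \<nu> True] by (rule order_trans[rotated])
  next
   case False
   have "C2 \<le> max C1 C2 + \<eta> * \<bar>t\<bar>" using \<eta> by (simp add: add_increasing2)
   then have "C2 * exp (- \<nu> / 2) \<le> (max C1 C2 + \<eta> * \<bar>t\<bar>) * exp (- \<nu> / 2)" by (intro mult_right_mono) auto
   then show ?thesis using far[of \<nu> t] False by linarith
  qed
 qed
qed

end

section \<open>Green's formula for the regularized modulus\<close>

text \<open>Since \<open>|F|\<^sup>p\<close> need not be smooth at the zeros, Green's formula is applied to \<open>u =
 (|F|\<^sup>2 + \<epsilon>) powr (p/2)\<close>. Below, \<open>ux\<close>, \<open>ut\<close>, \<open>uxx\<close>,
 \<open>utt\<close> are its partial derivatives and \<open>lap\<close> its Laplacian.\<close>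

locale hardy_stein =
 fixes p :: real and F :: "complex \<Rightarrow> complex"
 assumes p1: "1 \<le> p" and F_hol: "F holomorphic_on half_plane 0"
begin

definition re0 :: "real \<Rightarrow> real \<Rightarrow> real" where "re0 x t = Re (F (Complex x t))"
definition im0 :: "real \<Rightarrow> real \<Rightarrow> real" where "im0 x t = Im (F (Complex x t))"
definition re1 :: "real \<Rightarrow> real \<Rightarrow> real" where "re1 x t = Re (deriv F (Complex x t))"
definition im1 :: "real \<Rightarrow> real \<Rightarrow> real" where "im1 x t = Im (deriv F (Complex x t))"
definition re2 :: "real \<Rightarrow> real \<Rightarrow> real" where "re2 x t = Re (deriv (deriv F) (Complex x t))"
definition im2 :: "real \<Rightarrow> real \<Rightarrow> real" where "im2 x t = Im (deriv (deriv F) (Complex x t))"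

lemma deriv_hol: "deriv F holomorphic_on half_plane 0" "deriv (deriv F) holomorphic_on half_plane 0"
 by (intro holomorphic_deriv F_hol open_half_plane)+

lemma horizontal_derivative:
 assumes G: "G holomorphic_on half_plane 0" and x: "x > 0"
 shows "((\<lambda>x. Re (G (Complex x t))) has_real_derivative Re (deriv G (Complex x t))) (at x)"
  and "((\<lambda>x. Im (G (Complex x t))) has_real_derivative Im (deriv G (Complex x t))) (at x)"
proof -
 have z: "Complex x t \<in> half_plane 0" using x by (simp add: half_plane_def)
 have d: "(G has_field_derivative deriv G (Complex x t)) (at (Complex x t))"
  by (rule holomorphic_derivI[OF G open_half_plane z])
 have c: "((\<lambda>x. Complex x t) has_vector_derivative 1) (at x)"
  unfolding Complex_eq by (auto intro!: derivative_eq_intros)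
 have v: "((\<lambda>x. G (Complex x t)) has_vector_derivative 1 * deriv G (Complex x t)) (at x)"
  using field_vector_diff_chain_at[OF c d] by (simp add: o_def)
 then show "((\<lambda>x. Re (G (Complex x t))) has_real_derivative Re (deriv G (Complex x t))) (at x)"
  "((\<lambda>x. Im (G (Complex x t))) has_real_derivative Im (deriv G (Complex x t))) (at x)"
  using bounded_linear.has_vector_derivative[OF bounded_linear_Re v] bounded_linear.has_vector_derivative[OF bounded_linear_Im v]
  by (simp_all add: has_real_derivative_iff_has_vector_derivative)
qed

lemma vertical_derivative:
 assumes G: "G holomorphic_on half_plane 0" and x: "x > 0"
 shows "((\<lambda>t. Re (G (Complex x t))) has_real_derivative - Im (deriv G (Complex x t))) (at t)"
  and "((\<lambda>t. Im (G (Complex x t))) has_real_derivative Re (deriv G (Complex x t))) (at t)"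
proof -
 have z: "Complex x t \<in> half_plane 0" using x by (simp add: half_plane_def)
 have d: "(G has_field_derivative deriv G (Complex x t)) (at (Complex x t))"
  by (rule holomorphic_derivI[OF G open_half_plane z])
 have c: "((\<lambda>t. Complex x t) has_vector_derivative \<i>) (at t)"
  unfolding Complex_eq by (auto intro!: derivative_eq_intros)
 have v: "((\<lambda>t. G (Complex x t)) has_vector_derivative \<i> * deriv G (Complex x t)) (at t)"
  using field_vector_diff_chain_at[OF c d] by (simp add: o_def)
 then show "((\<lambda>t. Re (G (Complex x t))) has_real_derivative - Im (deriv G (Complex x t))) (at t)"
  "((\<lambda>t. Im (G (Complex x t))) has_real_derivative Re (deriv G (Complex x t))) (at t)"
  using bounded_linear.has_vector_derivative[OF bounded_linear_Re v] bounded_linear.has_vector_derivative[OF bounded_linear_Im v]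
  by (simp_all add: has_real_derivative_iff_has_vector_derivative)
qed

lemma derivs_x:
 assumes "x > 0"
 shows "((\<lambda>x. re0 x t) has_real_derivative re1 x t) (at x)" "((\<lambda>x. im0 x t) has_real_derivative im1 x t) (at x)"
  "((\<lambda>x. re1 x t) has_real_derivative re2 x t) (at x)" "((\<lambda>x. im1 x t) has_real_derivative im2 x t) (at x)"
 unfolding re0_def im0_def re1_def im1_def re2_def im2_def by (rule horizontal_derivative F_hol deriv_hol assms)+

lemma derivs_t:
 assumes "x > 0"
 shows "((\<lambda>t. re0 x t) has_real_derivative - im1 x t) (at t)" "((\<lambda>t. im0 x t) has_real_derivative re1 x t) (at t)"
  "((\<lambda>t. re1 x t) has_real_derivative - im2 x t) (at t)" "((\<lambda>t. im1 x t) has_real_derivative re2 x t) (at t)"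
 unfolding re0_def im0_def re1_def im1_def re2_def im2_def by (rule vertical_derivative F_hol deriv_hol assms)+

lemma continuous_pair:
 assumes G: "G holomorphic_on half_plane 0"
 shows "continuous_on ({0<..} \<times> UNIV) (\<lambda>z. Re (G (Complex (fst z) (snd z))))"
  "continuous_on ({0<..} \<times> UNIV) (\<lambda>z. Im (G (Complex (fst z) (snd z))))"
 by (intro continuous_intros continuous_on_compose2[OF holomorphic_on_imp_continuous_on[OF G]];
   auto simp: Complex_eq half_plane_def intro!: continuous_intros)+

lemma continuous_coords:
 "continuous_on ({0<..} \<times> UNIV) (\<lambda>z. re0 (fst z) (snd z))" "continuous_on ({0<..} \<times> UNIV) (\<lambda>z. im0 (fst z) (snd z))"
 "continuous_on ({0<..} \<times> UNIV) (\<lambda>z. re1 (fst z) (snd z))" "continuous_on ({0<..} \<times> UNIV) (\<lambda>z. im1 (fst z) (snd z))"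
 "continuous_on ({0<..} \<times> UNIV) (\<lambda>z. re2 (fst z) (snd z))" "continuous_on ({0<..} \<times> UNIV) (\<lambda>z. im2 (fst z) (snd z))"
 unfolding re0_def im0_def re1_def im1_def re2_def im2_def by (rule continuous_pair F_hol deriv_hol)+

definition reg :: "real \<Rightarrow> real \<Rightarrow> real \<Rightarrow> real" where
 "reg \<epsilon> x t = (re0 x t)\<^sup>2 + (im0 x t)\<^sup>2 + \<epsilon>"
definition ux :: "real \<Rightarrow> real \<Rightarrow> real \<Rightarrow> real" where
 "ux \<epsilon> x t = p * reg \<epsilon> x t powr (p/2 - 1) * (re0 x t * re1 x t + im0 x t * im1 x t)"
definition ut :: "real \<Rightarrow> real \<Rightarrow> real \<Rightarrow> real" where
 "ut \<epsilon> x t = p * reg \<epsilon> x t powr (p/2 - 1) * (im0 x t * re1 x t - re0 x t * im1 x t)"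
definition uxx :: "real \<Rightarrow> real \<Rightarrow> real \<Rightarrow> real" where
 "uxx \<epsilon> x t = p * (p - 2) * reg \<epsilon> x t powr (p/2 - 2) * (re0 x t * re1 x t + im0 x t * im1 x t)\<^sup>2
   + p * reg \<epsilon> x t powr (p/2 - 1) * ((re1 x t)\<^sup>2 + (im1 x t)\<^sup>2 + re0 x t * re2 x t + im0 x t * im2 x t)"
definition utt :: "real \<Rightarrow> real \<Rightarrow> real \<Rightarrow> real" where
 "utt \<epsilon> x t = p * (p - 2) * reg \<epsilon> x t powr (p/2 - 2) * (im0 x t * re1 x t - re0 x t * im1 x t)\<^sup>2
   + p * reg \<epsilon> x t powr (p/2 - 1) * ((re1 x t)\<^sup>2 + (im1 x t)\<^sup>2 - re0 x t * re2 x t - im0 x t * im2 x t)"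
definition lap :: "real \<Rightarrow> real \<Rightarrow> real \<Rightarrow> real" where
 "lap \<epsilon> x t = ((re1 x t)\<^sup>2 + (im1 x t)\<^sup>2) * reg \<epsilon> x t powr (p/2 - 2) *
   (p\<^sup>2 * ((re0 x t)\<^sup>2 + (im0 x t)\<^sup>2) + 2 * p * \<epsilon>)"

lemma reg_pos: "\<epsilon> > 0 \<Longrightarrow> reg \<epsilon> x t > 0"
 by (simp add: reg_def add_nonneg_pos)

lemma lap_nonneg: "\<epsilon> > 0 \<Longrightarrow> lap \<epsilon> x t \<ge> 0"
 using p1 by (simp add: lap_def)

lemma lap_eq:
 assumes "\<epsilon> > 0" shows "uxx \<epsilon> x t + utt \<epsilon> x t = lap \<epsilon> x t"
proof -
 define s A B A1 B1 where d: "s = reg \<epsilon> x t" "A = re0 x t" "B = im0 x t" "A1 = re1 x t" "B1 = im1 x t"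
 have s: "s > 0" "s = A\<^sup>2 + B\<^sup>2 + \<epsilon>" using reg_pos[OF assms] by (auto simp: d reg_def)
 have e: "s powr (p/2 - 1) = s powr (p/2 - 2) * s"
  using s(1) powr_mult_base[of s "p/2 - 2"] by (simp add: mult.commute)
 have "uxx \<epsilon> x t + utt \<epsilon> x t = p * (p - 2) * s powr (p/2 - 2) * ((A * A1 + B * B1)\<^sup>2 + (B * A1 - A * B1)\<^sup>2)
   + 2 * p * s powr (p/2 - 1) * (A1\<^sup>2 + B1\<^sup>2)"
  unfolding uxx_def utt_def d[symmetric] by (simp add: algebra_simps)
 also have "(A * A1 + B * B1)\<^sup>2 + (B * A1 - A * B1)\<^sup>2 = (A\<^sup>2 + B\<^sup>2) * (A1\<^sup>2 + B1\<^sup>2)"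
  by (simp add: power2_eq_square algebra_simps)
 also have "p * (p - 2) * s powr (p/2 - 2) * ((A\<^sup>2 + B\<^sup>2) * (A1\<^sup>2 + B1\<^sup>2)) + 2 * p * s powr (p/2 - 1) * (A1\<^sup>2 + B1\<^sup>2)
   = (A1\<^sup>2 + B1\<^sup>2) * s powr (p/2 - 2) * (p * (p - 2) * (A\<^sup>2 + B\<^sup>2) + 2 * p * s)"
  unfolding e by (simp add: algebra_simps)
 also have "p * (p - 2) * (A\<^sup>2 + B\<^sup>2) + 2 * p * s = p\<^sup>2 * (A\<^sup>2 + B\<^sup>2) + 2 * p * \<epsilon>"
  unfolding s(2) by (simp add: power2_eq_square algebra_simps)
 finally show ?thesis unfolding lap_def d .
qed

lemma reg_derivs:
 assumes "x > 0"
 shows "((\<lambda>x. reg \<epsilon> x t) has_real_derivative 2 * (re0 x t * re1 x t + im0 x t * im1 x t)) (at x)"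
  "((\<lambda>t. reg \<epsilon> x t) has_real_derivative 2 * (im0 x t * re1 x t - re0 x t * im1 x t)) (at t)" unfolding reg_def
 by (auto intro!: derivative_eq_intros derivs_x derivs_t assms simp: algebra_simps)

lemma u_derivs:
 assumes x: "x > 0" and \<epsilon>: "\<epsilon> > 0"
 shows "((\<lambda>x. reg \<epsilon> x t powr (p/2)) has_real_derivative ux \<epsilon> x t) (at x)"
  "((\<lambda>x. ux \<epsilon> x t) has_real_derivative uxx \<epsilon> x t) (at x)"
  "((\<lambda>t. ut \<epsilon> x t) has_real_derivative utt \<epsilon> x t) (at t)"
proof -
 have e1: "p / 2 - 1 - 1 = p / 2 - 2" by simp
 have pw: "((\<lambda>y. g y powr q) has_real_derivative q * g y powr (q - 1) * g') (at y)"
  if "(g has_real_derivative g') (at y)" "g y > 0" for g g' y and q :: real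
  using has_real_derivative_powr'[OF that(1) _ that(2), of "\<lambda>_. q" 0] that
  by (auto simp: powr_diff field_simps intro!: DERIV_cong)
 show "((\<lambda>x. reg \<epsilon> x t powr (p/2)) has_real_derivative ux \<epsilon> x t) (at x)"
  using pw[OF reg_derivs(1)[OF x] reg_pos[OF \<epsilon>]] by (rule DERIV_cong) (simp add: ux_def)
 show "((\<lambda>x. ux \<epsilon> x t) has_real_derivative uxx \<epsilon> x t) (at x)" unfolding ux_def
  by (rule DERIV_cong, rule DERIV_mult[OF DERIV_cmult[OF pw[OF reg_derivs(1)[OF x] reg_pos[OF \<epsilon>]]]
    DERIV_add[OF DERIV_mult[OF derivs_x(1)[OF x] derivs_x(3)[OF x]] DERIV_mult[OF derivs_x(2)[OF x] derivs_x(4)[OF x]]]])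
   (simp add: uxx_def e1 power2_eq_square algebra_simps)
 show "((\<lambda>t. ut \<epsilon> x t) has_real_derivative utt \<epsilon> x t) (at t)" unfolding ut_def
  by (rule DERIV_cong, rule DERIV_mult[OF DERIV_cmult[OF pw[OF reg_derivs(2)[OF x] reg_pos[OF \<epsilon>]]]
    DERIV_diff[OF DERIV_mult[OF derivs_t(2)[OF x] derivs_t(3)[OF x]] DERIV_mult[OF derivs_t(1)[OF x] derivs_t(4)[OF x]]]])
   (simp add: utt_def e1 power2_eq_square algebra_simps)
qed

lemma continuous_derivs:
 assumes \<epsilon>: "\<epsilon> > 0"
 shows "continuous_on ({0<..} \<times> UNIV) (\<lambda>z. reg \<epsilon> (fst z) (snd z) powr (p/2))"
  "continuous_on ({0<..} \<times> UNIV) (\<lambda>z. ux \<epsilon> (fst z) (snd z))"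
  "continuous_on ({0<..} \<times> UNIV) (\<lambda>z. ut \<epsilon> (fst z) (snd z))"
  "continuous_on ({0<..} \<times> UNIV) (\<lambda>z. uxx \<epsilon> (fst z) (snd z))"
  "continuous_on ({0<..} \<times> UNIV) (\<lambda>z. utt \<epsilon> (fst z) (snd z))"
  "continuous_on ({0<..} \<times> UNIV) (\<lambda>z. lap \<epsilon> (fst z) (snd z))"
proof -
 have r: "continuous_on ({0<..} \<times> UNIV) (\<lambda>z. reg \<epsilon> (fst z) (snd z))"
  unfolding reg_def by (intro continuous_intros continuous_coords)
 have pr: "continuous_on ({0<..} \<times> UNIV) (\<lambda>z. reg \<epsilon> (fst z) (snd z) powr q)" for q
  by (intro continuous_on_powr r continuous_intros) (use reg_pos[OF \<epsilon>] in \<open>auto simp: less_le\<close>)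
 show "continuous_on ({0<..} \<times> UNIV) (\<lambda>z. reg \<epsilon> (fst z) (snd z) powr (p/2))" by (rule pr)
 show "continuous_on ({0<..} \<times> UNIV) (\<lambda>z. ux \<epsilon> (fst z) (snd z))"
  "continuous_on ({0<..} \<times> UNIV) (\<lambda>z. ut \<epsilon> (fst z) (snd z))"
  "continuous_on ({0<..} \<times> UNIV) (\<lambda>z. uxx \<epsilon> (fst z) (snd z))"
  "continuous_on ({0<..} \<times> UNIV) (\<lambda>z. utt \<epsilon> (fst z) (snd z))"
  "continuous_on ({0<..} \<times> UNIV) (\<lambda>z. lap \<epsilon> (fst z) (snd z))" unfolding ux_def ut_def uxx_def utt_def lap_def
  by (intro continuous_intros continuous_coords pr)+
qed

lemma section_continuous:
 assumes "continuous_on ({0<..} \<times> UNIV) (\<lambda>z. f (fst z) (snd z))" "x > (0::real)"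
 shows "continuous_on A (\<lambda>t::real. f x t :: real)"
proof -
 have "continuous_on A (\<lambda>t. f (fst (x, t)) (snd (x, t)))"
  by (rule continuous_on_compose2[OF assms(1)]) (use assms(2) in \<open>auto intro!: continuous_intros\<close>)
 then show ?thesis by simp
qed

lemma rectangle_continuous:
 assumes "continuous_on ({0<..} \<times> UNIV) (\<lambda>z. f (fst z) (snd z))" "A \<subseteq> {0<..}"
 shows "continuous_on (A \<times> B) (\<lambda>(x::real, t::real). f x t :: real)"
 unfolding case_prod_beta using assms by (intro continuous_on_subset[OF assms(1)]) auto

lemma leibniz_vertical:
 fixes f f' :: "real \<Rightarrow> real \<Rightarrow> real"
 assumes f: "\<And>x t. x > 0 \<Longrightarrow> ((\<lambda>x. f x t) has_real_derivative f' x t) (at x)"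
  and cf: "continuous_on ({0<..} \<times> UNIV) (\<lambda>z. f (fst z) (snd z))"
  and cf': "continuous_on ({0<..} \<times> UNIV) (\<lambda>z. f' (fst z) (snd z))" and x: "x > 0"
 shows "((\<lambda>x. integral {-T..T} (f x)) has_real_derivative integral {-T..T} (f' x)) (at x)"
proof -
 have "((\<lambda>x. integral (cbox (-T) T) (f x)) has_real_derivative integral (cbox (-T) T) (f' x)) (at x within {0<..})"
 proof (rule leibniz_rule_field_derivative)
  show "((\<lambda>x. f x t) has_real_derivative f' x t) (at x within {0<..})" if "x \<in> {0<..}" for x t
   using f that by (auto intro: has_field_derivative_at_within)
  show "f x integrable_on cbox (-T) T" if "x \<in> {0<..}" for x
   using section_continuous[OF cf] that by (auto intro!: integrable_continuous_interval)
  show "continuous_on ({0<..} \<times> cbox (-T) T) (\<lambda>(x, t). f' x t)" by (rule rectangle_continuous[OF cf']) simp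
 qed (use x in auto)
 then show ?thesis using x by (simp add: at_within_open[of x "{0<..}"])
qed

lemma gradient_le:
 assumes \<epsilon>: "0 < \<epsilon>" "\<epsilon> \<le> 1"
 shows "\<bar>ux \<epsilon> x t\<bar> \<le> p * ((1 + norm (F (Complex x t))) powr (p - 1) * norm (deriv F (Complex x t)))"
  and "\<bar>ut \<epsilon> x t\<bar> \<le> p * ((1 + norm (F (Complex x t))) powr (p - 1) * norm (deriv F (Complex x t)))"
proof -
 define s m m1 where d: "s = reg \<epsilon> x t" "m = norm (F (Complex x t))" "m1 = norm (deriv F (Complex x t))"
 have s: "s > 0" "s = m\<^sup>2 + \<epsilon>" using reg_pos[OF \<epsilon>(1)] by (auto simp: d reg_def re0_def im0_def cmod_power2)
 have m0: "m \<ge> 0" "m1 \<ge> 0" by (auto simp: d)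
 have ms: "m \<le> s powr (1/2)" using s \<epsilon> m0 by (simp add: powr_half_sqrt real_le_rsqrt)
 have s2: "s powr (1/2) \<le> 1 + m"
 proof -
  have "s \<le> (1 + m)\<^sup>2" unfolding s(2) using \<epsilon> m0 by (simp add: power2_eq_square algebra_simps)
  then have "sqrt s \<le> 1 + m" using m0 by (intro real_le_lsqrt) (use s in auto)
  then show ?thesis using s by (simp add: powr_half_sqrt)
 qed
 have key: "s powr (p/2 - 1) * (m * m1) \<le> (1 + m) powr (p - 1) * m1"
 proof -
  have "s powr (p/2 - 1) * m \<le> s powr (p/2 - 1) * s powr (1/2)" using ms by (intro mult_left_mono) auto
  also have "\<dots> = (s powr (1/2)) powr (p - 1)" by (simp add: powr_add[symmetric] powr_powr diff_divide_distrib)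
  also have "\<dots> \<le> (1 + m) powr (p - 1)" using s2 p1 by (intro powr_mono2) auto
  finally show ?thesis using m0 by (simp add: mult.assoc[symmetric] mult_right_mono)
 qed
 have w: "\<bar>re0 x t * re1 x t + im0 x t * im1 x t\<bar> \<le> m * m1" "\<bar>im0 x t * re1 x t - re0 x t * im1 x t\<bar> \<le> m * m1"
 proof -
  have "\<bar>Re (cnj (F (Complex x t)) * deriv F (Complex x t))\<bar> \<le> norm (cnj (F (Complex x t)) * deriv F (Complex x t))"
   by (rule abs_Re_le_cmod)
  then show "\<bar>re0 x t * re1 x t + im0 x t * im1 x t\<bar> \<le> m * m1"
   by (simp add: d norm_mult re0_def im0_def re1_def im1_def)
  have "\<bar>Im (cnj (F (Complex x t)) * deriv F (Complex x t))\<bar> \<le> norm (cnj (F (Complex x t)) * deriv F (Complex x t))"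
   by (rule abs_Im_le_cmod)
  then show "\<bar>im0 x t * re1 x t - re0 x t * im1 x t\<bar> \<le> m * m1"
   by (simp add: d norm_mult re0_def im0_def re1_def im1_def abs_minus_commute)
 qed
 have fin: "\<bar>p * s powr (p/2 - 1) * q\<bar> \<le> p * ((1 + m) powr (p - 1) * m1)" if "\<bar>q\<bar> \<le> m * m1" for q
 proof -
  have "\<bar>p * s powr (p/2 - 1) * q\<bar> = p * (s powr (p/2 - 1) * \<bar>q\<bar>)" using p1 by (simp add: abs_mult)
  also have "\<dots> \<le> p * (s powr (p/2 - 1) * (m * m1))" using that p1 by (intro mult_left_mono) auto
  also have "\<dots> \<le> p * ((1 + m) powr (p - 1) * m1)" using key p1 by (intro mult_left_mono) auto
  finally show ?thesis .
 qed
 show "\<bar>ux \<epsilon> x t\<bar> \<le> p * ((1 + norm (F (Complex x t))) powr (p - 1) * norm (deriv F (Complex x t)))"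
  "\<bar>ut \<epsilon> x t\<bar> \<le> p * ((1 + norm (F (Complex x t))) powr (p - 1) * norm (deriv F (Complex x t)))"
  unfolding ux_def ut_def d(2,3)[symmetric] d(1)[symmetric] by (intro fin w)+
qed

lemma lap_integral_continuous:
 assumes \<epsilon>: "\<epsilon> > 0" and x: "x > 0"
 shows "continuous_on {x..y} (\<lambda>x. integral {-T..T} (lap \<epsilon> x))"
proof -
 have cu: "continuous_on {0<..} (\<lambda>x. integral (cbox (-T) T) (lap \<epsilon> x))"
  using rectangle_continuous[OF continuous_derivs(6)[OF \<epsilon>], of "{0<..}" "cbox (-T) T"]
  by (intro integral_continuous_on_param) simp
 show ?thesis using x continuous_on_subset[OF cu, of "{x..y}"] by (simp add: subset_eq)
qed

text \<open>With \<open>W = V'\<close> one has \<open>W' = l - d\<close>, where \<open>d\<close> is the flux through the two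
 horizontal edges. Integrating from \<open>x\<close> to \<open>b\<close> gives \<open>- W x\<close> up to
 \<open>\<beta>\<close>, and the mean value theorem expresses the secant of \<open>V\<close> through \<open>W\<close>
 at an intermediate point. The two bounds follow as \<open>l \<ge> 0\<close>.\<close>

lemma regularized_green:
 fixes T \<kappa> \<sigma> h b Q \<epsilon> :: real
 assumes \<epsilon>: "0 < \<epsilon>" "\<epsilon> \<le> 1" and T: "T > 0" and \<kappa>: "\<kappa> > 0" and \<sigma>: "\<sigma> \<ge> \<kappa>" and h: "h > 0" and b: "b > \<sigma> + h"
  and Q: "\<And>\<nu> t. \<nu> \<ge> \<kappa> \<Longrightarrow> \<bar>t\<bar> \<le> T \<Longrightarrow>
   (1 + norm (F (Complex \<nu> t))) powr (p - 1) * norm (deriv F (Complex \<nu> t)) \<le> Q * exp (- \<nu> / 2)"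
 defines "V \<equiv> \<lambda>x. integral {-T..T} (\<lambda>t. reg \<epsilon> x t powr (p/2))"
  and "l \<equiv> \<lambda>x. integral {-T..T} (lap \<epsilon> x)"
  and "\<beta> \<equiv> 4 * p * Q + 2 * T * p * Q * exp (- b / 2)"
 shows "h * (integral {\<sigma>+h..b} l - \<beta>) \<le> V \<sigma> - V (\<sigma> + h)" "V \<sigma> - V (\<sigma> + h) \<le> h * (integral {\<sigma>..b} l + \<beta>)"
proof -
 have Q0: "Q \<ge> 0"
 proof -
  have "0 \<le> (1 + norm (F (Complex \<kappa> 0))) powr (p - 1) * norm (deriv F (Complex \<kappa> 0))" by simp
  also have "\<dots> \<le> Q * exp (- \<kappa> / 2)" using T by (intro Q) auto
  finally have "0 \<le> Q * exp (- \<kappa> / 2)" .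
  then show ?thesis by (simp add: zero_le_mult_iff)
 qed
 define W where "W x = integral {-T..T} (ux \<epsilon> x)" for x
 define d where "d x = ut \<epsilon> x T - ut \<epsilon> x (-T)" for x
 have V': "(V has_real_derivative W x) (at x)" if "x > 0" for x
  unfolding V_def W_def by (rule leibniz_vertical) (auto intro: u_derivs continuous_derivs \<epsilon> that)
 have l_eq: "integral {-T..T} (uxx \<epsilon> x) = l x - d x" if x: "x > 0" for x
 proof -
  have "((utt \<epsilon> x) has_integral d x) {-T..T}" unfolding d_def
  proof (rule fundamental_theorem_of_calculus)
   fix t
   show "((ut \<epsilon> x) has_vector_derivative utt \<epsilon> x t) (at t within {-T..T})"
    using has_field_derivative_at_within[OF u_derivs(3)[OF x \<epsilon>(1)]]
    by (simp only: has_real_derivative_iff_has_vector_derivative)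
  qed (use T in simp)
  then have utt: "integral {-T..T} (utt \<epsilon> x) = d x" by (rule integral_unique)
  have "integral {-T..T} (uxx \<epsilon> x) = integral {-T..T} (\<lambda>t. lap \<epsilon> x t - utt \<epsilon> x t)"
   using lap_eq[OF \<epsilon>(1)] by (intro integral_cong) (auto simp: algebra_simps)
  also have "\<dots> = l x - d x" unfolding l_def utt[symmetric]
   by (intro Henstock_Kurzweil_Integration.integral_diff integrable_continuous_interval section_continuous continuous_derivs \<epsilon> x)
  finally show ?thesis .
 qed
 have W': "(W has_real_derivative l x - d x) (at x)" if "x > 0" for x unfolding l_eq[OF that, symmetric] W_def
  by (rule leibniz_vertical) (auto intro: u_derivs continuous_derivs \<epsilon> that)
 have db: "\<bar>d x\<bar> \<le> 2 * p * Q * exp (- x / 2)" if "x \<ge> \<kappa>" for x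
 proof -
  have "\<bar>ut \<epsilon> x t\<bar> \<le> p * (Q * exp (- x / 2))" if "\<bar>t\<bar> \<le> T" for t
  proof -
   have "p * ((1 + norm (F (Complex x t))) powr (p - 1) * norm (deriv F (Complex x t))) \<le> p * (Q * exp (- x / 2))"
    using p1 by (intro mult_left_mono Q \<open>x \<ge> \<kappa>\<close> that) auto
   then show ?thesis using gradient_le(2)[OF \<epsilon>, of x t] by simp
  qed
  from this[of T] this[of "-T"] show ?thesis using T unfolding d_def by simp
 qed
 have Wb: "\<bar>W x\<bar> \<le> 2 * T * p * Q * exp (- x / 2)" if "x \<ge> \<kappa>" for x
 proof -
  have "norm (W x) \<le> integral {-T..T} (\<lambda>t. p * (Q * exp (- x / 2)))" unfolding W_def
  proof (rule Henstock_Kurzweil_Integration.integral_norm_bound_integral)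
   show "ux \<epsilon> x integrable_on {-T..T}"
    using that \<kappa> by (intro integrable_continuous_interval section_continuous continuous_derivs \<epsilon>) auto
   show "norm (ux \<epsilon> x t) \<le> p * (Q * exp (- x / 2))" if t: "t \<in> {-T..T}" for t
   proof -
    have "p * ((1 + norm (F (Complex x t))) powr (p - 1) * norm (deriv F (Complex x t))) \<le> p * (Q * exp (- x / 2))"
     using p1 t by (intro mult_left_mono Q \<open>x \<ge> \<kappa>\<close>) auto
    then show ?thesis using gradient_le(1)[OF \<epsilon>, of x t] by simp
   qed
  qed auto
  then show ?thesis using T by (simp add: mult_ac)
 qed
 have cl: "continuous_on {x..y} l" if "x > 0" for x y
  unfolding l_def by (rule lap_integral_continuous[OF \<epsilon>(1) that])
 have cd: "continuous_on {x..y} d" if "x > 0" for x y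
 proof -
  have cu: "continuous_on {0<..} (\<lambda>x. ut \<epsilon> x t)" for t
  proof -
   have "continuous_on {0<..} (\<lambda>x. ut \<epsilon> (fst (x, t)) (snd (x, t)))"
    by (rule continuous_on_compose2[OF continuous_derivs(3)[OF \<epsilon>(1)]]) (auto intro!: continuous_intros)
   then show ?thesis by simp
  qed
  show ?thesis unfolding d_def using that by (intro continuous_on_diff continuous_on_subset[OF cu]) auto
 qed
 have l0: "l x \<ge> 0" if "x > 0" for x unfolding l_def
  using that by (intro integral_nonneg integrable_continuous_interval section_continuous continuous_derivs \<epsilon> lap_nonneg) auto
 have main: "\<bar>integral {y..b} l + W y\<bar> \<le> \<beta>" if y: "y \<ge> \<kappa>" "y \<le> b" for y
 proof -
  have y0: "y > 0" using y \<kappa> by simp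
  have il: "l integrable_on {y..b}" and idd: "d integrable_on {y..b}"
   by (intro integrable_continuous_interval cl cd y0)+
  have "((\<lambda>x. l x - d x) has_integral W b - W y) {y..b}"
  proof (rule fundamental_theorem_of_calculus[OF y(2)])
   fix x assume "x \<in> {y..b}"
   then have "x > 0" using y0 by simp
   from has_field_derivative_at_within[OF W'[OF this]]
   show "(W has_vector_derivative l x - d x) (at x within {y..b})"
    by (simp only: has_real_derivative_iff_has_vector_derivative)
  qed
  then have "W b - W y = integral {y..b} (\<lambda>x. l x - d x)" by (simp add: integral_unique)
  also have "\<dots> = integral {y..b} l - integral {y..b} d" by (rule Henstock_Kurzweil_Integration.integral_diff[OF il idd])
  finally have eq: "integral {y..b} l + W y = W b + integral {y..b} d" by simp
  have ex: "((\<lambda>x. 2 * p * Q * exp (- x / 2)) has_integral (- (4 * p * Q * exp (- b / 2)) - - (4 * p * Q * exp (- y / 2)))) {y..b}"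
  proof (rule fundamental_theorem_of_calculus[OF y(2)])
   fix x
   have "((\<lambda>x. - (4 * p * Q * exp (- x / 2))) has_real_derivative 2 * p * Q * exp (- x / 2)) (at x within {y..b})"
    by (auto intro!: derivative_eq_intros)
   then show "((\<lambda>x. - (4 * p * Q * exp (- x / 2))) has_vector_derivative 2 * p * Q * exp (- x / 2)) (at x within {y..b})"
    by (simp only: has_real_derivative_iff_has_vector_derivative)
  qed
  have "norm (integral {y..b} d) \<le> integral {y..b} (\<lambda>x. 2 * p * Q * exp (- x / 2))"
   using idd ex db y by (intro Henstock_Kurzweil_Integration.integral_norm_bound_integral) auto
  also have "\<dots> \<le> 4 * p * Q * exp (- y / 2)" unfolding integral_unique[OF ex] using p1 Q0 by simp
  also have "\<dots> \<le> 4 * p * Q * 1" using y0 p1 Q0 by (intro mult_left_mono) auto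
  finally have "\<bar>integral {y..b} d\<bar> \<le> 4 * p * Q" by simp
  moreover have "\<bar>W b\<bar> \<le> 2 * T * p * Q * exp (- b / 2)" using y by (intro Wb) auto
  ultimately show ?thesis unfolding eq \<beta>_def by linarith
 qed
 have "\<exists>\<xi>. \<xi> > \<sigma> \<and> \<xi> < \<sigma> + h \<and> V (\<sigma> + h) - V \<sigma> = (\<sigma> + h - \<sigma>) * W \<xi>" using h \<sigma> \<kappa> by (intro MVT2 V') auto
 then obtain \<xi> where \<xi>: "\<xi> > \<sigma>" "\<xi> < \<sigma> + h" "V \<sigma> - V (\<sigma> + h) = h * (- W \<xi>)" by (auto simp: algebra_simps)
 have mono: "integral {y..b} l \<le> integral {x..b} l" if "x > 0" "x \<le> y" for x y
  using that by (intro integral_subset_le integrable_continuous_interval cl) (auto intro!: l0)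
 have "integral {\<sigma>+h..b} l \<le> integral {\<xi>..b} l" "integral {\<xi>..b} l \<le> integral {\<sigma>..b} l"
  using \<xi> \<sigma> \<kappa> by (intro mono; simp)+
 moreover have "\<bar>integral {\<xi>..b} l + W \<xi>\<bar> \<le> \<beta>" using \<xi> \<sigma> b by (intro main) auto
 ultimately have "integral {\<sigma>+h..b} l - \<beta> \<le> - W \<xi>" "- W \<xi> \<le> integral {\<sigma>..b} l + \<beta>" by linarith+
 then show "h * (integral {\<sigma>+h..b} l - \<beta>) \<le> V \<sigma> - V (\<sigma> + h)" "V \<sigma> - V (\<sigma> + h) \<le> h * (integral {\<sigma>..b} l + \<beta>)"
  unfolding \<xi>(3) using h by (intro mult_left_mono; simp)+
qed

end

section \<open>The Hardy-Stein energy\<close>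

abbreviation plane :: "(real \<times> real) measure" where
 "plane \<equiv> lborel \<Otimes>\<^sub>M lborel"

context hardy_stein begin

text \<open>\<open>F\<close>, its derivative, and the densities built from them, as functions on the plane that vanish outside
 the half-plane.\<close>

definition F0 :: "real \<times> real \<Rightarrow> complex" where
 "F0 z = indicator ({0<..} \<times> UNIV) z *\<^sub>R F (Complex (fst z) (snd z))"
definition F1 :: "real \<times> real \<Rightarrow> complex" where
 "F1 z = indicator ({0<..} \<times> UNIV) z *\<^sub>R deriv F (Complex (fst z) (snd z))"
definition energy_density :: "real \<times> real \<Rightarrow> real" where
 "energy_density z = norm (F0 z) powr (p - 2) * (norm (F1 z))\<^sup>2"
definition lap0 :: "real \<Rightarrow> real \<times> real \<Rightarrow> real" where
 "lap0 \<epsilon> z = (norm (F1 z))\<^sup>2 * ((norm (F0 z))\<^sup>2 + \<epsilon>) powr (p/2 - 2) * (p\<^sup>2 * (norm (F0 z))\<^sup>2 + 2 * p * \<epsilon>)"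

lemma F01_measurable [measurable]:
 "F0 \<in> borel_measurable plane" "F1 \<in> borel_measurable plane"
proof -
 have o: "({0<..} \<times> UNIV :: (real \<times> real) set) \<in> sets borel" by (intro borel_open open_Times) auto
 have "continuous_on ({0<..} \<times> UNIV) (\<lambda>z. G (Complex (fst z) (snd z)))" if "G holomorphic_on half_plane 0" for G
  by (intro continuous_on_compose2[OF holomorphic_on_imp_continuous_on[OF that]])
   (auto simp: Complex_eq half_plane_def intro!: continuous_intros)
 then have "(\<lambda>z. indicator ({0<..} \<times> UNIV) z *\<^sub>R G (Complex (fst z) (snd z))) \<in> borel_measurable borel"
  if "G holomorphic_on half_plane 0" for G using that by (intro borel_measurable_continuous_on_indicator o)
 from this[OF F_hol] this[OF deriv_hol(1)]
 show "F0 \<in> borel_measurable plane" "F1 \<in> borel_measurable plane"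
  by (simp_all add: F0_def[abs_def] F1_def[abs_def] lborel_prod)
qed

lemma energy_density_measurable [measurable]:
 "energy_density \<in> borel_measurable plane" "lap0 \<epsilon> \<in> borel_measurable plane"
 unfolding energy_density_def[abs_def] lap0_def[abs_def] by measurable

lemma lap0_eq: "x > 0 \<Longrightarrow> lap0 \<epsilon> (x, t) = lap \<epsilon> x t"
 by (simp add: lap0_def lap_def F0_def F1_def reg_def re0_def im0_def re1_def im1_def cmod_power2)

lemma lap0_tendsto:
 assumes "F0 z \<noteq> 0 \<or> F1 z = 0"
 shows "(\<lambda>n. lap0 (1 / real (Suc n)) z) \<longlonglongrightarrow> p\<^sup>2 * energy_density z"
proof (cases "F1 z = 0")
 case False
 with assms have F0: "norm (F0 z) > 0" by simp
 have e: "(\<lambda>n. 1 / real (Suc n)) \<longlonglongrightarrow> 0" by (rule LIMSEQ_Suc[OF lim_1_over_n])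
 have "(\<lambda>n. lap0 (1 / real (Suc n)) z) \<longlonglongrightarrow> (norm (F1 z))\<^sup>2 * ((norm (F0 z))\<^sup>2 + 0) powr (p/2 - 2) * (p\<^sup>2 * (norm (F0 z))\<^sup>2 + 2 * p * 0)"
  unfolding lap0_def using F0 by (intro tendsto_intros e) auto
 also have "(norm (F1 z))\<^sup>2 * ((norm (F0 z))\<^sup>2 + 0) powr (p/2 - 2) * (p\<^sup>2 * (norm (F0 z))\<^sup>2 + 2 * p * 0) = p\<^sup>2 * energy_density z"
 proof -
  have sq: "(norm (F0 z))\<^sup>2 = norm (F0 z) powr 2" using F0 by (simp add: powr_numeral)
  have "((norm (F0 z))\<^sup>2) powr (p/2 - 2) * (norm (F0 z))\<^sup>2 = norm (F0 z) powr (p - 2)"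
   unfolding sq powr_powr powr_add[symmetric]
   by (rule arg_cong[where f = "\<lambda>q. norm (F0 z) powr q"]) (simp add: algebra_simps)
  then show ?thesis by (simp add: energy_density_def mult_ac)
 qed
 finally show ?thesis .
qed (simp add: lap0_def energy_density_def)

lemma fsigma_half_plane: "fsigma (half_plane 0)"
proof -
 have "half_plane 0 = (\<Union>n. {s. Re s \<ge> 1 / real (Suc n)})"
 proof (intro set_eqI iffI)
  fix s assume "s \<in> half_plane 0"
  then obtain n where "inverse (real (Suc n)) < Re s"
   using reals_Archimedean[of "Re s"] by (auto simp: half_plane_def)
  then show "s \<in> (\<Union>n. {s. Re s \<ge> 1 / real (Suc n)})" by (intro UN_I[of n]) (simp_all add: inverse_eq_divide)
 next
  fix s assume "s \<in> (\<Union>n. {s. Re s \<ge> 1 / real (Suc n)})"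
  then obtain n where n: "Re s \<ge> 1 / real (Suc n)" by auto
  have "1 / real (Suc n) > 0" by simp
  from this n have "0 < Re s" by (rule less_le_trans)
  then show "s \<in> half_plane 0" unfolding half_plane_def by simp
 qed
 moreover have "fsigma (\<Union>n. {s. Re s \<ge> 1 / real (Suc n)})" by (intro fsigma.intros) (rule closed_halfspace_Re_ge)
 ultimately show ?thesis by simp
qed

text \<open>At a simple zero the convention \<open>0 powr x = 0\<close> makes the density differ from the limit of the
 regularized Laplacians. Zeros are isolated unless \<open>F\<close> is constant, when the derivative vanishes.\<close>

lemma simple_zeros_null: "AE z in plane. F0 z \<noteq> 0 \<or> F1 z = 0"
proof (cases "F constant_on half_plane 0")
 case True
 then obtain c where c: "\<And>z. z \<in> half_plane 0 \<Longrightarrow> F z = c" by (auto simp: constant_on_def)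
 have "deriv F z = 0" if z: "z \<in> half_plane 0" for z
 proof -
  have "deriv F z = deriv (\<lambda>_. c) z"
   using c by (intro deriv_cong_ev eventually_mono[OF eventually_nhds_in_open[OF open_half_plane z]]) auto
  then show ?thesis by simp
 qed
 then show ?thesis by (intro AE_I2) (auto simp: F1_def half_plane_def indicator_def)
next
 case False
 have conn: "connected (half_plane 0)" by (intro convex_connected convex_half_plane)
 have "countable {z \<in> half_plane 0. F z = 0}"
  using False by (intro holomorphic_countable_zeros F_hol open_half_plane conn fsigma_half_plane)
 then have "countable ((\<lambda>z. (Re z, Im z)) ` {z \<in> half_plane 0. F z = 0})" by (rule countable_image)
 then have "(\<lambda>z. (Re z, Im z)) ` {z \<in> half_plane 0. F z = 0} \<in> null_sets lborel"
  by (rule countable_imp_null_set_lborel)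
 then have "AE z in lborel. z \<notin> (\<lambda>z. (Re z, Im z)) ` {z \<in> half_plane 0. F z = 0}" by (rule AE_not_in)
 then show ?thesis unfolding lborel_prod
 proof eventually_elim
  case (elim z)
  show ?case
  proof (cases "fst z > 0")
   case True
   then have "F (Complex (fst z) (snd z)) \<noteq> 0"
    using elim by (force simp: half_plane_def image_iff intro!: bexI[of _ "Complex (fst z) (snd z)"])
   then show ?thesis using True by (auto simp: F0_def indicator_def mem_Times_iff)
  qed (auto simp: F1_def indicator_def mem_Times_iff)
 qed
qed

text \<open>For \<open>p < 2\<close> the regularized Laplacians are dominated by a multiple of their limit, for \<open>p \<ge>
 2\<close> by a continuous function.\<close>

lemma lap0_le:
 assumes \<epsilon>: "0 < \<epsilon>" "\<epsilon> \<le> 1" and nz: "F0 z \<noteq> 0 \<or> F1 z = 0"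
 shows "lap0 \<epsilon> z \<le> 2 * p * energy_density z + (if p \<ge> 2 then p\<^sup>2 * (norm (F1 z))\<^sup>2 * ((norm (F0 z))\<^sup>2 + 1) powr (p/2 - 1) else 0)"
proof (cases "F1 z = 0")
 case False
 define v where "v = (norm (F0 z))\<^sup>2"
 have v: "v > 0" using nz False by (simp add: v_def)
 have e: "(v + \<epsilon>) powr (p/2 - 2) * (v + \<epsilon>) = (v + \<epsilon>) powr (p/2 - 1)"
  using v \<epsilon> powr_mult_base[of "v + \<epsilon>" "p/2 - 2"] by (simp add: mult.commute)
 have ed: "energy_density z = v powr (p/2 - 1) * (norm (F1 z))\<^sup>2"
 proof -
  have "v = norm (F0 z) powr 2" using nz False by (simp add: v_def powr_numeral)
  moreover have "(norm (F0 z) powr 2) powr (p/2 - 1) = norm (F0 z) powr (p - 2)"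
   unfolding powr_powr by (rule arg_cong[where f = "\<lambda>q. norm (F0 z) powr q"]) (simp add: algebra_simps)
  ultimately have "v powr (p/2 - 1) = norm (F0 z) powr (p - 2)" by metis
  then show ?thesis by (simp add: energy_density_def)
 qed
 have step: "lap0 \<epsilon> z \<le> c * (norm (F1 z))\<^sup>2 * (v + \<epsilon>) powr (p/2 - 1)" if "p\<^sup>2 * v + 2 * p * \<epsilon> \<le> c * (v + \<epsilon>)" for c
 proof -
  have "lap0 \<epsilon> z \<le> (norm (F1 z))\<^sup>2 * (v + \<epsilon>) powr (p/2 - 2) * (c * (v + \<epsilon>))"
   unfolding lap0_def v_def[symmetric] using that by (intro mult_left_mono) auto
  also have "\<dots> = c * (norm (F1 z))\<^sup>2 * ((v + \<epsilon>) powr (p/2 - 2) * (v + \<epsilon>))" by simp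
  finally show ?thesis unfolding e .
 qed
 show ?thesis
 proof (cases "p \<ge> 2")
  case True
  have "2 * p * \<epsilon> \<le> p * p * \<epsilon>" using True \<epsilon> by (intro mult_right_mono) auto
  then have "lap0 \<epsilon> z \<le> p\<^sup>2 * (norm (F1 z))\<^sup>2 * (v + \<epsilon>) powr (p/2 - 1)"
   by (intro step) (simp add: power2_eq_square algebra_simps)
  also have "\<dots> \<le> p\<^sup>2 * (norm (F1 z))\<^sup>2 * (v + 1) powr (p/2 - 1)"
   using True v \<epsilon> by (intro mult_left_mono powr_mono2) auto
  finally have "lap0 \<epsilon> z \<le> p\<^sup>2 * (norm (F1 z))\<^sup>2 * (v + 1) powr (p/2 - 1)" .
  moreover have "0 \<le> 2 * p * energy_density z" using p1 by (simp add: energy_density_def)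
  ultimately show ?thesis using True by (simp add: v_def)
 next
  case False
  have "p * p * v \<le> 2 * p * v" using False p1 v by (intro mult_right_mono) auto
  then have "lap0 \<epsilon> z \<le> (2 * p) * (norm (F1 z))\<^sup>2 * (v + \<epsilon>) powr (p/2 - 1)"
   by (intro step) (simp add: power2_eq_square algebra_simps)
  also have "\<dots> \<le> (2 * p) * (norm (F1 z))\<^sup>2 * v powr (p/2 - 1)"
   using False p1 v \<epsilon> by (intro mult_left_mono powr_mono2') auto
  finally show ?thesis using False by (simp add: ed mult_ac)
 qed
qed (use p1 in \<open>auto simp: lap0_def energy_density_def\<close>)

definition rect_energy :: "real \<Rightarrow> real \<Rightarrow> real \<Rightarrow> ennreal" where
 "rect_energy T a b = (\<integral>\<^sup>+z\<in>{a..b} \<times> {-T..T}. ennreal (p\<^sup>2 * energy_density z) \<partial>plane)"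

lemma rect_measurable [measurable]: "{a..b} \<times> {c..d} \<in> sets plane" for a b c d :: real
 by (intro pair_measureI) auto

lemma rect_lap:
 assumes \<epsilon>: "\<epsilon> > 0" and a: "a > 0"
 shows "ennreal (integral {a..b} (\<lambda>x. integral {-T..T} (lap \<epsilon> x))) = (\<integral>\<^sup>+z\<in>{a..b} \<times> {-T..T}. ennreal (lap0 \<epsilon> z) \<partial>plane)"
proof -
 have inner: "ennreal (integral {-T..T} (lap \<epsilon> x)) = (\<integral>\<^sup>+t\<in>{-T..T}. ennreal (lap \<epsilon> x t) \<partial>lborel)" if "x > 0" for x
  by (intro nn_integral_continuous_interval section_continuous continuous_derivs \<epsilon> that lap_nonneg)
 note cont = lap_integral_continuous[OF \<epsilon> a]
 have "ennreal (integral {a..b} (\<lambda>x. integral {-T..T} (lap \<epsilon> x))) = (\<integral>\<^sup>+x\<in>{a..b}. ennreal (integral {-T..T} (lap \<epsilon> x)) \<partial>lborel)"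
  using a by (intro nn_integral_continuous_interval cont integral_nonneg integrable_continuous_interval section_continuous
    continuous_derivs \<epsilon> lap_nonneg) auto
 also have "\<dots> = (\<integral>\<^sup>+x. (\<integral>\<^sup>+t. ennreal (lap0 \<epsilon> (x, t)) * indicator ({a..b} \<times> {-T..T}) (x, t) \<partial>lborel) \<partial>lborel)"
 proof (intro nn_integral_cong)
  fix x
  show "ennreal (integral {-T..T} (lap \<epsilon> x)) * indicator {a..b} x
    = (\<integral>\<^sup>+t. ennreal (lap0 \<epsilon> (x, t)) * indicator ({a..b} \<times> {-T..T}) (x, t) \<partial>lborel)"
   using a by (cases "x \<in> {a..b}") (auto simp: inner lap0_eq indicator_def intro!: nn_integral_cong)
 qed
 also have "\<dots> = (\<integral>\<^sup>+z\<in>{a..b} \<times> {-T..T}. ennreal (lap0 \<epsilon> z) \<partial>plane)" by (rule lborel.nn_integral_fst) measurable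
 finally show ?thesis .
qed

definition V :: "real \<Rightarrow> real \<Rightarrow> real" where
 "V T x = integral {-T..T} (\<lambda>t. norm (F (Complex x t)) powr p)"

lemma V_reg_tendsto:
 assumes x: "x > 0"
 shows "(\<lambda>n. integral {-T..T} (\<lambda>t. reg (1 / real (Suc n)) x t powr (p/2))) \<longlonglongrightarrow> V T x"
 unfolding V_def
proof (rule dominated_convergence(2))
 have e: "(\<lambda>n. 1 / real (Suc n)) \<longlonglongrightarrow> 0" by (rule LIMSEQ_Suc[OF lim_1_over_n])
 show "(\<lambda>t. reg (1 / real (Suc n)) x t powr (p/2)) integrable_on {-T..T}" for n
  by (intro integrable_continuous_interval section_continuous[where f = "\<lambda>x t. reg _ x t powr (p/2)"] continuous_derivs x) simp
 show "(\<lambda>t. reg 1 x t powr (p/2)) integrable_on {-T..T}"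
  by (intro integrable_continuous_interval section_continuous[where f = "\<lambda>x t. reg _ x t powr (p/2)"] continuous_derivs x) simp
 show "norm (reg (1 / real (Suc n)) x t powr (p/2)) \<le> reg 1 x t powr (p/2)" for n t
  using p1 by (auto simp: reg_def intro!: powr_mono2)
 show "(\<lambda>n. reg (1 / real (Suc n)) x t powr (p/2)) \<longlonglongrightarrow> norm (F (Complex x t)) powr p" for t
 proof -
  have "(\<lambda>n. reg (1 / real (Suc n)) x t powr (p/2)) \<longlonglongrightarrow> ((re0 x t)\<^sup>2 + (im0 x t)\<^sup>2 + 0) powr (p/2)"
   unfolding reg_def using p1 by (intro tendsto_powr' tendsto_intros e) auto
  also have "((re0 x t)\<^sup>2 + (im0 x t)\<^sup>2 + 0) powr (p/2) = norm (F (Complex x t)) powr p"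
  proof -
   have "(re0 x t)\<^sup>2 + (im0 x t)\<^sup>2 + 0 = (norm (F (Complex x t)))\<^sup>2" by (simp add: re0_def im0_def cmod_power2)
   also have "\<dots> powr (p/2) = norm (F (Complex x t)) powr p"
    by (cases "F (Complex x t) = 0") (simp_all add: powr_powr flip: powr_numeral)
   finally show ?thesis .
  qed
  finally show ?thesis .
 qed
qed

text \<open>The limit \<open>\<epsilon> \<rightarrow> 0\<close> in Green's formula. The first bound uses only Fatou's lemma and
 shows that the energy is finite; finiteness then allows dominated convergence in the last one.\<close>

lemma rect_energy_bounds:
 fixes T \<kappa> \<sigma> h b Q :: real
 assumes T: "T > 0" and \<kappa>: "\<kappa> > 0" and \<sigma>: "\<sigma> \<ge> \<kappa>" and h: "h > 0" and b: "b > \<sigma> + h"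
  and Q: "\<And>\<nu> t. \<nu> \<ge> \<kappa> \<Longrightarrow> \<bar>t\<bar> \<le> T \<Longrightarrow>
   (1 + norm (F (Complex \<nu> t))) powr (p - 1) * norm (deriv F (Complex \<nu> t)) \<le> Q * exp (- \<nu> / 2)"
 defines "\<beta> \<equiv> 4 * p * Q + 2 * T * p * Q * exp (- b / 2)"
 shows "rect_energy T (\<sigma> + h) b \<le> ennreal ((V T \<sigma> - V T (\<sigma> + h)) / h + \<beta>)"
  and "0 \<le> (V T \<sigma> - V T (\<sigma> + h)) / h + \<beta>"
  and "rect_energy T \<sigma> b < \<infinity> \<Longrightarrow> (V T \<sigma> - V T (\<sigma> + h)) / h \<le> enn2real (rect_energy T \<sigma> b) + \<beta>"
proof -
 define \<epsilon> where "\<epsilon> n = 1 / real (Suc n)" for n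
 have \<epsilon>: "0 < \<epsilon> n" "\<epsilon> n \<le> 1" for n by (auto simp: \<epsilon>_def)
 define Vn where "Vn n x = integral {-T..T} (\<lambda>t. reg (\<epsilon> n) x t powr (p/2))" for n x
 define ln where "ln n x = integral {-T..T} (lap (\<epsilon> n) x)" for n x
 have \<sigma>0: "\<sigma> > 0" "\<sigma> + h > 0" using \<sigma> \<kappa> h by auto
 note rg = regularized_green[OF \<epsilon> T \<kappa> \<sigma> h b Q, folded \<beta>_def]
 have rg1: "integral {\<sigma>+h..b} (ln n) \<le> (Vn n \<sigma> - Vn n (\<sigma> + h)) / h + \<beta>" for n
  using rg(1)[of n] h unfolding Vn_def ln_def by (simp add: field_simps)
 have rg2: "(Vn n \<sigma> - Vn n (\<sigma> + h)) / h \<le> integral {\<sigma>..b} (ln n) + \<beta>" for n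
  using rg(2)[of n] h unfolding Vn_def ln_def by (simp add: field_simps)
 have Vlim: "(\<lambda>n. (Vn n \<sigma> - Vn n (\<sigma> + h)) / h + \<beta>) \<longlonglongrightarrow> (V T \<sigma> - V T (\<sigma> + h)) / h + \<beta>"
  unfolding Vn_def \<epsilon>_def using h by (intro tendsto_intros V_reg_tendsto \<sigma>0) auto
 have ln_nn: "ennreal (integral {a..b} (ln n)) = (\<integral>\<^sup>+z\<in>{a..b} \<times> {-T..T}. ennreal (lap0 (\<epsilon> n) z) \<partial>plane)" if "a > 0" for a n
  unfolding ln_def by (rule rect_lap[OF \<epsilon>(1) that])
 show "rect_energy T (\<sigma> + h) b \<le> ennreal ((V T \<sigma> - V T (\<sigma> + h)) / h + \<beta>)"
 proof -
  have "rect_energy T (\<sigma> + h) b = (\<integral>\<^sup>+z. liminf (\<lambda>n. ennreal (lap0 (\<epsilon> n) z) * indicator ({\<sigma>+h..b} \<times> {-T..T}) z) \<partial>plane)"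
   unfolding rect_energy_def
  proof (intro nn_integral_cong_AE, use simple_zeros_null in eventually_elim)
   case (elim z)
   have "(\<lambda>n. ennreal (lap0 (\<epsilon> n) z) * indicator ({\<sigma>+h..b} \<times> {-T..T}) z) \<longlonglongrightarrow> ennreal (p\<^sup>2 * energy_density z) * indicator ({\<sigma>+h..b} \<times> {-T..T}) z"
    using lap0_tendsto[OF elim] unfolding \<epsilon>_def by (auto simp: indicator_def intro: tendsto_ennrealI)
   then show ?case using lim_imp_Liminf[OF trivial_limit_sequentially] by metis
  qed
  also have "\<dots> \<le> liminf (\<lambda>n. \<integral>\<^sup>+z. ennreal (lap0 (\<epsilon> n) z) * indicator ({\<sigma>+h..b} \<times> {-T..T}) z \<partial>plane)"
   by (rule nn_integral_liminf) measurable
  also have "\<dots> \<le> liminf (\<lambda>n. ennreal ((Vn n \<sigma> - Vn n (\<sigma> + h)) / h + \<beta>))"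
   unfolding ln_nn[OF \<sigma>0(2), symmetric] by (intro Liminf_mono always_eventually allI ennreal_leI rg1)
  also have "\<dots> = ennreal ((V T \<sigma> - V T (\<sigma> + h)) / h + \<beta>)" by (intro lim_imp_Liminf tendsto_ennrealI Vlim) simp
  finally show ?thesis .
 qed
 have ln0: "integral {a..b} (ln n) \<ge> 0" if a: "a > 0" for a n
 proof (cases "ln n integrable_on {a..b}")
  case True
  have "ln n x \<ge> 0" if "x \<in> {a..b}" for x unfolding ln_def using that a
   by (intro integral_nonneg integrable_continuous_interval section_continuous continuous_derivs \<epsilon> lap_nonneg) auto
  then show ?thesis using True by (intro integral_nonneg) auto
 qed (simp add: not_integrable_integral)
 show "0 \<le> (V T \<sigma> - V T (\<sigma> + h)) / h + \<beta>"
 proof (rule LIMSEQ_le_const[OF Vlim], intro exI[of _ 0] allI impI)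
  show "0 \<le> (Vn n \<sigma> - Vn n (\<sigma> + h)) / h + \<beta>" for n using ln0[OF \<sigma>0(2), of n] rg1[of n] by linarith
 qed
 assume fin: "rect_energy T \<sigma> b < \<infinity>"
 define R where "R = {\<sigma>..b} \<times> {-T..T}"
 have [measurable]: "R \<in> sets plane" unfolding R_def by measurable
 define D where "D z = (if p \<ge> 2 then p\<^sup>2 * (norm (F1 z))\<^sup>2 * ((norm (F0 z))\<^sup>2 + 1) powr (p/2 - 1) else 0)" for z
 have [measurable]: "D \<in> borel_measurable plane" unfolding D_def[abs_def] by measurable
 have D0: "D z \<ge> 0" for z by (simp add: D_def)
 have Dfin: "(\<integral>\<^sup>+z\<in>R. ennreal (D z) \<partial>plane) < \<infinity>"
 proof -
  have comp: "compact R" unfolding R_def by (intro compact_Times) auto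
  have sub: "R \<subseteq> {0<..} \<times> UNIV" using \<sigma>0 by (auto simp: R_def)
  have c: "continuous_on R (\<lambda>z. norm (F (Complex (fst z) (snd z))))" "continuous_on R (\<lambda>z. norm (deriv F (Complex (fst z) (snd z))))"
   using sub by (auto intro!: continuous_intros continuous_on_compose2[OF holomorphic_on_imp_continuous_on[OF F_hol]]
    continuous_on_compose2[OF holomorphic_on_imp_continuous_on[OF deriv_hol(1)]] simp: Complex_eq half_plane_def)
  from compact_imp_bounded[OF compact_continuous_image[OF c(1) comp]] obtain B0 where B0: "\<And>z. z \<in> R \<Longrightarrow> norm (F (Complex (fst z) (snd z))) \<le> B0"
   by (auto simp: bounded_iff)
  from compact_imp_bounded[OF compact_continuous_image[OF c(2) comp]] obtain B1 where B1: "\<And>z. z \<in> R \<Longrightarrow> norm (deriv F (Complex (fst z) (snd z))) \<le> B1"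
   by (auto simp: bounded_iff)
  have DB: "D z \<le> p\<^sup>2 * B1\<^sup>2 * (B0\<^sup>2 + 1) powr (p/2 - 1)" if z: "z \<in> R" for z
  proof (cases "p \<ge> 2")
   case True
   have "norm (F0 z) \<le> B0" "norm (F1 z) \<le> B1"
    using B0[OF z] B1[OF z] sub z by (auto simp: F0_def F1_def indicator_def)
   then show ?thesis using True unfolding D_def by (auto intro!: mult_mono powr_mono2 power_mono)
  qed (simp add: D_def)
  have "(\<integral>\<^sup>+z\<in>R. ennreal (D z) \<partial>plane) \<le> (\<integral>\<^sup>+z\<in>R. ennreal (p\<^sup>2 * B1\<^sup>2 * (B0\<^sup>2 + 1) powr (p/2 - 1)) \<partial>plane)"
   by (intro nn_integral_mono) (auto simp: indicator_def intro!: ennreal_leI DB)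
  also have "\<dots> = ennreal (p\<^sup>2 * B1\<^sup>2 * (B0\<^sup>2 + 1) powr (p/2 - 1)) * emeasure plane R"
   by (rule nn_integral_cmult_indicator) measurable
  also have "emeasure plane R = emeasure lborel {\<sigma>..b} * emeasure lborel {-T..T}"
   unfolding R_def by (rule lborel.emeasure_pair_measure_Times) auto
  also have "ennreal (p\<^sup>2 * B1\<^sup>2 * (B0\<^sup>2 + 1) powr (p/2 - 1)) * \<dots> < \<infinity>"
   using T b h by (simp add: ennreal_mult_less_top)
  finally show ?thesis .
 qed
 have gfin: "(\<integral>\<^sup>+z\<in>R. ennreal (2 * p * energy_density z) \<partial>plane) < \<infinity>"
 proof -
  have "(\<integral>\<^sup>+z\<in>R. ennreal (2 * p * energy_density z) \<partial>plane) = (\<integral>\<^sup>+z. ennreal (2 / p) * (ennreal (p\<^sup>2 * energy_density z) * indicator R z) \<partial>plane)"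
   using p1 by (intro nn_integral_cong) (auto simp: indicator_def ennreal_mult[symmetric] energy_density_def power2_eq_square)
  also have "\<dots> = ennreal (2 / p) * rect_energy T \<sigma> b"
   unfolding rect_energy_def R_def[symmetric] by (rule nn_integral_cmult) measurable
  also have "\<dots> < \<infinity>" using fin by (simp add: ennreal_mult_less_top)
  finally show ?thesis .
 qed
 have "(\<lambda>n. \<integral>\<^sup>+z. ennreal (lap0 (\<epsilon> n) z) * indicator R z \<partial>plane) \<longlonglongrightarrow> (\<integral>\<^sup>+z. ennreal (p\<^sup>2 * energy_density z) * indicator R z \<partial>plane)"
 proof (rule nn_integral_dominated_convergence[where w = "\<lambda>z. ennreal (2 * p * energy_density z) * indicator R z + ennreal (D z) * indicator R z"])
  show "AE z in plane. ennreal (lap0 (\<epsilon> n) z) * indicator R z \<le> ennreal (2 * p * energy_density z) * indicator R z + ennreal (D z) * indicator R z" for n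
   using simple_zeros_null
  proof eventually_elim
   case (elim z)
   have "lap0 (\<epsilon> n) z \<le> 2 * p * energy_density z + D z" using lap0_le[OF \<epsilon> elim] by (simp add: D_def)
   then have "ennreal (lap0 (\<epsilon> n) z) \<le> ennreal (2 * p * energy_density z) + ennreal (D z)"
   proof -
    have "0 \<le> 2 * p * energy_density z" using p1 by (simp add: energy_density_def)
    then have "ennreal (2 * p * energy_density z) + ennreal (D z) = ennreal (2 * p * energy_density z + D z)"
     using D0 by (intro ennreal_plus[symmetric]) auto
    then show ?thesis using ennreal_leI[OF \<open>lap0 (\<epsilon> n) z \<le> 2 * p * energy_density z + D z\<close>] by simp
   qed
   then show ?case by (auto simp: indicator_def)
  qed
  show "AE z in plane. (\<lambda>n. ennreal (lap0 (\<epsilon> n) z) * indicator R z) \<longlonglongrightarrow> ennreal (p\<^sup>2 * energy_density z) * indicator R z"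
   using simple_zeros_null
  proof eventually_elim
   case (elim z)
   show ?case using lap0_tendsto[OF elim] unfolding \<epsilon>_def by (auto simp: indicator_def intro: tendsto_ennrealI)
  qed
  show "(\<integral>\<^sup>+z. ennreal (2 * p * energy_density z) * indicator R z + ennreal (D z) * indicator R z \<partial>plane) < \<infinity>"
   using Dfin gfin by (subst nn_integral_add) auto
 qed measurable
 then have "(\<lambda>n. ennreal (integral {\<sigma>..b} (ln n))) \<longlonglongrightarrow> rect_energy T \<sigma> b"
  unfolding ln_nn[OF \<sigma>0(1)] rect_energy_def R_def .
 then have "(\<lambda>n. enn2real (ennreal (integral {\<sigma>..b} (ln n)))) \<longlonglongrightarrow> enn2real (rect_energy T \<sigma> b)"
  using fin by (intro tendsto_enn2real) auto
 moreover have "integral {\<sigma>..b} (ln n) \<ge> 0" for n using \<sigma>0(1) by (rule ln0)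
 ultimately have Il: "(\<lambda>n. integral {\<sigma>..b} (ln n) + \<beta>) \<longlonglongrightarrow> enn2real (rect_energy T \<sigma> b) + \<beta>"
  by (intro tendsto_add tendsto_const) simp
 have "(\<lambda>n. (Vn n \<sigma> - Vn n (\<sigma> + h)) / h) \<longlonglongrightarrow> (V T \<sigma> - V T (\<sigma> + h)) / h"
  unfolding Vn_def \<epsilon>_def using h by (intro tendsto_intros V_reg_tendsto \<sigma>0) auto
 from LIMSEQ_le[OF this Il] show "(V T \<sigma> - V T (\<sigma> + h)) / h \<le> enn2real (rect_energy T \<sigma> b) + \<beta>" using rg2 by blast
qed

lemma energy_integral_eq:
 assumes \<sigma>: "\<sigma> > 0"
 shows "energy_integral p F \<sigma> T = (\<integral>\<^sup>+z\<in>{\<sigma><..} \<times> {-T..T}. ennreal (energy_density z) \<partial>plane)"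
proof -
 have [measurable]: "{\<sigma><..} \<times> {-T..T} \<in> sets plane" by (intro pair_measureI) auto
 have "(\<integral>\<^sup>+z\<in>{\<sigma><..} \<times> {-T..T}. ennreal (energy_density z) \<partial>plane)
   = (\<integral>\<^sup>+t. (\<integral>\<^sup>+x. ennreal (energy_density (x, t)) * indicator ({\<sigma><..} \<times> {-T..T}) (x, t) \<partial>lborel) \<partial>lborel)"
  by (rule lborel_pair.nn_integral_snd[symmetric]) measurable
 also have "\<dots> = energy_integral p F \<sigma> T" unfolding energy_integral_def
 proof (intro nn_integral_cong)
  fix t
  show "(\<integral>\<^sup>+x. ennreal (energy_density (x, t)) * indicator ({\<sigma><..} \<times> {-T..T}) (x, t) \<partial>lborel)
   = (\<integral>\<^sup>+\<nu>\<in>{\<sigma><..}. ennreal (norm (F (Complex \<nu> t)) powr (p - 2) * (norm (deriv F (Complex \<nu> t)))\<^sup>2) \<partial>lborel) * indicator {-T..T} t"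
   using \<sigma> by (cases "t \<in> {-T..T}")
    (auto simp: indicator_def energy_density_def F0_def F1_def intro!: nn_integral_cong)
 qed
 finally show ?thesis by simp
qed

lemma rect_energy_le:
 assumes \<sigma>: "\<sigma> > 0"
 shows "rect_energy T \<sigma> b \<le> ennreal (p\<^sup>2) * energy_integral p F \<sigma> T"
proof -
 have [measurable]: "{\<sigma><..} \<times> {-T..T} \<in> sets plane" by (intro pair_measureI) auto
 have ae: "AE z in plane. fst z \<noteq> \<sigma>"
 proof -
  have "{\<sigma>} \<times> UNIV \<in> null_sets plane" by (intro null_setsI) (auto simp: lborel.emeasure_pair_measure_Times)
  from AE_not_in[OF this] show ?thesis by eventually_elim (auto simp: mem_Times_iff)
 qed
 have "rect_energy T \<sigma> b \<le> (\<integral>\<^sup>+z. ennreal (p\<^sup>2) * (ennreal (energy_density z) * indicator ({\<sigma><..} \<times> {-T..T}) z) \<partial>plane)"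
  unfolding rect_energy_def
 proof (intro nn_integral_mono_AE, use ae in eventually_elim)
  case (elim z)
  then show ?case by (auto simp: indicator_def ennreal_mult energy_density_def)
 qed
 also have "\<dots> = ennreal (p\<^sup>2) * energy_integral p F \<sigma> T"
  unfolding energy_integral_eq[OF \<sigma>] by (rule nn_integral_cmult) measurable
 finally show ?thesis .
qed

lemma energy_le_rect_energy:
 assumes \<sigma>: "\<sigma> > 0" and le: "\<And>b. b > \<sigma> + 1 \<Longrightarrow> rect_energy T \<sigma> b \<le> B"
 shows "ennreal (p\<^sup>2) * energy_integral p F \<sigma> T \<le> B"
proof -
 have [measurable]: "{\<sigma><..} \<times> {-T..T} \<in> sets plane" by (intro pair_measureI) auto
 let ?f = "\<lambda>n z. ennreal (p\<^sup>2 * energy_density z) * indicator ({\<sigma>..\<sigma> + 2 + real n} \<times> {-T..T}) z"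
 have "ennreal (p\<^sup>2) * energy_integral p F \<sigma> T = (\<integral>\<^sup>+z. ennreal (p\<^sup>2) * (ennreal (energy_density z) * indicator ({\<sigma><..} \<times> {-T..T}) z) \<partial>plane)"
  unfolding energy_integral_eq[OF \<sigma>] by (rule nn_integral_cmult[symmetric]) measurable
 also have "\<dots> \<le> (\<integral>\<^sup>+z. (SUP n. ?f n z) \<partial>plane)"
 proof (intro nn_integral_mono)
  fix z :: "real \<times> real"
  obtain n where n: "fst z - \<sigma> - 2 < real n" using reals_Archimedean2 by blast
  have "ennreal (p\<^sup>2) * (ennreal (energy_density z) * indicator ({\<sigma><..} \<times> {-T..T}) z) \<le> ?f n z"
   using n by (auto simp: indicator_def ennreal_mult energy_density_def)
  also have "\<dots> \<le> (SUP n. ?f n z)" by (rule SUP_upper) simp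
  finally show "ennreal (p\<^sup>2) * (ennreal (energy_density z) * indicator ({\<sigma><..} \<times> {-T..T}) z) \<le> (SUP n. ?f n z)" .
 qed
 also have "\<dots> = (SUP n. rect_energy T \<sigma> (\<sigma> + 2 + real n))" unfolding rect_energy_def
  by (rule nn_integral_monotone_convergence_SUP) (auto simp: incseq_def le_fun_def indicator_def)
 also have "\<dots> \<le> B" by (intro SUP_least le) auto
 finally show ?thesis .
qed

lemma energy_bounds:
 fixes T \<kappa> \<sigma> h Q :: real
 assumes T: "T > 0" and \<kappa>: "\<kappa> > 0" and \<sigma>: "\<sigma> \<ge> \<kappa>" and h: "h > 0"
  and Q: "\<And>\<nu> t. \<nu> \<ge> \<kappa> \<Longrightarrow> \<bar>t\<bar> \<le> T \<Longrightarrow>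
   (1 + norm (F (Complex \<nu> t))) powr (p - 1) * norm (deriv F (Complex \<nu> t)) \<le> Q * exp (- \<nu> / 2)"
 shows "energy_integral p F (\<sigma> + h) T < \<infinity>"
  and "p\<^sup>2 * enn2real (energy_integral p F (\<sigma> + h) T) \<le> (V T \<sigma> - V T (\<sigma> + h)) / h + 4 * p * Q"
  and "energy_integral p F \<sigma> T < \<infinity> \<Longrightarrow> (V T \<sigma> - V T (\<sigma> + h)) / h \<le> p\<^sup>2 * enn2real (energy_integral p F \<sigma> T) + 4 * p * Q"
proof -
 have \<sigma>0: "\<sigma> > 0" "\<sigma> + h > 0" using \<sigma> \<kappa> h by auto
 define w where "w b = 2 * T * p * Q * exp (- b / 2)" for b
 have w: "(w \<longlongrightarrow> 0) at_top"
 proof -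
  have "((\<lambda>b::real. exp (- b / 2)) \<longlongrightarrow> 0) at_top"
  proof (rule filterlim_compose[OF exp_at_bot])
   have "filterlim (\<lambda>b::real. (-1/2) * b) at_bot at_top"
    by (rule filterlim_tendsto_neg_mult_at_bot[OF tendsto_const _ filterlim_ident]) simp
   then show "filterlim (\<lambda>b::real. - b / 2) at_bot at_top" by simp
  qed
  then show ?thesis unfolding w_def by (rule tendsto_mult_right_zero)
 qed
 have dec: "\<forall>\<^sub>F b in at_top. w b < e" if "e > 0" for e using order_tendstoD(2)[OF w that] .
 have mono: "rect_energy T s b \<le> rect_energy T s b'" if "b \<le> b'" for s b b'
  unfolding rect_energy_def using that by (intro nn_integral_mono) (auto simp: indicator_def)
 let ?c = "(V T \<sigma> - V T (\<sigma> + h)) / h + 4 * p * Q"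
 have up: "rect_energy T (\<sigma> + h) b \<le> ennreal (?c + e)" if e: "e > 0" for b e
 proof -
  from eventually_conj[OF dec[OF e] eventually_gt_at_top[of "max b (\<sigma> + h)"]]
  obtain b' where b': "w b' < e" "b' > max b (\<sigma> + h)"
   using eventually_happens'[OF trivial_limit_at_top_linorder] by blast
  have "rect_energy T (\<sigma> + h) b \<le> rect_energy T (\<sigma> + h) b'" using b' by (intro mono) auto
  also have "\<dots> \<le> ennreal ((V T \<sigma> - V T (\<sigma> + h)) / h + (4 * p * Q + 2 * T * p * Q * exp (- b' / 2)))"
   using b' by (intro rect_energy_bounds(1)[OF T \<kappa> \<sigma> h _ Q]) auto
  also have "\<dots> \<le> ennreal (?c + e)" using b' by (intro ennreal_leI) (simp add: w_def)
  finally show ?thesis .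
 qed
 have E: "ennreal (p\<^sup>2) * energy_integral p F (\<sigma> + h) T \<le> ennreal (?c + e)" if "e > 0" for e
  using up[OF that] by (intro energy_le_rect_energy \<sigma>0) auto
 show fin: "energy_integral p F (\<sigma> + h) T < \<infinity>"
 proof -
  have "ennreal (p\<^sup>2) * energy_integral p F (\<sigma> + h) T < \<infinity>" using E[of 1] by (simp add: le_less_trans less_top)
  then show ?thesis using p1 by (auto simp: ennreal_mult_less_top)
 qed
 have c0: "p\<^sup>2 * enn2real (energy_integral p F (\<sigma> + h) T) \<le> max 0 (?c + e)" if "e > 0" for e
 proof -
  have "enn2real (ennreal (p\<^sup>2) * energy_integral p F (\<sigma> + h) T) \<le> enn2real (ennreal (?c + e))"
   by (rule enn2real_mono[OF E[OF that]]) simp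
  also have "enn2real (ennreal (?c + e)) = max 0 (?c + e)" by (auto simp: max_def enn2real_ennreal ennreal_neg)
  finally show ?thesis by (simp add: enn2real_mult)
 qed
 show "p\<^sup>2 * enn2real (energy_integral p F (\<sigma> + h) T) \<le> ?c"
 proof -
  have cc: "?c + e \<ge> 0" if "e > 0" for e
  proof -
   from dec[OF that] eventually_gt_at_top[of "\<sigma> + h"] have "\<forall>\<^sub>F b in at_top. w b < e \<and> b > \<sigma> + h" by eventually_elim auto
   then obtain b where b: "w b < e" "b > \<sigma> + h"
    using eventually_happens'[OF trivial_limit_at_top_linorder] by blast
   have "0 \<le> (V T \<sigma> - V T (\<sigma> + h)) / h + (4 * p * Q + w b)"
    unfolding w_def by (rule rect_energy_bounds(2)[OF T \<kappa> \<sigma> h b(2) Q])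
   then show ?thesis using b by linarith
  qed
  have "p\<^sup>2 * enn2real (energy_integral p F (\<sigma> + h) T) \<le> ?c + e" if "e > 0" for e
   using c0[OF that] cc[OF that] by simp
  then show ?thesis by (rule field_le_epsilon)
 qed
 assume fin\<sigma>: "energy_integral p F \<sigma> T < \<infinity>"
 have "(V T \<sigma> - V T (\<sigma> + h)) / h \<le> (p\<^sup>2 * enn2real (energy_integral p F \<sigma> T) + 4 * p * Q) + e" if e: "e > 0" for e
 proof -
  from dec[OF e] eventually_gt_at_top[of "\<sigma> + h"] have "\<forall>\<^sub>F b in at_top. w b < e \<and> b > \<sigma> + h" by eventually_elim auto
  then obtain b where b: "w b < e" "b > \<sigma> + h"
   using eventually_happens'[OF trivial_limit_at_top_linorder] by blast
  have pf: "ennreal (p\<^sup>2) * energy_integral p F \<sigma> T < \<infinity>" using fin\<sigma> by (simp add: ennreal_mult_less_top)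
  have le: "rect_energy T \<sigma> b \<le> ennreal (p\<^sup>2) * energy_integral p F \<sigma> T" by (rule rect_energy_le[OF \<sigma>0(1)])
  then have rf: "rect_energy T \<sigma> b < \<infinity>" using pf by (rule le_less_trans)
  have "enn2real (rect_energy T \<sigma> b) \<le> p\<^sup>2 * enn2real (energy_integral p F \<sigma> T)"
   using enn2real_mono[OF le] pf by (simp add: enn2real_mult)
  moreover have "(V T \<sigma> - V T (\<sigma> + h)) / h \<le> enn2real (rect_energy T \<sigma> b) + (4 * p * Q + w b)"
   unfolding w_def by (rule rect_energy_bounds(3)[OF T \<kappa> \<sigma> h b(2) Q rf])
  ultimately show ?thesis using b by linarith
 qed
 then show "(V T \<sigma> - V T (\<sigma> + h)) / h \<le> p\<^sup>2 * enn2real (energy_integral p F \<sigma> T) + 4 * p * Q"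
  by (rule field_le_epsilon)
qed

end

section \<open>The maximal inequality along the flow\<close>

text \<open>Garsia's argument. The function \<open>m N\<close> is the largest of 0 and the first \<open>N\<close> ergodic sums
 of \<open>g - \<alpha>\<close>, and \<open>m N \<le> (g - \<alpha>) 1\<^bsub>m N > 0\<^esub> + m N \<circ>
 S\<close>. Since \<open>S\<close> preserves the measure, integration cancels \<open>m N\<close>.\<close>

lemma (in prob_space) maximal_inequality:
 fixes g :: "'a \<Rightarrow> real" and S :: "'a \<Rightarrow> 'a"
 assumes S [measurable]: "S \<in> M \<rightarrow>\<^sub>M M" and inv: "distr M M S = M"
  and g [measurable]: "g \<in> borel_measurable M" and gB: "\<And>\<omega>. \<omega> \<in> space M \<Longrightarrow> 0 \<le> g \<omega> \<and> g \<omega> \<le> B"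
  and \<alpha>: "\<alpha> > 0"
 shows "\<exists>A\<in>sets M. measure M A \<le> expectation g / \<alpha> \<and>
  (\<forall>\<omega>\<in>space M - A. \<forall>n. (\<Sum>k<n. g ((S ^^ k) \<omega>)) \<le> \<alpha> * real n)"
proof -
 define m where "m = rec_nat (\<lambda>\<omega>. 0) (\<lambda>_ f \<omega>. max 0 (g \<omega> - \<alpha> + f (S \<omega>)))"
 have m0: "m 0 = (\<lambda>\<omega>. 0)" and mS: "m (Suc N) \<omega> = max 0 (g \<omega> - \<alpha> + m N (S \<omega>))" for N \<omega> by (simp_all add: m_def)
 have Ssp: "S \<omega> \<in> space M" if "\<omega> \<in> space M" for \<omega> using measurable_space[OF S that] .
 have mm [measurable]: "m N \<in> borel_measurable M" for N
 proof (induction N)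
  case (Suc N)
  have "m (Suc N) = (\<lambda>\<omega>. max 0 (g \<omega> - \<alpha> + m N (S \<omega>)))" by (rule ext) (rule mS)
  then show ?case using Suc by simp
 qed (simp add: m0)
 have m_nonneg: "m N \<omega> \<ge> 0" for N \<omega> by (cases N) (simp_all add: m0 mS)
 have m_mono: "m N \<omega> \<le> m (Suc N) \<omega>" for N \<omega>
 proof (induction N arbitrary: \<omega>)
  case (Suc N)
  have "max 0 (g \<omega> - \<alpha> + m N (S \<omega>)) \<le> max 0 (g \<omega> - \<alpha> + m (Suc N) (S \<omega>))"
   using Suc[of "S \<omega>"] by (intro max.mono add_left_mono order_refl)
  then show ?case unfolding mS[of N \<omega>] mS[of "Suc N" \<omega>] .
 qed (simp add: m0 mS)
 have m_bound: "m N \<omega> \<le> real N * B" if "\<omega> \<in> space M" for N \<omega> using that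
 proof (induction N arbitrary: \<omega>)
  case (Suc N)
  show ?case using Suc.IH[OF Ssp[OF Suc.prems]] gB[OF Suc.prems] \<alpha> m_nonneg[of N "S \<omega>"]
   by (simp add: mS algebra_simps)
 qed (simp add: m0)
 have m_int: "integrable M (m N)" for N
  by (rule integrable_const_bound[where B = "real N * B"]) (auto intro!: AE_I2 m_bound simp: m_nonneg)
 have g_int: "integrable M g" by (rule integrable_const_bound[where B = B]) (auto intro!: AE_I2 dest: gB)
 define A where "A N = {\<omega> \<in> space M. m N \<omega> > 0}" for N
 have A [measurable]: "A N \<in> sets M" for N unfolding A_def by measurable
 have A_bound: "measure M (A N) \<le> expectation g / \<alpha>" for N
 proof (cases N)
  case 0
  have "0 \<le> expectation g" using gB by (intro integral_nonneg_AE AE_I2) auto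
  then show ?thesis using \<alpha> 0 by (simp add: A_def m0)
 next
  case (Suc L)
  have Sint: "integrable M (\<lambda>\<omega>. m N (S \<omega>))" "expectation (\<lambda>\<omega>. m N (S \<omega>)) = expectation (m N)"
   using integrable_distr_eq[OF S mm[of N]] integral_distr[OF S mm[of N]] m_int[of N] by (simp_all add: inv)
  have Gint: "integrable M (\<lambda>\<omega>. g \<omega> * indicator (A N) \<omega>)" "integrable M (\<lambda>\<omega>. \<alpha> * indicator (A N) \<omega>)"
   using integrable_real_mult_indicator[OF A g_int] integrable_real_mult_indicator[OF A, of "\<lambda>_. \<alpha>"] by simp_all
  have "expectation (m N) \<le> expectation (\<lambda>\<omega>. (g \<omega> * indicator (A N) \<omega> - \<alpha> * indicator (A N) \<omega>) + m N (S \<omega>))"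
  proof (rule integral_mono[OF m_int])
   show "integrable M (\<lambda>\<omega>. (g \<omega> * indicator (A N) \<omega> - \<alpha> * indicator (A N) \<omega>) + m N (S \<omega>))"
    by (intro Bochner_Integration.integrable_add Bochner_Integration.integrable_diff Gint Sint)
   fix \<omega> assume \<omega>: "\<omega> \<in> space M"
   show "m N \<omega> \<le> (g \<omega> * indicator (A N) \<omega> - \<alpha> * indicator (A N) \<omega>) + m N (S \<omega>)"
   proof (cases "m N \<omega> > 0")
    case True
    then have "m N \<omega> = g \<omega> - \<alpha> + m L (S \<omega>)" unfolding Suc mS by linarith
    then show ?thesis using m_mono[of L "S \<omega>"] True \<omega> by (simp add: A_def Suc)
   next
    case False
    then have "\<omega> \<notin> A N" by (simp add: A_def)
    then show ?thesis using False m_nonneg[of N "S \<omega>"] by simp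
   qed
  qed
  also have "\<dots> = expectation (\<lambda>\<omega>. g \<omega> * indicator (A N) \<omega>) - \<alpha> * measure M (A N) + expectation (m N)"
   using Gint Sint by (simp add: Bochner_Integration.integral_add Bochner_Integration.integral_diff)
  finally have "\<alpha> * measure M (A N) \<le> expectation (\<lambda>\<omega>. g \<omega> * indicator (A N) \<omega>)" by simp
  also have "\<dots> \<le> expectation g" using gB by (intro integral_mono Gint g_int) (auto simp: indicator_def)
  finally show ?thesis using \<alpha> by (simp add: pos_le_divide_eq mult.commute)
 qed
 have inc: "incseq A"
 proof (rule incseq_SucI)
  show "A N \<le> A (Suc N)" for N using m_mono[of N] by (auto simp: A_def intro: less_le_trans)
 qed
 have "(\<lambda>N. measure M (A N)) \<longlonglongrightarrow> measure M (\<Union>N. A N)" using inc by (intro finite_Lim_measure_incseq) auto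
 then have "measure M (\<Union>N. A N) \<le> expectation g / \<alpha>"
  using A_bound by (intro LIMSEQ_le_const2[of _ "measure M (\<Union>N. A N)"]) auto
 moreover have "(\<Sum>k<n. g ((S ^^ k) \<omega>)) \<le> \<alpha> * real n" if \<omega>: "\<omega> \<in> space M - (\<Union>N. A N)" for \<omega> n
 proof -
  have "(\<Sum>k<n. g ((S ^^ k) \<omega>) - \<alpha>) \<le> m n \<omega>" for \<omega>
  proof (induction n arbitrary: \<omega>)
   case (Suc n)
   have "(\<Sum>k<Suc n. g ((S ^^ k) \<omega>) - \<alpha>) = g \<omega> - \<alpha> + (\<Sum>k<n. g ((S ^^ k) (S \<omega>)) - \<alpha>)"
    by (subst sum.lessThan_Suc_shift) (simp add: funpow_swap1)
   also have "\<dots> \<le> m (Suc n) \<omega>" using Suc[of "S \<omega>"] by (simp add: mS)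
   finally show ?case .
  qed (simp add: m0)
  moreover have "m n \<omega> \<le> 0" using \<omega> by (auto simp: A_def not_less)
  ultimately have "(\<Sum>k<n. g ((S ^^ k) \<omega>) - \<alpha>) \<le> 0" by (rule order_trans)
  then show ?thesis by (simp add: sum_subtractf mult.commute)
 qed
 ultimately show ?thesis by (intro bexI[of _ "\<Union>N. A N"]) auto
qed

lemma window_cover:
 fixes t T :: real
 assumes "T \<ge> 0" "\<bar>t\<bar> \<le> T"
 shows "1 \<le> (\<Sum>k<Suc (nat \<lfloor>T\<rfloor>). indicator {0..1} (t - real k) + indicator {-1..0} (t + real k) :: ennreal)"
proof -
 define k where "k = nat \<lfloor>\<bar>t\<bar>\<rfloor>"
 have k: "k < Suc (nat \<lfloor>T\<rfloor>)" "real k \<le> \<bar>t\<bar>" "\<bar>t\<bar> \<le> real k + 1"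
 proof -
  show "k < Suc (nat \<lfloor>T\<rfloor>)" unfolding k_def using assms by (intro le_imp_less_Suc nat_mono floor_mono)
  show "real k \<le> \<bar>t\<bar>" "\<bar>t\<bar> \<le> real k + 1" unfolding k_def by (simp_all add: of_nat_nat)
 qed
 have "1 \<le> (indicator {0..1} (t - real k) + indicator {-1..0} (t + real k) :: ennreal)"
  using k by (cases "t \<ge> 0") (auto simp: indicator_def)
 also have "\<dots> \<le> (\<Sum>k<Suc (nat \<lfloor>T\<rfloor>). indicator {0..1} (t - real k) + indicator {-1..0} (t + real k))"
  using k(1) by (intro member_le_sum) auto
 finally show ?thesis .
qed

lemma flow_funpow: "\<omega> \<in> space torus \<Longrightarrow> (flow c ^^ Suc k) \<omega> = flow (c * real (Suc k)) \<omega>"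
proof (induction k)
 case (Suc k)
 have "(flow c ^^ Suc (Suc k)) \<omega> = flow c (flow (c * real (Suc k)) \<omega>)" using Suc by simp
 also have "\<dots> = flow (c * real (Suc (Suc k))) \<omega>" using Suc.prems by (simp add: flow_flow algebra_simps)
 finally show ?case .
qed simp

text \<open>The integrals over consecutive unit windows are the values along an orbit of \<open>flow c\<close>, for \<open>c =
 1\<close> upwards and for \<open>c = -1\<close> downwards.\<close>

lemma twisted_poly_window_sums:
 fixes b c p \<alpha> :: real and K :: nat and d :: "nat \<Rightarrow> complex"
 assumes p: "p > 0" and \<alpha>: "\<alpha> > 0"
 defines "h \<equiv> \<lambda>\<omega> t. ennreal (norm (twisted_poly K d \<omega> (Complex 0 t)) powr p)"
 shows "\<exists>A\<in>sets torus. measure torus A \<le> torus_norm p K d 0 / \<alpha> \<and>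
  (\<forall>\<omega>\<in>space torus - A. \<forall>n. (\<Sum>k<n. \<integral>\<^sup>+t\<in>{b..b+1}. h \<omega> (t + c * real k) \<partial>lborel) \<le> ennreal (\<alpha> * real n))"
proof -
 define G where "G \<omega> = (\<integral>\<^sup>+t\<in>{b..b+1}. h \<omega> t \<partial>lborel)" for \<omega>
 define B where "B = (\<Sum>n=1..K. norm (d n)) powr p"
 have GB: "G \<omega> \<le> ennreal B" if "\<omega> \<in> space torus" for \<omega>
 proof -
  have "G \<omega> \<le> (\<integral>\<^sup>+t\<in>{b..b+1}. ennreal B \<partial>lborel)"
   unfolding G_def h_def B_def using that p by (intro nn_integral_mono mult_right_mono ennreal_leI twisted_poly_powr_bound) auto
  then show ?thesis by (simp add: nn_integral_cmult_indicator)
 qed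
 have "(\<lambda>(\<omega>, t). h \<omega> t * indicator {b..b+1} t) \<in> borel_measurable (torus \<Otimes>\<^sub>M lborel)"
  unfolding h_def by measurable
 then have Gm [measurable]: "G \<in> borel_measurable torus"
  unfolding G_def[abs_def] by (rule lborel.borel_measurable_nn_integral)
 define g where "g \<omega> = enn2real (G \<omega>)" for \<omega>
 have gG: "ennreal (g \<omega>) = G \<omega>" if "\<omega> \<in> space torus" for \<omega>
  unfolding g_def using GB[OF that] by (intro ennreal_enn2real) (simp add: le_less_trans[OF _ ennreal_less_top])
 have g: "0 \<le> g \<omega> \<and> g \<omega> \<le> B" if "\<omega> \<in> space torus" for \<omega>
  using enn2real_mono[OF GB[OF that]] by (simp add: g_def B_def)
 have gm [measurable]: "g \<in> borel_measurable torus" unfolding g_def[abs_def] by measurable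
 have gint: "integrable torus g" by (rule torus.integrable_const_bound[where B = B]) (auto intro!: AE_I2 dest: g)
 have "ennreal (torus.expectation g) = (\<integral>\<^sup>+\<omega>. ennreal (g \<omega>) \<partial>torus)"
  using g by (intro nn_integral_eq_integral[symmetric] gint AE_I2) auto
 also have "\<dots> = (\<integral>\<^sup>+\<omega>. G \<omega> \<partial>torus)" by (intro nn_integral_cong gG)
 also have "\<dots> = ennreal (torus_norm p K d 0)"
  unfolding G_def h_def using nn_integral_twisted_poly_window[OF p order_refl, of "{b..b+1}" K d] by simp
 finally have Eg: "torus.expectation g = torus_norm p K d 0"
  using g torus_norm_nn(2)[OF p order_refl] by (subst (asm) ennreal_inj) (auto intro!: integral_nonneg_AE AE_I2)
 from torus.maximal_inequality[OF flow_measurable distr_flow gm g \<alpha>, of c]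
 obtain A where A: "A \<in> sets torus" "measure torus A \<le> torus_norm p K d 0 / \<alpha>"
  "\<And>\<omega> n. \<omega> \<in> space torus - A \<Longrightarrow> (\<Sum>k<n. g ((flow c ^^ k) \<omega>)) \<le> \<alpha> * real n" unfolding Eg by auto
 show ?thesis
 proof (intro bexI[of _ A] conjI ballI allI A(1,2))
  fix \<omega> n assume \<omega>: "\<omega> \<in> space torus - A"
  have "(\<integral>\<^sup>+t\<in>{b..b+1}. h \<omega> (t + c * real k) \<partial>lborel) = ennreal (g ((flow c ^^ k) \<omega>))" for k
  proof (cases k)
   case 0
   then show ?thesis using \<omega> by (simp add: gG) (simp add: G_def)
  next
   case (Suc l)
   have "h (flow (c * real k) \<omega>) t = h \<omega> (t + c * real k)" for t
    unfolding h_def by (simp add: twisted_poly_flow Complex_eq algebra_simps)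
   then show ?thesis using \<omega> flow_funpow[where \<omega> = \<omega> and c = c and k = l] gG[OF flow_space[of \<omega> "c * real k"]] by (simp add: Suc G_def)
  qed
  then have "(\<Sum>k<n. \<integral>\<^sup>+t\<in>{b..b+1}. h \<omega> (t + c * real k) \<partial>lborel) = ennreal (\<Sum>k<n. g ((flow c ^^ k) \<omega>))"
   by (simp add: g_def sum_ennreal)
  also have "\<dots> \<le> ennreal (\<alpha> * real n)" by (intro ennreal_leI A(3) \<omega>)
  finally show "(\<Sum>k<n. \<integral>\<^sup>+t\<in>{b..b+1}. h \<omega> (t + c * real k) \<partial>lborel) \<le> ennreal (\<alpha> * real n)" .
 qed
qed

lemma twisted_poly_mean_bdd_outside:
 assumes p: "p > 0" and \<alpha>: "\<alpha> > 0"
 shows "\<exists>A\<in>sets torus. measure torus A \<le> 2 * (torus_norm p K d 0 / \<alpha>) \<and>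
  (\<forall>\<omega>\<in>space torus - A. mean_bdd (\<lambda>t. ennreal (norm (twisted_poly K d \<omega> (Complex 0 t)) powr p)) (2 * \<alpha>))"
proof -
 let ?h = "\<lambda>\<omega> t. ennreal (norm (twisted_poly K d \<omega> (Complex 0 t)) powr p)"
 from twisted_poly_window_sums[OF p \<alpha>, where K = K and d = d and b = 0 and c = 1] obtain A where A: "A \<in> sets torus" "measure torus A \<le> torus_norm p K d 0 / \<alpha>"
  "\<And>\<omega> n. \<omega> \<in> space torus - A \<Longrightarrow> (\<Sum>k<n. \<integral>\<^sup>+t\<in>{0..1}. ?h \<omega> (t + real k) \<partial>lborel) \<le> ennreal (\<alpha> * real n)" by auto
 from twisted_poly_window_sums[OF p \<alpha>, where K = K and d = d and b = "-1" and c = "-1"] obtain A' where A': "A' \<in> sets torus" "measure torus A' \<le> torus_norm p K d 0 / \<alpha>"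
  "\<And>\<omega> n. \<omega> \<in> space torus - A' \<Longrightarrow> (\<Sum>k<n. \<integral>\<^sup>+t\<in>{-1..0}. ?h \<omega> (t - real k) \<partial>lborel) \<le> ennreal (\<alpha> * real n)" by auto
 show ?thesis
 proof (intro bexI[of _ "A \<union> A'"] conjI ballI)
  show "A \<union> A' \<in> sets torus" using A A' by auto
  show "measure torus (A \<union> A') \<le> 2 * (torus_norm p K d 0 / \<alpha>)"
   using measure_Un_le[OF A(1) A'(1)] A(2) A'(2) by linarith
  fix \<omega> assume \<omega>: "\<omega> \<in> space torus - (A \<union> A')"
  have hm [measurable]: "?h \<omega> \<in> borel_measurable borel" by measurable
  show "mean_bdd (?h \<omega>) (2 * \<alpha>)" unfolding mean_bdd_def
  proof (intro conjI allI impI hm)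
   show "0 \<le> 2 * \<alpha>" using \<alpha> by simp
   fix T :: real assume T: "T \<ge> 1"
   (* At most 2 T unit windows are needed, since T \<ge> 1; this is where the factor 2 comes from. *)
   define n where "n = Suc (nat \<lfloor>T\<rfloor>)"
   have n: "real n \<le> 2 * T" using T by (simp add: n_def of_nat_nat) linarith
   have "(\<integral>\<^sup>+t\<in>{-T..T}. ?h \<omega> t \<partial>lborel)
    \<le> (\<integral>\<^sup>+t. (\<Sum>k<n. ?h \<omega> t * indicator {0..1} (t - real k) + ?h \<omega> t * indicator {-1..0} (t + real k)) \<partial>lborel)"
   proof (intro nn_integral_mono)
    fix t :: real
    have "indicator {-T..T} t \<le> (\<Sum>k<n. indicator {0..1} (t - real k) + indicator {-1..0} (t + real k) :: ennreal)"
     using window_cover[of T t] T by (auto simp: n_def indicator_def abs_le_iff)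
    then have "?h \<omega> t * indicator {-T..T} t \<le> ?h \<omega> t * (\<Sum>k<n. indicator {0..1} (t - real k) + indicator {-1..0} (t + real k))"
     by (rule mult_left_mono) simp
    then show "?h \<omega> t * indicator {-T..T} t \<le> (\<Sum>k<n. ?h \<omega> t * indicator {0..1} (t - real k) + ?h \<omega> t * indicator {-1..0} (t + real k))"
     by (simp add: sum_distrib_left distrib_left)
   qed
   also have "\<dots> = (\<Sum>k<n. (\<integral>\<^sup>+t. ?h \<omega> t * indicator {0..1} (t - real k) \<partial>lborel) + (\<integral>\<^sup>+t. ?h \<omega> t * indicator {-1..0} (t + real k) \<partial>lborel))"
    by (subst nn_integral_sum) (auto simp: nn_integral_add)
   also have "\<dots> = (\<Sum>k<n. \<integral>\<^sup>+t\<in>{0..1}. ?h \<omega> (t + real k) \<partial>lborel) + (\<Sum>k<n. \<integral>\<^sup>+t\<in>{-1..0}. ?h \<omega> (t - real k) \<partial>lborel)"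
   proof -
    have "(\<integral>\<^sup>+t. ?h \<omega> t * indicator {0..1} (t - real k) \<partial>lborel) = (\<integral>\<^sup>+t\<in>{0..1}. ?h \<omega> (t + real k) \<partial>lborel)" for k
     using nn_integral_real_shift[of "\<lambda>t. ?h \<omega> t * indicator {0..1} (t - real k)" "real k"] by simp
    moreover have "(\<integral>\<^sup>+t. ?h \<omega> t * indicator {-1..0} (t + real k) \<partial>lborel) = (\<integral>\<^sup>+t\<in>{-1..0}. ?h \<omega> (t - real k) \<partial>lborel)" for k
     using nn_integral_real_shift[of "\<lambda>t. ?h \<omega> t * indicator {-1..0} (t + real k)" "- real k"] by simp
    ultimately show ?thesis by (simp add: sum.distrib)
   qed
   also have "\<dots> \<le> ennreal (\<alpha> * real n) + ennreal (\<alpha> * real n)" using \<omega> by (intro add_mono A(3) A'(3)) auto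
   also have "\<dots> = ennreal (2 * \<alpha> * real n)" using \<alpha> by (simp flip: ennreal_plus)
   also have "\<dots> \<le> ennreal (2 * \<alpha> * (2 * T))" using n \<alpha> by (intro ennreal_leI mult_left_mono) auto
   finally show "(\<integral>\<^sup>+t\<in>{-T..T}. ?h \<omega> t \<partial>lborel) \<le> ennreal (2 * T * (2 * \<alpha>))" by (simp add: mult_ac)
  qed
 qed
qed

text \<open>The rate \<open>16\<^sup>-\<^sup>j\<close> leaves room for thresholds \<open>4\<^sup>-\<^sup>j\<close> whose
 exceptional sets have summable measure.\<close>

lemma Hp_approximation:
 assumes a: "a \<in> Hp p" and p: "p > 0"
 shows "\<exists>K P. mono K \<and> (\<forall>j n. n > K j \<longrightarrow> P j n = 0) \<and> (\<forall>n. (\<lambda>j. P j n) \<longlonglongrightarrow> a n) \<and>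
  (\<forall>j. torus_norm p (K (Suc j)) (\<lambda>n. P (Suc j) n - P j n) 0 \<le> (1 / 16 ^ j) powr p)"
proof -
 from a obtain c where c: "\<And>k. c k \<in> dirichlet_polys"
  "\<And>\<epsilon>. \<epsilon> > 0 \<Longrightarrow> \<exists>N. \<forall>j\<ge>N. \<forall>k\<ge>N. Hp_norm p (\<lambda>n. c j n - c k n) < \<epsilon>"
  "\<And>n. (\<lambda>k. c k n) \<longlonglongrightarrow> a n" by (auto simp: Hp_def)
 have "\<exists>N. \<forall>j. \<forall>i\<ge>N j. \<forall>k\<ge>N j. Hp_norm p (\<lambda>n. c i n - c k n) < 1 / 16 ^ j" by (intro choice allI c(2)) simp
 then obtain N where N: "\<And>j i k. i \<ge> N j \<Longrightarrow> k \<ge> N j \<Longrightarrow> Hp_norm p (\<lambda>n. c i n - c k n) < 1 / 16 ^ j" by blast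
 define r where "r j = (\<Sum>i\<le>j. N i) + j" for j
 have rN: "N j \<le> r j" for j unfolding r_def by (rule trans_le_add1) (rule member_le_sum, auto)
 have rS: "r j < r (Suc j)" for j by (simp add: r_def)
 then have sm: "strict_mono r" by (rule strict_monoI_Suc)
 have c0: "c k 0 = 0" and fin: "finite {n. c k n \<noteq> 0}" for k using c(1)[of k] by (auto simp: dirichlet_polys_def)
 define L where "L k = Max (insert 0 {n. c k n \<noteq> 0})" for k
 have L: "c k n = 0" if "n > L k" for k n
 proof (rule ccontr)
  assume "c k n \<noteq> 0"
  then have "n \<le> L k" unfolding L_def using fin by (intro Max_ge) auto
  then show False using that by simp
 qed
 define K where "K j = (\<Sum>i\<le>j. L (r i))" for j
 have LK: "L (r j) \<le> K j" for j unfolding K_def by (rule member_le_sum) auto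
 have K: "mono K" unfolding K_def by (intro monoI sum_mono2) auto
 define P where "P j = c (r j)" for j
 have supp: "P j n = 0" if "n > K j" for j n using LK[of j] that by (auto simp: P_def intro!: L)
 have "(\<lambda>j. P j n) \<longlonglongrightarrow> a n" for n using LIMSEQ_subseq_LIMSEQ[OF c(3)[of n] sm] by (simp add: P_def o_def)
 moreover have "torus_norm p (K (Suc j)) (\<lambda>n. P (Suc j) n - P j n) 0 \<le> (1 / 16 ^ j) powr p" for j
 proof -
  let ?n = "torus_norm p (K (Suc j)) (\<lambda>n. P (Suc j) n - P j n) 0"
  have KS: "K j \<le> K (Suc j)" using K by (simp add: mono_def)
  have "?n powr (1/p) = Hp_norm p (\<lambda>n. P (Suc j) n - P j n)"
   using KS by (intro Hp_norm_eq_torus_norm[symmetric] p) (auto simp: supp, auto simp: P_def c0)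
  also have "\<dots> < 1 / 16 ^ j" unfolding P_def using rN[of j] rS[of j] by (intro N) auto
  finally have "(?n powr (1/p)) powr p \<le> (1 / 16 ^ j) powr p" using p by (intro powr_mono2) auto
  then show ?thesis using p torus_norm_nn(2)[OF p order_refl] by (simp add: powr_powr)
 qed
 ultimately show ?thesis using K supp by blast
qed

section \<open>The Carlson set has full measure\<close>

lemma mean_bdd_mono: "mean_bdd h X \<Longrightarrow> X \<le> Y \<Longrightarrow> mean_bdd h Y"
 unfolding mean_bdd_def
proof (intro conjI allI impI)
 assume h: "h \<in> borel_measurable borel \<and> X \<ge> 0 \<and> (\<forall>T\<ge>1. (\<integral>\<^sup>+u\<in>{-T..T}. h u \<partial>lborel) \<le> ennreal (2 * T * X))"
  and XY: "X \<le> Y"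
 show "h \<in> borel_measurable borel" "0 \<le> Y" using h XY by auto
 fix T :: real assume T: "T \<ge> 1"
 have "ennreal (2 * T * X) \<le> ennreal (2 * T * Y)" using T XY by (intro ennreal_leI mult_left_mono) auto
 with h T show "(\<integral>\<^sup>+u\<in>{-T..T}. h u \<partial>lborel) \<le> ennreal (2 * T * Y)" by (blast intro: order_trans)
qed

lemma mean_bdd_const:
 assumes [measurable]: "h \<in> borel_measurable borel" and "\<And>u. h u \<le> ennreal B" "B \<ge> 0"
 shows "mean_bdd h B"
 unfolding mean_bdd_def
proof (intro conjI allI impI assms)
 fix T :: real assume T: "T \<ge> 1"
 have "(\<integral>\<^sup>+u\<in>{-T..T}. h u \<partial>lborel) \<le> (\<integral>\<^sup>+u\<in>{-T..T}. ennreal B \<partial>lborel)"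
  using assms by (intro nn_integral_mono mult_right_mono) auto
 also have "\<dots> = ennreal (2 * T * B)"
  using T assms(3) by (simp add: nn_integral_cmult_indicator mult.commute flip: ennreal_mult)
 finally show "(\<integral>\<^sup>+u\<in>{-T..T}. h u \<partial>lborel) \<le> ennreal (2 * T * B)" .
qed

lemma mean_bdd_powr_add:
 fixes f g :: "real \<Rightarrow> complex"
 assumes p: "p \<ge> 0" and [measurable]: "f \<in> borel_measurable borel" "g \<in> borel_measurable borel"
  and f: "mean_bdd (\<lambda>u. ennreal (norm (f u) powr p)) X" and g: "mean_bdd (\<lambda>u. ennreal (norm (g u) powr p)) Y"
 shows "mean_bdd (\<lambda>u. ennreal (norm (f u + g u) powr p)) (2 powr p * (X + Y))"
 unfolding mean_bdd_def
proof (intro conjI allI impI)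
 have XY: "X \<ge> 0" "Y \<ge> 0" using f g by (auto simp: mean_bdd_def)
 then show "0 \<le> 2 powr p * (X + Y)" by simp
 fix T :: real assume T: "T \<ge> 1"
 have "ennreal (norm (f u + g u) powr p) \<le> ennreal (2 powr p) * (ennreal (norm (f u) powr p) + ennreal (norm (g u) powr p))" for u
 proof -
  have "norm (f u + g u) powr p \<le> (norm (f u) + norm (g u)) powr p"
   using p by (intro powr_mono2 norm_triangle_ineq) auto
  also have "\<dots> \<le> 2 powr p * (norm (f u) powr p + norm (g u) powr p)" using p by (intro powr_add_le) auto
  finally have "ennreal (norm (f u + g u) powr p) \<le> ennreal (2 powr p * (norm (f u) powr p + norm (g u) powr p))" by (rule ennreal_leI)
  then show ?thesis by (simp add: ennreal_mult ennreal_plus)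
 qed
 then have "(\<integral>\<^sup>+u\<in>{-T..T}. ennreal (norm (f u + g u) powr p) \<partial>lborel)
  \<le> (\<integral>\<^sup>+u. ennreal (2 powr p) * (ennreal (norm (f u) powr p) * indicator {-T..T} u + ennreal (norm (g u) powr p) * indicator {-T..T} u) \<partial>lborel)"
  by (intro nn_integral_mono) (auto simp: indicator_def)
 also have "\<dots> = ennreal (2 powr p) * ((\<integral>\<^sup>+u\<in>{-T..T}. ennreal (norm (f u) powr p) \<partial>lborel) + (\<integral>\<^sup>+u\<in>{-T..T}. ennreal (norm (g u) powr p) \<partial>lborel))"
  by (simp add: nn_integral_cmult nn_integral_add)
 also have "\<dots> \<le> ennreal (2 powr p) * (ennreal (2 * T * X) + ennreal (2 * T * Y))"
  using T by (intro mult_left_mono add_mono mean_bdd_le[OF f] mean_bdd_le[OF g]) auto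
 also have "\<dots> = ennreal (2 powr p * (2 * T * X + 2 * T * Y))" using T XY by (simp add: ennreal_mult ennreal_plus)
 finally show "(\<integral>\<^sup>+u\<in>{-T..T}. ennreal (norm (f u + g u) powr p) \<partial>lborel) \<le> ennreal (2 * T * (2 powr p * (X + Y)))"
  by (simp add: algebra_simps)
qed measurable

lemma geometric_increments:
 fixes x :: "nat \<Rightarrow> complex"
 assumes "\<And>j. j \<ge> J \<Longrightarrow> norm (x (Suc j) - x j) \<le> B / 4 ^ j"
 shows "\<exists>L. x \<longlonglongrightarrow> L \<and> (\<forall>j\<ge>J. norm (x j - L) \<le> 2 * B / 4 ^ j)"
proof -
 have "norm (x (Suc J) - x J) \<le> B / 4 ^ J" by (rule assms) simp
 from order_trans[OF norm_ge_zero this] have "0 \<le> B / 4 ^ J * 4 ^ J" by (intro mult_nonneg_nonneg) auto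
 then have B: "B \<ge> 0" by simp
 have "summable (\<lambda>j. x (Suc j) - x j)"
 proof (rule summable_comparison_test)
  show "\<exists>N. \<forall>j\<ge>N. norm (x (Suc j) - x j) \<le> B * (1/4) ^ j"
   using assms by (intro exI[of _ J]) (simp add: power_divide)
  show "summable (\<lambda>j. B * (1/4::real) ^ j)" by (intro summable_mult summable_geometric) simp
 qed
 then have "(\<lambda>n. (\<Sum>j<n. x (Suc j) - x j) + x 0) \<longlonglongrightarrow> (\<Sum>j. x (Suc j) - x j) + x 0"
  by (intro tendsto_add tendsto_const summable_LIMSEQ)
 then have L: "x \<longlonglongrightarrow> (\<Sum>j. x (Suc j) - x j) + x 0" by (simp add: sum_lessThan_telescope)
 have bound: "norm (x j - x (j + m)) \<le> 2 * B / 4 ^ j - 2 * B / 4 ^ (j + m)" if "j \<ge> J" for j m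
 proof (induction m)
  case (Suc m)
  have "norm (x j - x (j + Suc m)) \<le> norm (x j - x (j + m)) + norm (x (Suc (j + m)) - x (j + m))"
   using norm_triangle_ineq4[of "x j - x (j + m)" "x (Suc (j + m)) - x (j + m)"] by simp
  also have "\<dots> \<le> (2 * B / 4 ^ j - 2 * B / 4 ^ (j + m)) + B / 4 ^ (j + m)" using that by (intro add_mono Suc assms) auto
  also have "\<dots> \<le> 2 * B / 4 ^ j - 2 * B / 4 ^ (j + Suc m)" using B by (simp add: field_simps)
  finally show ?case .
 qed simp
 show ?thesis
 proof (intro exI[of _ "(\<Sum>j. x (Suc j) - x j) + x 0"] conjI L allI impI)
  fix j assume j: "j \<ge> J"
  have "(\<lambda>m. norm (x j - x (j + m))) \<longlonglongrightarrow> norm (x j - ((\<Sum>j. x (Suc j) - x j) + x 0))"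
   using LIMSEQ_ignore_initial_segment[OF L, of j] by (intro tendsto_intros) (simp add: add.commute)
  moreover have "norm (x j - x (j + m)) \<le> 2 * B / 4 ^ j" for m
   using bound[OF j, of m] B by (smt (verit) divide_nonneg_pos zero_less_power)
  ultimately show "norm (x j - ((\<Sum>j. x (Suc j) - x j) + x 0)) \<le> 2 * B / 4 ^ j" by (intro LIMSEQ_le_const2) auto
 qed
qed

locale dirichlet_approx =
 fixes p :: real and a :: "nat \<Rightarrow> complex" and K :: "nat \<Rightarrow> nat" and P :: "nat \<Rightarrow> nat \<Rightarrow> complex"
 assumes p1: "1 \<le> p" and K_mono: "mono K" and supp: "n > K j \<Longrightarrow> P j n = 0"
  and coeff: "(\<lambda>j. P j n) \<longlonglongrightarrow> a n"
  and close: "torus_norm p (K (Suc j)) (\<lambda>n. P (Suc j) n - P j n) 0 \<le> (1 / 16 ^ j) powr p"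
begin

definition approx :: "nat \<Rightarrow> (nat \<Rightarrow> complex) \<Rightarrow> complex \<Rightarrow> complex" where
 "approx j = twisted_poly (K j) (P j)"

lemma approx_diff: "approx (Suc j) \<omega> s - approx j \<omega> s = twisted_poly (K (Suc j)) (\<lambda>n. P (Suc j) n - P j n) \<omega> s"
 using twisted_poly_extend[of "K j" "K (Suc j)" "P j" \<omega> s] K_mono supp
 by (simp add: approx_def mono_def flip: twisted_poly_diff)

lemma approx_vertical_measurable [measurable]: "(\<lambda>u. approx j \<omega> (Complex \<sigma> u)) \<in> borel_measurable borel"
 unfolding approx_def by measurable

end

text \<open>By Borel-Cantelli almost every \<open>\<omega>\<close> is such a point for some \<open>J\<close>.\<close>

locale carlson_point = dirichlet_approx +
 fixes \<omega> :: "nat \<Rightarrow> complex" and J :: nat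
 assumes \<omega>: "\<omega> \<in> space torus"
  and increments: "j \<ge> J \<Longrightarrow>
   mean_bdd (\<lambda>u. ennreal (norm (approx (Suc j) \<omega> (Complex 0 u) - approx j \<omega> (Complex 0 u)) powr p)) (2 * (1 / 4 ^ j) powr p)"
begin

definition bound :: "complex \<Rightarrow> real" where
 "bound s = 8 * ((Re s + 1 / Re s) * (1 + \<bar>Im s\<bar>)\<^sup>2)"

lemma bound_ge_1:
 assumes "Re s > 0" shows "bound s \<ge> 1"
proof -
 have "Re s + 1 / Re s \<ge> 1"
 proof (cases "Re s \<ge> 1")
  case False
  then have "1 / Re s \<ge> 1" using assms by (simp add: pos_le_divide_eq)
  then show ?thesis using assms by linarith
 next
  case True
  have "1 / Re s > 0" using assms by simp
  then show ?thesis using True by linarith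
 qed
 then have "1 * 1 \<le> (Re s + 1 / Re s) * (1 + \<bar>Im s\<bar>)\<^sup>2" by (intro mult_mono one_le_power) auto
 then show ?thesis by (simp add: bound_def)
qed

lemma increment_bound:
 assumes s: "Re s > 0" and j: "j \<ge> J"
 shows "norm (approx (Suc j) \<omega> s - approx j \<omega> s) \<le> bound s / 4 ^ j"
proof -
 let ?q = "\<lambda>s. norm (approx (Suc j) \<omega> s - approx j \<omega> s)"
 have s_eq: "Complex (Re s) (Im s) = s" by simp
 have "ennreal (?q s powr p) \<le> ennreal ((Re s + 1 / Re s) * (1 + \<bar>Im s\<bar>)\<^sup>2) *
   (\<integral>\<^sup>+u. ennreal (?q (Complex 0 u) powr p) * ennreal ((1 + \<bar>u\<bar>) powr (-2)) \<partial>lborel)"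
  using twisted_poly_pointwise[OF \<omega> p1 s, of "K (Suc j)" "\<lambda>n. P (Suc j) n - P j n" "Im s"] unfolding s_eq approx_diff .
 also have "\<dots> \<le> ennreal ((Re s + 1 / Re s) * (1 + \<bar>Im s\<bar>)\<^sup>2) * ennreal (2 * 2 / (2 - 1) * (2 * (1 / 4 ^ j) powr p))"
  by (intro mult_left_mono nn_integral_mean_bdd_weight increments j) auto
 also have "\<dots> = ennreal (bound s * (1 / 4 ^ j) powr p)"
  unfolding bound_def using s by (subst ennreal_mult[symmetric]) (auto simp: mult_ac)
 finally have "?q s powr p \<le> bound s * (1 / 4 ^ j) powr p" using bound_ge_1[OF s] by (simp add: ennreal_le_iff)
 also have "\<dots> \<le> bound s powr p * (1 / 4 ^ j) powr p"
  using bound_ge_1[OF s] powr_mono[of 1 p "bound s"] p1 by (intro mult_right_mono) auto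
 also have "\<dots> = (bound s * (1 / 4 ^ j)) powr p" by (rule powr_mult[symmetric])
 finally have "?q s powr p \<le> (bound s * (1 / 4 ^ j)) powr p" .
 moreover have "bound s * (1 / 4 ^ j) \<ge> 0" using bound_ge_1[OF s] by simp
 ultimately have "?q s \<le> bound s * (1 / 4 ^ j)"
  using powr_less_mono2[of p "bound s * (1 / 4 ^ j)" "?q s"] p1 by linarith
 then show ?thesis by simp
qed

definition F :: "complex \<Rightarrow> complex" where
 "F s = lim (\<lambda>j. approx j \<omega> s)"

lemma approx_limit:
 assumes s: "Re s > 0"
 shows "(\<lambda>j. approx j \<omega> s) \<longlonglongrightarrow> F s" "j \<ge> J \<Longrightarrow> norm (approx j \<omega> s - F s) \<le> 2 * bound s / 4 ^ j"
proof -
 obtain L where L: "(\<lambda>j. approx j \<omega> s) \<longlonglongrightarrow> L" "\<And>j. j \<ge> J \<Longrightarrow> norm (approx j \<omega> s - L) \<le> 2 * bound s / 4 ^ j"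
  using geometric_increments[OF increment_bound[OF s]] by auto
 then have "F s = L" unfolding F_def by (intro limI)
 with L show "(\<lambda>j. approx j \<omega> s) \<longlonglongrightarrow> F s" "j \<ge> J \<Longrightarrow> norm (approx j \<omega> s - F s) \<le> 2 * bound s / 4 ^ j" by auto
qed

lemma limit_holomorphic: "F holomorphic_on half_plane 0"
proof (rule holomorphic_uniform_sequence[OF open_half_plane])
 show "approx n \<omega> holomorphic_on half_plane 0" for n unfolding approx_def by (rule twisted_poly_holomorphic)
 fix x assume "x \<in> half_plane 0"
 then have x: "Re x > 0" by (simp add: half_plane_def)
 define D where "D = 8 * ((2 * Re x + 2 / Re x) * (1 + \<bar>Im x\<bar> + Re x)\<^sup>2)"
 have near: "Re x / 2 \<le> Re z \<and> bound z \<le> D" if z: "z \<in> cball x (Re x / 2)" for z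
 proof -
  have d: "\<bar>Re z - Re x\<bar> \<le> Re x / 2" "\<bar>Im z - Im x\<bar> \<le> Re x / 2"
   using z abs_Re_le_cmod[of "z - x"] abs_Im_le_cmod[of "z - x"] by (auto simp: dist_norm norm_minus_commute)
  then have rz: "Re x / 2 \<le> Re z" "Re z \<le> 2 * Re x" "\<bar>Im z\<bar> \<le> \<bar>Im x\<bar> + Re x" using x by linarith+
  have "1 / Re z \<le> 1 / (Re x / 2)" using rz x by (intro divide_left_mono) auto
  then have "Re z + 1 / Re z \<le> 2 * Re x + 2 / Re x" using rz by simp
  moreover have "(1 + \<bar>Im z\<bar>)\<^sup>2 \<le> (1 + \<bar>Im x\<bar> + Re x)\<^sup>2" using rz by (intro power_mono) auto
  ultimately have "bound z \<le> D" unfolding bound_def D_def using x by (intro mult_left_mono mult_mono) auto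
  then show ?thesis using rz by simp
 qed
 show "\<exists>d>0. cball x d \<subseteq> half_plane 0 \<and> uniform_limit (cball x d) (\<lambda>n. approx n \<omega>) F sequentially"
 proof (intro exI[of _ "Re x / 2"] conjI)
  show "cball x (Re x / 2) \<subseteq> half_plane 0"
  proof
   fix z assume "z \<in> cball x (Re x / 2)"
   from near[OF this] x have "0 < Re z" by linarith
   then show "z \<in> half_plane 0" by (simp add: half_plane_def)
  qed
  show "uniform_limit (cball x (Re x / 2)) (\<lambda>n. approx n \<omega>) F sequentially"
  proof (rule uniform_limitI)
   fix e :: real assume e: "e > 0"
   have "(\<lambda>n. 2 * D * (1/4) ^ n) \<longlonglongrightarrow> 2 * D * 0" by (intro tendsto_intros LIMSEQ_power_zero) simp
   then have "\<forall>\<^sub>F n in sequentially. 2 * D * (1/4) ^ n < e" using e by (intro order_tendstoD(2)) auto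
   then show "\<forall>\<^sub>F n in sequentially. \<forall>z\<in>cball x (Re x / 2). dist (approx n \<omega> z) (F z) < e"
    using eventually_ge_at_top[of J]
   proof eventually_elim
    case (elim n)
    show ?case
    proof
     fix z assume "z \<in> cball x (Re x / 2)"
     from near[OF this] x have z: "Re z > 0" "bound z \<le> D" by auto
     have "norm (approx n \<omega> z - F z) \<le> 2 * bound z / 4 ^ n" by (rule approx_limit(2)[OF z(1) elim(2)])
     also have "\<dots> \<le> 2 * D / 4 ^ n" using z(2) by (intro divide_right_mono) auto
     also have "\<dots> < e" using elim(1) by (simp add: power_divide)
     finally show "dist (approx n \<omega> z) (F z) < e" by (simp add: dist_norm)
    qed
   qed
  qed
 qed (use x in simp)
qed

text \<open>Each application of the triangle inequality loses a factor \<open>2 powr p\<close>, which the gain \<open>4 powr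
 (-p)\<close> from one increment to the next outweighs.\<close>

lemma increments_sum:
 "j \<ge> J \<Longrightarrow> mean_bdd (\<lambda>u. ennreal (norm (approx (j + m) \<omega> (Complex 0 u) - approx j \<omega> (Complex 0 u)) powr p)) (4 * 2 powr p * (1 / 4 ^ j) powr p)"
proof (induction m arbitrary: j)
 case 0
 show ?case by (rule mean_bdd_const) simp_all
next
 case (Suc m)
 have q: "2 powr p * (1 / 4 ^ Suc j) powr p \<le> (1 / 4 ^ j) powr p / 2"
 proof -
  have "2 powr p * (1 / 4 ^ Suc j) powr p = ((1/2) * (1 / 4 ^ j)) powr p" by (simp add: powr_mult[symmetric])
  also have "\<dots> = (1/2) powr p * (1 / 4 ^ j) powr p" by (rule powr_mult)
  also have "\<dots> \<le> (1/2) * (1 / 4 ^ j) powr p" using powr_mono'[of 1 p "1/2"] p1 by (intro mult_right_mono) auto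
  finally show ?thesis by simp
 qed
 have "mean_bdd (\<lambda>u. ennreal (norm ((approx (Suc j) \<omega> (Complex 0 u) - approx j \<omega> (Complex 0 u))
   + (approx (Suc j + m) \<omega> (Complex 0 u) - approx (Suc j) \<omega> (Complex 0 u))) powr p))
   (2 powr p * (2 * (1 / 4 ^ j) powr p + 4 * 2 powr p * (1 / 4 ^ Suc j) powr p))"
  using p1 Suc.prems by (intro mean_bdd_powr_add increments Suc.IH) auto
 then have "mean_bdd (\<lambda>u. ennreal (norm (approx (j + Suc m) \<omega> (Complex 0 u) - approx j \<omega> (Complex 0 u)) powr p))
   (2 powr p * (2 * (1 / 4 ^ j) powr p + 4 * 2 powr p * (1 / 4 ^ Suc j) powr p))" by simp
 then show ?case
 proof (rule mean_bdd_mono)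
  have "2 powr p * (4 * (2 powr p * (1 / 4 ^ Suc j) powr p)) \<le> 2 powr p * (4 * ((1 / 4 ^ j) powr p / 2))"
   using q by (intro mult_left_mono) auto
  then show "2 powr p * (2 * (1 / 4 ^ j) powr p + 4 * 2 powr p * (1 / 4 ^ Suc j) powr p) \<le> 4 * 2 powr p * (1 / 4 ^ j) powr p"
   by (simp add: algebra_simps)
 qed
qed

lemma approx_mean_bdd:
 "\<exists>X. \<forall>j\<ge>J. mean_bdd (\<lambda>u. ennreal (norm (approx j \<omega> (Complex 0 u)) powr p)) X"
proof -
 define B where "B = (\<Sum>n=1..K J. norm (P J n)) powr p"
 have "mean_bdd (\<lambda>u. ennreal (norm (approx J \<omega> (Complex 0 u)) powr p)) B"
  unfolding approx_def B_def using p1 by (intro mean_bdd_const ennreal_leI twisted_poly_powr_bound \<omega>) auto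
 then have "mean_bdd (\<lambda>u. ennreal (norm (approx J \<omega> (Complex 0 u) + (approx (J + m) \<omega> (Complex 0 u) - approx J \<omega> (Complex 0 u))) powr p))
  (2 powr p * (B + 4 * 2 powr p * (1 / 4 ^ J) powr p))" for m
  using p1 by (intro mean_bdd_powr_add increments_sum) auto
 then have "mean_bdd (\<lambda>u. ennreal (norm (approx (J + m) \<omega> (Complex 0 u)) powr p)) (2 powr p * (B + 4 * 2 powr p * (1 / 4 ^ J) powr p))" for m
  by simp
 then show ?thesis by (metis le_Suc_ex)
qed

lemma approx_partial_sum:
 "twisted_poly (K j) (\<lambda>n. if n \<le> N then P j n else 0) \<omega> s = (\<Sum>n=1..N. P j n * torus_char \<omega> n * of_nat n powr (- s))"
proof -
 let ?t = "\<lambda>n. if n \<le> N then P j n else 0"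
 have "twisted_poly (K j) ?t \<omega> s = twisted_poly (max (K j) N) ?t \<omega> s"
  by (rule twisted_poly_extend[symmetric]) (auto simp: supp)
 also have "\<dots> = twisted_poly N ?t \<omega> s" by (rule twisted_poly_extend) auto
 also have "\<dots> = (\<Sum>n=1..N. P j n * torus_char \<omega> n * of_nat n powr (- s))"
  unfolding twisted_poly_def by (intro sum.cong) auto
 finally show ?thesis .
qed

text \<open>Fatou's lemma transfers the means to the limit. For the series, the truncation error is bounded uniformly in
 \<open>j\<close>, so one may let \<open>j \<rightarrow> \<infinity>\<close> for each fixed \<open>N\<close> and only
 then \<open>N \<rightarrow> \<infinity>\<close>.\<close>

lemma limit_carlson: "\<exists>C. carlson p a \<omega> F C"
proof -
 obtain X where X: "\<And>j. j \<ge> J \<Longrightarrow> mean_bdd (\<lambda>u. ennreal (norm (approx j \<omega> (Complex 0 u)) powr p)) X"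
  using approx_mean_bdd by blast
 have X\<sigma>: "mean_bdd (\<lambda>u. ennreal (norm (approx j \<omega> (Complex \<sigma> u)) powr p)) (2 * X)" if "j \<ge> J" "\<sigma> > 0" for j \<sigma>
  using X[OF that(1)] unfolding approx_def by (rule twisted_poly_mean_bdd[OF \<omega> p1 that(2)])
 have X0: "X \<ge> 0" using X[of J] by (simp add: mean_bdd_def)
 have contF: "continuous_on UNIV (\<lambda>t. F (Complex \<sigma> t))" if "\<sigma> > 0" for \<sigma>
  by (rule continuous_on_compose2[OF holomorphic_on_imp_continuous_on[OF limit_holomorphic]])
   (use that in \<open>auto simp: Complex_eq half_plane_def intro!: continuous_intros\<close>)
 have mean: "vertical_mean p F \<sigma> T \<le> 2 * X" if \<sigma>: "\<sigma> > 0" and T: "T \<ge> 1" for \<sigma> T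
 proof -
  have "(\<integral>\<^sup>+t\<in>{-T..T}. ennreal (norm (F (Complex \<sigma> t)) powr p) \<partial>lborel)
   = (\<integral>\<^sup>+t. liminf (\<lambda>j. ennreal (norm (approx j \<omega> (Complex \<sigma> t)) powr p) * indicator {-T..T} t) \<partial>lborel)"
  proof (intro nn_integral_cong)
   fix t
   have "(\<lambda>j. ennreal (norm (approx j \<omega> (Complex \<sigma> t)) powr p) * indicator {-T..T} t)
    \<longlonglongrightarrow> ennreal (norm (F (Complex \<sigma> t)) powr p) * indicator {-T..T} t"
   proof -
    have "(\<lambda>j. norm (approx j \<omega> (Complex \<sigma> t)) powr p) \<longlonglongrightarrow> norm (F (Complex \<sigma> t)) powr p"
     using \<sigma> p1 by (intro tendsto_powr' tendsto_norm approx_limit tendsto_const) auto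
    then show ?thesis by (auto simp: indicator_def intro!: tendsto_ennrealI)
   qed
   then show "ennreal (norm (F (Complex \<sigma> t)) powr p) * indicator {-T..T} t
    = liminf (\<lambda>j. ennreal (norm (approx j \<omega> (Complex \<sigma> t)) powr p) * indicator {-T..T} t)"
    by (intro lim_imp_Liminf[symmetric]) simp_all
  qed
  also have "\<dots> \<le> liminf (\<lambda>j. \<integral>\<^sup>+t\<in>{-T..T}. ennreal (norm (approx j \<omega> (Complex \<sigma> t)) powr p) \<partial>lborel)"
   by (rule nn_integral_liminf) measurable
  also have "\<dots> \<le> ennreal (2 * T * (2 * X))"
  proof (rule Liminf_le)
   show "\<forall>\<^sub>F j in sequentially. (\<integral>\<^sup>+t\<in>{-T..T}. ennreal (norm (approx j \<omega> (Complex \<sigma> t)) powr p) \<partial>lborel) \<le> ennreal (2 * T * (2 * X))"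
    using eventually_ge_at_top[of J] by eventually_elim (rule mean_bdd_le[OF X\<sigma>[OF _ \<sigma>] T])
  qed simp
  finally have "ennreal (vertical_mean p F \<sigma> T) \<le> ennreal (1 / (2 * T)) * ennreal (2 * T * (2 * X))"
   using T p1 by (subst vertical_mean_nn_integral(1)[OF contF[OF \<sigma>]]) (auto intro: mult_left_mono)
  also have "\<dots> = ennreal (2 * X)" using T X0 by (simp add: ennreal_mult[symmetric])
  finally show ?thesis using X0 by (simp add: ennreal_le_iff)
 qed
 have sums: "(\<lambda>n. a (Suc n) * torus_char \<omega> (Suc n) * of_nat (Suc n) powr (- s)) sums F s" if "s \<in> half_plane (1/2)" for s
 proof -
  define \<eta> where "\<eta> = Re s - 1/2"
  have \<eta>: "\<eta> > 0" "s = Complex (\<eta> + 1/2) (Im s)" "Re s > 0" using that by (auto simp: \<eta>_def half_plane_def)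
  define Y where "Y = 1 + 2 * X"
  have Y: "mean_bdd (\<lambda>u. ennreal (norm (approx j \<omega> (Complex \<eta> u)))) Y" if j: "j \<ge> J" for j
   unfolding Y_def by (rule mean_bdd_of_powr[OF p1 approx_vertical_measurable X\<sigma>[OF j \<eta>(1)]])
  let ?S = "\<lambda>N. \<Sum>n=1..N. a n * torus_char \<omega> n * of_nat n powr (- s)"
  have err: "norm (?S N - F s) \<le> 80 * (1 + \<bar>Im s\<bar>) * Y * real N powr (-1/4)" if N: "N \<ge> 1" for N
  proof (rule LIMSEQ_le_const2)
   show "(\<lambda>j. norm ((\<Sum>n=1..N. P j n * torus_char \<omega> n * of_nat n powr (- s)) - approx j \<omega> s)) \<longlonglongrightarrow> norm (?S N - F s)"
    by (intro tendsto_intros coeff approx_limit \<eta>)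
   have "norm ((\<Sum>n=1..N. P j n * torus_char \<omega> n * of_nat n powr (- s)) - approx j \<omega> s) \<le> 80 * (1 + \<bar>Im s\<bar>) * Y * real N powr (-1/4)" if "j \<ge> J" for j
    using twisted_poly_truncate_bound[OF \<omega> N Y[OF that, unfolded approx_def], of "Im s"]
    unfolding \<eta>(2)[symmetric] approx_partial_sum approx_def .
   then show "\<exists>j0. \<forall>j\<ge>j0. norm ((\<Sum>n=1..N. P j n * torus_char \<omega> n * of_nat n powr (- s)) - approx j \<omega> s) \<le> 80 * (1 + \<bar>Im s\<bar>) * Y * real N powr (-1/4)"
    by blast
  qed
  have "?S \<longlonglongrightarrow> F s"
  proof (rule LIM_zero_cancel, rule Lim_null_comparison)
   show "\<forall>\<^sub>F N in sequentially. norm (?S N - F s) \<le> 80 * (1 + \<bar>Im s\<bar>) * Y * real N powr (-1/4)"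
    using eventually_ge_at_top[of 1] by eventually_elim (rule err)
   have "(\<lambda>N. real N powr (-1/4)) \<longlonglongrightarrow> 0" by (rule tendsto_neg_powr[OF _ filterlim_real_sequentially]) simp
   then show "(\<lambda>N. 80 * (1 + \<bar>Im s\<bar>) * Y * real N powr (-1/4)) \<longlonglongrightarrow> 0" by (rule tendsto_mult_right_zero)
  qed
  moreover have "?S = (\<lambda>N. \<Sum>n<N. a (Suc n) * torus_char \<omega> (Suc n) * of_nat (Suc n) powr (- s))"
   by (rule ext, rule sum.reindex_bij_witness[of _ Suc "\<lambda>n. n - 1"]) auto
  ultimately show ?thesis by (simp add: sums_def)
 qed
 show ?thesis
 proof (intro exI[of _ "2 * X"], unfold_locales)
  show "twist_continuation a \<omega> F" using limit_holomorphic sums by (simp add: twist_continuation_def)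
 qed (rule p1 \<omega> mean; assumption?)+
qed

end

context dirichlet_approx begin

lemma AE_carlson_point: "AE \<omega> in torus. \<exists>J. carlson_point p a K P \<omega> J"
proof -
 have "\<forall>j. \<exists>A. A \<in> sets torus \<and> measure torus A \<le> 2 * (1/4) ^ j \<and>
  (\<forall>\<omega>\<in>space torus - A. mean_bdd (\<lambda>u. ennreal (norm (approx (Suc j) \<omega> (Complex 0 u) - approx j \<omega> (Complex 0 u)) powr p)) (2 * (1 / 4 ^ j) powr p))" (is "\<forall>j. ?P j")
 proof
  fix j
  let ?N = "torus_norm p (K (Suc j)) (\<lambda>n. P (Suc j) n - P j n) 0"
  have p0: "p > 0" and pos: "(1 / 4 ^ j :: real) powr p > 0" using p1 by auto
  from twisted_poly_mean_bdd_outside[OF p0 pos, of "K (Suc j)" "\<lambda>n. P (Suc j) n - P j n"]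
  obtain A where A: "A \<in> sets torus" "measure torus A \<le> 2 * (?N / (1 / 4 ^ j) powr p)"
   "\<And>\<omega>. \<omega> \<in> space torus - A \<Longrightarrow> mean_bdd (\<lambda>u. ennreal (norm (approx (Suc j) \<omega> (Complex 0 u) - approx j \<omega> (Complex 0 u)) powr p)) (2 * (1 / 4 ^ j) powr p)"
   unfolding approx_diff by blast
  have "?N \<le> (1 / 4 ^ j) powr p * (1/4) ^ j"
  proof -
   have "?N \<le> (1 / 16 ^ j) powr p" by (rule close)
   also have "(1 / 16 ^ j :: real) = (1 / 4 ^ j) * (1 / 4) ^ j" by (simp add: power_mult_distrib[symmetric] power_divide)
   also have "((1 / 4 ^ j) * (1 / 4) ^ j :: real) powr p = (1 / 4 ^ j) powr p * ((1 / 4) ^ j) powr p" by (rule powr_mult)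
   also have "\<dots> \<le> (1 / 4 ^ j) powr p * (1 / 4) ^ j"
    using powr_mono'[of 1 p "(1/4) ^ j"] p1 by (intro mult_left_mono) (auto simp: power_le_one)
   finally show ?thesis .
  qed
  then have "?N / (1 / 4 ^ j) powr p \<le> (1/4) ^ j" using pos by (simp add: pos_divide_le_eq mult.commute)
  with A show "?P j" by (intro exI[of _ A]) auto
 qed
 from choice[OF this] obtain A where "\<forall>j. A j \<in> sets torus \<and> measure torus (A j) \<le> 2 * (1/4) ^ j \<and>
  (\<forall>\<omega>\<in>space torus - (A j). mean_bdd (\<lambda>u. ennreal (norm (approx (Suc j) \<omega> (Complex 0 u) - approx j \<omega> (Complex 0 u)) powr p)) (2 * (1 / 4 ^ j) powr p))" ..
 note A = this[rule_format, THEN conjunct1] this[rule_format, THEN conjunct2, THEN conjunct1] this[rule_format, THEN conjunct2, THEN conjunct2, THEN bspec]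
 have "summable (\<lambda>j. measure torus (A j))"
 proof (rule summable_comparison_test)
  show "\<exists>N. \<forall>j\<ge>N. norm (measure torus (A j)) \<le> 2 * (1/4) ^ j" by (intro exI[of _ 0]) (simp add: A(2))
  show "summable (\<lambda>j. 2 * (1/4::real) ^ j)" by (intro summable_mult summable_geometric) simp
 qed
 then have "AE \<omega> in torus. \<forall>\<^sub>F j in sequentially. \<omega> \<in> space torus - A j"
  by (intro borel_cantelli_AE1 A(1)) (auto simp: torus.emeasure_eq_measure)
 then show ?thesis
 proof eventually_elim
  case (elim \<omega>)
  then obtain J where J: "\<And>j. j \<ge> J \<Longrightarrow> \<omega> \<in> space torus - A j" by (auto simp: eventually_sequentially)
  have "\<omega> \<in> space torus" using J[of J] by simp
  then have "carlson_point p a K P \<omega> J" by unfold_locales (simp, rule A(3)[OF J])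
  then show ?case by blast
 qed
qed

lemma full_measure_Carlson_set: "full_measure (Carlson_set p a)"
 unfolding full_measure_def
proof
 show "Carlson_set p a \<subseteq> space torus" by (auto simp: Carlson_set_def)
 show "AE \<omega> in torus. \<omega> \<in> Carlson_set p a" using AE_carlson_point
 proof eventually_elim
  case (elim \<omega>)
  then obtain J where "carlson_point p a K P \<omega> J" by blast
  then interpret carlson_point p a K P \<omega> J .
  obtain C where "carlson p a \<omega> F C" using limit_carlson by blast
  then show ?case by (auto simp: Carlson_set_def carlson_def)
 qed
qed

end

section \<open>From secant slopes to the derivative\<close>

lemma derivative_from_secants:
 fixes M g :: "real \<Rightarrow> real"
 assumes cont: "continuous_on {0<..} g"
  and sec: "\<And>\<sigma> h. \<sigma> > 0 \<Longrightarrow> h > 0 \<Longrightarrow> g (\<sigma> + h) \<le> (M \<sigma> - M (\<sigma> + h)) / h"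
   "\<And>\<sigma> h. \<sigma> > 0 \<Longrightarrow> h > 0 \<Longrightarrow> (M \<sigma> - M (\<sigma> + h)) / h \<le> g \<sigma>"
  and \<sigma>: "\<sigma> > 0"
 shows "(M has_real_derivative - g \<sigma>) (at \<sigma>)"
 unfolding has_field_derivative_iff
proof (rule Lim_transform2)
 have "(g \<longlongrightarrow> g \<sigma>) (at \<sigma>)" using cont \<sigma> by (simp add: continuous_on_eq_continuous_at isCont_def)
 then have g: "((\<lambda>y. norm (g y - g \<sigma>)) \<longlongrightarrow> 0) (at \<sigma>)" by (intro tendsto_norm_zero LIM_zero)
 show "((\<lambda>y. - g \<sigma>) \<longlongrightarrow> - g \<sigma>) (at \<sigma>)" by (rule tendsto_const)
 have pos: "\<forall>\<^sub>F y in at \<sigma>. y > 0" using \<sigma> by (intro order_tendstoD(1)[OF tendsto_ident_at])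
 have ne: "\<forall>\<^sub>F y in at \<sigma>. y \<noteq> \<sigma>" by (rule eventually_neq_at_within)
 have "\<forall>\<^sub>F y in at \<sigma>. norm (- g \<sigma> - (M y - M \<sigma>) / (y - \<sigma>)) \<le> norm (g y - g \<sigma>)" using pos ne
 proof eventually_elim
  case (elim y)
  show ?case
  proof (cases "y > \<sigma>")
   case True
   have "g y \<le> (M \<sigma> - M y) / (y - \<sigma>)" "(M \<sigma> - M y) / (y - \<sigma>) \<le> g \<sigma>" using sec[OF \<sigma>, of "y - \<sigma>"] True by auto
   moreover have "(M \<sigma> - M y) / (y - \<sigma>) = - ((M y - M \<sigma>) / (y - \<sigma>))" by (simp add: minus_divide_left)
   ultimately show ?thesis by simp
  next
   case False
   then have "g \<sigma> \<le> (M y - M \<sigma>) / (\<sigma> - y)" "(M y - M \<sigma>) / (\<sigma> - y) \<le> g y"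
    using sec[OF elim(1), of "\<sigma> - y"] elim(2) by auto
   moreover have "(M y - M \<sigma>) / (\<sigma> - y) = - ((M y - M \<sigma>) / (y - \<sigma>))" by (metis minus_diff_eq minus_divide_right)
   ultimately show ?thesis by simp
  qed
 qed
 from this g show "((\<lambda>y. - g \<sigma> - (M y - M \<sigma>) / (y - \<sigma>)) \<longlongrightarrow> 0) (at \<sigma>)" by (rule Lim_null_comparison)
qed

text \<open>Pointwise convergence follows by choosing \<open>h\<close> small. As in Dini's theorem, monotonicity and the
 continuity of the limit make it locally uniform, and near infinity everything is small because \<open>g \<le> X /
 H\<close> at distance \<open>H\<close>.\<close>

lemma uniform_limit_from_secants:
 fixes e v :: "real \<Rightarrow> real \<Rightarrow> real" and M g :: "real \<Rightarrow> real" and X :: real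
 assumes anti: "\<And>T x y. T > 0 \<Longrightarrow> 0 < x \<Longrightarrow> x \<le> y \<Longrightarrow> e T y \<le> e T x"
  and e0: "\<And>T x. T > 0 \<Longrightarrow> e T x \<ge> 0"
  and lim: "\<And>\<sigma>. \<sigma> > 0 \<Longrightarrow> ((\<lambda>T. v T \<sigma>) \<longlongrightarrow> M \<sigma>) at_top"
  and ineq: "\<And>\<kappa> \<delta>. \<kappa> > 0 \<Longrightarrow> \<delta> > 0 \<Longrightarrow> \<forall>\<^sub>F T in at_top. \<forall>\<sigma>>\<kappa>. \<forall>h>0.
    e T (\<sigma> + h) \<le> (v T \<sigma> - v T (\<sigma> + h)) / h + \<delta> \<and> (v T \<sigma> - v T (\<sigma> + h)) / h \<le> e T \<sigma> + \<delta>"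
  and MX: "\<And>\<sigma>. \<sigma> > 0 \<Longrightarrow> 0 \<le> M \<sigma> \<and> M \<sigma> \<le> X"
  and cont: "continuous_on {0<..} g"
  and sec: "\<And>\<sigma> h. \<sigma> > 0 \<Longrightarrow> h > 0 \<Longrightarrow> g (\<sigma> + h) \<le> (M \<sigma> - M (\<sigma> + h)) / h"
   "\<And>\<sigma> h. \<sigma> > 0 \<Longrightarrow> h > 0 \<Longrightarrow> (M \<sigma> - M (\<sigma> + h)) / h \<le> g \<sigma>"
  and \<kappa>: "\<kappa> > 0"
 shows "uniform_limit {\<kappa><..} e g at_top"
proof -
 have pointwise: "((\<lambda>T. e T \<sigma>) \<longlongrightarrow> g \<sigma>) at_top" if \<sigma>: "\<sigma> > 0" for \<sigma>
 proof (rule tendstoI)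
  fix \<epsilon> :: real assume "\<epsilon> > 0"
  define \<delta> where "\<delta> = \<epsilon> / 4"
  have \<delta>: "\<delta> > 0" "\<epsilon> = 4 * \<delta>" using \<open>\<epsilon> > 0\<close> by (auto simp: \<delta>_def)
  have "isCont g \<sigma>" using cont \<sigma> by (simp add: continuous_on_eq_continuous_at)
  then obtain d where d: "d > 0" "\<And>y. dist y \<sigma> < d \<Longrightarrow> dist (g y) (g \<sigma>) < \<delta>"
   using \<delta>(1) unfolding continuous_at_eps_delta dist_real_def by metis
  define h where "h = min (d/2) (\<sigma>/4)"
  have h: "h > 0" "h < d" "h < \<sigma>/2" using d \<sigma> by (auto simp: h_def)
  have gh: "g (\<sigma> + h) > g \<sigma> - \<delta>" "g (\<sigma> - h) < g \<sigma> + \<delta>"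
   using d(2)[of "\<sigma> + h"] d(2)[of "\<sigma> - h"] h by (auto simp: dist_real_def)
  have l1: "((\<lambda>T. (v T \<sigma> - v T (\<sigma> + h)) / h) \<longlongrightarrow> (M \<sigma> - M (\<sigma> + h)) / h) at_top"
   using \<sigma> h by (intro tendsto_intros lim) auto
  have l2: "((\<lambda>T. (v T (\<sigma> - h) - v T \<sigma>) / h) \<longlongrightarrow> (M (\<sigma> - h) - M \<sigma>) / h) at_top"
   using \<sigma> h by (intro tendsto_intros lim) auto
  have b1: "(M \<sigma> - M (\<sigma> + h)) / h > g \<sigma> - \<delta>" using sec(1)[OF \<sigma> h(1)] gh by simp
  have b2: "(M (\<sigma> - h) - M \<sigma>) / h < g \<sigma> + \<delta>" using sec(2)[of "\<sigma> - h" h] gh h \<sigma> by simp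
  have s2: "\<sigma>/2 > 0" using \<sigma> by simp
  show "\<forall>\<^sub>F T in at_top. dist (e T \<sigma>) (g \<sigma>) < \<epsilon>"
   using order_tendstoD(1)[OF l1 b1] order_tendstoD(2)[OF l2 b2] ineq[OF s2 \<delta>(1)]
  proof eventually_elim
   case (elim T)
   have "(v T \<sigma> - v T (\<sigma> + h)) / h \<le> e T \<sigma> + \<delta>" using elim(3) \<sigma> h by auto
   moreover have "e T ((\<sigma> - h) + h) \<le> (v T (\<sigma> - h) - v T ((\<sigma> - h) + h)) / h + \<delta>"
   proof -
    have "\<sigma> - h > \<sigma>/2" using h by simp
    with elim(3) h(1) show ?thesis by blast
   qed
   ultimately have "e T \<sigma> + \<delta> > g \<sigma> - \<delta>" "e T \<sigma> < g \<sigma> + \<delta> + \<delta>" using elim(1,2) by simp_all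
   then show ?case using \<delta> by (simp add: dist_real_def abs_less_iff)
  qed
 qed
 have antig: "g y \<le> g x" if "0 < x" "x \<le> y" for x y
  using that order_trans[OF sec(1) sec(2), of x "y - x"] by (cases "x = y") auto
 have g0: "g x \<ge> 0" if "x > 0" for x
 proof (rule tendsto_lowerbound[OF pointwise[OF that]])
  show "\<forall>\<^sub>F T in at_top. 0 \<le> e T x" using eventually_gt_at_top[of 0] by eventually_elim (use e0 in auto)
 qed simp
 show "uniform_limit {\<kappa><..} e g at_top"
 proof (rule uniform_limitI)
  fix \<epsilon> :: real assume "\<epsilon> > 0"
  define \<eta> where "\<eta> = \<epsilon> / 3"
  have \<eta>: "\<eta> > 0" "\<epsilon> = 3 * \<eta>" using \<open>\<epsilon> > 0\<close> by (auto simp: \<eta>_def)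
  have X0: "X \<ge> 0" using MX[of 1] by simp
  (* A secant of length H has slope at most X / H, which therefore bounds g at S and beyond. *)
  define H where "H = X / \<eta> + 1"
  have H: "H > 0" using X0 \<eta> by (simp add: H_def add_nonneg_pos)
  define S where "S = \<kappa> + H"
  have S: "S > \<kappa>" "S > 0" using H \<kappa> by (auto simp: S_def)
  have gS: "g S \<le> \<eta>"
  proof -
   have "g S \<le> (M \<kappa> - M (\<kappa> + H)) / H" unfolding S_def by (rule sec(1)[OF \<kappa> H])
   also have "\<dots> \<le> X / H" using MX[OF \<kappa>] MX[of "\<kappa> + H"] \<kappa> H by (intro divide_right_mono) auto
   also have "\<dots> \<le> \<eta>"
   proof -
    have "X \<le> \<eta> * H" using \<eta> by (simp add: H_def distrib_left)
    then show ?thesis using H by (simp add: pos_divide_le_eq)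
   qed
   finally show ?thesis .
  qed
  have "\<forall>x\<in>{\<kappa>..S}. \<exists>d. d > 0 \<and> (\<forall>\<^sub>F T in at_top. \<forall>\<sigma>\<in>{x - d<..<x + d}. dist (e T \<sigma>) (g \<sigma>) < \<epsilon>)"
  proof
   fix x assume x: "x \<in> {\<kappa>..S}"
   have x0: "x > 0" using x \<kappa> by simp
   then have "isCont g x" using cont by (simp add: continuous_on_eq_continuous_at)
   then obtain d0 where d0: "d0 > 0" "\<And>y. dist y x < d0 \<Longrightarrow> dist (g y) (g x) < \<eta>"
    using \<eta>(1) unfolding continuous_at_eps_delta dist_real_def by blast
   define d where "d = min d0 x / 2"
   have d: "d > 0" "d < d0" "x - d > 0" using d0 x0 by (auto simp: d_def min_def)
   have gd: "g (x - d) < g x + \<eta>" "g (x + d) > g x - \<eta>"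
    using d0(2)[of "x - d"] d0(2)[of "x + d"] d by (auto simp: dist_real_def)
   have "\<forall>\<^sub>F T in at_top. e T (x - d) < g x + \<eta>" "\<forall>\<^sub>F T in at_top. e T (x + d) > g x - \<eta>"
    using order_tendstoD(2)[OF pointwise gd(1)] order_tendstoD(1)[OF pointwise gd(2)] d x0 by simp_all
   then have "\<forall>\<^sub>F T in at_top. \<forall>\<sigma>\<in>{x - d<..<x + d}. dist (e T \<sigma>) (g \<sigma>) < \<epsilon>" using eventually_gt_at_top[of 0]
   proof eventually_elim
    case (elim T)
    show ?case
    proof
     fix \<sigma> assume s: "\<sigma> \<in> {x - d<..<x + d}"
     have "e T \<sigma> \<le> e T (x - d)" "e T (x + d) \<le> e T \<sigma>" using elim s d by (auto intro!: anti)
     moreover have "g \<sigma> \<le> g (x - d)" "g (x + d) \<le> g \<sigma>" using s d by (auto intro!: antig)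
     ultimately show "dist (e T \<sigma>) (g \<sigma>) < \<epsilon>" using elim gd \<eta> by (simp add: dist_real_def abs_less_iff)
    qed
   qed
   with d(1) show "\<exists>d. d > 0 \<and> (\<forall>\<^sub>F T in at_top. \<forall>\<sigma>\<in>{x - d<..<x + d}. dist (e T \<sigma>) (g \<sigma>) < \<epsilon>)"
    by (intro exI[of _ d]) simp
  qed
  from bchoice[OF this] obtain d where d: "\<forall>x\<in>{\<kappa>..S}. d x > 0 \<and> (\<forall>\<^sub>F T in at_top. \<forall>\<sigma>\<in>{x - d x<..<x + d x}. dist (e T \<sigma>) (g \<sigma>) < \<epsilon>)" ..
  have cover: "{\<kappa>..S} \<subseteq> (\<Union>x\<in>{\<kappa>..S}. {x - d x<..<x + d x})"
  proof
   fix x assume "x \<in> {\<kappa>..S}"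
   with d show "x \<in> (\<Union>x\<in>{\<kappa>..S}. {x - d x<..<x + d x})" by (intro UN_I[of x]) auto
  qed
  obtain C where C: "C \<subseteq> {\<kappa>..S}" "finite C" "{\<kappa>..S} \<subseteq> (\<Union>x\<in>C. {x - d x<..<x + d x})"
   by (rule compactE_image[OF compact_Icc _ cover]) auto
  have "\<forall>\<^sub>F T in at_top. \<forall>x\<in>C. \<forall>\<sigma>\<in>{x - d x<..<x + d x}. dist (e T \<sigma>) (g \<sigma>) < \<epsilon>"
   using C(1,2) d by (intro eventually_ball_finite) auto
  moreover have "\<forall>\<^sub>F T in at_top. e T S < 2 * \<eta>"
   using gS \<eta> by (intro order_tendstoD(2)[OF pointwise[OF S(2)]]) simp
  ultimately show "\<forall>\<^sub>F T in at_top. \<forall>\<sigma>\<in>{\<kappa><..}. dist (e T \<sigma>) (g \<sigma>) < \<epsilon>" using eventually_gt_at_top[of 0]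
  proof eventually_elim
   case (elim T)
   show ?case
   proof
    fix \<sigma> assume "\<sigma> \<in> {\<kappa><..}"
    then have \<sigma>: "\<sigma> > \<kappa>" "\<sigma> > 0" using \<kappa> by auto
    show "dist (e T \<sigma>) (g \<sigma>) < \<epsilon>"
    proof (cases "\<sigma> \<ge> S")
     case True
     have "e T \<sigma> \<le> e T S" using elim True S by (intro anti) auto
     moreover have "e T \<sigma> \<ge> 0" using elim by (intro e0)
     moreover have "g \<sigma> \<le> \<eta>" using antig[OF S(2) True] gS by simp
     moreover have "g \<sigma> \<ge> 0" by (rule g0[OF \<sigma>(2)])
     ultimately show ?thesis using \<eta> elim by (simp add: dist_real_def abs_less_iff)
    next
     case False
     then have "\<sigma> \<in> (\<Union>x\<in>C. {x - d x<..<x + d x})" using \<sigma> by (intro subsetD[OF C(3)]) auto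
     then show ?thesis using elim(1) by blast
    qed
   qed
  qed
 qed
qed

context carlson begin

definition mean_energy :: "real \<Rightarrow> real \<Rightarrow> real" where
 "mean_energy \<sigma> T = p\<^sup>2 / (2 * T) * enn2real (energy_integral p F \<sigma> T)"

lemma growth_le:
 fixes \<kappa> C \<eta> \<nu> t T q :: real
 assumes "\<And>\<nu> t. \<nu> \<ge> \<kappa> \<Longrightarrow> (1 + norm (F (Complex \<nu> t))) powr q * norm (deriv F (Complex \<nu> t)) \<le> (C + \<eta> * \<bar>t\<bar>) * exp (- \<nu> / 2)"
  "\<eta> > 0" "\<nu> \<ge> \<kappa>" "\<bar>t\<bar> \<le> T"
 shows "(1 + norm (F (Complex \<nu> t))) powr q * norm (deriv F (Complex \<nu> t)) \<le> (C + \<eta> * T) * exp (- \<nu> / 2)"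
proof -
 have "(C + \<eta> * \<bar>t\<bar>) * exp (- \<nu> / 2) \<le> (C + \<eta> * T) * exp (- \<nu> / 2)"
  using assms by (intro mult_right_mono add_left_mono mult_left_mono) auto
 then show ?thesis using assms(1)[OF assms(3), of t] by linarith
qed

lemma energy_finite:
 assumes \<sigma>: "\<sigma> > 0" and T: "T > 0"
 shows "energy_integral p F \<sigma> T < \<infinity>"
proof -
 interpret hs: hardy_stein p F by unfold_locales (rule p1, rule F_holomorphic)
  have s2: "\<sigma>/2 > 0" using \<sigma> by simp
  from gradient_growth[OF s2 zero_less_one] obtain C where
   C: "\<And>\<nu> t. \<nu> \<ge> \<sigma>/2 \<Longrightarrow> (1 + norm (F (Complex \<nu> t))) powr (p - 1) * norm (deriv F (Complex \<nu> t)) \<le> (C + 1 * \<bar>t\<bar>) * exp (- \<nu> / 2)" by auto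
  have "energy_integral p F (\<sigma>/2 + \<sigma>/2) T < \<infinity>"
   by (rule hs.energy_bounds(1)[OF T s2 order_refl s2 growth_le[OF C]]) auto
  then show ?thesis by simp
qed

lemma energy_secant_bounds:
 assumes \<kappa>: "\<kappa> > 0" and \<delta>: "\<delta> > 0"
 shows "\<forall>\<^sub>F T in at_top. \<forall>\<sigma>>\<kappa>. \<forall>h>0.
    mean_energy (\<sigma> + h) T \<le> (vertical_mean p F \<sigma> T - vertical_mean p F (\<sigma> + h) T) / h + \<delta> \<and>
    (vertical_mean p F \<sigma> T - vertical_mean p F (\<sigma> + h) T) / h \<le> mean_energy \<sigma> T + \<delta>"
proof -
 interpret hs: hardy_stein p F by unfold_locales (rule p1, rule F_holomorphic)
 have p0: "p > 0" using p1 by simp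
 have V: "hs.V T x = 2 * T * vertical_mean p F x T" if "T > 0" "x > 0" for T x
 proof -
  have "(LINT t:{-T..T}|lborel. norm (F (Complex x t)) powr p) = hs.V T x" unfolding hs.V_def
   by (intro set_borel_integral_eq_integral(2) vertical_mean_nn_integral(2) F_vertical_continuous that p0)
  then show ?thesis using that by (simp add: vertical_mean_def)
 qed
  define \<eta> where "\<eta> = \<delta> / (4 * p)"
  have \<eta>: "\<eta> > 0" using \<delta> p0 by (simp add: \<eta>_def)
  from gradient_growth[OF \<kappa> \<eta>] obtain C where
   C: "C \<ge> 0" "\<And>\<nu> t. \<nu> \<ge> \<kappa> \<Longrightarrow> (1 + norm (F (Complex \<nu> t))) powr (p - 1) * norm (deriv F (Complex \<nu> t)) \<le> (C + \<eta> * \<bar>t\<bar>) * exp (- \<nu> / 2)" by auto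
  show ?thesis using eventually_ge_at_top[of "max 1 (4 * p * C / \<delta>)"]
  proof eventually_elim
   case (elim T)
   then have T: "T > 0" "4 * p * C \<le> \<delta> * T" using \<delta> by (auto simp: pos_divide_le_eq mult.commute)
   define Q where "Q = C + \<eta> * T"
   have Q: "4 * p * Q / (2 * T) \<le> \<delta>"
   proof -
    have "4 * p * Q = 4 * p * C + \<delta> * T" using p0 by (simp add: Q_def \<eta>_def algebra_simps)
    also have "\<dots> \<le> \<delta> * (2 * T)" using T by (simp add: mult_ac)
    finally show ?thesis using T by (simp add: pos_divide_le_eq mult.commute)
   qed
   show ?case
   proof (intro allI impI conjI)
    fix \<sigma> h :: real assume \<sigma>: "\<sigma> > \<kappa>" and h: "h > 0"
    have \<sigma>0: "\<sigma> > 0" "\<sigma> + h > 0" using \<sigma> \<kappa> h by auto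
    have Qb': "(1 + norm (F (Complex \<nu> t))) powr (p - 1) * norm (deriv F (Complex \<nu> t)) \<le> Q * exp (- \<nu> / 2)"
     if "\<nu> \<ge> \<kappa>" "\<bar>t\<bar> \<le> T" for \<nu> t unfolding Q_def by (rule growth_le[OF C(2) \<eta> that])
    note eb = hs.energy_bounds[OF T(1) \<kappa> less_imp_le[OF \<sigma>] h Qb']
    have q: "(hs.V T \<sigma> - hs.V T (\<sigma> + h)) / h = 2 * T * ((vertical_mean p F \<sigma> T - vertical_mean p F (\<sigma> + h) T) / h)"
     using T \<sigma>0 by (simp add: V right_diff_distrib)
    have s: "mean_energy x T = p\<^sup>2 * enn2real (energy_integral p F x T) / (2 * T)" for x by (simp add: mean_energy_def)
    have dd: "(2 * T * y + 4 * p * Q) / (2 * T) = y + 4 * p * Q / (2 * T)" for y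
     using T by (simp add: add_divide_distrib)
    have "mean_energy (\<sigma> + h) T \<le> (2 * T * ((vertical_mean p F \<sigma> T - vertical_mean p F (\<sigma> + h) T) / h) + 4 * p * Q) / (2 * T)"
     unfolding s using T eb(2) unfolding q by (intro divide_right_mono) auto
    then show "mean_energy (\<sigma> + h) T \<le> (vertical_mean p F \<sigma> T - vertical_mean p F (\<sigma> + h) T) / h + \<delta>"
     unfolding dd using Q by linarith
    have "2 * T * ((vertical_mean p F \<sigma> T - vertical_mean p F (\<sigma> + h) T) / h) / (2 * T) \<le> (p\<^sup>2 * enn2real (energy_integral p F \<sigma> T) + 4 * p * Q) / (2 * T)"
     using T eb(3)[OF _ _ energy_finite[OF \<sigma>0(1) T(1)]] unfolding q by (intro divide_right_mono) auto
    then show "(vertical_mean p F \<sigma> T - vertical_mean p F (\<sigma> + h) T) / h \<le> mean_energy \<sigma> T + \<delta>"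
     using T Q by (simp add: s add_divide_distrib)
   qed
  qed
qed

lemma derivative_formula:
 assumes M: "\<And>\<sigma>. \<sigma> > 0 \<Longrightarrow> (vertical_mean p F \<sigma> \<longlongrightarrow> M \<sigma>) at_top"
  and cont: "continuous_on {0<..} g"
  and sec: "\<And>\<sigma> h. \<sigma> > 0 \<Longrightarrow> h > 0 \<Longrightarrow> g (\<sigma> + h) \<le> (M \<sigma> - M (\<sigma> + h)) / h"
   "\<And>\<sigma> h. \<sigma> > 0 \<Longrightarrow> h > 0 \<Longrightarrow> (M \<sigma> - M (\<sigma> + h)) / h \<le> g \<sigma>"
 shows "mean_derivative_formula p F"
proof -
 have p0: "p > 0" using p1 by simp
 have mean0: "vertical_mean p F \<sigma> T \<ge> 0" if "\<sigma> > 0" "T > 0" for \<sigma> T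
  using that p0 by (intro vertical_mean_nn_integral(3) F_vertical_continuous)
 have M0: "0 \<le> M \<sigma> \<and> M \<sigma> \<le> X" if \<sigma>: "\<sigma> > 0" for \<sigma>
 proof
  show "0 \<le> M \<sigma>"
  proof (rule tendsto_lowerbound[OF M[OF \<sigma>]])
   show "\<forall>\<^sub>F T in at_top. 0 \<le> vertical_mean p F \<sigma> T"
    using eventually_gt_at_top[of 0] by eventually_elim (rule mean0[OF \<sigma>])
  qed simp
  show "M \<sigma> \<le> X"
  proof (rule tendsto_upperbound[OF M[OF \<sigma>]])
   show "\<forall>\<^sub>F T in at_top. vertical_mean p F \<sigma> T \<le> X"
    using eventually_ge_at_top[of 1] by eventually_elim (rule bounded[OF \<sigma>])
  qed simp
 qed
 have anti: "mean_energy y T \<le> mean_energy x T" if "T > 0" "0 < x" "x \<le> y" for T x y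
 proof -
  have "energy_integral p F y T \<le> energy_integral p F x T" unfolding energy_integral_def using that(3)
   by (intro nn_integral_mono mult_right_mono) (auto simp: indicator_def)
  then have "enn2real (energy_integral p F y T) \<le> enn2real (energy_integral p F x T)"
   using energy_finite[of x T] that by (intro enn2real_mono) auto
  then show ?thesis unfolding mean_energy_def using that by (intro mult_left_mono) auto
 qed
 have e0: "mean_energy x T \<ge> 0" if "T > 0" for T x using that by (simp add: mean_energy_def)
 have uniform: "uniform_limit {\<kappa><..} (\<lambda>T \<sigma>. mean_energy \<sigma> T) g at_top" if "\<kappa> > 0" for \<kappa>
  by (rule uniform_limit_from_secants[where e = "\<lambda>T \<sigma>. mean_energy \<sigma> T" and v = "\<lambda>T \<sigma>. vertical_mean p F \<sigma> T" and M = M and X = X,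
    OF anti e0 M energy_secant_bounds M0 cont sec that])
 show ?thesis unfolding mean_derivative_formula_def
 proof (intro conjI allI impI)
  show "\<exists>L. (vertical_mean p F \<sigma> \<longlongrightarrow> L) at_top" if "\<sigma> > 0" for \<sigma> using M[OF that] by blast
  show "energy_integral p F \<sigma> T < \<infinity>" if "\<sigma> > 0" "T > 0" for \<sigma> T using that by (rule energy_finite)
  show "\<exists>D. (\<forall>\<sigma>>0. ((\<lambda>\<sigma>. Mp p F \<sigma> powr p) has_real_derivative D \<sigma>) (at \<sigma>)) \<and> continuous_on {0<..} D \<and>
    (\<forall>\<kappa>>0. uniform_limit {\<kappa><..} (\<lambda>T \<sigma>. - (p\<^sup>2 / (2 * T) * enn2real (energy_integral p F \<sigma> T))) D at_top)"
  proof (intro exI[of _ "\<lambda>\<sigma>. - g \<sigma>"] conjI allI impI)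
   show "continuous_on {0<..} (\<lambda>\<sigma>. - g \<sigma>)" by (intro continuous_intros cont)
   show "uniform_limit {\<kappa><..} (\<lambda>T \<sigma>. - (p\<^sup>2 / (2 * T) * enn2real (energy_integral p F \<sigma> T))) (\<lambda>\<sigma>. - g \<sigma>) at_top" if "\<kappa> > 0" for \<kappa>
    using uniform_limit_uminus[OF uniform[OF that]] unfolding mean_energy_def .
   fix \<sigma> :: real assume \<sigma>: "\<sigma> > 0"
   have eq: "Mp p F x powr p = M x" if "x > 0" for x
   proof -
    have "Lim at_top (vertical_mean p F x) = M x" by (rule tendsto_Lim[OF trivial_limit_at_top_linorder M[OF that]])
    then show ?thesis using M0[OF that] p0 by (simp add: Mp_def powr_powr)
   qed
   show "((\<lambda>\<sigma>. Mp p F \<sigma> powr p) has_real_derivative - g \<sigma>) (at \<sigma>)"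
    by (rule has_field_derivative_transform_within_open[OF derivative_from_secants[OF cont sec \<sigma>], of "{0<..}"]) (use \<sigma> eq in auto)
  qed
 qed
qed

end

section \<open>The expected energy\<close>

lemma twisted_poly_measurable_compose:
 assumes W: "W \<in> N \<rightarrow>\<^sub>M torus" and s [measurable]: "s \<in> borel_measurable N"
 shows "(\<lambda>x. twisted_poly K c (W x) (s x)) \<in> borel_measurable N"
 unfolding twisted_poly_def
proof (intro borel_measurable_sum borel_measurable_times borel_measurable_const)
 fix n assume "n \<in> {1..K}"
 then have n: "n > 0" by simp
 show "(\<lambda>x. torus_char (W x) n) \<in> borel_measurable N" by (rule measurable_compose[OF W torus_char_measurable])
 show "(\<lambda>x. of_nat n powr - s x) \<in> borel_measurable N" unfolding nat_powr_eq_exp[OF n] by measurable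
qed

context dirichlet_approx begin

definition twist :: "(nat \<Rightarrow> complex) \<Rightarrow> complex \<Rightarrow> complex" where
 "twist \<omega> s = lim (\<lambda>j. approx j \<omega> s)"

definition twist_deriv :: "(nat \<Rightarrow> complex) \<Rightarrow> complex \<Rightarrow> complex" where
 "twist_deriv \<omega> s = lim (\<lambda>n. (twist \<omega> (s + of_real (1 / real (Suc n))) - twist \<omega> s) / of_real (1 / real (Suc n)))"

definition energy :: "(nat \<Rightarrow> complex) \<Rightarrow> complex \<Rightarrow> ennreal" where
 "energy \<omega> s = ennreal (norm (twist \<omega> s) powr (p - 2) * (norm (twist_deriv \<omega> s))\<^sup>2)"

text \<open>The energy on the horizontal ray to the right of \<open>\<sigma>\<close>. Along the flow it becomes the inner
 integral of \<open>energy_integral\<close> at height \<open>t\<close>.\<close>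

definition ray_energy :: "real \<Rightarrow> (nat \<Rightarrow> complex) \<Rightarrow> ennreal" where
 "ray_energy \<sigma> \<omega> = (\<integral>\<^sup>+\<nu>\<in>{\<sigma><..}. energy \<omega> (of_real \<nu>) \<partial>lborel)"

definition expected_energy :: "real \<Rightarrow> ennreal" where
 "expected_energy \<sigma> = (\<integral>\<^sup>+\<omega>. ray_energy \<sigma> \<omega> \<partial>torus)"

lemma energy_measurable:
 assumes W: "W \<in> N \<rightarrow>\<^sub>M torus" and s [measurable]: "s \<in> borel_measurable N"
 shows "(\<lambda>x. energy (W x) (s x)) \<in> borel_measurable N"
proof -
 have tw: "(\<lambda>x. twist (W x) (r x)) \<in> borel_measurable N" if "r \<in> borel_measurable N" for r
  unfolding twist_def approx_def by (intro borel_measurable_lim_metric twisted_poly_measurable_compose W that)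
 have [measurable]: "(\<lambda>x. twist (W x) (s x)) \<in> borel_measurable N" by (rule tw[OF s])
 have [measurable]: "(\<lambda>x. twist (W x) (s x + of_real (1 / real (Suc n)))) \<in> borel_measurable N" for n
  by (rule tw) measurable
 have [measurable]: "(\<lambda>x. twist_deriv (W x) (s x)) \<in> borel_measurable N"
  unfolding twist_deriv_def by (rule borel_measurable_lim_metric) measurable
 show ?thesis unfolding energy_def by measurable
qed

lemma energy_flow: "energy (flow t \<omega>) s = energy \<omega> (s + \<i> * of_real t)"
proof -
 have "twist (flow t \<omega>) s = twist \<omega> (s + \<i> * of_real t)" for s
  by (simp add: twist_def approx_def twisted_poly_flow)
 then show ?thesis by (simp add: energy_def twist_deriv_def add_ac)
qed

lemma ray_energy_flow_measurable: "(\<lambda>(\<omega>, t). ray_energy \<sigma> (flow t \<omega>)) \<in> borel_measurable (torus \<Otimes>\<^sub>M lborel)"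
proof -
 have "(\<lambda>x. energy (fst (fst x)) (of_real (snd x) + \<i> * of_real (snd (fst x))))
   \<in> borel_measurable ((torus \<Otimes>\<^sub>M lborel) \<Otimes>\<^sub>M lborel)" by (intro energy_measurable) measurable
 then have "(\<lambda>(z, \<nu>). energy (fst z) (of_real \<nu> + \<i> * of_real (snd z)) * indicator {\<sigma><..} \<nu>)
   \<in> borel_measurable ((torus \<Otimes>\<^sub>M lborel) \<Otimes>\<^sub>M lborel)" by (simp add: case_prod_unfold)
 then have "(\<lambda>z. \<integral>\<^sup>+\<nu>\<in>{\<sigma><..}. energy (fst z) (of_real \<nu> + \<i> * of_real (snd z)) \<partial>lborel) \<in> borel_measurable (torus \<Otimes>\<^sub>M lborel)"
  by (rule lborel.borel_measurable_nn_integral)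
 then show ?thesis by (simp add: case_prod_unfold ray_energy_def energy_flow)
qed

lemma ray_measurable: "(\<lambda>(\<omega>, \<nu>). energy \<omega> (of_real \<nu>) * indicator {\<sigma><..} \<nu>) \<in> borel_measurable (torus \<Otimes>\<^sub>M lborel)"
proof -
 have [measurable]: "(\<lambda>x. energy (fst x) (of_real (snd x))) \<in> borel_measurable (torus \<Otimes>\<^sub>M lborel)"
  by (intro energy_measurable) measurable
 show ?thesis unfolding case_prod_unfold by measurable
qed

lemma ray_energy_measurable [measurable]: "ray_energy \<sigma> \<in> borel_measurable torus"
 unfolding ray_energy_def[abs_def] by (rule lborel.borel_measurable_nn_integral[OF ray_measurable])

text \<open>The mean energy over a window, truncated at \<open>B\<close> ray by ray. The truncation provides the integrable
 majorant for the reverse Fatou lemma.\<close>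

definition window_energy :: "real \<Rightarrow> ennreal \<Rightarrow> nat \<Rightarrow> (nat \<Rightarrow> complex) \<Rightarrow> ennreal" where
 "window_energy \<sigma> B n \<omega> = ennreal (p\<^sup>2 / (2 * real (Suc n))) *
   (\<integral>\<^sup>+t\<in>{- real (Suc n)..real (Suc n)}. inf (ray_energy \<sigma> (flow t \<omega>)) B \<partial>lborel)"

lemma window_energy_measurable [measurable]: "window_energy \<sigma> B n \<in> borel_measurable torus"
proof -
 note ray_energy_flow_measurable[measurable]
 have "(\<lambda>(\<omega>, t). inf (ray_energy \<sigma> (flow t \<omega>)) B * indicator {- real (Suc n)..real (Suc n)} t) \<in> borel_measurable (torus \<Otimes>\<^sub>M lborel)"
  by measurable
 then show ?thesis
  unfolding window_energy_def[abs_def] by (intro borel_measurable_times_ennreal borel_measurable_const lborel.borel_measurable_nn_integral)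
qed

lemma window_average:
 fixes y :: ennreal
 shows "ennreal (p\<^sup>2 / (2 * real (Suc n))) * (ennreal (2 * real (Suc n)) * y) = ennreal (p\<^sup>2) * y"
 unfolding mult.assoc[symmetric] by (subst ennreal_mult[symmetric]) (auto simp del: of_nat_Suc)

text \<open>By stationarity the expectation does not depend on the length of the window.\<close>

lemma expected_window_energy:
 "(\<integral>\<^sup>+\<omega>. window_energy \<sigma> B n \<omega> \<partial>torus) = ennreal (p\<^sup>2) * (\<integral>\<^sup>+\<omega>. inf (ray_energy \<sigma> \<omega>) B \<partial>torus)"
proof -
 note ray_energy_flow_measurable[measurable]
 let ?A = "{- real (Suc n)..real (Suc n)}"
 have pm: "(\<lambda>(\<omega>, t). inf (ray_energy \<sigma> (flow t \<omega>)) B) \<in> borel_measurable (torus \<Otimes>\<^sub>M lborel)" by measurable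
 then have im: "(\<lambda>(\<omega>, t). inf (ray_energy \<sigma> (flow t \<omega>)) B * indicator ?A t) \<in> borel_measurable (torus \<Otimes>\<^sub>M lborel)" by measurable
 have "(\<integral>\<^sup>+\<omega>. window_energy \<sigma> B n \<omega> \<partial>torus) = ennreal (p\<^sup>2 / (2 * real (Suc n))) *
  (\<integral>\<^sup>+\<omega>. (\<integral>\<^sup>+t\<in>?A. inf (ray_energy \<sigma> (flow t \<omega>)) B \<partial>lborel) \<partial>torus)"
  unfolding window_energy_def by (rule nn_integral_cmult[OF lborel.borel_measurable_nn_integral[OF im]])
 also have "(\<integral>\<^sup>+\<omega>. (\<integral>\<^sup>+t\<in>?A. inf (ray_energy \<sigma> (flow t \<omega>)) B \<partial>lborel) \<partial>torus)
   = emeasure lborel ?A * (\<integral>\<^sup>+\<omega>. inf (ray_energy \<sigma> \<omega>) B \<partial>torus)"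
  by (rule nn_integral_flow_window[where G = "\<lambda>\<omega>. inf (ray_energy \<sigma> \<omega>) B"]) (use pm in auto)
 also have "emeasure lborel ?A = ennreal (2 * real (Suc n))" by simp
 finally show ?thesis unfolding window_average .
qed

lemma window_energy_le: "window_energy \<sigma> B n \<omega> \<le> ennreal (p\<^sup>2) * B"
proof -
 have "(\<integral>\<^sup>+t\<in>{- real (Suc n)..real (Suc n)}. inf (ray_energy \<sigma> (flow t \<omega>)) B \<partial>lborel)
   \<le> (\<integral>\<^sup>+t\<in>{- real (Suc n)..real (Suc n)}. B \<partial>lborel)" by (intro nn_integral_mono mult_right_mono) auto
 also have "\<dots> = ennreal (2 * real (Suc n)) * B" by (simp add: nn_integral_cmult_indicator mult.commute)
 finally show ?thesis unfolding window_energy_def window_average[of n B, symmetric] by (rule mult_left_mono) simp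
qed

end

context carlson_point begin

lemma F_twist: "F = twist \<omega>" by (rule ext) (simp add: F_def twist_def)

lemma window_energy_eq:
 assumes \<sigma>: "\<sigma> > 0"
 shows "window_energy \<sigma> \<top> n \<omega> = ennreal (p\<^sup>2 / (2 * real (Suc n))) * energy_integral p F \<sigma> (real (Suc n))"
proof -
 have d: "twist_deriv \<omega> s = deriv F s" if "Re s > 0" for s
 proof -
  have "s \<in> half_plane 0" using that by (simp add: half_plane_def)
  then have "(F has_field_derivative deriv F s) (at s)" by (rule holomorphic_derivI[OF limit_holomorphic open_half_plane])
  then have "((\<lambda>h. (F (s + h) - F s) / h) \<longlongrightarrow> deriv F s) (at 0)" by (simp add: DERIV_def)
  moreover have "filterlim (\<lambda>n. complex_of_real (1 / real (Suc n))) (at 0) sequentially" unfolding filterlim_at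
  proof
   have "(\<lambda>n. complex_of_real (1 / real (Suc n))) \<longlonglongrightarrow> complex_of_real 0"
    by (intro tendsto_of_real LIMSEQ_Suc[OF lim_1_over_n])
   then show "(\<lambda>n. complex_of_real (1 / real (Suc n))) \<longlonglongrightarrow> 0" by simp
  qed (simp del: of_nat_Suc)
  ultimately have "(\<lambda>n. (F (s + complex_of_real (1 / real (Suc n))) - F s) / complex_of_real (1 / real (Suc n))) \<longlonglongrightarrow> deriv F s"
   by (rule filterlim_compose)
  then show ?thesis unfolding twist_deriv_def F_twist[symmetric] by (rule limI)
 qed
 have "ray_energy \<sigma> (flow t \<omega>) = (\<integral>\<^sup>+\<nu>\<in>{\<sigma><..}. ennreal (norm (F (Complex \<nu> t)) powr (p - 2) * (norm (deriv F (Complex \<nu> t)))\<^sup>2) \<partial>lborel)" for t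
  unfolding ray_energy_def energy_flow
 proof (intro nn_integral_cong)
  fix \<nu> :: real
  have "complex_of_real \<nu> + \<i> * complex_of_real t = Complex \<nu> t" by (simp add: Complex_eq)
  then show "energy \<omega> (complex_of_real \<nu> + \<i> * complex_of_real t) * indicator {\<sigma><..} \<nu>
   = ennreal (norm (F (Complex \<nu> t)) powr (p - 2) * (norm (deriv F (Complex \<nu> t)))\<^sup>2) * indicator {\<sigma><..} \<nu>"
   using \<sigma> by (auto simp: indicator_def energy_def F_twist[symmetric] d)
 qed
 then show ?thesis by (simp add: window_energy_def energy_integral_def)
qed

end

lemma ennreal_add_le: "b \<ge> 0 \<Longrightarrow> ennreal (a + b) \<le> ennreal a + ennreal b"
 by (cases "a \<ge> 0") (auto simp: ennreal_neg ennreal_plus[symmetric] intro!: ennreal_leI simp del: ennreal_plus)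

lemma (in carlson) mean_energy_secant:
 fixes M :: "real \<Rightarrow> real"
 assumes M: "\<And>\<sigma>. \<sigma> > 0 \<Longrightarrow> (vertical_mean p F \<sigma> \<longlongrightarrow> M \<sigma>) at_top"
  and \<sigma>: "\<sigma> > 0" and h: "h > 0" and \<delta>: "\<delta> > 0"
 shows "\<forall>\<^sub>F n in sequentially. mean_energy (\<sigma> + h) (real (Suc n)) \<le> (M \<sigma> - M (\<sigma> + h)) / h + \<delta> \<and>
  (M \<sigma> - M (\<sigma> + h)) / h \<le> mean_energy \<sigma> (real (Suc n)) + \<delta>"
proof -
 have \<delta>2: "\<delta> / 2 > 0" and \<sigma>2: "\<sigma> / 2 > 0" using \<delta> \<sigma> by auto
 let ?q = "\<lambda>T. (vertical_mean p F \<sigma> T - vertical_mean p F (\<sigma> + h) T) / h"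
 have "(?q \<longlongrightarrow> (M \<sigma> - M (\<sigma> + h)) / h) at_top" using \<sigma> h by (intro tendsto_intros M) auto
 from tendstoD[OF this \<delta>2] energy_secant_bounds[OF \<sigma>2 \<delta>2]
 have "\<forall>\<^sub>F T in at_top. mean_energy (\<sigma> + h) T \<le> (M \<sigma> - M (\<sigma> + h)) / h + \<delta> \<and> (M \<sigma> - M (\<sigma> + h)) / h \<le> mean_energy \<sigma> T + \<delta>"
 proof eventually_elim
  case (elim T)
  have "mean_energy (\<sigma> + h) T \<le> ?q T + \<delta> / 2" "?q T \<le> mean_energy \<sigma> T + \<delta> / 2" using elim(2) \<sigma> h by auto
  moreover have "\<bar>?q T - (M \<sigma> - M (\<sigma> + h)) / h\<bar> < \<delta> / 2" using elim(1) unfolding dist_real_def .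
  ultimately show ?case by (intro conjI) linarith+
 qed
 moreover have "filterlim (\<lambda>n. real (Suc n)) at_top sequentially"
  using filterlim_real_sequentially by (rule filterlim_compose) (rule filterlim_Suc)
 ultimately show ?thesis by (rule eventually_compose_filterlim)
qed

context dirichlet_approx begin

context
 fixes M :: "real \<Rightarrow> real"
 assumes M: "\<And>\<omega> F X \<sigma>. carlson p a \<omega> F X \<Longrightarrow> \<sigma> > 0 \<Longrightarrow> (vertical_mean p F \<sigma> \<longlongrightarrow> M \<sigma>) at_top"
begin

lemma AE_window_energy:
 assumes \<sigma>: "\<sigma> > 0" and h: "h > 0"
 shows "AE \<omega> in torus. ennreal ((M \<sigma> - M (\<sigma> + h)) / h) \<le> liminf (\<lambda>n. window_energy \<sigma> \<top> n \<omega>) \<and>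
  limsup (\<lambda>n. window_energy (\<sigma> + h) \<top> n \<omega>) \<le> ennreal ((M \<sigma> - M (\<sigma> + h)) / h)" using AE_carlson_point
proof eventually_elim
 case (elim \<omega>)
 then obtain J where "carlson_point p a K P \<omega> J" by blast
 then interpret carlson_point p a K P \<omega> J .
 obtain C where "carlson p a \<omega> F C" using limit_carlson by blast
 then interpret c: carlson p a \<omega> F C .
 let ?S = "(M \<sigma> - M (\<sigma> + h)) / h"
 have we: "window_energy x \<top> n \<omega> = ennreal (c.mean_energy x (real (Suc n)))" if "x > 0" for x n
 proof -
  have "ennreal (enn2real (energy_integral p F x (real (Suc n)))) = energy_integral p F x (real (Suc n))"
   using c.energy_finite[OF that, of "real (Suc n)"] by simp
  moreover have "ennreal (c.mean_energy x (real (Suc n))) = ennreal (p\<^sup>2 / (2 * real (Suc n))) * ennreal (enn2real (energy_integral p F x (real (Suc n))))"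
   unfolding c.mean_energy_def by (rule ennreal_mult) auto
  ultimately show ?thesis unfolding window_energy_eq[OF that] by (simp only:)
 qed
 have sec: "\<forall>\<^sub>F n in sequentially. c.mean_energy (\<sigma> + h) (real (Suc n)) \<le> ?S + e \<and> ?S \<le> c.mean_energy \<sigma> (real (Suc n)) + e" if "e > 0" for e
  by (rule c.mean_energy_secant[OF M[OF c.carlson_axioms] \<sigma> h that])
 show ?case
 proof
  show "ennreal ?S \<le> liminf (\<lambda>n. window_energy \<sigma> \<top> n \<omega>)"
  proof (rule ennreal_le_epsilon)
   fix e :: real assume e: "e > 0"
   have "\<forall>\<^sub>F n in sequentially. ennreal (?S - e) \<le> window_energy \<sigma> \<top> n \<omega>"
    using sec[OF e] by eventually_elim (auto simp: we[OF \<sigma>] intro!: ennreal_leI)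
   then have "ennreal (?S - e) \<le> liminf (\<lambda>n. window_energy \<sigma> \<top> n \<omega>)" by (rule Liminf_bounded)
   then have "ennreal (?S - e) + ennreal e \<le> liminf (\<lambda>n. window_energy \<sigma> \<top> n \<omega>) + ennreal e" by (rule add_right_mono)
   then show "ennreal ?S \<le> liminf (\<lambda>n. window_energy \<sigma> \<top> n \<omega>) + ennreal e"
    using ennreal_add_le[of e "?S - e"] e by (auto intro: order_trans)
  qed
  show "limsup (\<lambda>n. window_energy (\<sigma> + h) \<top> n \<omega>) \<le> ennreal ?S"
  proof (rule ennreal_le_epsilon)
   fix e :: real assume e: "e > 0"
   have "\<forall>\<^sub>F n in sequentially. window_energy (\<sigma> + h) \<top> n \<omega> \<le> ennreal (?S + e)"
    using sec[OF e] by eventually_elim (use \<sigma> h in \<open>auto simp: we intro!: ennreal_leI\<close>)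
   then have "limsup (\<lambda>n. window_energy (\<sigma> + h) \<top> n \<omega>) \<le> ennreal (?S + e)" by (rule Limsup_bounded)
   also have "\<dots> \<le> ennreal ?S + ennreal e" using e by (intro ennreal_add_le) simp
   finally show "limsup (\<lambda>n. window_energy (\<sigma> + h) \<top> n \<omega>) \<le> ennreal ?S + ennreal e" .
  qed
 qed
qed

text \<open>Almost surely the mean energies at \<open>\<sigma>\<close> are eventually above the secant slope and those at
 \<open>\<sigma> + h\<close> below it, up to arbitrarily small errors. Fatou's lemma gives the upper bound, the
 reverse Fatou lemma for the truncated energies and \<open>B \<rightarrow> \<infinity>\<close> the lower one.\<close>

lemma expected_energy_secant:
 assumes \<sigma>: "\<sigma> > 0" and h: "h > 0"
 shows "ennreal ((M \<sigma> - M (\<sigma> + h)) / h) \<le> ennreal (p\<^sup>2) * expected_energy \<sigma>"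
  and "ennreal (p\<^sup>2) * expected_energy (\<sigma> + h) \<le> ennreal ((M \<sigma> - M (\<sigma> + h)) / h)"
proof -
 let ?S = "ennreal ((M \<sigma> - M (\<sigma> + h)) / h)"
 have S: "?S = (\<integral>\<^sup>+\<omega>. ?S \<partial>torus)" by (simp add: torus.emeasure_space_1)
 also have "\<dots> \<le> (\<integral>\<^sup>+\<omega>. liminf (\<lambda>n. window_energy \<sigma> \<top> n \<omega>) \<partial>torus)"
  using AE_window_energy[OF \<sigma> h] by (intro nn_integral_mono_AE) (auto elim: eventually_mono)
 also have "\<dots> \<le> liminf (\<lambda>n. \<integral>\<^sup>+\<omega>. window_energy \<sigma> \<top> n \<omega> \<partial>torus)" by (rule nn_integral_liminf) measurable
 also have "\<dots> = ennreal (p\<^sup>2) * expected_energy \<sigma>"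
  unfolding expected_window_energy by (simp add: expected_energy_def Liminf_const)
 finally show "?S \<le> ennreal (p\<^sup>2) * expected_energy \<sigma>" .
 have trunc: "ennreal (p\<^sup>2) * (\<integral>\<^sup>+\<omega>. inf (ray_energy (\<sigma> + h) \<omega>) (of_nat k) \<partial>torus) \<le> ?S" for k
 proof -
  have "ennreal (p\<^sup>2) * (\<integral>\<^sup>+\<omega>. inf (ray_energy (\<sigma> + h) \<omega>) (of_nat k) \<partial>torus)
    = limsup (\<lambda>n. \<integral>\<^sup>+\<omega>. window_energy (\<sigma> + h) (of_nat k) n \<omega> \<partial>torus)"
   unfolding expected_window_energy by (simp add: Limsup_const)
  also have "\<dots> \<le> (\<integral>\<^sup>+\<omega>. limsup (\<lambda>n. window_energy (\<sigma> + h) (of_nat k) n \<omega>) \<partial>torus)"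
  proof (rule nn_integral_limsup[where w = "\<lambda>_. ennreal (p\<^sup>2) * of_nat k"])
   show "(\<integral>\<^sup>+\<omega>. ennreal (p\<^sup>2) * of_nat k \<partial>torus) < \<infinity>"
    by (simp add: torus.emeasure_space_1 ennreal_mult_less_top ennreal_of_nat_eq_real_of_nat)
  qed (auto intro!: AE_I2 window_energy_le)
  also have "\<dots> \<le> (\<integral>\<^sup>+\<omega>. ?S \<partial>torus)"
  proof (rule nn_integral_mono_AE)
   show "AE \<omega> in torus. limsup (\<lambda>n. window_energy (\<sigma> + h) (of_nat k) n \<omega>) \<le> ?S" using AE_window_energy[OF \<sigma> h]
   proof eventually_elim
    case (elim \<omega>)
    have "limsup (\<lambda>n. window_energy (\<sigma> + h) (of_nat k) n \<omega>) \<le> limsup (\<lambda>n. window_energy (\<sigma> + h) \<top> n \<omega>)"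
     unfolding window_energy_def
     by (intro Limsup_mono always_eventually allI mult_left_mono nn_integral_mono mult_right_mono inf_mono) auto
    then show ?case using elim by (auto intro: order_trans)
   qed
  qed
  finally show ?thesis unfolding S[symmetric] .
 qed
 have "expected_energy (\<sigma> + h) = (\<integral>\<^sup>+\<omega>. (SUP k. inf (ray_energy (\<sigma> + h) \<omega>) (of_nat k)) \<partial>torus)"
  unfolding expected_energy_def inf_SUP[symmetric] by (simp add: ennreal_SUP_of_nat_eq_top)
 also have "\<dots> = (SUP k. \<integral>\<^sup>+\<omega>. inf (ray_energy (\<sigma> + h) \<omega>) (of_nat k) \<partial>torus)"
 proof (rule nn_integral_monotone_convergence_SUP)
  show "incseq (\<lambda>k \<omega>. inf (ray_energy (\<sigma> + h) \<omega>) (of_nat k))"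
   by (intro incseq_SucI le_funI inf_mono order_refl) simp
 qed measurable
 finally have "ennreal (p\<^sup>2) * expected_energy (\<sigma> + h) = (SUP k. ennreal (p\<^sup>2) * (\<integral>\<^sup>+\<omega>. inf (ray_energy (\<sigma> + h) \<omega>) (of_nat k) \<partial>torus))"
  by (simp add: SUP_mult_left_ennreal)
 also have "\<dots> \<le> ?S" by (intro SUP_least trunc)
 finally show "ennreal (p\<^sup>2) * expected_energy (\<sigma> + h) \<le> ?S" .
qed

lemma expected_energy_finite:
 assumes \<sigma>: "\<sigma> > 0" shows "expected_energy \<sigma> < \<infinity>"
proof -
 have "ennreal (p\<^sup>2) * expected_energy (\<sigma>/2 + \<sigma>/2) < \<infinity>"
  using \<sigma> by (intro le_less_trans[OF expected_energy_secant(2)]) auto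
 then show ?thesis using p1 by (auto simp: ennreal_mult_less_top)
qed

lemma expected_energy_continuous: "continuous_on {0<..} (\<lambda>\<sigma>. enn2real (expected_energy \<sigma>))"
proof (intro continuous_at_imp_continuous_on ballI)
 fix \<sigma> :: real assume "\<sigma> \<in> {0<..}"
 then have \<sigma>: "\<sigma> > 0" and \<sigma>2: "\<sigma>/2 > 0" by auto
 define D where "D \<nu> = (\<integral>\<^sup>+\<omega>. energy \<omega> (complex_of_real \<nu>) \<partial>torus)" for \<nu>
 have em: "(\<lambda>(\<nu>, \<omega>). energy \<omega> (complex_of_real \<nu>)) \<in> borel_measurable (lborel \<Otimes>\<^sub>M torus)"
  unfolding case_prod_unfold by (intro energy_measurable) measurable
 then have Dm [measurable]: "D \<in> borel_measurable lborel"
  unfolding D_def[abs_def] by (rule torus.borel_measurable_nn_integral)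
 have G: "expected_energy x = (\<integral>\<^sup>+\<nu>. D \<nu> * indicator {x<..} \<nu> \<partial>lborel)" for x
 proof -
  have "expected_energy x = (\<integral>\<^sup>+\<nu>. (\<integral>\<^sup>+\<omega>. energy \<omega> (of_real \<nu>) * indicator {x<..} \<nu> \<partial>torus) \<partial>lborel)"
   unfolding expected_energy_def ray_energy_def by (rule torus_line.Fubini'[OF ray_measurable, symmetric])
  also have "\<dots> = (\<integral>\<^sup>+\<nu>. D \<nu> * indicator {x<..} \<nu> \<partial>lborel)"
   unfolding D_def by (intro nn_integral_cong) (auto simp: indicator_def)
  finally show ?thesis .
 qed
 show "isCont (\<lambda>\<sigma>. enn2real (expected_energy \<sigma>)) \<sigma>" unfolding continuous_at_sequentially o_def
 proof (intro allI impI)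
  fix x assume x: "x \<longlonglongrightarrow> \<sigma>"
  define y where "y n = max (\<sigma>/2) (x n)" for n
  have y: "y \<longlonglongrightarrow> \<sigma>" using tendsto_max[OF tendsto_const[of "\<sigma>/2"] x] \<sigma> by (simp add: y_def[abs_def] max_def)
  have "AE \<nu> in lborel. \<nu> \<noteq> \<sigma>" by (rule AE_lborel_singleton)
  then have ae: "AE \<nu> in lborel. (\<lambda>n. D \<nu> * indicator {y n<..} \<nu>) \<longlonglongrightarrow> D \<nu> * indicator {\<sigma><..} \<nu>"
  proof eventually_elim
   case (elim \<nu>)
   have "\<forall>\<^sub>F n in sequentially. D \<nu> * indicator {y n<..} \<nu> = D \<nu> * indicator {\<sigma><..} \<nu>"
   proof (cases "\<nu> > \<sigma>")
    case True
    from order_tendstoD(2)[OF y this] show ?thesis by eventually_elim (use True in \<open>auto simp: indicator_def\<close>)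
   next
    case False
    then have "\<nu> < \<sigma>" using elim by simp
    from order_tendstoD(1)[OF y this] show ?thesis by eventually_elim (use False in \<open>auto simp: indicator_def\<close>)
   qed
   then show ?case by (rule tendsto_eventually)
  qed
  have "(\<lambda>n. \<integral>\<^sup>+\<nu>. D \<nu> * indicator {y n<..} \<nu> \<partial>lborel) \<longlonglongrightarrow> (\<integral>\<^sup>+\<nu>. D \<nu> * indicator {\<sigma><..} \<nu> \<partial>lborel)"
  proof (rule nn_integral_dominated_convergence[where w = "\<lambda>\<nu>. D \<nu> * indicator {\<sigma>/2<..} \<nu>", OF _ _ _ _ _ ae])
   show "(\<integral>\<^sup>+\<nu>. D \<nu> * indicator {\<sigma>/2<..} \<nu> \<partial>lborel) < \<infinity>" using expected_energy_finite[OF \<sigma>2] unfolding G .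
  qed (auto simp: y_def indicator_def)
  then have "(\<lambda>n. enn2real (expected_energy (y n))) \<longlonglongrightarrow> enn2real (expected_energy \<sigma>)"
   unfolding G[symmetric] using expected_energy_finite[OF \<sigma>] by (intro tendsto_enn2real) auto
  moreover have "\<forall>\<^sub>F n in sequentially. \<sigma>/2 < x n" using \<sigma> by (intro order_tendstoD(1)[OF x]) simp
  then have "\<forall>\<^sub>F n in sequentially. enn2real (expected_energy (y n)) = enn2real (expected_energy (x n))"
   by eventually_elim (simp add: y_def max_def)
  ultimately show "(\<lambda>n. enn2real (expected_energy (x n))) \<longlonglongrightarrow> enn2real (expected_energy \<sigma>)"
   by (rule Lim_transform_eventually)
 qed
qed

lemma mean_derivative_formula_carlson:
 assumes c: "carlson p a \<omega> F X"
 shows "mean_derivative_formula p F"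
proof (rule carlson.derivative_formula[OF c M[OF c]])
 let ?g = "\<lambda>\<sigma>. p\<^sup>2 * enn2real (expected_energy \<sigma>)"
 interpret c: carlson p a \<omega> F X by (rule c)
 show "continuous_on {0<..} ?g" by (intro continuous_intros expected_energy_continuous)
 fix \<sigma> h :: real assume \<sigma>: "\<sigma> > 0" and h: "h > 0"
 let ?S = "(M \<sigma> - M (\<sigma> + h)) / h"
 have conv: "?g x = enn2real (ennreal (p\<^sup>2) * expected_energy x)" for x by (simp add: enn2real_mult)
 have "?S + \<delta> \<ge> 0" if "\<delta> > 0" for \<delta>
 proof -
  have "\<forall>\<^sub>F n in sequentially. c.mean_energy (\<sigma> + h) (real (Suc n)) \<le> ?S + \<delta> \<and> ?S \<le> c.mean_energy \<sigma> (real (Suc n)) + \<delta>"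
   by (rule c.mean_energy_secant[OF M[OF c] \<sigma> h that])
  then obtain n where "c.mean_energy (\<sigma> + h) (real (Suc n)) \<le> ?S + \<delta>" by (auto simp: eventually_sequentially)
  moreover have "c.mean_energy (\<sigma> + h) (real (Suc n)) \<ge> 0" by (simp add: c.mean_energy_def)
  ultimately show ?thesis by linarith
 qed
 then have S0: "?S \<ge> 0" using field_le_epsilon[of 0 ?S] by auto
 show "?g (\<sigma> + h) \<le> ?S" using enn2real_mono[OF expected_energy_secant(2)[OF \<sigma> h]] S0 by (simp add: conv)
 show "?S \<le> ?g \<sigma>" using enn2real_mono[OF expected_energy_secant(1)[OF \<sigma> h]] expected_energy_finite[OF \<sigma>] S0
  by (simp add: conv ennreal_mult_less_top)
qed

end

end

theorem theorem5p1:
 fixes p :: real and a :: "nat \<Rightarrow> complex"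
 assumes "1 \<le> p" and "a \<in> Hp p"
 shows "(\<exists>E. full_measure E \<and>
      (\<forall>\<omega>\<in>E. \<exists>F. twist_continuation a \<omega> F \<and> mean_derivative_formula p F)) \<and>
     (p \<noteq> 1 \<longrightarrow> full_measure (Carlson_set p a) \<and>
      (\<forall>\<omega>\<in>Carlson_set p a. \<exists>F. twist_continuation a \<omega> F \<and> mean_derivative_formula p F))"
proof -
 obtain K P where "mono K" "\<forall>j n. n > K j \<longrightarrow> P j n = 0" "\<forall>n. (\<lambda>j. P j n) \<longlonglongrightarrow> a n"
  "\<forall>j. torus_norm p (K (Suc j)) (\<lambda>n. P (Suc j) n - P j n) 0 \<le> (1 / 16 ^ j) powr p"
  using Hp_approximation[OF assms(2)] assms(1) by auto
 then interpret dirichlet_approx p a K P by unfold_locales (use assms in auto)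
 obtain M where M: "\<And>\<omega> F X \<sigma>. carlson p a \<omega> F X \<Longrightarrow> \<sigma> > 0 \<Longrightarrow> (vertical_mean p F \<sigma> \<longlongrightarrow> M \<sigma>) at_top"
  using carlson_mean_limit[of p a] by blast
 have "\<exists>F. twist_continuation a \<omega> F \<and> mean_derivative_formula p F" if \<omega>: "\<omega> \<in> Carlson_set p a" for \<omega>
 proof -
  from \<omega> obtain F C where F: "twist_continuation a \<omega> F" "carlson p a \<omega> F C"
   using assms(1) by (auto simp: Carlson_set_def carlson_def)
  have "mean_derivative_formula p F" by (rule mean_derivative_formula_carlson[OF M F(2)])
  with F(1) show ?thesis by blast
 qed
 then show ?thesis using full_measure_Carlson_set by blast
qed

end
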